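(* Let $\frac19<\alpha\le1$ and let $\Sigma_0,\mu_0,g$ and the bounded domain $\Omega_0$ be as defined in the context. Suppose that the part of $\Sigma_0$ in the open left half-plane (and by symmetry, the part of $-\Sigma_0$ in the open right half-plane) is contained in $\Omega_0$. Then $$\operatorname{Re}g(-z)>\operatorname{Re}g(z)\qquad\text{for all }z\in\mathbb{C}\text{ with }\operatorname{Re}z>0.$$
   Context: Let $\beta=\frac{1-\alpha}{2}$, $$z_\pm=(1+\sqrt\alpha)\left(-\frac{1+\sqrt\alpha}{8}\pm\frac{3i}{8}\sqrt{\left(1-\tfrac{\sqrt\alpha}{3}\right)(3\sqrt\alpha-1)}\right),\qquad Q_\alpha(z)=\frac{(z-z_+)(z-z_-)\left(z+\frac{(1-\sqrt\alpha)^2}{2}\right)^2}{(z-\beta)^2(z+\beta)^2(z+\alpha+\beta)^2}.$$ Trajectories of the quadratic differential $Q_\alpha(z)dz^2$ are the smooth arcs along which $Q_\alpha(z)(dz)^2<0$; a critical trajectory is one ending at a zero of $Q_\alpha$. It is known that there are three critical trajectories connecting $z_-$ and $z_+$; $\Sigma_0$ denotes (the closure of) the one that intersects the positive real axis. It is symmetric under complex conjugation and meets the positive real axis in one point $x^*>\beta$. It is known that $d\mu_0(s)=\frac{1}{\pi i}Q_\alpha(s)^{1/2}ds$ on $\Sigma_0$ ($ds$ the complex line element, branch of the square root chosen so that the measure is positive) is a probability measure. $g(z)=\int\log(z-s)\,d\mu_0(s)$, so that $\operatorname{Re}g(z)=\int\log|z-s|\,d\mu_0(s)$ for all $z\in\mathbb{C}$.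 The curve $\Sigma_0$ intersects the imaginary axis, so it is partly in the right half-plane and partly in the left half-plane. The part of $\Sigma_0$ in the (closed) right half-plane together with the part of $-\Sigma_0=\{-z\mid z\in\Sigma_0\}$ in the (closed) left half-plane form a closed curve that encloses a bounded domain, denoted $\Omega_0$. *)

theory Defs
  imports "HOL-Analysis.Analysis" "HOL-Probability.Probability"
begin

definition beta :: "real \<Rightarrow> real" where
  "beta \<alpha> = (1 - \<alpha>) / 2"

definition z_plus :: "real \<Rightarrow> complex" where
  "z_plus \<alpha> = of_real (1 + sqrt \<alpha>) *
     (- of_real ((1 + sqrt \<alpha>) / 8)
      + (3 * \<i> / 8) * of_real (sqrt ((1 - sqrt \<alpha> / 3) * (3 * sqrt \<alpha> - 1))))"

definition z_minus :: "real \<Rightarrow> complex" where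
  "z_minus \<alpha> = of_real (1 + sqrt \<alpha>) *
     (- of_real ((1 + sqrt \<alpha>) / 8)
      - (3 * \<i> / 8) * of_real (sqrt ((1 - sqrt \<alpha> / 3) * (3 * sqrt \<alpha> - 1))))"

definition Q :: "real \<Rightarrow> complex \<Rightarrow> complex" where
  "Q \<alpha> z =
     (z - z_plus \<alpha>) * (z - z_minus \<alpha>) * (z + of_real ((1 - sqrt \<alpha>)\<^sup>2 / 2))\<^sup>2 /
     ((z - of_real (beta \<alpha>))\<^sup>2 * (z + of_real (beta \<alpha>))\<^sup>2 * (z + of_real (\<alpha> + beta \<alpha>))\<^sup>2)"

definition neg_real :: "complex \<Rightarrow> bool" where
  "neg_real w \<longleftrightarrow> w \<in> \<real> \<and> Re w < 0"

text \<open>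
  A trajectory of the quadratic differential \<open>q(z) dz\<^sup>2\<close>, parametrized over the open unit interval.
  Strict negativity keeps it away from the zeros of \<open>q\<close>; it also keeps it away from the poles of a
  rational \<open>q\<close> written as a quotient, where the value is \<open>0\<close> by the convention for division by zero.
\<close>

definition trajectory :: "(complex \<Rightarrow> complex) \<Rightarrow> (real \<Rightarrow> complex) \<Rightarrow> bool" where
  "trajectory q \<gamma> \<longleftrightarrow>
     \<gamma> C1_differentiable_on {0<..<1} \<and>
     (\<forall>t\<in>{0<..<1}. neg_real (q (\<gamma> t) * (vector_derivative \<gamma> (at t))\<^sup>2))"

text \<open>
  The path is a parametrization of the closure of a critical trajectory from \<open>a\<close> to \<open>b\<close>.
  It need not be differentiable at the two end points.
\<close>

definition critical_trajectory ::
    "(complex \<Rightarrow> complex) \<Rightarrow> (real \<Rightarrow> complex) \<Rightarrow> complex \<Rightarrow> complex \<Rightarrow> bool" where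
  "critical_trajectory q \<gamma> a b \<longleftrightarrow>
     arc \<gamma> \<and> pathstart \<gamma> = a \<and> pathfinish \<gamma> = b \<and> q a = 0 \<and> q b = 0 \<and> trajectory q \<gamma>"

text \<open>
  The value at \<open>s\<close> of the branch of \<open>q\<^sup>1\<^sup>/\<^sup>2\<close> that makes \<open>q(s)\<^sup>1\<^sup>/\<^sup>2 ds / (\<pi> \<i>)\<close> positive
  when \<open>ds\<close> points in the direction \<open>v\<close>.
\<close>

definition pos_branch :: "(complex \<Rightarrow> complex) \<Rightarrow> complex \<Rightarrow> complex \<Rightarrow> complex" where
  "pos_branch q s v =
     (THE w. w\<^sup>2 = q s \<and> w * v / (of_real pi * \<i>) \<in> \<real> \<and> 0 < Re (w * v / (of_real pi * \<i>)))"

lemma pos_branch_ex1: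
  assumes "neg_real (q s * v\<^sup>2)"
  shows "\<exists>!w. w\<^sup>2 = q s \<and> w * v / (of_real pi * \<i>) \<in> \<real> \<and> 0 < Re (w * v / (of_real pi * \<i>))"
proof -
  define r where "r = sqrt (- Re (q s * v\<^sup>2))"
  have r: "r > 0" and r2: "q s * v\<^sup>2 = - of_real (r\<^sup>2)"
    using assms by (auto simp: neg_real_def r_def complex_eq_iff complex_is_Real_iff)
  have v: "v \<noteq> 0" using assms by (auto simp: neg_real_def)
  show ?thesis
  proof (rule ex1I)
    let ?w = "\<i> * of_real r / v"
    have "?w\<^sup>2 = q s" using r2 v by (simp add: field_simps power_mult_distrib)
    moreover have "?w * v / (of_real pi * \<i>) = of_real (r / pi)" using v by simp
    ultimately show "?w\<^sup>2 = q s \<and> ?w * v / (of_real pi * \<i>) \<in> \<real> \<and>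
        0 < Re (?w * v / (of_real pi * \<i>))" using r by simp
  next
    fix w assume w: "w\<^sup>2 = q s \<and> w * v / (of_real pi * \<i>) \<in> \<real> \<and>
        0 < Re (w * v / (of_real pi * \<i>))"
    define k where "k = Re (w * v / (of_real pi * \<i>))"
    have k: "w * v / (of_real pi * \<i>) = of_real k" "k > 0"
      using w by (auto simp: k_def)
    then have wv: "w * v = of_real (k * pi) * \<i>" by (simp add: field_simps)
    have "(w * v)\<^sup>2 = - of_real (r\<^sup>2)" using w r2 by (simp add: power_mult_distrib)
    then have "complex_of_real ((k * pi)\<^sup>2) = of_real (r\<^sup>2)"
      unfolding wv by (simp add: power_mult_distrib)
    then have "(k * pi)\<^sup>2 = r\<^sup>2" using of_real_eq_iff by blast
    then have "k * pi = r" using k r by simp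
    then show "w = \<i> * of_real r / v" using wv v by (simp add: field_simps)
  qed
qed

text \<open>
  The measure \<open>d\<mu>\<^sub>0(s) = q(s)\<^sup>1\<^sup>/\<^sup>2 ds / (\<pi> \<i>)\<close> on the trajectory parametrized by \<open>\<gamma>\<close>, with
  \<open>ds = \<gamma>'(t) dt\<close>, as a Borel measure on the complex plane.
\<close>

definition trajectory_measure :: "(complex \<Rightarrow> complex) \<Rightarrow> (real \<Rightarrow> complex) \<Rightarrow> complex measure" where
  "trajectory_measure q \<gamma> =
     distr
       (density (restrict_space lborel {0<..<1})
         (\<lambda>t. let v = vector_derivative \<gamma> (at t)
              in ennreal (Re (pos_branch q (\<gamma> t) v * v / (of_real pi * \<i>)))))
       borel \<gamma>"

text \<open>
  The logarithmic transform \<open>g\<close>, with the principal branch of the logarithm. Only its real part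
  matters, and this does not depend on the choice of branch.
\<close>

definition g_fun :: "complex measure \<Rightarrow> complex \<Rightarrow> complex" where
  "g_fun \<mu> z = (\<integral>s. Ln (z - s) \<partial>\<mu>)"

lemma borel_measurable_Ln: "Ln \<in> borel_measurable borel"
proof -
  let ?f = "\<lambda>z. if z \<in> \<real>\<^sub>\<le>\<^sub>0 then (if z = 0 then Ln 0 else of_real (ln (cmod z)) + \<i> * of_real pi)
                 else indicat_real (- \<real>\<^sub>\<le>\<^sub>0) z *\<^sub>R Ln z"
  have "Ln z = of_real (ln (cmod z)) + \<i> * of_real pi" if "z \<in> \<real>\<^sub>\<le>\<^sub>0" "z \<noteq> 0" for z
    using that by (elim nonpos_Reals_cases) (simp add: Ln_of_real')
  then have eq: "Ln = ?f" by (intro ext) simp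
  have "(\<lambda>z. indicat_real (- \<real>\<^sub>\<le>\<^sub>0) z *\<^sub>R Ln z) \<in> borel_measurable borel"
    by (intro borel_measurable_continuous_on_indicator continuous_intros) auto
  then have meas: "?f \<in> borel_measurable borel"
    by (intro measurable_If_set measurable_If) auto
  show ?thesis by (subst eq) (rule meas)
qed

lemma Re_g_fun:
  assumes "finite_measure \<mu>" and sets: "sets \<mu> = sets borel" and z: "emeasure \<mu> {z} = 0"
  shows "Re (g_fun \<mu> z) = (\<integral>s. ln (cmod (z - s)) \<partial>\<mu>)"
proof -
  interpret finite_measure \<mu> by fact
  have [measurable]: "(\<lambda>s. Ln (z - s)) \<in> borel_measurable \<mu>"
    using measurable_compose[OF _ borel_measurable_Ln, of "\<lambda>s. z - s" borel]
    by (simp add: measurable_cong_sets[OF sets refl])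
  have "{z} \<in> null_sets \<mu>" using z sets by (auto simp: null_sets_def)
  then have ae: "AE s in \<mu>. s \<noteq> z" using AE_not_in[of "{z}" \<mu>] by simp
  have eq: "AE s in \<mu>. Re (Ln (z - s)) = ln (cmod (z - s))"
    by (rule AE_mp[OF ae], intro AE_I2) simp
  have meas2: "(\<lambda>s. ln (cmod (z - s))) \<in> borel_measurable \<mu>"
    by (simp add: measurable_cong_sets[OF sets refl])
  have int: "(\<integral>s. Re (Ln (z - s)) \<partial>\<mu>) = (\<integral>s. ln (cmod (z - s)) \<partial>\<mu>)"
    by (intro integral_cong_AE) (use eq meas2 in auto)
  show ?thesis
  proof (cases "integrable \<mu> (\<lambda>s. Ln (z - s))")
    case True
    then show ?thesis using int by (simp add: g_fun_def)
  next
    case False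
    have im: "integrable \<mu> (\<lambda>s. \<i> * complex_of_real (Im (Ln (z - s))))"
    proof (rule integrable_const_bound[where B = "pi"])
      have Im: "\<bar>Im (Ln (z - s))\<bar> \<le> pi" if "s \<noteq> z" for s
        using that mpi_less_Im_Ln[of "z - s"] Im_Ln_le_pi[of "z - s"] by auto
      show "AE s in \<mu>. cmod (\<i> * complex_of_real (Im (Ln (z - s)))) \<le> pi"
        by (rule AE_mp[OF ae], intro AE_I2) (auto simp: norm_mult Im)
    qed simp
    have "\<not> integrable \<mu> (\<lambda>s. Re (Ln (z - s)))"
    proof
      assume "integrable \<mu> (\<lambda>s. Re (Ln (z - s)))"
      then have "integrable \<mu> (\<lambda>s. complex_of_real (Re (Ln (z - s))))" by simp
      from Bochner_Integration.integrable_add[OF this im] False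
      show False unfolding complex_eq[symmetric] by simp
    qed
    then show ?thesis using False int by (simp add: g_fun_def not_integrable_integral_eq)
  qed
qed

text \<open>
  The part of \<open>S\<close> in the closed right half-plane together with the part of \<open>-S\<close> in the closed
  left half-plane, and the region enclosed by it.
\<close>

definition closed_curve :: "complex set \<Rightarrow> complex set" where
  "closed_curve S = (S \<inter> {z. 0 \<le> Re z}) \<union> (uminus ` S \<inter> {z. Re z \<le> 0})"

definition Omega0 :: "complex set \<Rightarrow> complex set" where
  "Omega0 S = inside (closed_curve S)"

end

(*
  After the substitution z = sigma Z the square root of the quadratic differential lives on the
  two-sheeted surface t^2 = (Z + 2) t + 3 w, which has genus zero.  There the complex potential of the
  measure is the logarithm of the explicit rational function Y of the coordinate t: the potential
  equals L = ln |Y| at the root continued from infinity off the arc, because the difference is harmonic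
  across the arc, nonpositive by the maximum principle, and attains its maximum at infinity.
  The difference U(-Z) - U(Z) is touched above by harmonic functions in the right half-plane away from
  the reflected arc, tends to 0 at infinity and vanishes on the imaginary axis, so it is nonnegative
  once it is positive on the reflected arc.  There it dominates the explicit comparison function S,
  whose positivity again follows from the minimum principle, since inside the closed curve the
  root in the left half-plane has the larger value of L.
*)
theory Submission
  imports Defs "HOL-Complex_Analysis.Complex_Analysis" "HOL-Real_Asymp.Real_Asymp"
begin

text \<open>In the coordinate \<open>t\<close> one has z = t - 2 - 3w/t, and t -> -3w/t exchanges
  the sheets. \<open>Y\<close> is built from the residues of the square root: half the logarithm of
  Y(t)/Y(-3w/t) is a primitive of it, so along the trajectory \<open>L\<close> takes the same value
  at both roots. The obstacle is the reflected arc. There U(-Z) has an upward kink, so the minimum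
  principle cannot be applied across it. \<open>Yhat\<close> replaces U(-Z) by a function whose
  kinks point down, the smaller of the two values of \<open>L\<close>. Near the imaginary axis,
  inside the curve, the smaller value is the wrong one, since S has to vanish on that axis; so the
  root in the left half-plane is kept as long as it lies in \<open>Delta\<close>, the left part of
  the disc with diameter [-3, w]. The change of rule is harmless because on the edge of
  \<open>Delta\<close> that root already gives the smaller value, an inequality between two explicit
  polynomials. Reflected branch points and end points of the arc are isolated exceptions, absorbed
  by a small multiple of a logarithm.\<close>

section \<open>Minimum principles for functions touched from above by harmonic functions\<close>

definition harmonic_at :: "(complex \<Rightarrow> real) \<Rightarrow> complex \<Rightarrow> bool" where
  "harmonic_at u p \<longleftrightarrow> (\<exists>F r. 0 < r \<and> F holomorphic_on ball p r \<and> (\<forall>z\<in>ball p r. u z = Re (F z)))"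

text \<open>A local form of superharmonicity without mean values: one harmonic majorant that agrees
  at \<open>p\<close>. Sums inherit the property, and a minimum of harmonic functions has it,
  touched by whichever of them attains the minimum at \<open>p\<close>.\<close>

definition touched_above :: "(complex \<Rightarrow> real) \<Rightarrow> complex \<Rightarrow> bool" where
  "touched_above u p \<longleftrightarrow> (\<exists>F r. 0 < r \<and> F holomorphic_on ball p r \<and> Re (F p) = u p \<and>
     (\<forall>z\<in>ball p r. u z \<le> Re (F z)))"

lemma harmonic_atI:
  assumes "F holomorphic_on S" "open S" "p \<in> S" "\<And>z. z \<in> S \<Longrightarrow> u z = Re (F z)"
  shows "harmonic_at u p"
proof -
  obtain r where "r > 0" "ball p r \<subseteq> S" using assms openE by blast
  then show ?thesis unfolding harmonic_at_def using assms
    by (intro exI[of _ F] exI[of _ r]) (auto intro: holomorphic_on_subset)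
qed

lemma harmonic_at_cong:
  assumes "harmonic_at u p" "open S" "p \<in> S" "\<And>z. z \<in> S \<Longrightarrow> u z = v z"
  shows "harmonic_at v p"
proof -
  obtain F r where F: "0 < r" "F holomorphic_on ball p r" "\<forall>z\<in>ball p r. u z = Re (F z)"
    using assms(1) unfolding harmonic_at_def by blast
  have "v z = Re (F z)" if "z \<in> ball p r \<inter> S" for z
    using that assms(4)[of z] F(3) by (metis IntD1 IntD2)
  moreover have "F holomorphic_on ball p r \<inter> S" using F(2) by (rule holomorphic_on_subset) auto
  ultimately show ?thesis
    using F(1) assms(2,3) by (intro harmonic_atI[of F "ball p r \<inter> S"]) auto
qed

lemma harmonic_at_imp_touched_above: "harmonic_at u p \<Longrightarrow> touched_above u p"
  unfolding harmonic_at_def touched_above_def by (metis centre_in_ball order_refl)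

lemma harmonic_at_imp_isCont: assumes "harmonic_at u p" shows "isCont u p"
proof -
  obtain F r where F: "0 < r" "F holomorphic_on ball p r" "\<forall>z\<in>ball p r. u z = Re (F z)"
    using assms(1) unfolding harmonic_at_def by blast
  have "continuous_on (ball p r) (\<lambda>z. Re (F z))"
    using F(2) by (intro continuous_intros holomorphic_on_imp_continuous_on)
  then have "continuous_on (ball p r) u" using F(3) by (subst continuous_on_cong[OF refl]) auto
  then show ?thesis using F(1) by (simp add: continuous_on_eq_continuous_at)
qed

lemma harmonic_at_const [intro, simp]: "harmonic_at (\<lambda>z. c) p"
  by (rule harmonic_atI[of "\<lambda>z. of_real c" UNIV]) auto

lemma harmonic_at_minus: assumes "harmonic_at u p" shows "harmonic_at (\<lambda>z. - u z) p"
proof -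
  obtain F r where F: "0 < r" "F holomorphic_on ball p r" "\<forall>z\<in>ball p r. u z = Re (F z)"
    using assms(1) unfolding harmonic_at_def by blast
  show ?thesis
    by (rule harmonic_atI[of "\<lambda>z. - F z" "ball p r"]) (use F in \<open>auto intro: holomorphic_intros\<close>)
qed

lemma touched_above_add:
  assumes "touched_above u p" "touched_above v p" shows "touched_above (\<lambda>z. u z + v z) p"
proof -
  obtain F r where F: "0 < r" "F holomorphic_on ball p r" "Re (F p) = u p" "\<forall>z\<in>ball p r. u z \<le> Re (F z)"
    using assms(1) unfolding touched_above_def by blast
  obtain G s where G: "0 < s" "G holomorphic_on ball p s" "Re (G p) = v p" "\<forall>z\<in>ball p s. v z \<le> Re (G z)"
    using assms(2) unfolding touched_above_def by blast
  have "(\<lambda>z. F z + G z) holomorphic_on ball p (min r s)"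
    by (intro holomorphic_intros holomorphic_on_subset[OF F(2)] holomorphic_on_subset[OF G(2)]) auto
  then show ?thesis unfolding touched_above_def using F G
    by (intro exI[of _ "\<lambda>z. F z + G z"] exI[of _ "min r s"]) (auto intro!: add_mono)
qed

lemma harmonic_at_add:
  assumes "harmonic_at u p" "harmonic_at v p" shows "harmonic_at (\<lambda>z. u z + v z) p"
proof -
  obtain F r where F: "0 < r" "F holomorphic_on ball p r" "\<forall>z\<in>ball p r. u z = Re (F z)"
    using assms(1) unfolding harmonic_at_def by blast
  obtain G s where G: "0 < s" "G holomorphic_on ball p s" "\<forall>z\<in>ball p s. v z = Re (G z)"
    using assms(2) unfolding harmonic_at_def by blast
  show ?thesis
    by (rule harmonic_atI[of "\<lambda>z. F z + G z" "ball p (min r s)"])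
      (use F G in \<open>auto intro!: holomorphic_intros intro: holomorphic_on_subset\<close>)
qed

lemma harmonic_at_diff:
  "harmonic_at u p \<Longrightarrow> harmonic_at v p \<Longrightarrow> harmonic_at (\<lambda>z. u z - v z) p"
  using harmonic_at_add[of u p "\<lambda>z. - v z"] harmonic_at_minus by auto

lemma harmonic_at_cmult: assumes "harmonic_at u p" shows "harmonic_at (\<lambda>z. c * u z) p"
proof -
  obtain F r where F: "0 < r" "F holomorphic_on ball p r" "\<forall>z\<in>ball p r. u z = Re (F z)"
    using assms(1) unfolding harmonic_at_def by blast
  show ?thesis
    by (rule harmonic_atI[of "\<lambda>z. of_real c * F z" "ball p r"]) (use F in \<open>auto intro!: holomorphic_intros\<close>)
qed

lemma harmonic_at_compose:
  assumes "harmonic_at u (g p)" "g holomorphic_on S" "open S" "p \<in> S"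
  shows "harmonic_at (\<lambda>z. u (g z)) p"
proof -
  obtain F r where F: "0 < r" "F holomorphic_on ball (g p) r" "\<forall>z\<in>ball (g p) r. u z = Re (F z)"
    using assms(1) unfolding harmonic_at_def by blast
  define V where "V = S \<inter> g -` ball (g p) r"
  have V: "open V" unfolding V_def
    by (rule continuous_open_preimage) (use assms holomorphic_on_imp_continuous_on in auto)
  have "(F \<circ> g) holomorphic_on V"
    by (rule holomorphic_on_compose_gen[OF _ F(2)]) (use assms in \<open>auto simp: V_def intro: holomorphic_on_subset\<close>)
  then show ?thesis
    by (rule harmonic_atI[OF _ V]) (use F assms in \<open>auto simp: V_def\<close>)
qed

lemma touched_above_compose_uminus:
  assumes "touched_above u (- p)" shows "touched_above (\<lambda>z. u (- z)) p"
proof -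
  obtain F r where F: "0 < r" "F holomorphic_on ball (-p) r" "Re (F (-p)) = u (-p)" "\<forall>z\<in>ball (-p) r. u z \<le> Re (F z)"
    using assms(1) unfolding touched_above_def by blast
  have m: "- z \<in> ball (-p) r" if "z \<in> ball p r" for z
    using that by (simp add: dist_norm norm_minus_commute)
  have "(F \<circ> uminus) holomorphic_on ball p r"
    by (rule holomorphic_on_compose_gen[OF _ F(2)]) (use m in \<open>auto intro: holomorphic_intros simp del: mem_ball\<close>)
  then show ?thesis unfolding touched_above_def using F m
    by (intro exI[of _ "F \<circ> uminus"] exI[of _ r]) auto
qed

lemma harmonic_at_ln_norm:
  assumes "f holomorphic_on S" "open S" "p \<in> S" "f p \<noteq> 0"
  shows "harmonic_at (\<lambda>z. ln (cmod (f z))) p"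
proof -
  have "open (S \<inter> f -` (- {0}))"
    by (rule continuous_open_preimage) (use assms holomorphic_on_imp_continuous_on in auto)
  then obtain r where r: "r > 0" "ball p r \<subseteq> S \<inter> f -` (- {0})" 
    using openE[of "S \<inter> f -` (- {0})" p] assms by blast
  obtain g where g: "g holomorphic_on ball p r" "\<And>z. z \<in> ball p r \<Longrightarrow> f z = exp (g z)"
    by (rule contractible_imp_holomorphic_log[of f "ball p r"])
      (use r assms in \<open>auto intro: holomorphic_on_subset convex_imp_contractible\<close>)
  show ?thesis
    by (rule harmonic_atI[OF g(1)]) (use r g(2) in auto)
qed

text \<open>The majorant \<open>Re F\<close> also has a local minimum at \<open>p\<close>. A
  nonconstant \<open>F\<close> would be open and take values to the left of \<open>F p\<close>, so
  \<open>F\<close> is constant, and \<open>u\<close> is squeezed between \<open>u p\<close> and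
  \<open>Re F\<close>.\<close>

lemma touched_above_local_min:
  assumes "touched_above u p" "0 < r" "\<And>z. z \<in> ball p r \<Longrightarrow> u p \<le> u z"
  shows "\<exists>s>0. \<forall>z\<in>ball p s. u z = u p"
proof -
  obtain F r' where F: "0 < r'" "F holomorphic_on ball p r'" "Re (F p) = u p" "\<forall>z\<in>ball p r'. u z \<le> Re (F z)"
    using assms(1) unfolding touched_above_def by blast
  define s where "s = min r r'"
  have s: "s > 0" using F assms s_def by auto
  have hol: "F holomorphic_on ball p s" using F(2) by (rule holomorphic_on_subset) (auto simp: s_def)
  have ge: "Re (F p) \<le> Re (F z)" if "z \<in> ball p s" for z
    using F(4) assms(3)[of z] that F(3) by (force simp: s_def)
  have "F constant_on ball p s"
  proof (rule ccontr)
    assume "\<not> F constant_on ball p s"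
    then have "open (F ` ball p s)"
      by (intro open_mapping_thm[OF hol]) auto
    then obtain d where d: "d > 0" "ball (F p) d \<subseteq> F ` ball p s" using s
      by (meson centre_in_ball imageI openE)
    have "F p - of_real (d/2) \<in> ball (F p) d" using d by (simp add: dist_norm)
    then obtain z where "z \<in> ball p s" "F z = F p - of_real (d/2)" using d(2) by (smt (verit) imageE subsetD)
    with ge[of z] d show False by simp
  qed
  then have "F z = F p" if "z \<in> ball p s" for z
    using that s unfolding constant_on_def by (metis centre_in_ball)
  then have "u z = u p" if "z \<in> ball p s" for z
    using that F(3,4) assms(3)[of z] by (force simp: s_def)
  then show ?thesis using s by blast
qed

text \<open>Local rigidity makes the set of minimum points open, and compactness makes it closed; it
  would be a bounded nonempty set that is open and closed in the plane.\<close>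

lemma minimum_principle:
  fixes u :: "complex \<Rightarrow> real"
  assumes W: "open W" "bounded W"
    and touch: "\<And>p. p \<in> W \<Longrightarrow> touched_above u p"
    and cont: "\<And>p. p \<in> W \<Longrightarrow> isCont u p"
    and bd: "\<And>q \<epsilon>. q \<in> frontier W \<Longrightarrow> \<epsilon> > 0 \<Longrightarrow> eventually (\<lambda>z. u z > - \<epsilon>) (at q within W)"
    and z1: "z1 \<in> W"
  shows "0 \<le> u z1"
proof (rule ccontr)
  assume neg: "\<not> 0 \<le> u z1"
  \<comment> \<open>The boundary hypothesis with \<epsilon> = - \<open>u z1\<close> keeps this
    sublevel set away from the frontier, so it is closed in the whole plane although
    \<open>W\<close> is only open.\<close>
  define K where "K = {z\<in>W. u z \<le> u z1}"
  have "closed K"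
    unfolding closed_limpt
  proof (intro allI impI)
    fix q assume q: "q islimpt K"
    then have qW: "q \<in> closure W" using islimpt_subset[of q K W] by (auto simp: K_def closure_def)
    have ev: "frequently (\<lambda>z. z \<in> K) (at q)" using q by (simp add: islimpt_conv_frequently_at)
    show "q \<in> K"
    proof (cases "q \<in> W")
      case False
      then have "q \<in> frontier W" using qW W by (simp add: frontier_def interior_open)
      from bd[OF this, of "- u z1"] neg have "eventually (\<lambda>z. z \<in> W \<longrightarrow> u z > u z1) (at q)"
        by (simp add: eventually_at_filter)
      then have "eventually (\<lambda>z. z \<notin> K) (at q)" by eventually_elim (auto simp: K_def)
      with ev show ?thesis by (auto simp: frequently_def)
    next
      case True
      have "u q \<le> u z1"
      proof (rule ccontr)
        assume "\<not> ?thesis"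
        then have "u q > u z1" by simp
        with cont[OF True] have "eventually (\<lambda>z. u z > u z1) (at q)"
          unfolding isCont_def by (rule order_tendstoD(1))
        then have "eventually (\<lambda>z. z \<notin> K) (at q)" by eventually_elim (auto simp: K_def)
        with ev show False by (auto simp: frequently_def)
      qed
      with True show ?thesis by (simp add: K_def)
    qed
  qed
  moreover have "bounded K" using W(2) by (rule bounded_subset) (auto simp: K_def)
  ultimately have "compact K" by (simp add: compact_eq_bounded_closed)
  moreover have contK: "continuous_on K u"
    using cont by (auto simp: K_def intro!: continuous_at_imp_continuous_on)
  ultimately obtain p where p: "p \<in> K" "\<And>z. z \<in> K \<Longrightarrow> u p \<le> u z"
    using continuous_attains_inf[of K u] z1 by (auto simp: K_def)
  define A where "A = {z\<in>K. u z = u p}"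
  have "closed A"
    using continuous_closed_preimage[OF contK \<open>closed K\<close>, of "{u p}"] by (simp add: A_def vimage_def Int_def)
  moreover have "open A"
    unfolding open_contains_ball
  proof
    fix q assume q: "q \<in> A"
    then have qW: "q \<in> W" and uq: "u q = u p" by (auto simp: A_def K_def)
    obtain r where r: "r > 0" "ball q r \<subseteq> W" using W(1) qW openE by blast
    have min: "u q \<le> u z" if "z \<in> ball q r" for z
      using p that r uq by (cases "z \<in> K") (auto simp: K_def)
    obtain s where s: "s > 0" "\<forall>z\<in>ball q s. u z = u q"
      using touched_above_local_min[OF touch[OF qW] r(1) min] by blast
    have "ball q (min r s) \<subseteq> A"
      using s r uq q p(1) by (auto simp: A_def K_def)
    then show "\<exists>e>0. ball q e \<subseteq> A" using r(1) s(1) by (metis min_less_iff_conj)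
  qed
  moreover have "A \<noteq> {}" using p by (auto simp: A_def)
  ultimately have "A = UNIV" using clopen by blast
  moreover have "bounded A" using \<open>bounded K\<close> by (rule bounded_subset) (auto simp: A_def)
  ultimately show False by (simp add: not_bounded_UNIV)
qed

text \<open>Adding \<delta> times a nonnegative harmonic function that tends to +infinity at every
  point of \<open>X\<close> restores the boundary condition there; then \<delta> tends to 0. A lower
  bound of \<open>u\<close> near \<open>X\<close> is what this consumes.\<close>

lemma minimum_principle_except:
  fixes u :: "complex \<Rightarrow> real"
  assumes W: "open W" "bounded W" and X: "finite X"
    and touch: "\<And>p. p \<in> W - X \<Longrightarrow> touched_above u p"
    and cont: "\<And>p. p \<in> W - X \<Longrightarrow> isCont u p"
    and bd: "\<And>q \<epsilon>. q \<in> frontier W - X \<Longrightarrow> \<epsilon> > 0 \<Longrightarrow> eventually (\<lambda>z. u z > - \<epsilon>) (at q within W)"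
    and below: "\<And>q. q \<in> X \<Longrightarrow> \<exists>M. eventually (\<lambda>z. u z \<ge> M) (at q within W)"
    and z1: "z1 \<in> W - X"
  shows "0 \<le> u z1"
proof -
  obtain R0 where R0: "R0 > 0" "W \<union> X \<subseteq> ball 0 R0"
    using bounded_subset_ballD[of "W \<union> X" 0] W X by (auto simp: finite_imp_bounded)
  \<comment> \<open>\<open>R \<ge> 1\<close> makes ln (2 R) nonnegative, which covers the point z =
    x, where the other logarithm is ln 0 = 0.\<close>
  define R where "R = max R0 1"
  have R: "R \<ge> 1" "W \<union> X \<subseteq> ball 0 R" using R0 by (auto simp: R_def)
  \<comment> \<open>The distance between two points of the ball is at most 2 R, so every summand is
    nonnegative on \<open>W\<close>.\<close>
  define k where "k z = (\<Sum>x\<in>X. ln (2 * R) - ln (cmod (z - x)))" for z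
  have lek: "0 \<le> ln (2 * R) - ln (cmod (z - x))" if "z \<in> W" "x \<in> X" for z x
  proof -
    have "cmod z < R" "cmod x < R" using R that by auto
    then have "cmod (z - x) \<le> 2 * R" using norm_triangle_ineq4[of z x] by linarith
    then show ?thesis using R by (cases "z = x") (simp_all add: ln_mono)
  qed
  have k0: "0 \<le> k z" if "z \<in> W" for z unfolding k_def by (intro sum_nonneg lek that)
  have kharm: "harmonic_at (\<lambda>z. \<Sum>x\<in>Y. ln (2 * R) - ln (cmod (z - x))) p" if "p \<notin> X" "Y \<subseteq> X" for p Y
  proof -
    have "finite Y" using X that finite_subset by blast
    then show ?thesis using that(2)
    proof induction
      case (insert x F)
      have "harmonic_at (\<lambda>z. ln (cmod (z - x))) p"
        by (rule harmonic_at_ln_norm[of _ UNIV]) (use insert that in \<open>auto intro!: holomorphic_intros\<close>)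
      then show ?case using insert by (simp add: harmonic_at_add harmonic_at_diff)
    qed simp
  qed
  have main: "0 \<le> u z1 + \<delta> * k z1" if \<delta>: "\<delta> > 0" for \<delta>
  proof (rule minimum_principle[of "W - X"])
    show "open (W - X)" using W X by (simp add: finite_imp_closed open_Diff)
    show "bounded (W - X)" using W(2) by (rule bounded_subset) auto
    show "z1 \<in> W - X" by fact
  next
    fix p assume p: "p \<in> W - X"
    then have h: "harmonic_at (\<lambda>z. \<delta> * k z) p" using kharm[of p X] unfolding k_def by (intro harmonic_at_cmult) auto
    show "touched_above (\<lambda>z. u z + \<delta> * k z) p"
      by (intro touched_above_add touch p harmonic_at_imp_touched_above h)
    show "isCont (\<lambda>z. u z + \<delta> * k z) p"
      by (intro isCont_add cont p harmonic_at_imp_isCont h)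
  next
    fix q \<epsilon> :: "_" assume q: "q \<in> frontier (W - X)" and \<epsilon>: "(\<epsilon>::real) > 0"
    have "eventually (\<lambda>z. u z + \<delta> * k z > - \<epsilon>) (at q within W)"
    proof (cases "q \<in> X")
      case False
      have "q \<in> frontier W"
      proof -
        have "q \<in> closure W" using q closure_mono[of "W - X" W] by (auto simp: frontier_def)
        moreover have "q \<notin> W"
        proof
          assume "q \<in> W"
          then have "q \<in> interior (W - X)"
            using False W X by (simp add: finite_imp_closed open_Diff interior_open)
          with q show False by (simp add: frontier_def)
        qed
        ultimately show ?thesis using W by (simp add: frontier_def interior_open)
      qed
      then have "eventually (\<lambda>z. u z > - \<epsilon>) (at q within W)" using bd False \<epsilon> by blast
      moreover have "eventually (\<lambda>z. z \<in> W) (at q within W)" by (simp add: eventually_at_filter)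
      ultimately show ?thesis
      proof eventually_elim
        case (elim z) then show ?case using k0[of z] \<delta> by (smt (verit) mult_nonneg_nonneg)
      qed
    next
      case True
      obtain M where M: "eventually (\<lambda>z. u z \<ge> M) (at q within W)" using below True by blast
      have "filterlim (\<lambda>z. cmod (z - q)) (at_right 0) (at q)"
      proof -
        have "((\<lambda>z. cmod (z - q)) \<longlongrightarrow> cmod (q - q)) (at q)" by (intro tendsto_intros)
        moreover have "eventually (\<lambda>z. cmod (z - q) \<in> {0<..} \<and> cmod (z - q) \<noteq> 0) (at q)"
          by (simp add: eventually_at_filter)
        ultimately show ?thesis by (simp add: filterlim_at)
      qed
      then have "filterlim (\<lambda>z. ln (cmod (z - q))) at_bot (at q)"
        by (rule filterlim_compose[OF ln_at_0])
      then have "eventually (\<lambda>z. ln (cmod (z - q)) < ln (2 * R) - (\<bar>M\<bar> + 1) / \<delta>) (at q)"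
        unfolding filterlim_at_bot_dense by blast
      then have "eventually (\<lambda>z. ln (cmod (z - q)) < ln (2 * R) - (\<bar>M\<bar> + 1) / \<delta>) (at q within W)"
        by (rule filter_leD[OF at_le, rotated]) auto
      moreover have "eventually (\<lambda>z. z \<in> W) (at q within W)" by (simp add: eventually_at_filter)
      ultimately show ?thesis using M
      proof eventually_elim
        case (elim z)
        have "k z \<ge> ln (2 * R) - ln (cmod (z - q))" unfolding k_def
          using member_le_sum[of q X "\<lambda>x. ln (2 * R) - ln (cmod (z - x))"] True X lek elim by auto
        then have "k z \<ge> (\<bar>M\<bar> + 1) / \<delta>" using elim by linarith
        then have "\<delta> * k z \<ge> \<bar>M\<bar> + 1" using \<delta> by (simp add: field_simps)
        then show ?case using elim \<epsilon> by linarith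
      qed
    qed
    then show "eventually (\<lambda>z. u z + \<delta> * k z > - \<epsilon>) (at q within (W - X))"
      by (rule filter_leD[OF at_le, rotated]) auto
  qed
  show ?thesis
  proof (rule ccontr)
    assume n: "\<not> ?thesis"
    have kz: "k z1 \<ge> 0" using k0 z1 by auto
    \<comment> \<open>With this value \<delta> times \<open>k z1\<close> is at most half of -
      \<open>u z1\<close>; the summand 1 keeps the denominator positive.\<close>
    define \<delta> where "\<delta> = - u z1 / (2 * (k z1 + 1))"
    have "\<delta> > 0" unfolding \<delta>_def using n kz by (intro divide_pos_pos) auto
    moreover have "\<delta> * k z1 \<le> \<delta> * (k z1 + 1)" using \<open>\<delta> > 0\<close> by simp
    moreover have "\<delta> * (k z1 + 1) = - u z1 / 2" using kz by (simp add: \<delta>_def field_simps)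
    ultimately show False using main[of \<delta>] n by linarith
  qed
qed

text \<open>Each zero of a nonnegative function is a minimum, so by local rigidity the zero set is
  open; continuity makes its complement in \<open>W\<close> open as well.\<close>

lemma touched_above_zero_set:
  assumes W: "open W" "connected W"
    and touch: "\<And>p. p \<in> W \<Longrightarrow> touched_above u p"
    and cont: "\<And>p. p \<in> W \<Longrightarrow> isCont u p"
    and ge: "\<And>z. z \<in> W \<Longrightarrow> 0 \<le> u z"
    and z0: "z0 \<in> W" "u z0 = 0" and z: "z \<in> W"
  shows "u z = (0::real)"
proof -
  define A where "A = {z\<in>W. u z = 0}"
  have "open A" unfolding open_contains_ball
  proof
    fix q assume q: "q \<in> A"
    obtain r where r: "r > 0" "ball q r \<subseteq> W" using W(1) q openE by (auto simp: A_def)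
    have "u q \<le> u z" if "z \<in> ball q r" for z using ge[of z] q r that by (auto simp: A_def)
    moreover have "touched_above u q" using touch q by (auto simp: A_def)
    ultimately obtain s where s: "s > 0" "\<forall>z\<in>ball q s. u z = u q"
      using touched_above_local_min[of u q r] r(1) by blast
    have "u y = 0" if "y \<in> ball q s" for y
      using s(2)[rule_format, OF that] q by (simp add: A_def)
    then have "ball q (min r s) \<subseteq> A" using r(2) by (auto simp: A_def)
    then show "\<exists>e>0. ball q e \<subseteq> A" using r(1) s(1) by (metis min_less_iff_conj)
  qed
  moreover have "open (W \<inter> u -` (- {0}))"
    by (rule continuous_open_preimage) (use W cont in \<open>auto intro: continuous_at_imp_continuous_on\<close>)
  moreover have "A \<inter> (W \<inter> u -` (- {0})) \<inter> W = {}" "W \<subseteq> A \<union> (W \<inter> u -` (- {0}))"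
    by (auto simp: A_def)
  ultimately have "(W \<inter> u -` (- {0})) \<inter> W = {}"
    using connectedD[OF W(2), of A "W \<inter> u -` (- {0})"] z0 by (auto simp: A_def)
  then show ?thesis using z by auto
qed

text \<open>Cauchy's inequality on discs of radius r/2 turns the single bound \<open>g\<close> into
  the bound 2 g / r for all difference quotients near \<open>w0\<close>, so dominated convergence
  differentiates under the integral.\<close>

lemma holomorphic_on_lebesgue_integral:
  fixes F :: "complex \<Rightarrow> 'a \<Rightarrow> complex"
  assumes S: "open S"
    and hol: "\<And>s. s \<in> space M \<Longrightarrow> (\<lambda>w. F w s) holomorphic_on S"
    and meas: "\<And>w. w \<in> S \<Longrightarrow> F w \<in> borel_measurable M"
    and bound: "\<And>w s. w \<in> S \<Longrightarrow> s \<in> space M \<Longrightarrow> norm (F w s) \<le> g s"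
    and g: "integrable M g"
  shows "(\<lambda>w. \<integral>s. F w s \<partial>M) holomorphic_on S"
proof (rule holomorphic_onI)
  fix w0 assume w0: "w0 \<in> S"
  have int: "integrable M (F w)" if "w \<in> S" for w
    by (rule Bochner_Integration.integrable_bound[OF g meas[OF that]])
      (use bound[OF that] in \<open>force intro!: AE_I2\<close>)
  obtain r where r: "r > 0" "cball w0 r \<subseteq> S" using S w0 open_contains_cball by blast
  define D where "D s = deriv (\<lambda>w. F w s) w0" for s
  have quot: "norm ((F w s - F w0 s) / (w - w0)) \<le> g s * (2 / r)"
    if w: "w \<in> ball w0 (r/2)" "w \<noteq> w0" and s: "s \<in> space M" for w s
  proof -
    have dS: "(\<lambda>w. F w s) field_differentiable at x" if "x \<in> S" for x
      using holomorphic_on_imp_differentiable_at[OF hol[OF s] S that] .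
    have "norm (F w s - F w0 s) \<le> (g s * (2 / r)) * norm (w - w0)"
    proof (rule field_differentiable_bound[of "ball w0 (r/2)" "\<lambda>w. F w s" "deriv (\<lambda>w. F w s)"])
      fix x assume x: "x \<in> ball w0 (r/2)"
      have sub: "cball x (r/2) \<subseteq> cball w0 r"
      proof
        fix y assume "y \<in> cball x (r/2)"
        then show "y \<in> cball w0 r" using x dist_triangle[of w0 y x] by simp
      qed
      have "norm ((deriv ^^ 1) (\<lambda>w. F w s) x) \<le> fact 1 * g s / (r/2) ^ 1"
      proof (rule Cauchy_inequality)
        show "(\<lambda>w. F w s) holomorphic_on ball x (r/2)"
          using hol[OF s] by (rule holomorphic_on_subset) (use sub r ball_subset_cball in blast)
        show "continuous_on (cball x (r/2)) (\<lambda>w. F w s)"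
          by (rule continuous_on_subset[OF holomorphic_on_imp_continuous_on[OF hol[OF s]]]) (use sub r in blast)
        show "0 < r/2" using r by simp
        show "norm (F y s) \<le> g s" if "norm (x - y) = r/2" for y
        proof (rule bound[OF _ s])
          have "y \<in> cball x (r/2)" using that by (simp add: dist_norm)
          then show "y \<in> S" using sub r by blast
        qed
      qed
      then show "norm (deriv (\<lambda>w. F w s) x) \<le> g s * (2 / r)" by simp
      show "((\<lambda>w. F w s) has_field_derivative deriv (\<lambda>w. F w s) x) (at x within ball w0 (r/2))"
      proof (rule has_field_derivative_at_within, rule field_differentiable_derivI, rule dS)
        show "x \<in> S" by (rule subsetD[OF r(2)]) (use x r in auto)
      qed
    qed (use w r in auto)
    then show ?thesis using w by (simp add: norm_divide pos_divide_le_eq)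
  qed
  have "((\<lambda>w. ((\<integral>s. F w s \<partial>M) - (\<integral>s. F w0 s \<partial>M)) / (w - w0)) \<longlongrightarrow> (\<integral>s. D s \<partial>M)) (at w0)"
    unfolding tendsto_at_iff_sequentially o_def
  proof (intro allI impI)
    fix X :: "nat \<Rightarrow> complex" assume X: "\<forall>i. X i \<in> UNIV - {w0}" "X \<longlonglongrightarrow> w0"
    have "eventually (\<lambda>n. X n \<in> ball w0 (r/2)) sequentially"
      using X(2) r by (intro topological_tendstoD) auto
    then obtain n0 where n0: "\<And>n. n \<ge> n0 \<Longrightarrow> X n \<in> ball w0 (r/2)" by (auto simp: eventually_sequentially)
    have XS: "X n \<in> S" if "n \<ge> n0" for n using n0[OF that] r by (auto simp: subset_iff)
    have lim: "(\<lambda>n. (F (X (n + n0)) s - F w0 s) / (X (n + n0) - w0)) \<longlonglongrightarrow> D s" if s: "s \<in> space M" for s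
    proof -
      have "((\<lambda>w. F w s) has_field_derivative D s) (at w0)"
        unfolding D_def using hol[OF s] S w0 holomorphic_derivI by blast
      then have "((\<lambda>w. (F w s - F w0 s) / (w - w0)) \<longlongrightarrow> D s) (at w0)" by (simp add: has_field_derivative_iff)
      then have "(\<lambda>n. (F (X n) s - F w0 s) / (X n - w0)) \<longlonglongrightarrow> D s"
        using X unfolding tendsto_at_iff_sequentially o_def by blast
      then show ?thesis by (rule LIMSEQ_ignore_initial_segment)
    qed
    have mq: "(\<lambda>s. (F (X (n + n0)) s - F w0 s) / (X (n + n0) - w0)) \<in> borel_measurable M" for n
      using meas[OF XS[of "n + n0"]] meas[OF w0] by measurable
    have "(\<lambda>n. \<integral>s. (F (X (n + n0)) s - F w0 s) / (X (n + n0) - w0) \<partial>M) \<longlonglongrightarrow> (\<integral>s. D s \<partial>M)"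
    proof (rule integral_dominated_convergence[where w = "\<lambda>s. g s * (2 / r)"])
      show "D \<in> borel_measurable M" using mq lim by (rule borel_measurable_LIMSEQ_metric)
      show "integrable M (\<lambda>s. g s * (2 / r))" using g by simp
      show "AE s in M. (\<lambda>n. (F (X (n + n0)) s - F w0 s) / (X (n + n0) - w0)) \<longlonglongrightarrow> D s"
        using lim by (intro AE_I2)
      show "AE s in M. norm ((F (X (n + n0)) s - F w0 s) / (X (n + n0) - w0)) \<le> g s * (2 / r)" for n
        using quot[of "X (n + n0)"] n0[of "n + n0"] X(1) by (intro AE_I2) auto
    qed (use mq in auto)
    moreover have "(\<integral>s. (F (X (n + n0)) s - F w0 s) / (X (n + n0) - w0) \<partial>M) =
        ((\<integral>s. F (X (n + n0)) s \<partial>M) - (\<integral>s. F w0 s \<partial>M)) / (X (n + n0) - w0)" for n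
      using int[OF XS[of "n + n0"]] int[OF w0] by simp
    ultimately have "(\<lambda>n. ((\<integral>s. F (X (n + n0)) s \<partial>M) - (\<integral>s. F w0 s \<partial>M)) / (X (n + n0) - w0)) \<longlonglongrightarrow> (\<integral>s. D s \<partial>M)"
      by (simp only:)
    then show "(\<lambda>n. ((\<integral>s. F (X n) s \<partial>M) - (\<integral>s. F w0 s \<partial>M)) / (X n - w0)) \<longlonglongrightarrow> (\<integral>s. D s \<partial>M)"
      by (rule LIMSEQ_offset)
  qed
  then have "((\<lambda>w. \<integral>s. F w s \<partial>M) has_field_derivative (\<integral>s. D s \<partial>M)) (at w0)"
    by (simp add: has_field_derivative_iff)
  then show "(\<lambda>w. \<integral>s. F w s \<partial>M) field_differentiable at w0 within S"
    using field_differentiable_at_within field_differentiable_def by blast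
qed

section \<open>The two-sheeted surface and its rational functions\<close>

locale two_sheets =
  fixes w :: real
  assumes w_pos: "0 < w" and w_le_1: "w \<le> 1"
begin

definition root :: "complex \<Rightarrow> complex \<Rightarrow> bool" where
  "root z t \<longleftrightarrow> t\<^sup>2 = (z + 2) * t + of_real (3 * w)"

text \<open>The sheet exchange: the product of the two roots over the same \<open>z\<close> is -3w.
  Its fixed points t^2 = -3w lie over the branch points.\<close>

definition conj_root :: "complex \<Rightarrow> complex" where
  "conj_root t = - of_real (3 * w) / t"

text \<open>The factors are read off from the residues of the square root of \<open>qd\<close>. The
  zeros 3 + 3s and 3 - 3s with s = sqrt (1 - w) lie over z = 4s and z = -4s, the double pole t = w
  over z = w - 5, and the zero t = 0 over infinity on the sheet of the small root. For large
  \<open>t\<close> one has Y(t) ~ t ~ z, as a logarithmic potential of mass one requires.\<close>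

definition Y :: "complex \<Rightarrow> complex" where
  "Y t = t * (t\<^sup>2 - 6 * t + of_real (9 * w)) / (t - of_real w)\<^sup>2"

text \<open>\<open>num t / den t\<close> is - Y(t) / Y(conj_root t). Keeping two polynomials instead
  of a quotient lets the values at the two roots be compared even over a pole.\<close>

definition num :: "complex \<Rightarrow> complex" where
  "num t = t\<^sup>2 * (t\<^sup>2 - 6 * t + of_real (9 * w)) * (t + 3)\<^sup>2"

definition den :: "complex \<Rightarrow> complex" where
  "den t = 27 * (t\<^sup>2 + 2 * t + of_real w) * (t - of_real w)\<^sup>2"

text \<open>The part in the left half-plane of the open disc with diameter [-3, w]. The circle
  passes through the double roots t^2 = -3w, and through -3 and w, the two roots over the pole z = w
  - 5.\<close>

definition Delta :: "complex set" where
  "Delta = {t. Re t < 0 \<and> (cmod t)\<^sup>2 + (3 - w) * Re t < 3 * w}"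

lemma root_nz: "root z t \<Longrightarrow> t \<noteq> 0"
  using w_pos by (auto simp: root_def)

lemma conj_root_nz: "t \<noteq> 0 \<Longrightarrow> conj_root t \<noteq> 0"
  using w_pos by (auto simp: conj_root_def)

lemma conj_root_conj_root [simp]: "conj_root (conj_root t) = t"
  using w_pos by (cases "t = 0") (auto simp: conj_root_def)

lemma root_iff: "t \<noteq> 0 \<Longrightarrow> root z t \<longleftrightarrow> z = t - 2 + conj_root t"
  unfolding root_def conj_root_def by (auto simp: field_simps power2_eq_square)

lemma root_conj_root: "root z t \<Longrightarrow> root z (conj_root t)"
  using root_iff[of t z] root_iff[of "conj_root t" z] root_nz[of z t] conj_root_nz[of t] by auto

lemma root_cases: assumes "root z t" "root z s" shows "s = t \<or> s = conj_root t"
proof -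
  have "t \<noteq> 0" using assms root_nz by auto
  have "(s - t) * (s - conj_root t) = s\<^sup>2 - (t + conj_root t) * s + t * conj_root t"
    by (simp add: algebra_simps power2_eq_square)
  also have "t + conj_root t = z + 2" using root_iff[OF \<open>t \<noteq> 0\<close>] assms by simp
  also have "t * conj_root t = - of_real (3 * w)" using \<open>t \<noteq> 0\<close> by (simp add: conj_root_def)
  finally show ?thesis using assms(2) by (auto simp: root_def)
qed

lemma Re_conj_root: "Re (conj_root t) = - (3 * w * Re t / (cmod t)\<^sup>2)"
  unfolding conj_root_def by (simp add: complex_div_cnj[of _ t] Re_divide_of_real flip: of_real_power)

lemma conj_root_Re_pos: "Re t < 0 \<Longrightarrow> Re (conj_root t) > 0"
  using w_pos by (subst Re_conj_root) (auto intro!: divide_neg_pos mult_pos_neg)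

lemma cmod_conj_root: "cmod (conj_root t) = 3 * w / cmod t"
  using w_pos by (simp add: conj_root_def norm_divide)

lemma root_exists: "\<exists>t. root z t \<and> Re t \<le> 0"
proof -
  define s where "s = csqrt ((z + 2)\<^sup>2 + of_real (12 * w))"
  define t where "t = (z + 2 + s) / 2"
  have s2: "s\<^sup>2 = (z + 2)\<^sup>2 + of_real (12 * w)" by (simp add: s_def)
  have "root z t" unfolding root_def t_def using s2 by (simp add: power2_eq_square field_simps)
  moreover have "Re (conj_root t) \<le> 0" if "Re t > 0"
    using that w_pos by (simp add: Re_conj_root)
  ultimately show ?thesis using root_conj_root[of z t] by (meson not_le)
qed

text \<open>The real parts of the two roots have opposite signs, so the choice is arbitrary only
  when both roots are purely imaginary; wherever the real part is negative the root is
  unique.\<close>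

definition neg_root :: "complex \<Rightarrow> complex" where
  "neg_root z = (SOME t. root z t \<and> Re t \<le> 0)"

lemma neg_root: "root z (neg_root z)" "Re (neg_root z) \<le> 0"
  using someI_ex[OF root_exists[of z]] unfolding neg_root_def by auto

lemma neg_root_eq: assumes "root z t" "Re t < 0" shows "neg_root z = t"
  using root_cases[OF assms(1) neg_root(1)] conj_root_Re_pos[OF assms(2)] neg_root(2)[of z] by auto

lemma root_cnj: assumes "root z t" shows "root (cnj z) (cnj t)"
proof -
  have "cnj (t\<^sup>2) = cnj ((z + 2) * t + of_real (3 * w))" using assms by (simp add: root_def)
  then show ?thesis by (simp add: root_def)
qed

lemma root_disc: assumes "root z t" shows "(2 * t - z - 2)\<^sup>2 = (z + 2)\<^sup>2 + of_real (12 * w)"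
proof -
  have "(2 * t - z - 2)\<^sup>2 = (z + 2)\<^sup>2 + 4 * (t\<^sup>2 - (z + 2) * t)"
    by (simp add: power2_eq_square algebra_simps)
  then show ?thesis using assms by (simp add: root_def)
qed

lemma conj_root_eq_iff: "root z t \<Longrightarrow> conj_root t = t \<longleftrightarrow> (z + 2)\<^sup>2 + of_real (12 * w) = 0"
proof -
  assume r: "root z t"
  have "2 * t - z - 2 = t - conj_root t" using root_iff[of t z] r root_nz[OF r] by (simp add: algebra_simps)
  then show ?thesis using root_disc[OF r] by (metis eq_iff_diff_eq_0 zero_eq_power2)
qed

lemma Y_conj_root: "t \<noteq> 0 \<Longrightarrow> Y (conj_root t) = - 27 * (t\<^sup>2 + 2 * t + of_real w) / (t * (t + 3)\<^sup>2)"
proof (cases "t = -3")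
  \<comment> \<open>Here the conjugate root is w, and both sides are 0 because each is a quotient
    with denominator 0.\<close>
  case True then show ?thesis using w_pos by (simp add: Y_def conj_root_def)
next
  case False
  assume t: "t \<noteq> 0"
  have w: "complex_of_real w \<noteq> 0" using w_pos by simp
  have t3: "t + 3 \<noteq> 0" using False by (simp add: add_eq_0_iff2)
  have "conj_root t - of_real w = - of_real w * (t + 3) / t"
    using t by (simp add: conj_root_def field_simps)
  moreover have "(conj_root t)\<^sup>2 - 6 * conj_root t + of_real (9 * w) = 9 * of_real w * (t\<^sup>2 + 2 * t + of_real w) / t\<^sup>2"
    using t by (simp add: conj_root_def power2_eq_square) (simp add: field_simps)
  moreover have "- of_real (3 * w) / t * (9 * of_real w * B / t\<^sup>2) / (- of_real w * u / t)\<^sup>2 = - 27 * B / (t * u\<^sup>2)"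
    if "u \<noteq> 0" for B u using t w that by (simp add: field_simps power2_eq_square)
  ultimately show ?thesis unfolding Y_def using t3 by (simp only: conj_root_def)
qed

lemma num_conj_root: "t \<noteq> 0 \<Longrightarrow> num (conj_root t) = 27 * of_real w ^ 3 * den t / t ^ 6"
proof -
  assume t: "t \<noteq> 0"
  have "conj_root t + 3 = 3 * (t - of_real w) / t"
    using t by (simp add: conj_root_def field_simps)
  moreover have "(conj_root t)\<^sup>2 - 6 * conj_root t + of_real (9 * w) = 9 * of_real w * (t\<^sup>2 + 2 * t + of_real w) / t\<^sup>2"
    using t by (simp add: conj_root_def power2_eq_square) (simp add: field_simps)
  ultimately show ?thesis unfolding num_def den_def using t
    by (simp add: conj_root_def power_divide power_mult_distrib) (simp add: field_simps eval_nat_numeral)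
qed

lemma den_conj_root: "t \<noteq> 0 \<Longrightarrow> den (conj_root t) = 27 * of_real w ^ 3 * num t / t ^ 6"
proof -
  assume t: "t \<noteq> 0"
  have "conj_root t - of_real w = - of_real w * (t + 3) / t"
    using t by (simp add: conj_root_def field_simps)
  moreover have "(conj_root t)\<^sup>2 + 2 * conj_root t + of_real w = of_real w * (t\<^sup>2 - 6 * t + of_real (9 * w)) / t\<^sup>2"
    using t by (simp add: conj_root_def power2_eq_square) (simp add: field_simps)
  ultimately show ?thesis unfolding num_def den_def using t
    by (simp add: conj_root_def power_divide power_mult_distrib) (simp add: field_simps eval_nat_numeral)
qed

text \<open>Exchanging the sheets swaps \<open>num\<close> and \<open>den\<close> up to the common
  factor 27 w^3 / t^6, hence reverses the comparison.\<close>

lemma num_le_den_conj_root: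
  assumes "t \<noteq> 0" shows "cmod (num (conj_root t)) \<le> cmod (den (conj_root t)) \<longleftrightarrow> cmod (den t) \<le> cmod (num t)"
proof -
  have "27 * w ^ 3 / cmod t ^ 6 > 0" using assms w_pos by simp
  moreover have "cmod (num (conj_root t)) = 27 * w ^ 3 / cmod t ^ 6 * cmod (den t)"
    "cmod (den (conj_root t)) = 27 * w ^ 3 / cmod t ^ 6 * cmod (num t)"
    using assms w_pos by (simp_all add: num_conj_root den_conj_root norm_mult norm_divide norm_power)
  ultimately show ?thesis using mult_le_cancel_left_pos by metis
qed

lemma quadratic_norm:
  "(cmod (t\<^sup>2 + of_real b * t + of_real c))\<^sup>2 =
    (let X = (cmod t)\<^sup>2; x = Re t in X\<^sup>2 + b\<^sup>2 * X + c\<^sup>2 + 2 * b * X * x + 2 * c * (2 * x\<^sup>2 - X) + 2 * b * c * x)"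
  unfolding cmod_power2 Let_def by (simp add: power2_eq_square algebra_simps)

text \<open>Squared moduli depend only on X = |t|^2 and x = Re t. On the two boundary pieces of
  \<open>Delta\<close> one linear relation between X and x remains, so the comparison becomes one
  about polynomials in a single variable.\<close>

lemma num_den_norms:
  defines "X \<equiv> \<lambda>t. (cmod t)\<^sup>2"
  shows "(cmod (num t))\<^sup>2 = (X t)\<^sup>2 * ((X t)\<^sup>2 + 36 * X t + 81 * w\<^sup>2 - 12 * X t * Re t + 18 * w * (2 * (Re t)\<^sup>2 - X t) - 108 * w * Re t)
      * (X t + 6 * Re t + 9)\<^sup>2"
    "(cmod (den t))\<^sup>2 = 729 * ((X t)\<^sup>2 + 4 * X t + w\<^sup>2 + 4 * X t * Re t + 2 * w * (2 * (Re t)\<^sup>2 - X t) + 4 * w * Re t)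
      * (X t - 2 * w * Re t + w\<^sup>2)\<^sup>2"
proof -
  have a: "(cmod (t + 3))\<^sup>2 = X t + 6 * Re t + 9" "(cmod (t - of_real w))\<^sup>2 = X t - 2 * w * Re t + w\<^sup>2"
    unfolding X_def cmod_power2 by (simp_all add: power2_eq_square algebra_simps)
  have e: "(cmod (z\<^sup>2))\<^sup>2 = ((cmod z)\<^sup>2)\<^sup>2" for z by (simp add: norm_power)
  have q1: "(cmod (t\<^sup>2 - 6 * t + of_real (9 * w)))\<^sup>2 =
      (X t)\<^sup>2 + 36 * X t + 81 * w\<^sup>2 - 12 * X t * Re t + 18 * w * (2 * (Re t)\<^sup>2 - X t) - 108 * w * Re t"
    using quadratic_norm[of t "-6" "9 * w"] unfolding Let_def X_def by (simp add: power_mult_distrib)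
  have q2: "(cmod (t\<^sup>2 + 2 * t + of_real w))\<^sup>2 =
      (X t)\<^sup>2 + 4 * X t + w\<^sup>2 + 4 * X t * Re t + 2 * w * (2 * (Re t)\<^sup>2 - X t) + 4 * w * Re t"
    using quadratic_norm[of t 2 w] unfolding Let_def X_def by simp
  have X: "(cmod t)\<^sup>2 = X t" by (simp add: X_def)
  show "(cmod (num t))\<^sup>2 = (X t)\<^sup>2 * ((X t)\<^sup>2 + 36 * X t + 81 * w\<^sup>2 - 12 * X t * Re t + 18 * w * (2 * (Re t)\<^sup>2 - X t) - 108 * w * Re t)
      * (X t + 6 * Re t + 9)\<^sup>2"
    unfolding num_def norm_mult power_mult_distrib e a q1 X ..
  show "(cmod (den t))\<^sup>2 = 729 * ((X t)\<^sup>2 + 4 * X t + w\<^sup>2 + 4 * X t * Re t + 2 * w * (2 * (Re t)\<^sup>2 - X t) + 4 * w * Re t)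
      * (X t - 2 * w * Re t + w\<^sup>2)\<^sup>2"
    unfolding den_def norm_mult power_mult_distrib e a q2 X by simp
qed

text \<open>The factorisation exposes the sign: for X < 3w every factor is positive. The triple zero
  at X = 3w is at the double root, where \<open>num\<close> and \<open>den\<close> have equal
  modulus.\<close>

lemma num_den_imaginary:
  assumes "Re t = 0" "(cmod t)\<^sup>2 = X"
  shows "(cmod (den t))\<^sup>2 - (cmod (num t))\<^sup>2 = (9 * w\<^sup>2 - X\<^sup>2) * (X - 3 * w)\<^sup>2 * (X\<^sup>2 + (54 - 12 * w) * X + 9 * w\<^sup>2)"
  unfolding num_den_norms assms by (simp add: eval_nat_numeral algebra_simps)

lemma num_le_den_imaginary:
  assumes "Re t = 0" "(cmod t)\<^sup>2 \<le> 3 * w"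
  shows "cmod (num t) \<le> cmod (den t)"
    and "(cmod t)\<^sup>2 < 3 * w \<Longrightarrow> cmod (num t) < cmod (den t)"
proof -
  define X where "X = (cmod t)\<^sup>2"
  have X: "0 \<le> X" "X \<le> 3 * w" using assms by (auto simp: X_def)
  have a: "X\<^sup>2 \<le> 9 * w\<^sup>2" using power_mono[OF X(2) X(1), of 2] by (simp add: power_mult_distrib)
  have b: "X\<^sup>2 + (54 - 12 * w) * X + 9 * w\<^sup>2 > 0" using X w_pos w_le_1
    by (intro add_nonneg_pos add_nonneg_nonneg mult_nonneg_nonneg) auto
  have "0 \<le> (cmod (den t))\<^sup>2 - (cmod (num t))\<^sup>2"
    unfolding num_den_imaginary[OF assms(1) X_def[symmetric]] using a b by simp
  then have "(cmod (num t))\<^sup>2 \<le> (cmod (den t))\<^sup>2" by linarith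
  then show "cmod (num t) \<le> cmod (den t)" by (rule power2_le_imp_le) (rule norm_ge_zero)
  assume "(cmod t)\<^sup>2 < 3 * w"
  then have c: "X < 3 * w" by (simp add: X_def)
  have "X\<^sup>2 < 9 * w\<^sup>2" using power_strict_mono[OF c X(1), of 2] by (simp add: power_mult_distrib)
  then have "0 < (cmod (den t))\<^sup>2 - (cmod (num t))\<^sup>2"
    unfolding num_den_imaginary[OF assms(1) X_def[symmetric]] using b c by simp
  then have "(cmod (num t))\<^sup>2 < (cmod (den t))\<^sup>2" by linarith
  then show "cmod (num t) < cmod (den t)" by (rule power2_less_imp_less) (rule norm_ge_zero)
qed

text \<open>On the circle m x = 3w - X with m = 3 - w, so x is eliminated after multiplying by
  powers of m. The difference of the squares then contains the factors X^2 - 9w^2 and (X - 3w)^2,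
  and a quadratic P in X is left to be estimated on [3w, 9].\<close>

lemma num_le_den_circle:
  assumes "Re t \<le> 0" and circ: "(cmod t)\<^sup>2 + (3 - w) * Re t = 3 * w"
  shows "cmod (num t) \<le> cmod (den t)"
proof -
  define X x m where "X = (cmod t)\<^sup>2" and "x = Re t" and "m = 3 - w"
  have w_m: "w = 3 - m" by (simp add: m_def)
  have m: "2 \<le> m" "m < 3" using w_pos w_le_1 by (auto simp: m_def)
  have Xx: "X = 3 * w - m * x" using circ by (simp add: X_def x_def m_def)
  have x: "- 3 \<le> x" "x \<le> 0"
  \<comment> \<open>The endpoints of the arc give the range: the circle meets the real axis at -3
    and w, and x \<le> 0 selects the part between x = -3 and the imaginary axis.\<close>
  proof -
    have "x\<^sup>2 \<le> X" by (simp add: x_def X_def cmod_power2)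
    then have "(x + 3) * (x - w) \<le> 0" unfolding Xx m_def by (simp add: power2_eq_square algebra_simps)
    then show "- 3 \<le> x" using w_pos assms(1) mult_neg_neg[of "x + 3" "x - w"] by (auto simp: x_def not_less intro: ccontr)
    show "x \<le> 0" using assms by (simp add: x_def)
  qed
  have X3: "3 * w \<le> X" using Xx x m by (simp add: mult_nonneg_nonpos)
  have X9: "X \<le> 9"
    unfolding Xx using mult_left_mono[of "-3" x m] x m by (simp add: m_def)
  \<comment> \<open>The cofactor that remains after the vanishing factors are split off. Subtracting
    the multiple of (X - 3w)(9 - X) that cancels its leading term leaves a linear function of X with
    nonnegative coefficients for w \<le> 1.\<close>
  define P where "P = - (15 + w) * X\<^sup>2 + (12 * w\<^sup>2 + 18 * w + 162) * X - 9 * w\<^sup>2 * (w + 15)"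
  have "P \<ge> 0"
  proof -
    have 1: "(X - 3 * w) * (9 - X) \<ge> 0" using X3 X9 by simp
    have "P = (15 + w) * ((X - 3 * w) * (9 - X))
       + ((12 * w\<^sup>2 + 18 * w + 162) - (15 + w) * (9 + 3 * w)) * X + (15 + w) * (27 * w) - 9 * w\<^sup>2 * (w + 15)"
      unfolding P_def by (simp add: power2_eq_square algebra_simps)
    also have "(12 * w\<^sup>2 + 18 * w + 162) - (15 + w) * (9 + 3 * w) = 9 * w\<^sup>2 - 36 * w + 27"
      by (simp add: power2_eq_square algebra_simps)
    also have "9 * w\<^sup>2 - 36 * w + 27 = 9 * ((1 - w) * (3 - w))" by (simp add: power2_eq_square algebra_simps)
    finally have "P = (15 + w) * ((X - 3 * w) * (9 - X)) + 9 * ((1 - w) * (3 - w)) * X + 9 * w * (15 + w) * (3 - w)"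
      by (simp add: power2_eq_square algebra_simps)
    moreover have "0 \<le> (15 + w) * ((X - 3 * w) * (9 - X))" using 1 w_pos by (intro mult_nonneg_nonneg[of "15 + w"]) auto
    moreover have "0 \<le> 9 * ((1 - w) * (3 - w)) * X" using w_pos w_le_1 X3 by (intro mult_nonneg_nonneg) auto
    moreover have "0 \<le> 9 * w * (15 + w) * (3 - w)" using w_pos w_le_1 by (intro mult_nonneg_nonneg) auto
    ultimately show ?thesis by linarith
  qed
  define A B a c where "A = X\<^sup>2 + 36 * X + 81 * w\<^sup>2 - 12 * X * x + 18 * w * (2 * x\<^sup>2 - X) - 108 * w * x"
    and "B = X\<^sup>2 + 4 * X + w\<^sup>2 + 4 * X * x + 2 * w * (2 * x\<^sup>2 - X) + 4 * w * x"
    and "a = X + 6 * x + 9" and "c = X - 2 * w * x + w\<^sup>2"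
  \<comment> \<open>B times m^2, divided by the common factor 3 + w, after m x has been replaced by
    3w - X.\<close>
  define B0 where "B0 = (w - 1) * X\<^sup>2 - 2 * (w + 6) * (w - 1) * X + w\<^sup>2 * (w + 15)"
  have mx: "m * x = 3 * w - X" using Xx by simp
  have "m * a = m * X + 6 * (m * x) + 9 * m" "m * c = m * X - 2 * w * (m * x) + m * w\<^sup>2"
    unfolding a_def c_def by (simp_all add: algebra_simps)
  then have ma: "m * a = (3 + w) * (9 - X)" and mc: "m * c = (3 + w) * (X - w\<^sup>2)"
    unfolding mx by (simp_all add: m_def power2_eq_square algebra_simps)
  have mB: "m\<^sup>2 * B = (3 + w) * B0"
  proof -
    have "m\<^sup>2 * B = m\<^sup>2 * (X\<^sup>2 + 4 * X + w\<^sup>2 - 2 * w * X) + 4 * X * m * (m * x) + 4 * w * (m * x)\<^sup>2 + 4 * w * m * (m * x)"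
      unfolding B_def by (simp add: power2_eq_square algebra_simps)
    then show ?thesis unfolding mx B0_def by (simp add: m_def power2_eq_square algebra_simps)
  qed
  have mA: "m\<^sup>2 * A = 9 * ((3 + w) * B0) + 8 * m * (3 + w) * (X\<^sup>2 - 9 * w\<^sup>2)"
  proof -
    have "m\<^sup>2 * A = 9 * (m\<^sup>2 * B) + m * (- 8 * m * X\<^sup>2 + 72 * m * w\<^sup>2 - 48 * X * (m * x) - 144 * w * (m * x))"
      unfolding A_def B_def by (simp add: power2_eq_square algebra_simps)
    then show ?thesis unfolding mx mB by (simp add: m_def power2_eq_square algebra_simps)
  qed
  have "m ^ 4 * ((cmod (den t))\<^sup>2 - (cmod (num t))\<^sup>2) = 729 * (m\<^sup>2 * B) * (m * c)\<^sup>2 - X\<^sup>2 * (m\<^sup>2 * A) * (m * a)\<^sup>2"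
    unfolding num_den_norms X_def[symmetric] x_def[symmetric] A_def[symmetric] B_def[symmetric] a_def[symmetric] c_def[symmetric]
    by (simp add: eval_nat_numeral algebra_simps)
  also have "\<dots> = (3 + w) ^ 3 * (729 * B0 * (X - w\<^sup>2)\<^sup>2 - X\<^sup>2 * (9 * B0 + 8 * m * (X\<^sup>2 - 9 * w\<^sup>2)) * (9 - X)\<^sup>2)"
    unfolding mA mB ma mc by (simp only: power_mult_distrib) (simp add: eval_nat_numeral algebra_simps)
  also have "729 * B0 * (X - w\<^sup>2)\<^sup>2 - X\<^sup>2 * (9 * B0 + 8 * m * (X\<^sup>2 - 9 * w\<^sup>2)) * (9 - X)\<^sup>2 = (X\<^sup>2 - 9 * w\<^sup>2) * (X - 3 * w)\<^sup>2 * P"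
    unfolding B0_def P_def m_def by (simp add: eval_nat_numeral algebra_simps)
  finally have id: "m ^ 4 * ((cmod (den t))\<^sup>2 - (cmod (num t))\<^sup>2) = (3 + w) ^ 3 * ((X\<^sup>2 - 9 * w\<^sup>2) * (X - 3 * w)\<^sup>2 * P)" .
  have "X\<^sup>2 \<ge> 9 * w\<^sup>2" using power_mono[OF X3, of 2] w_pos by (simp add: power_mult_distrib)
  then have "0 \<le> m ^ 4 * ((cmod (den t))\<^sup>2 - (cmod (num t))\<^sup>2)" unfolding id using \<open>P \<ge> 0\<close> w_pos by simp
  then have "0 \<le> (cmod (den t))\<^sup>2 - (cmod (num t))\<^sup>2" using m by (simp add: zero_le_mult_iff)
  then have "(cmod (num t))\<^sup>2 \<le> (cmod (den t))\<^sup>2" by linarith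
  then show ?thesis by (rule power2_le_imp_le) (rule norm_ge_zero)
qed

end

section \<open>The square root of the quadratic differential and its logarithmic primitive\<close>

context two_sheets
begin

definition pole :: "complex \<Rightarrow> bool" where
  "pole z \<longleftrightarrow> z\<^sup>2 = of_real (16 * (1 - w)) \<or> z = of_real (w - 5)"

text \<open>The points where \<open>Y\<close> has neither a zero nor a pole, that is, where
  \<open>L\<close> is harmonic.\<close>

definition regular :: "complex \<Rightarrow> bool" where
  "regular t \<longleftrightarrow> t \<noteq> 0 \<and> t\<^sup>2 - 6 * t + of_real (9 * w) \<noteq> 0 \<and> t \<noteq> of_real w"

definition L :: "complex \<Rightarrow> real" where
  "L t = ln (cmod (Y t))"

text \<open>A rational square root of \<open>qd\<close> on the surface: t - conj_root t is a square
  root of the discriminant (z + 2)^2 + 12w and changes sign under the sheet exchange.\<close>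

definition R :: "complex \<Rightarrow> complex \<Rightarrow> complex" where
  "R z t = (t - conj_root t) * (z + of_real (2 - 2 * w)) / ((z\<^sup>2 - of_real (16 * (1 - w))) * (z + of_real (5 - w)))"

definition qd :: "complex \<Rightarrow> complex" where
  "qd z = ((z + 2)\<^sup>2 + of_real (12 * w)) * (z + of_real (2 - 2 * w))\<^sup>2 /
     ((z\<^sup>2 - of_real (16 * (1 - w)))\<^sup>2 * (z + of_real (5 - w))\<^sup>2)"

lemma open_not_pole: "open {z. \<not> pole z}"
proof -
  have eq: "{z. \<not> pole z} = (\<lambda>z. z\<^sup>2) -` (- {of_real (16 * (1 - w))}) \<inter> - {of_real (w - 5)}"
    by (auto simp: pole_def)
  show ?thesis unfolding eq by (intro open_Int open_vimage) (auto intro!: continuous_intros)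
qed

lemma root_sum: assumes "root z t" shows "t + conj_root t = z + 2"
proof -
  have z: "z = t - 2 + conj_root t" using root_iff[of t z] assms root_nz[OF assms] by blast
  show ?thesis by (subst z) simp
qed

lemma root_diff: assumes "root z t" shows "t - conj_root t = 2 * t - z - 2"
proof -
  have "conj_root t = z + 2 - t" using root_sum[OF assms] by (metis add_diff_cancel_left')
  then show ?thesis by simp
qed

lemma R_square: "root z t \<Longrightarrow> (R z t)\<^sup>2 = qd z"
proof -
  assume r: "root z t"
  have "(t - conj_root t)\<^sup>2 = (z + 2)\<^sup>2 + of_real (12 * w)" unfolding root_diff[OF r] by (rule root_disc[OF r])
  then show ?thesis by (simp add: R_def qd_def power_mult_distrib power_divide)
qed

text \<open>Each finite pole in \<open>z\<close> splits over the two sheets. The factors t^2 - 6t +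
  9w and t - w belong to \<open>Y\<close> itself; t^2 + 2t + w and t + 3 are their images under the
  sheet exchange.\<close>

lemma root_pole_factors:
  assumes "root z t"
  shows "(z\<^sup>2 - of_real (16 * (1 - w))) * t\<^sup>2 = (t\<^sup>2 - 6 * t + of_real (9 * w)) * (t\<^sup>2 + 2 * t + of_real w)"
    and "(z + of_real (5 - w)) * t = (t + 3) * (t - of_real w)"
    and "(z + of_real (2 - 2 * w)) * t = t\<^sup>2 - 2 * of_real w * t - of_real (3 * w)"
proof -
  have zt: "z * t = t\<^sup>2 - 2 * t - of_real (3 * w)" using assms by (simp add: root_def algebra_simps)
  have "(z\<^sup>2 - of_real (16 * (1 - w))) * t\<^sup>2 = (z * t)\<^sup>2 - of_real (16 * (1 - w)) * t\<^sup>2"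
    by (simp add: algebra_simps power2_eq_square)
  then show "(z\<^sup>2 - of_real (16 * (1 - w))) * t\<^sup>2 = (t\<^sup>2 - 6 * t + of_real (9 * w)) * (t\<^sup>2 + 2 * t + of_real w)"
    unfolding zt by (simp add: algebra_simps power2_eq_square)
  show "(z + of_real (5 - w)) * t = (t + 3) * (t - of_real w)"
    unfolding distrib_right zt by (simp add: algebra_simps power2_eq_square)
  show "(z + of_real (2 - 2 * w)) * t = t\<^sup>2 - 2 * of_real w * t - of_real (3 * w)"
    unfolding distrib_right zt by (simp add: algebra_simps power2_eq_square)
qed

lemma not_pole_nz:
  assumes "root z t" "\<not> pole z"
  shows "t \<noteq> 0" "t\<^sup>2 - 6 * t + of_real (9 * w) \<noteq> 0" "t\<^sup>2 + 2 * t + of_real w \<noteq> 0" "t + 3 \<noteq> 0" "t - of_real w \<noteq> 0"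
proof -
  show t: "t \<noteq> 0" using root_nz assms by blast
  have "z\<^sup>2 - of_real (16 * (1 - w)) \<noteq> 0" "z + of_real (5 - w) \<noteq> 0"
    using assms(2) unfolding pole_def by (auto simp: add_eq_0_iff2)
  then show "t\<^sup>2 - 6 * t + of_real (9 * w) \<noteq> 0" "t\<^sup>2 + 2 * t + of_real w \<noteq> 0" "t + 3 \<noteq> 0" "t - of_real w \<noteq> 0"
    using root_pole_factors(1,2)[OF assms(1)] t by auto
qed

lemma not_pole_num_den:
  assumes "root z t" "\<not> pole z" shows "num t \<noteq> 0" "den t \<noteq> 0" "regular t"
  unfolding num_def den_def regular_def mult_eq_0_iff using not_pole_nz[OF assms] by simp_all

text \<open>All finite zeros and poles of \<open>Y\<close> are nonnegative reals: 0, w, 3 + 3 sqrt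
  (1 - w) and 3 - 3 sqrt (1 - w). Thus \<open>L\<close> has no singularity at a root in the open
  left half-plane, even over a pole of \<open>qd\<close>.\<close>

lemma regular_neg: assumes "Re t < 0" shows "regular t"
proof -
  have "t\<^sup>2 - 6 * t + of_real (9 * w) \<noteq> 0"
  proof
    assume "t\<^sup>2 - 6 * t + of_real (9 * w) = 0"
    then have "(t - 3)\<^sup>2 = of_real (9 * (1 - w))" by (simp add: power2_eq_square algebra_simps)
    then have "(t - 3)\<^sup>2 = (of_real (3 * sqrt (1 - w)))\<^sup>2"
      using w_le_1 by (simp add: power_mult_distrib flip: of_real_power)
    then have "t - 3 = of_real (3 * sqrt (1 - w)) \<or> t - 3 = - of_real (3 * sqrt (1 - w))" by (simp only: power2_eq_iff)
    then have "Re t = 3 + 3 * sqrt (1 - w) \<or> Re t = 3 - 3 * sqrt (1 - w)"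
      by (auto simp: complex_eq_iff)
    moreover have "sqrt (1 - w) \<le> 1" "0 \<le> sqrt (1 - w)" using w_pos w_le_1 by auto
    ultimately show False using assms by auto
  qed
  then show ?thesis using assms w_pos by (auto simp: regular_def)
qed

lemma regular_Y: "regular t \<Longrightarrow> Y t \<noteq> 0" by (auto simp: regular_def Y_def)

lemma open_regular: "open {t. regular t}"
proof -
  have eq: "{t. regular t} = - {0} \<inter> (\<lambda>t. t\<^sup>2 - 6 * t + of_real (9 * w)) -` (- {0}) \<inter> - {of_real w}"
    by (auto simp: regular_def)
  show ?thesis unfolding eq by (intro open_Int open_vimage) (auto intro!: continuous_intros)
qed

lemma Y_holomorphic: "Y holomorphic_on {t. regular t}"
  unfolding Y_def by (intro holomorphic_intros) (auto simp: regular_def)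

lemma L_harmonic: "regular t \<Longrightarrow> harmonic_at L t"
  unfolding L_def by (rule harmonic_at_ln_norm[OF Y_holomorphic open_regular]) (auto simp: regular_Y)

lemma L_isCont: "regular t \<Longrightarrow> isCont L t"
  by (intro harmonic_at_imp_isCont L_harmonic)

lemma Y_num_den:
  assumes "root z t" "\<not> pole z"
  shows "cmod (Y t) * cmod (den t) = cmod (Y (conj_root t)) * cmod (num t)"
proof -
  note nz = not_pole_nz[OF assms]
  have 1: "t * A / u\<^sup>2 * (27 * B * u\<^sup>2) = 27 * t * A * B" if "u \<noteq> 0" for A B u using that by simp
  have 2: "- 27 * B / (t * v\<^sup>2) * (t\<^sup>2 * A * v\<^sup>2) = - (27 * t * A * B)" if "v \<noteq> 0" for A B v
    using that nz(1) by (simp add: power2_eq_square)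
  have "Y t * den t = - (Y (conj_root t) * num t)"
    unfolding Y_conj_root[OF nz(1)] unfolding Y_def num_def den_def 1[OF nz(5)] 2[OF nz(4)] by simp
  then show ?thesis by (metis norm_minus_cancel norm_mult)
qed

lemma L_diff:
  assumes "root z t" "\<not> pole z"
  shows "L t - L (conj_root t) = ln (cmod (num t) / cmod (den t))"
proof -
  note n = not_pole_num_den[OF assms] not_pole_num_den[OF root_conj_root[OF assms(1)] assms(2)]
  have "cmod (Y t) = cmod (Y (conj_root t)) * (cmod (num t) / cmod (den t))"
    using Y_num_den[OF assms] n by (simp add: field_simps)
  then show ?thesis unfolding L_def using n regular_Y by (simp add: ln_mult ln_div)
qed

lemma L_le_conj_root:
  assumes "root z t" "\<not> pole z"
  shows "L t \<le> L (conj_root t) \<longleftrightarrow> cmod (num t) \<le> cmod (den t)"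
proof -
  have "L t \<le> L (conj_root t) \<longleftrightarrow> ln (cmod (num t) / cmod (den t)) \<le> 0" using L_diff[OF assms] by linarith
  then show ?thesis using not_pole_num_den[OF assms] by (simp add: field_simps)
qed

lemma L_cnj: "L (cnj t) = L t"
proof -
  have "Y (cnj t) = cnj (Y t)" by (simp add: Y_def)
  then show ?thesis by (simp add: L_def)
qed

lemma num_cnj: "cmod (num (cnj t)) = cmod (num t)" and den_cnj: "cmod (den (cnj t)) = cmod (den t)"
proof -
  have "num (cnj t) = cnj (num t)" "den (cnj t) = cnj (den t)" by (simp_all add: num_def den_def)
  then show "cmod (num (cnj t)) = cmod (num t)" "cmod (den (cnj t)) = cmod (den t)" by simp_all
qed

text \<open>The discriminant divided by its value at \<open>z0\<close> equals 1 there, so its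
  principal square root is holomorphic nearby; the factor \<open>y\<close> = 2 t0 - z0 - 2 selects
  the branch through \<open>t0\<close>.\<close>

lemma local_branch:
  assumes "root z0 t0" "conj_root t0 \<noteq> t0"
  obtains r T where "r > 0" "T holomorphic_on ball z0 r" "T z0 = t0"
    "\<And>z. z \<in> ball z0 r \<Longrightarrow> root z (T z)" "\<And>z. z \<in> ball z0 r \<Longrightarrow> conj_root (T z) \<noteq> T z"
proof -
  define P where "P z = (z + 2)\<^sup>2 + of_real (12 * w)" for z :: complex
  have P0: "P z0 \<noteq> 0" using conj_root_eq_iff[OF assms(1)] assms(2) by (simp add: P_def)
  define y where "y = 2 * t0 - z0 - 2"
  have y2: "y\<^sup>2 = P z0" using root_disc[OF assms(1)] by (simp add: P_def y_def)
  define S where "S = (\<lambda>z. P z / P z0) -` (- \<real>\<^sub>\<le>\<^sub>0)"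
  have "open S" unfolding S_def P_def
    by (rule open_vimage) (use P0 in \<open>auto intro!: continuous_intros simp: P_def\<close>)
  moreover have "z0 \<in> S" using P0 by (simp add: S_def)
  ultimately obtain r where r: "r > 0" "ball z0 r \<subseteq> S" using openE by blast
  define T where "T z = (z + 2 + y * csqrt (P z / P z0)) / 2" for z
  show thesis
  proof
    show "r > 0" by fact
    show "T holomorphic_on ball z0 r" unfolding T_def P_def
      by (intro holomorphic_intros) (use r P0 in \<open>auto simp: S_def P_def\<close>)
    show "T z0 = t0" using P0 by (simp add: T_def y_def)
    show rt: "root z (T z)" if "z \<in> ball z0 r" for z
    proof -
      have "2 * T z - z - 2 = y * csqrt (P z / P z0)" by (simp add: T_def field_simps)
      then have "(2 * T z - z - 2)\<^sup>2 = P z" using P0 y2 by (simp add: power_mult_distrib)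
      moreover have "(2 * T z - z - 2)\<^sup>2 - P z = 4 * ((T z)\<^sup>2 - ((z + 2) * T z + of_real (3 * w)))"
        by (simp add: P_def power2_eq_square algebra_simps)
      ultimately have "4 * ((T z)\<^sup>2 - ((z + 2) * T z + of_real (3 * w))) = 0" by (simp only: diff_self)
      then have "(T z)\<^sup>2 - ((z + 2) * T z + of_real (3 * w)) = 0" unfolding mult_eq_0_iff by simp
      then show ?thesis unfolding root_def by (simp only: right_minus_eq)
    qed
    show "conj_root (T z) \<noteq> T z" if "z \<in> ball z0 r" for z
    proof -
      have "P z \<noteq> 0" using that r by (auto simp: S_def)
      then show ?thesis using conj_root_eq_iff[OF rt[OF that]] by (simp add: P_def)
    qed
  qed
qed

lemma branch_deriv:
  assumes T: "T holomorphic_on S" "open S" "z \<in> S"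
    and rt: "\<And>z. z \<in> S \<Longrightarrow> root z (T z)" and ne: "conj_root (T z) \<noteq> T z"
  shows "(T has_field_derivative T z / (T z - conj_root (T z))) (at z)"
proof -
  define D where "D = deriv T z"
  have d: "(T has_field_derivative D) (at z)" unfolding D_def using holomorphic_derivI T by blast
  have nz: "T z \<noteq> 0" using root_nz rt T by blast
  have "((\<lambda>x. (T x)\<^sup>2 - (x + 2) * T x) has_field_derivative 2 * T z * D - (T z + (z + 2) * D)) (at z)"
    by (auto intro!: derivative_eq_intros d)
  moreover have "((\<lambda>x. (T x)\<^sup>2 - (x + 2) * T x) has_field_derivative 0) (at z)"
    by (rule has_field_derivative_transform_within_open[of "\<lambda>x. of_real (3 * w)" _ _ S])
      (use T rt in \<open>auto simp: root_def\<close>)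
  ultimately have "2 * T z * D - (T z + (z + 2) * D) = 0" by (rule DERIV_unique)
  moreover have "z + 2 = T z + conj_root (T z)" using root_sum[OF rt[OF T(3)]] by simp
  ultimately have "(T z - conj_root (T z)) * D = T z" by (simp add: algebra_simps)
  then have "D = T z / (T z - conj_root (T z))" using ne by (simp add: field_simps)
  then show ?thesis using d by simp
qed

text \<open>The identity that justifies the choice of \<open>Y\<close>: since dz/dt = (t - conj_root
  t) / t, half the logarithm of \<open>num t / den t\<close> is a primitive of \<open>R\<close> with
  respect to \<open>z\<close>.\<close>

lemma log_num_den_deriv:
  assumes rt: "root z t" and np: "\<not> pole z" and ne: "conj_root t \<noteq> t"
  shows "((\<lambda>t. num t / den t) has_field_derivative 2 * (num t / den t) * (R z t * (t - conj_root t) / t)) (at t)"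
proof -
  note nz = not_pole_nz[OF rt np]
  define A B where "A = t\<^sup>2 - 6 * t + of_real (9 * w)" and "B = t\<^sup>2 + 2 * t + of_real w"
  define W where "W = complex_of_real w"
  have AB: "A \<noteq> 0" "B \<noteq> 0" using nz by (auto simp: A_def B_def)
  have n: "num t = t\<^sup>2 * A * (t + 3)\<^sup>2" "den t = 27 * B * (t - W)\<^sup>2" by (simp_all add: num_def den_def A_def B_def W_def)
  have tW: "t - W \<noteq> 0" "t + 3 \<noteq> 0" "t \<noteq> 0" using nz by (auto simp: W_def)
  have "(num has_field_derivative (2 * t * A + t\<^sup>2 * (2 * t - 6)) * (t + 3)\<^sup>2 + t\<^sup>2 * A * (2 * (t + 3))) (at t)"
    unfolding num_def[abs_def] A_def
    by (auto intro!: derivative_eq_intros simp: eval_nat_numeral algebra_simps)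
  moreover have "(2 * t * A + t\<^sup>2 * v) * u\<^sup>2 + t\<^sup>2 * A * (2 * u) = t\<^sup>2 * A * u\<^sup>2 * (2 / t + v / A + 2 / u)"
    if "u \<noteq> 0" for u v using that AB tW by (simp add: field_simps power2_eq_square)
  note this[of "t + 3" "2 * t - 6", OF tW(2), folded n(1)]
  ultimately have dn: "(num has_field_derivative num t * (2 / t + (2 * t - 6) / A + 2 / (t + 3))) (at t)" by simp
  have "(den has_field_derivative 27 * (2 * t + 2) * (t - W)\<^sup>2 + 27 * B * (2 * (t - W))) (at t)"
    unfolding den_def[abs_def] B_def W_def
    by (auto intro!: derivative_eq_intros simp: eval_nat_numeral algebra_simps)
  moreover have "27 * v * u\<^sup>2 + 27 * B * (2 * u) = 27 * B * u\<^sup>2 * (v / B + 2 / u)"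
    if "u \<noteq> 0" for u v using that AB by (simp add: field_simps power2_eq_square)
  note this[of "t - W" "2 * t + 2", OF tW(1), folded n(2)]
  ultimately have dd: "(den has_field_derivative den t * ((2 * t + 2) / B + 2 / (t - W))) (at t)" by simp
  have d0: "den t \<noteq> 0" using not_pole_num_den rt np by blast
  have "((\<lambda>t. num t / den t) has_field_derivative
     (num t / den t) * (2 / t + (2 * t - 6) / A + 2 / (t + 3) - (2 * t + 2) / B - 2 / (t - W))) (at t)"
    by (rule DERIV_cong[OF DERIV_divide[OF dn dd d0]]) (use d0 in \<open>simp add: field_simps power2_eq_square\<close>)
  \<comment> \<open>The five logarithmic derivatives combine into one fraction whose numerator is
    (t^2 + 3w)^2 times the double zero factor of \<open>qd\<close>, transported to
    \<open>t\<close>.\<close>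
  also have "2 / t + (2 * t - 6) / A + 2 / (t + 3) - (2 * t + 2) / B - 2 / (t - W) =
      2 * (t\<^sup>2 + 3 * W)\<^sup>2 * (t\<^sup>2 - 2 * W * t - 3 * W) / (t * A * B * (t + 3) * (t - W))" (is "?l = ?r")
  proof -
    have "(2 / t + a / A + 2 / u - b / B - 2 / v) * (t * A * B * u * v) =
        2 * A * B * u * v + a * t * B * u * v + 2 * t * A * B * v - b * t * A * u * v - 2 * t * A * B * u"
      if "u \<noteq> 0" "v \<noteq> 0" for a b u v using that AB tW by (simp add: field_simps)
    note this[of "t + 3" "t - W" "2 * t - 6" "2 * t + 2", OF tW(2,1)]
    also have "2 * A * B * (t + 3) * (t - W) + (2 * t - 6) * t * B * (t + 3) * (t - W) + 2 * t * A * B * (t - W)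
        - (2 * t + 2) * t * A * (t + 3) * (t - W) - 2 * t * A * B * (t + 3) = 2 * (t\<^sup>2 + 3 * W)\<^sup>2 * (t\<^sup>2 - 2 * W * t - 3 * W)"
      unfolding A_def B_def by (simp add: W_def[symmetric] eval_nat_numeral algebra_simps)
    finally show ?thesis using AB tW by (simp add: eq_divide_eq)
  qed
  also have "\<dots> = 2 * (R z t * (t - conj_root t) / t)"
  proof -
    have f: "z\<^sup>2 - of_real (16 * (1 - w)) = A * B / t\<^sup>2" "z + of_real (5 - w) = (t + 3) * (t - W) / t"
      "z + of_real (2 - 2 * w) = (t\<^sup>2 - 2 * W * t - 3 * W) / t"
      using root_pole_factors[OF rt] tW by (simp_all add: A_def B_def W_def eq_divide_eq)
    have c: "t - conj_root t = (t\<^sup>2 + 3 * W) / t" using tW by (simp add: conj_root_def W_def field_simps power2_eq_square)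
    have "2 * N\<^sup>2 * M / (t * A * B * u * v) = 2 * (N / t * (M / t) / (A * B / t\<^sup>2 * (u * v / t)) * (N / t) / t)"
      if "u \<noteq> 0" "v \<noteq> 0" for N M u v using that AB tW by (simp add: field_simps power2_eq_square)
    from this[OF tW(2,1)] show ?thesis unfolding R_def f c .
  qed
  finally show ?thesis by (simp add: mult_ac)
qed

text \<open>The constant of integration is fixed by exp (2 \<psi>) = num / den. So 2 Re \<psi> is
  the difference of \<open>L\<close> at the two roots, and since \<psi> is a primitive of
  \<open>R\<close>, trajectories run along level lines of Re \<psi>.\<close>

lemma branch_log:
  assumes "root z0 t0" "conj_root t0 \<noteq> t0" "\<not> pole z0"
  obtains r T \<psi> where "r > 0" "T holomorphic_on ball z0 r" "T z0 = t0" "\<psi> holomorphic_on ball z0 r"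
    "\<And>z. z \<in> ball z0 r \<Longrightarrow> root z (T z) \<and> conj_root (T z) \<noteq> T z \<and> \<not> pole z"
    "\<And>z. z \<in> ball z0 r \<Longrightarrow> exp (2 * \<psi> z) = num (T z) / den (T z)"
    "\<And>z. z \<in> ball z0 r \<Longrightarrow> (\<psi> has_field_derivative R z (T z)) (at z)"
proof -
  obtain r1 T where T: "r1 > 0" "T holomorphic_on ball z0 r1" "T z0 = t0"
    "\<And>z. z \<in> ball z0 r1 \<Longrightarrow> root z (T z)" "\<And>z. z \<in> ball z0 r1 \<Longrightarrow> conj_root (T z) \<noteq> T z"
    using local_branch[OF assms(1,2)] by metis
  have "open {z. \<not> pole z}" by (rule open_not_pole)
  then obtain r2 where r2: "r2 > 0" "ball z0 r2 \<subseteq> {z. \<not> pole z}" using assms(3) openE by blast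
  define r where "r = min r1 r2"
  have r: "r > 0" "\<And>z. z \<in> ball z0 r \<Longrightarrow> z \<in> ball z0 r1 \<and> \<not> pole z" using T r2 by (auto simp: r_def)
  have Th: "T holomorphic_on ball z0 r" by (rule holomorphic_on_subset[OF T(2)]) (use r in auto)
  have props: "root z (T z) \<and> conj_root (T z) \<noteq> T z \<and> \<not> pole z" if "z \<in> ball z0 r" for z
    using T r that by blast
  have nd: "num (T z) \<noteq> 0" "den (T z) \<noteq> 0" if "z \<in> ball z0 r" for z
    using not_pole_num_den props[OF that] by blast+
  have Gh: "(\<lambda>z. num (T z) / den (T z)) holomorphic_on ball z0 r"
    using nd unfolding num_def den_def by (intro holomorphic_intros Th) auto
  obtain g where g: "g holomorphic_on ball z0 r" "\<And>z. z \<in> ball z0 r \<Longrightarrow> num (T z) / den (T z) = exp (g z)"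
    by (rule contractible_imp_holomorphic_log[OF Gh]) (use nd in \<open>auto intro: convex_imp_contractible\<close>)
  show thesis
  proof
    show "r > 0" "T holomorphic_on ball z0 r" "T z0 = t0" using r T Th by auto
    show "(\<lambda>z. g z / 2) holomorphic_on ball z0 r" by (intro holomorphic_intros g) auto
    show "root z (T z) \<and> conj_root (T z) \<noteq> T z \<and> \<not> pole z" if "z \<in> ball z0 r" for z by (rule props[OF that])
    show "exp (2 * (g z / 2)) = num (T z) / den (T z)" if "z \<in> ball z0 r" for z using g(2)[OF that] by simp
    fix z assume z: "z \<in> ball z0 r"
    note pz = props[OF z]
    have dg: "(g has_field_derivative deriv g z) (at z)" using holomorphic_derivI[OF g(1)] z by simp
    have d1: "((\<lambda>z. exp (g z)) has_field_derivative exp (g z) * deriv g z) (at z)"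
      by (rule DERIV_chain2[OF DERIV_exp dg])
    have dT: "(T has_field_derivative T z / (T z - conj_root (T z))) (at z)"
      by (rule branch_deriv[OF Th]) (use z props in auto)
    have "((\<lambda>z. num (T z) / den (T z)) has_field_derivative
       2 * (num (T z) / den (T z)) * (R z (T z) * (T z - conj_root (T z)) / T z) * (T z / (T z - conj_root (T z)))) (at z)"
      by (rule DERIV_chain2[OF log_num_den_deriv dT]) (use pz in auto)
    then have d2: "((\<lambda>z. exp (g z)) has_field_derivative
       2 * (num (T z) / den (T z)) * (R z (T z) * (T z - conj_root (T z)) / T z) * (T z / (T z - conj_root (T z)))) (at z)"
      by (rule has_field_derivative_transform_within_open[of _ _ _ "ball z0 r"]) (use z g(2) in auto)
    have ne: "T z \<noteq> conj_root (T z)" using pz by metis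
    have "exp (g z) * deriv g z = exp (g z) * (2 * R z (T z))"
      using DERIV_unique[OF d1 d2] pz ne root_nz[of z "T z"] unfolding g(2)[OF z] by simp
    then have "deriv g z = 2 * R z (T z)" by simp
    then have "(g has_field_derivative 2 * R z (T z)) (at z)" using dg by simp
    from DERIV_cdivide[OF this, of 2] show "((\<lambda>z. g z / 2) has_field_derivative R z (T z)) (at z)" by simp
  qed
qed

end

section \<open>The comparison function \<open>Yhat\<close>\<close>

context two_sheets
begin

text \<open>The real parts of the two roots add up to Re z + 2 > 0, which reads Re t (1 - 3w /
  |t|^2) > 0; with Re t \<le> 0 both factors must be negative. Hence |t|^2 < 3w, and
  \<open>t\<close> lies in \<open>Delta\<close>.\<close>

lemma neg_root_right:
  assumes "Re z > - 2"
  shows "Re (neg_root z) < 0" "neg_root z \<in> Delta" "(cmod (neg_root z))\<^sup>2 < 3 * w"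
proof -
  define t where "t = neg_root z"
  have r: "root z t" and le: "Re t \<le> 0" using neg_root by (auto simp: t_def)
  have t0: "cmod t > 0" using root_nz[OF r] by simp
  have "Re t + Re (conj_root t) > 0" using root_sum[OF r] assms by (metis add.commute less_add_same_cancel1 plus_complex.sel(1) complex_Re_numeral add_less_cancel_right diff_less_eq diff_minus_eq_add neg_less_iff_less add_0 diff_0 minus_less_iff)
  then have pos: "Re t * ((cmod t)\<^sup>2 - 3 * w) > 0"
    using t0 by (simp add: Re_conj_root field_simps)
  then have "Re t \<noteq> 0" by auto
  with le show n: "Re (neg_root z) < 0" by (simp add: t_def)
  with pos show X: "(cmod (neg_root z))\<^sup>2 < 3 * w" by (simp add: t_def zero_less_mult_iff)
  have "(3 - w) * Re (neg_root z) < 0" using n w_le_1 by (simp add: mult_pos_neg)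
  then show "neg_root z \<in> Delta" using n X by (simp add: Delta_def)
qed

lemma Delta_bound: assumes "t \<in> Delta" shows "cmod t < 3"
proof -
  have "- Re t \<le> cmod t" using abs_Re_le_cmod[of t] by linarith
  then have "(3 - w) * (- Re t) \<le> (3 - w) * cmod t" using w_le_1 by (intro mult_left_mono) auto
  then have "(cmod t - 3) * (cmod t + w) < 0" using assms by (simp add: Delta_def power2_eq_square algebra_simps)
  then show ?thesis using w_pos by (simp add: mult_less_0_iff add_nonneg_pos not_less)
     (smt (verit) norm_ge_zero)
qed

lemma open_Delta: "open Delta"
proof -
  have eq: "Delta = {t. Re t < 0} \<inter> {t. (cmod t)\<^sup>2 + (3 - w) * Re t < 3 * w}" by (auto simp: Delta_def)
  show ?thesis unfolding eq by (intro open_Int open_Collect_less continuous_intros)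
qed

definition cDelta :: "complex set" where
  "cDelta = {t. Re t \<le> 0 \<and> (cmod t)\<^sup>2 + (3 - w) * Re t \<le> 3 * w}"

lemma closed_cDelta: "closed cDelta"
proof -
  have eq: "cDelta = {t. Re t \<le> 0} \<inter> {t. (cmod t)\<^sup>2 + (3 - w) * Re t \<le> 3 * w}" by (auto simp: cDelta_def)
  show ?thesis unfolding eq by (intro closed_Int closed_Collect_le continuous_intros)
qed

lemma Delta_subset: "Delta \<subseteq> cDelta" by (auto simp: Delta_def cDelta_def)

text \<open>This is what allows \<open>Yhat\<close> to change its rule across the edge of
  \<open>Delta\<close>: away from poles, the root on that edge already has the smaller value of
  \<open>L\<close>.\<close>

lemma num_le_den_boundary: assumes "t \<in> cDelta - Delta" shows "cmod (num t) \<le> cmod (den t)"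
proof (cases "Re t = 0")
  case True then show ?thesis using assms num_le_den_imaginary(1)[of t] by (auto simp: cDelta_def)
next
  case False
  then show ?thesis using assms num_le_den_circle[of t] by (auto simp: cDelta_def Delta_def)
qed

lemma neg_root_nbhd:
  assumes "Re (neg_root z0) < 0"
  obtains r where "r > 0" "neg_root holomorphic_on ball z0 r" "\<And>z. z \<in> ball z0 r \<Longrightarrow> Re (neg_root z) < 0"
proof -
  have ne: "conj_root (neg_root z0) \<noteq> neg_root z0" using conj_root_Re_pos[OF assms] assms by auto
  obtain r T where T: "r > 0" "T holomorphic_on ball z0 r" "T z0 = neg_root z0"
    "\<And>z. z \<in> ball z0 r \<Longrightarrow> root z (T z)"
    using local_branch[OF neg_root(1) ne] by metis
  have "isCont T z0" using T(1,2) holomorphic_on_imp_continuous_on continuous_on_interior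
    by (metis centre_in_ball interior_ball)
  then have "((\<lambda>z. Re (T z)) \<longlongrightarrow> Re (T z0)) (at z0)" by (intro tendsto_Re) (simp add: isCont_def)
  then have "eventually (\<lambda>z. Re (T z) < 0) (at z0)" using assms T(3) by (intro order_tendstoD(2)) auto
  then obtain s where s: "s > 0" "\<And>z. z \<in> ball z0 s \<Longrightarrow> Re (T z) < 0"
    using assms T(3) by (auto simp: eventually_at dist_commute) metis
  have eq: "neg_root z = T z" if "z \<in> ball z0 (min r s)" for z
    using that T(4) s(2) by (intro neg_root_eq) auto
  show thesis
  proof
    show "min r s > 0" using T s by simp
    have "T holomorphic_on ball z0 (min r s)" by (rule holomorphic_on_subset[OF T(2)]) auto
    then show "neg_root holomorphic_on ball z0 (min r s)"
      by (subst holomorphic_cong[OF refl eq]) auto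
    show "Re (neg_root z) < 0" if "z \<in> ball z0 (min r s)" for z using eq[OF that] s(2) that by auto
  qed
qed

lemma neg_root_isCont: "Re (neg_root z) < 0 \<Longrightarrow> isCont neg_root z"
  by (rule neg_root_nbhd[of z]) (auto intro: holomorphic_on_imp_continuous_on simp: continuous_on_eq_continuous_at dest!: holomorphic_on_imp_continuous_on)

lemma L_neg_root_harmonic: "Re (neg_root z) < 0 \<Longrightarrow> harmonic_at (\<lambda>z. L (neg_root z)) z"
proof -
  assume a: "Re (neg_root z) < 0"
  obtain r where r: "r > 0" "neg_root holomorphic_on ball z r" using neg_root_nbhd[OF a] by metis
  show ?thesis by (rule harmonic_at_compose[OF L_harmonic[OF regular_neg[OF a]] r(2)]) (use r in auto)
qed

lemma neg_root_cnj: "Re (neg_root z) < 0 \<Longrightarrow> neg_root (cnj z) = cnj (neg_root z)"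
  by (rule neg_root_eq) (auto intro: root_cnj neg_root)

text \<open>Away from \<open>Delta\<close> this is the minimum of the two values of
  \<open>L\<close>. The test uses \<open>num\<close> and \<open>den\<close> because over the pole z
  = w - 5 the root -3 has to be chosen, while the other root w is a pole of \<open>Y\<close>, where
  the convention for division would give a meaningless value of \<open>L\<close>.\<close>

definition Yhat :: "complex \<Rightarrow> real" where
  "Yhat z = (if neg_root z \<in> Delta \<or> cmod (num (neg_root z)) \<le> cmod (den (neg_root z))
     then L (neg_root z) else L (conj_root (neg_root z)))"

text \<open>The poles are real, hence so are their roots. Over z^2 = 16 (1 - w) the negative root
  solves t^2 + 2t + w = 0, so |t|^2 + (3 - w) t = (1 - w) t - w < 3w; over w - 5 it is -3, on the
  bounding circle of \<open>Delta\<close>.\<close>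

lemma pole_neg_root:
  assumes "pole z" shows "Re (neg_root z) < 0" "neg_root z \<in> Delta \<or> neg_root z = -3"
proof -
  define n where "n = neg_root z"
  have r: "root z n" and le: "Re n \<le> 0" using neg_root by (auto simp: n_def)
  have zr: "Im z = 0"
  proof (cases "z = of_real (w - 5)")
    case False
    then have "z\<^sup>2 = of_real (16 * (1 - w))" using assms by (auto simp: pole_def)
    also have "\<dots> = (of_real (4 * sqrt (1 - w)))\<^sup>2"
      using w_le_1 by (simp add: power_mult_distrib flip: of_real_power)
    finally have "z = of_real (4 * sqrt (1 - w)) \<or> z = - of_real (4 * sqrt (1 - w))" by (simp only: power2_eq_iff)
    then show ?thesis by auto
  qed (auto)
  have "Re n \<noteq> 0"
  proof
    assume n0: "Re n = 0"
    have n: "n \<noteq> 0" using root_nz[OF r] .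
    have ni: "Im n \<noteq> 0" using n n0 by (simp add: complex_eq_iff)
    have "Im n + Im (conj_root n) = 0" using root_sum[OF r] zr by (metis complex_Im_numeral plus_complex.sel(2) add.right_neutral)
    moreover have "Im (conj_root n) = 3 * w * Im n / (cmod n)\<^sup>2"
      unfolding conj_root_def by (simp add: complex_div_cnj[of _ n] Im_divide_of_real flip: of_real_power)
    ultimately have "Im n * (1 + 3 * w / (cmod n)\<^sup>2) = 0" by (simp add: algebra_simps)
    moreover have "1 + 3 * w / (cmod n)\<^sup>2 > 0" using w_pos by (intro add_pos_nonneg) auto
    ultimately show False using ni by auto
  qed
  then show neg: "Re (neg_root z) < 0" using le by (simp add: n_def)
  have "n \<in> Delta \<or> n = -3"
  proof (cases "z = of_real (w - 5)")
    case True
    then have "(n + 3) * (n - of_real w) = 0" using root_pole_factors(2)[OF r] by simp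
    then show ?thesis using neg w_pos by (auto simp: n_def add_eq_0_iff2)
  next
    case False
    then have "(n\<^sup>2 - 6 * n + of_real (9 * w)) * (n\<^sup>2 + 2 * n + of_real w) = 0"
      using root_pole_factors(1)[OF r] assms by (simp add: pole_def)
    then have B: "n\<^sup>2 + 2 * n + of_real w = 0" using regular_neg[of n] neg by (auto simp: regular_def n_def)
    then have "(n + 1)\<^sup>2 = of_real (1 - w)" by (simp add: power2_eq_square algebra_simps)
    also have "\<dots> = (of_real (sqrt (1 - w)))\<^sup>2" using w_le_1 by (simp flip: of_real_power)
    finally have "n + 1 = of_real (sqrt (1 - w)) \<or> n + 1 = - of_real (sqrt (1 - w))" by (simp only: power2_eq_iff)
    then have im: "Im n = 0" by (auto simp: complex_eq_iff)
    have "Re (n\<^sup>2 + 2 * n + of_real w) = 0" using B by simp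
    then have "(Re n)\<^sup>2 = - 2 * Re n - w" using im by (simp add: power2_eq_square)
    moreover have "(cmod n)\<^sup>2 = (Re n)\<^sup>2" using im by (simp add: cmod_power2)
    moreover have "Re n * (1 - w) \<le> 0" using le w_le_1 by (simp add: mult_nonpos_nonneg)
    ultimately have "(cmod n)\<^sup>2 + (3 - w) * Re n < 3 * w" using w_pos by (simp add: algebra_simps)
    then show ?thesis using neg by (simp add: Delta_def n_def)
  qed
  then show "neg_root z \<in> Delta \<or> neg_root z = -3" by (simp add: n_def)
qed

lemma finite_pole: "finite {z. pole z}"
proof -
  have "{z. pole z} \<subseteq> {of_real (4 * sqrt (1 - w)), - of_real (4 * sqrt (1 - w)), of_real (w - 5)}"
  proof
    fix z assume "z \<in> {z. pole z}"
    moreover have "of_real (16 * (1 - w)) = (complex_of_real (4 * sqrt (1 - w)))\<^sup>2"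
      using w_le_1 by (simp add: power_mult_distrib flip: of_real_power)
    ultimately show "z \<in> {of_real (4 * sqrt (1 - w)), - of_real (4 * sqrt (1 - w)), of_real (w - 5)}"
      unfolding pole_def by (auto simp only: power2_eq_iff mem_Collect_eq insert_iff)
  qed
  then show ?thesis by (rule finite_subset) auto
qed

text \<open>Provides the root that realises \<open>Yhat\<close> at \<open>z0\<close> and will be
  continued to a neighbourhood. Its conjugate avoids the closed set \<open>cDelta\<close>, so by
  continuity the conjugate branch does not enter \<open>Delta\<close> nearby, and the special rule
  there can only select the continued root.\<close>

lemma chosen_root:
  assumes "conj_root (neg_root z0) \<noteq> neg_root z0" and nD: "neg_root z0 \<notin> Delta"
  obtains t0 where "root z0 t0" "conj_root t0 \<noteq> t0" "cmod (num t0) \<le> cmod (den t0)" "conj_root t0 \<notin> cDelta"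
    "Yhat z0 = L t0" "regular t0" "pole z0 \<longrightarrow> cmod (num t0) < cmod (den t0)"
proof -
  define n where "n = neg_root z0"
  have r: "root z0 n" and le: "Re n \<le> 0" using neg_root by (auto simp: n_def)
  have n0: "n \<noteq> 0" using root_nz[OF r] .
  note r' = root_conj_root[OF r]
  have ne: "conj_root n \<noteq> n" using assms by (simp add: n_def)
  have P: "n = -3" "Re n < 0" if "pole z0" using pole_neg_root[OF that] nD by (auto simp: n_def)
  have n3: "cmod (num (-3)) < cmod (den (-3))"
  proof -
    have "num (-3) = 0" by (simp add: num_def)
    moreover have "den (-3) = of_real (27 * (3 + w) ^ 3)" by (simp add: den_def eval_nat_numeral algebra_simps)
    ultimately show ?thesis using w_pos by (simp del: of_real_add of_real_mult of_real_power)
  qed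
  \<comment> \<open>If Re n = 0, both roots are imaginary with product of moduli 3w. Away from a
    double root exactly one of them has modulus below sqrt (3w), and it is the one with |num| <
    |den|.\<close>
  show thesis
  proof (cases "Re n = 0")
    case True
    have np: "\<not> pole z0" using P(2) True by auto
    have cc: "cmod n * cmod (conj_root n) = 3 * w" using n0 by (simp add: cmod_conj_root)
    have neq: "(cmod n)\<^sup>2 \<noteq> 3 * w"
    proof
      assume a: "(cmod n)\<^sup>2 = 3 * w"
      have "(cmod n)\<^sup>2 = (Im n)\<^sup>2" using True by (simp add: cmod_power2)
      then have "n * n = - of_real ((cmod n)\<^sup>2)" using True by (simp add: complex_eq_iff power2_eq_square)
      then have "conj_root n = n" using n0 a by (simp add: conj_root_def field_simps)
      then show False using ne by simp
    qed
    have re: "Re (conj_root n) = 0" using True by (simp add: Re_conj_root)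
    show thesis
    proof (cases "(cmod n)\<^sup>2 < 3 * w")
      case l: True
      have "cmod (num n) < cmod (den n)" using num_le_den_imaginary(2)[OF True] l by simp
      moreover have "conj_root n \<notin> cDelta"
      proof
        assume "conj_root n \<in> cDelta"
        then have "(cmod (conj_root n))\<^sup>2 \<le> 3 * w" using re by (simp add: cDelta_def)
        then have "(cmod n)\<^sup>2 * (cmod (conj_root n))\<^sup>2 < (3 * w) * (3 * w)"
          using l w_pos n0 conj_root_nz[OF n0] by (intro mult_less_le_imp_less) auto
        then show False using cc by (simp add: power2_eq_square algebra_simps flip: power_mult_distrib)
      qed
      ultimately show thesis using r ne not_pole_num_den(3)[OF r np] by (intro that[of n]) (auto simp: Yhat_def n_def)
    next
      case False
      then have l: "(cmod n)\<^sup>2 > 3 * w" using neq by simp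
      have l': "(cmod (conj_root n))\<^sup>2 < 3 * w"
      proof (rule ccontr)
        assume "\<not> ?thesis"
        then have "(3 * w) * (3 * w) < (cmod n)\<^sup>2 * (cmod (conj_root n))\<^sup>2"
          using l w_pos by (intro mult_less_le_imp_less) auto
        also have "\<dots> = (3 * w) * (3 * w)" by (metis cc power2_eq_square power_mult_distrib)
        finally show False by simp
      qed
      have lt: "cmod (num (conj_root n)) < cmod (den (conj_root n))" using num_le_den_imaginary(2)[OF re] l' by simp
      then have "\<not> cmod (num n) \<le> cmod (den n)" using num_le_den_conj_root[of "conj_root n"] conj_root_nz[OF n0] by simp
      then have "Yhat z0 = L (conj_root n)" using nD by (auto simp: Yhat_def n_def)
      moreover have "n \<notin> cDelta" using l True by (simp add: cDelta_def)
      ultimately show thesis using lt r' ne not_pole_num_den(3)[OF r' np] by (intro that[of "conj_root n"]) auto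
    qed
  next
    case False
    then have neg: "Re n < 0" using le by simp
    have c: "conj_root n \<notin> cDelta" using conj_root_Re_pos[OF neg] by (simp add: cDelta_def)
    show thesis
    proof (cases "cmod (num n) \<le> cmod (den n)")
      case True
      then show thesis using r ne c regular_neg[OF neg] P n3 by (intro that[of n]) (auto simp: Yhat_def n_def)
    next
      case F: False
      then have "n \<notin> cDelta" using num_le_den_boundary nD by (auto simp: n_def)
      moreover have np: "\<not> pole z0" using P n3 F by auto
      moreover have "cmod (num (conj_root n)) \<le> cmod (den (conj_root n))" using F num_le_den_conj_root[OF n0] by simp
      moreover have "Yhat z0 = L (conj_root n)" using F nD by (auto simp: Yhat_def n_def)
      ultimately show thesis using r' ne not_pole_num_den(3)[OF r' np] by (intro that[of "conj_root n"]) auto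
    qed
  qed
qed

lemma Yhat_min:
  assumes "neg_root z \<notin> Delta" "\<not> pole z" "root z t"
  shows "Yhat z = min (L t) (L (conj_root t))"
proof -
  have "Yhat z = min (L (neg_root z)) (L (conj_root (neg_root z)))"
    using assms(1) L_le_conj_root[OF neg_root(1) assms(2)] by (auto simp: Yhat_def)
  then show ?thesis using root_cases[OF neg_root(1) assms(3)] by auto
qed

text \<open>Outside \<open>Delta\<close>, continue the chosen root to a branch T. Near
  \<open>z0\<close> either the left root lies in \<open>Delta\<close> and equals T, or
  \<open>Yhat\<close> is the minimum of L(T) and L(conj_root T); in both cases L(T) is a harmonic
  majorant that agrees at \<open>z0\<close>.\<close>

lemma Yhat_touched_above_isCont:
  assumes "(z0 + 2)\<^sup>2 + of_real (12 * w) \<noteq> 0"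
  shows "touched_above Yhat z0" "isCont Yhat z0"
proof -
  have ne: "conj_root (neg_root z0) \<noteq> neg_root z0" using conj_root_eq_iff[OF neg_root(1)] assms by blast
  have "touched_above Yhat z0 \<and> isCont Yhat z0"
  proof (cases "neg_root z0 \<in> Delta")
    case True
    then have neg: "Re (neg_root z0) < 0" by (simp add: Delta_def)
    obtain r where r: "r > 0" "neg_root holomorphic_on ball z0 r" using neg_root_nbhd[OF neg] by metis
    have op: "open (ball z0 r \<inter> neg_root -` Delta)"
      using continuous_open_preimage[OF holomorphic_on_imp_continuous_on[OF r(2)] open_ball open_Delta] .
    have "harmonic_at Yhat z0"
      by (rule harmonic_at_cong[OF L_neg_root_harmonic[OF neg] op]) (use True r in \<open>auto simp: Yhat_def\<close>)
    then show ?thesis using harmonic_at_imp_isCont harmonic_at_imp_touched_above by blast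
  next
    case False
    obtain t0 where t0: "root z0 t0" "conj_root t0 \<noteq> t0" "cmod (num t0) \<le> cmod (den t0)" "conj_root t0 \<notin> cDelta"
      "Yhat z0 = L t0" "regular t0" "pole z0 \<longrightarrow> cmod (num t0) < cmod (den t0)"
      using chosen_root[OF ne False] by blast
    obtain r T where T: "r > 0" "T holomorphic_on ball z0 r" "T z0 = t0" "\<And>z. z \<in> ball z0 r \<Longrightarrow> root z (T z)"
      using local_branch[OF t0(1,2)] by metis
    have Tc: "continuous_on (ball z0 r) T" using T(2) by (rule holomorphic_on_imp_continuous_on)
    have nz: "T z \<noteq> 0" if "z \<in> ball z0 r" for z using root_nz T(4)[OF that] by blast
    have cTc: "continuous_on (ball z0 r) (\<lambda>z. conj_root (T z))"
      unfolding conj_root_def by (intro continuous_intros Tc) (use nz in auto)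
    \<comment> \<open>Poles other than \<open>z0\<close> are removed since the minimum formula is
      stated away from poles; \<open>z0\<close> itself may be a pole, and there
      \<open>Yhat z0 = L t0\<close> is known directly.\<close>
    define V where "V = (ball z0 r \<inter> (\<lambda>z. conj_root (T z)) -` (- cDelta)) \<inter> (ball z0 r \<inter> T -` {t. regular t})
        - ({z. pole z} - {z0})"
    have V: "open V" unfolding V_def
      by (intro open_Diff open_Int continuous_open_preimage cTc Tc open_ball open_Compl closed_cDelta open_regular
          finite_imp_closed finite_Diff finite_pole)
    have z0V: "z0 \<in> V" using T t0 by (simp add: V_def)
    have LT: "harmonic_at (\<lambda>z. L (T z)) z0"
      by (rule harmonic_at_compose[OF _ T(2)]) (use T t0 L_harmonic in auto)
    have D: "Yhat z = L (T z)" if "z \<in> V" "neg_root z \<in> Delta" for z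
    proof -
      have "neg_root z = T z \<or> neg_root z = conj_root (T z)"
        using root_cases[of z "T z" "neg_root z"] neg_root(1) T(4) that(1) by (auto simp: V_def)
      moreover have "neg_root z \<noteq> conj_root (T z)" using that Delta_subset by (auto simp: V_def)
      ultimately show ?thesis using that(2) by (simp add: Yhat_def)
    qed
    have nD: "Yhat z = min (L (T z)) (L (conj_root (T z)))" if "z \<in> V" "neg_root z \<notin> Delta" "z \<noteq> z0" for z
      by (rule Yhat_min) (use that T(4) in \<open>auto simp: V_def\<close>)
    have le: "Yhat z \<le> L (T z)" if "z \<in> V" for z
      using D[OF that] nD[OF that] T(3) t0(5) by (cases "z = z0"; cases "neg_root z \<in> Delta") auto
    have touch: "touched_above Yhat z0"
    proof -
      obtain F s where F: "0 < s" "F holomorphic_on ball z0 s" "\<forall>z\<in>ball z0 s. L (T z) = Re (F z)"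
        using LT unfolding harmonic_at_def by blast
      obtain s' where s': "s' > 0" "ball z0 s' \<subseteq> V" using V z0V openE by blast
      show ?thesis unfolding touched_above_def
      proof (intro exI[of _ F] exI[of _ "min s s'"] conjI ballI)
        show "0 < min s s'" using F s' by simp
        show "F holomorphic_on ball z0 (min s s')" by (rule holomorphic_on_subset[OF F(2)]) auto
        show "Re (F z0) = Yhat z0" using F T t0 by auto
        fix z assume "z \<in> ball z0 (min s s')"
        then show "Yhat z \<le> Re (F z)" using le[of z] s' F(3) by (auto simp: subset_iff)
      qed
    qed
    moreover have "isCont Yhat z0"
    proof (cases "cmod (num t0) < cmod (den t0)")
      case True
      have "continuous_on (ball z0 r) (\<lambda>z. cmod (num (T z)))" "continuous_on (ball z0 r) (\<lambda>z. cmod (den (T z)))"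
        unfolding num_def den_def by (intro continuous_intros Tc)+
      then have "continuous_on (ball z0 r) (\<lambda>z. cmod (den (T z)) - cmod (num (T z)))" by (intro continuous_on_diff)
      from continuous_open_preimage[OF this open_ball, of "{0<..}"]
      have op: "open (V \<inter> (ball z0 r \<inter> (\<lambda>z. cmod (den (T z)) - cmod (num (T z))) -` {0<..}))"
        by (intro open_Int[OF V]) simp
      have "L (T z) = Yhat z" if "z \<in> V \<inter> (ball z0 r \<inter> (\<lambda>z. cmod (den (T z)) - cmod (num (T z))) -` {0<..})" for z
      proof (cases "z = z0 \<or> neg_root z \<in> Delta")
        case False
        then have "\<not> pole z" "root z (T z)" using that T(4) by (auto simp: V_def)
        then have "L (T z) \<le> L (conj_root (T z))" using that by (subst L_le_conj_root) auto
        then show ?thesis using nD[of z] that False by auto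
      qed (use D that T t0 in auto)
      then have "harmonic_at Yhat z0" by (rule harmonic_at_cong[OF LT op, rotated]) (use z0V T True in auto)
      then show ?thesis by (rule harmonic_at_imp_isCont)
    next
      \<comment> \<open>Now L agrees at the two roots over \<open>z0\<close>, so both branches tend
        to \<open>L t0\<close> and enclose \<open>Yhat\<close>.\<close>
      case eq: False
      then have np: "\<not> pole z0" using t0 by auto
      have "L t0 = L (conj_root t0)"
        using L_diff[OF t0(1) np] eq t0(3) not_pole_num_den[OF t0(1) np] by simp
      moreover have "isCont (\<lambda>z. L (conj_root (T z))) z0"
      proof (rule isCont_o2[of _ "\<lambda>z. conj_root (T z)" L])
        show "isCont (\<lambda>z. conj_root (T z)) z0" using cTc T(1) by (simp add: continuous_on_eq_continuous_at)
        show "isCont L (conj_root (T z0))" using not_pole_num_den(3)[OF root_conj_root[OF t0(1)] np] T(3) by (simp add: L_isCont)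
      qed
      ultimately have l2: "((\<lambda>z. L (conj_root (T z))) \<longlongrightarrow> L t0) (at z0)" using T(3) by (simp add: isCont_def)
      have l1: "((\<lambda>z. L (T z)) \<longlongrightarrow> L t0) (at z0)" using harmonic_at_imp_isCont[OF LT] T(3) by (simp add: isCont_def)
      have "(Yhat \<longlongrightarrow> L t0) (at z0)"
      proof (rule real_tendsto_sandwich)
        show "((\<lambda>z. min (L (T z)) (L (conj_root (T z)))) \<longlongrightarrow> L t0) (at z0)" using tendsto_min[OF l1 l2] by simp
        show "((\<lambda>z. L (T z)) \<longlongrightarrow> L t0) (at z0)" by (rule l1)
        have ev: "eventually (\<lambda>z. z \<in> V) (at z0)" using V z0V by (simp add: eventually_at_in_open')
        then show "eventually (\<lambda>z. Yhat z \<le> L (T z)) (at z0)" by eventually_elim (rule le)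
        have "eventually (\<lambda>z. z \<noteq> z0) (at z0)" by (simp add: eventually_at_filter)
        with ev show "eventually (\<lambda>z. min (L (T z)) (L (conj_root (T z))) \<le> Yhat z) (at z0)"
        proof eventually_elim
          case (elim z) then show ?case using D[of z] nD[of z] by (cases "neg_root z \<in> Delta") auto
        qed
      qed
      then show ?thesis using t0(5) by (simp add: isCont_def)
    qed
    ultimately show ?thesis ..
  qed
  then show "touched_above Yhat z0" "isCont Yhat z0" by auto
qed

end

section \<open>Branch points, infinity and the positivity of \<open>S\<close>\<close>

context two_sheets
begin

text \<open>Subtracting the two quadratic equations gives (t - t0)^2 = t (z - z0), so every root
  over \<open>z\<close> is within order sqrt |z - z0| of the double root. The radius is chosen so
  that |t - t0| = \<epsilon> just fails.\<close>

lemma double_root_near: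
  assumes r0: "root z0 t0" "conj_root t0 = t0" and e: "\<epsilon> > 0"
  shows "\<exists>\<delta>>0. \<forall>z t. cmod (z - z0) < \<delta> \<longrightarrow> root z t \<longrightarrow> cmod (t - t0) < \<epsilon>"
proof (intro exI[of _ "\<epsilon>\<^sup>2 / (cmod t0 + \<epsilon>)"] conjI allI impI)
  have p: "cmod t0 + \<epsilon> > 0" using e by (simp add: add_nonneg_pos)
  then show "0 < \<epsilon>\<^sup>2 / (cmod t0 + \<epsilon>)" using e by simp
  fix z t assume z: "cmod (z - z0) < \<epsilon>\<^sup>2 / (cmod t0 + \<epsilon>)" and r: "root z t"
  define x where "x = cmod (t - t0)"
  have "t0 + t0 = z0 + 2" using root_sum[OF r0(1)] r0(2) by simp
  moreover have "t0\<^sup>2 = (z0 + 2) * t0 + of_real (3 * w)" using r0(1) by (simp add: root_def)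
  moreover have "t\<^sup>2 = (z + 2) * t + of_real (3 * w)" using r by (simp add: root_def)
  ultimately have "(t - t0)\<^sup>2 = t * (z - z0)" by algebra
  then have "x\<^sup>2 = cmod t * cmod (z - z0)" unfolding x_def by (metis norm_mult norm_power)
  moreover have "cmod t \<le> cmod t0 + x" unfolding x_def using norm_triangle_ineq[of t0 "t - t0"] by simp
  ultimately have x2: "x\<^sup>2 \<le> (cmod t0 + x) * cmod (z - z0)" by (simp add: mult_right_mono)
  show "cmod (t - t0) < \<epsilon>"
  proof (rule ccontr)
    assume "\<not> ?thesis"
    then have xe: "\<epsilon> \<le> x" by (simp add: x_def)
    have "(cmod t0 + x) * cmod (z - z0) < (cmod t0 + x) * (\<epsilon>\<^sup>2 / (cmod t0 + \<epsilon>))"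
      using z xe e by (intro mult_strict_left_mono) (auto simp: add_nonneg_pos)
    then have "x\<^sup>2 < (cmod t0 + x) * \<epsilon>\<^sup>2 / (cmod t0 + \<epsilon>)" using x2 by simp
    then have "x\<^sup>2 * (cmod t0 + \<epsilon>) < (cmod t0 + x) * \<epsilon>\<^sup>2" using p by (simp only: pos_less_divide_eq)
    moreover have "\<epsilon>\<^sup>2 * cmod t0 \<le> x\<^sup>2 * cmod t0" using xe e by (intro mult_right_mono power_mono) auto
    moreover have "x * \<epsilon> * \<epsilon> \<le> x * \<epsilon> * x" using xe e by (intro mult_left_mono) auto
    ultimately show False by (simp add: power2_eq_square algebra_simps)
  qed
qed

lemma double_root_regular:
  assumes "root z t" "conj_root t = t" shows "regular t"
proof -
  have t0: "t \<noteq> 0" using root_nz assms by blast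
  then have t2: "t\<^sup>2 = - of_real (3 * w)" using assms(2) by (simp add: conj_root_def power2_eq_square field_simps)
  have re: "Re t = 0"
  proof -
    have "Im (t\<^sup>2) = 0" "Re (t\<^sup>2) < 0" using t2 w_pos by auto
    then show ?thesis by (auto simp: power2_eq_square)
  qed
  have "t\<^sup>2 - 6 * t + of_real (9 * w) \<noteq> 0"
  proof
    assume "t\<^sup>2 - 6 * t + of_real (9 * w) = 0"
    then have "Re (t\<^sup>2 - 6 * t + of_real (9 * w)) = 0" by simp
    then show False unfolding t2 using re w_pos by simp
  qed
  then show ?thesis using t0 re w_pos by (auto simp: regular_def)
qed

lemma Yhat_cases: "\<exists>t. root z t \<and> Yhat z = L t"
  unfolding Yhat_def using neg_root(1)[of z] root_conj_root by auto

lemma L_near_double_root: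
  assumes r0: "root z0 t0" "conj_root t0 = t0" and e: "\<epsilon> > 0"
  shows "\<exists>\<delta>>0. \<forall>z t. cmod (z - z0) < \<delta> \<longrightarrow> root z t \<longrightarrow> \<bar>L t - L t0\<bar> < \<epsilon>"
proof -
  have "isCont L t0" using L_isCont double_root_regular[OF r0] .
  then obtain d where d: "d > 0" "\<And>t. cmod (t - t0) < d \<Longrightarrow> \<bar>L t - L t0\<bar> < \<epsilon>"
    using e by (auto simp: continuous_at_eps_delta dist_norm)
  then show ?thesis using double_root_near[OF r0 d(1)] by blast
qed

lemma Yhat_isCont: "isCont Yhat z0"
proof (cases "(z0 + 2)\<^sup>2 + of_real (12 * w) = 0")
  case False then show ?thesis by (rule Yhat_touched_above_isCont)
next
  case True
  obtain t0 where r0: "root z0 t0" "Yhat z0 = L t0" using Yhat_cases by blast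
  have c: "conj_root t0 = t0" using conj_root_eq_iff[OF r0(1)] True by simp
  show ?thesis unfolding continuous_at_eps_delta
  proof (intro allI impI)
    fix \<epsilon> :: real assume "\<epsilon> > 0"
    then obtain \<delta> where d: "\<delta> > 0" "\<And>z t. cmod (z - z0) < \<delta> \<Longrightarrow> root z t \<Longrightarrow> \<bar>L t - L t0\<bar> < \<epsilon>"
      using L_near_double_root[OF r0(1) c] by blast
    have "dist (Yhat z) (Yhat z0) < \<epsilon>" if "dist z z0 < \<delta>" for z
      using Yhat_cases[of z] d(2)[of z] that r0(2) by (auto simp: dist_norm)
    then show "\<exists>d>0. \<forall>x'. dist x' z0 < d \<longrightarrow> dist (Yhat x') (Yhat z0) < \<epsilon>" using d(1) by blast
  qed
qed

text \<open>The roots have sum z + 2 and product -3w: the larger one carries at least half of the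
  sum, and the smaller one is 3w divided by it in modulus.\<close>

lemma small_root_bound:
  assumes "root z t" "cmod t \<le> cmod (conj_root t)" "cmod z > 2"
  shows "(cmod z - 2) / 2 \<le> cmod (conj_root t)" "cmod t \<le> 6 * w / (cmod z - 2)"
proof -
  have "z = t + conj_root t - 2" using root_sum[OF assms(1)] by simp
  then have "cmod z \<le> cmod (t + conj_root t) + 2" using norm_triangle_ineq4[of "t + conj_root t" 2] by simp
  also have "\<dots> \<le> cmod t + cmod (conj_root t) + 2" using norm_triangle_ineq by simp
  finally show b: "(cmod z - 2) / 2 \<le> cmod (conj_root t)" using assms(2) by simp
  have "cmod t = 3 * w / cmod (conj_root t)"
    using cmod_conj_root[of t] root_nz[OF assms(1)] conj_root_nz[of t] by (simp add: field_simps)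
  also have "\<dots> \<le> 3 * w / ((cmod z - 2) / 2)" using b assms(3) w_pos conj_root_nz[OF root_nz[OF assms(1)]]
    by (intro divide_left_mono mult_pos_pos) auto
  finally show "cmod t \<le> 6 * w / (cmod z - 2)" by simp
qed

lemma small_root_small:
  assumes "\<rho> > 0"
  shows "\<exists>M>2. \<forall>z t. cmod z > M \<longrightarrow> root z t \<longrightarrow> cmod t \<le> cmod (conj_root t) \<longrightarrow> cmod t < \<rho> \<and> 3 < cmod (conj_root t)"
proof (intro exI[of _ "8 + 6 * w / \<rho>"] conjI allI impI)
  have p: "6 * w / \<rho> > 0" using w_pos assms by simp
  then show "2 < 8 + 6 * w / \<rho>" by simp
  fix z t assume z: "cmod z > 8 + 6 * w / \<rho>" and r: "root z t" "cmod t \<le> cmod (conj_root t)"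
  have z2: "cmod z > 2" using z p by simp
  note b = small_root_bound[OF r z2]
  show "3 < cmod (conj_root t)" proof -
    have "6 < cmod z - 2" using z p by simp
    then show ?thesis using b(1) by simp
  qed
  have "6 * w / \<rho> < cmod z - 2" using z by simp
  then have "6 * w / (cmod z - 2) < \<rho>" using assms z2 by (simp add: field_simps)
  then show "cmod t < \<rho>" using b(2) by simp
qed

lemma small_root_num_den:
  "\<exists>M>2. \<forall>z t. cmod z > M \<longrightarrow> root z t \<longrightarrow> cmod t \<le> cmod (conj_root t) \<longrightarrow>
     cmod (num t) < cmod (den t) \<and> 3 < cmod (conj_root t)"
proof -
  have "isCont (\<lambda>t. cmod (den t) - cmod (num t)) 0" unfolding num_def den_def by (intro continuous_intros)
  moreover have "cmod (den 0) - cmod (num 0) > 0" using w_pos by (simp add: num_def den_def)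
  ultimately have "eventually (\<lambda>t. cmod (den t) - cmod (num t) > 0) (at 0)"
    unfolding isCont_def by (rule order_tendstoD(1))
  then obtain \<rho> where "\<rho> > 0" "\<And>t. t \<noteq> 0 \<Longrightarrow> cmod t < \<rho> \<Longrightarrow> cmod (num t) < cmod (den t)"
    by (auto simp: eventually_at)
  then show ?thesis using small_root_small[of \<rho>] root_nz by metis
qed

lemma L_small_root:
  assumes "\<epsilon> > 0"
  shows "\<exists>M>2. \<forall>z t. cmod z > M \<longrightarrow> root z t \<longrightarrow> cmod t \<le> cmod (conj_root t) \<longrightarrow> \<bar>L t + ln (cmod z) - ln 27\<bar> < \<epsilon>"
proof -
  \<comment> \<open>Since z t = t^2 - 2t - 3w, \<open>h t\<close> is Y(t) z written without
    \<open>z\<close>. At the small root t tends to 0, and h 0 = 9w (-3w) / w^2 = -27 is the source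
    of ln 27.\<close>
  define h where "h t = (t\<^sup>2 - 6 * t + of_real (9 * w)) * (t\<^sup>2 - 2 * t - of_real (3 * w)) / (t - of_real w)\<^sup>2" for t :: complex
  have h0: "h 0 = -27" using w_pos by (simp add: h_def power2_eq_square)
  have "isCont h 0" unfolding h_def using w_pos by (intro continuous_intros) auto
  then have "isCont (\<lambda>t. ln (cmod (h t))) 0"
    unfolding isCont_def by (intro tendsto_ln tendsto_norm) (auto simp: h0)
  then obtain \<rho> where \<rho>: "\<rho> > 0" "\<And>t. cmod t < \<rho> \<Longrightarrow> \<bar>ln (cmod (h t)) - ln 27\<bar> < \<epsilon>"
    using assms h0 by (auto simp: continuous_at_eps_delta dist_norm)
  have "isCont h 0" unfolding h_def using w_pos by (intro continuous_intros) auto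
  then have "eventually (\<lambda>t. h t \<noteq> 0) (at 0)"
    unfolding isCont_def by (rule tendsto_imp_eventually_ne) (simp add: h0)
  then obtain \<rho>' where \<rho>': "\<rho>' > 0" "\<And>t. t \<noteq> 0 \<Longrightarrow> cmod t < \<rho>' \<Longrightarrow> h t \<noteq> 0" by (auto simp: eventually_at)
  obtain M where M: "M > 2" "\<And>z t. cmod z > M \<Longrightarrow> root z t \<Longrightarrow> cmod t \<le> cmod (conj_root t) \<Longrightarrow> cmod t < min \<rho> \<rho>'"
  proof -
    have "min \<rho> \<rho>' > 0" using \<rho> \<rho>' by simp
    from small_root_small[OF this] that show thesis by blast
  qed
  have "\<bar>L t + ln (cmod z) - ln 27\<bar> < \<epsilon>" if z: "cmod z > M" and r: "root z t" "cmod t \<le> cmod (conj_root t)" for z t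
  proof -
    have t: "cmod t < \<rho>" "cmod t < \<rho>'" using M(2)[OF z r] by auto
    have t0: "t \<noteq> 0" using root_nz r by blast
    have "z * t = t\<^sup>2 - 2 * t - of_real (3 * w)" using r(1) by (simp add: root_def algebra_simps)
    then have "Y t * z = h t" unfolding Y_def h_def by (simp add: mult_ac)
    then have "cmod (Y t) * cmod z = cmod (h t)" by (metis norm_mult)
    moreover have "h t \<noteq> 0" using \<rho>'(2)[OF t0 t(2)] .
    ultimately have yz: "cmod (Y t) * cmod z = cmod (h t)" "cmod (Y t) * cmod z \<noteq> 0" by auto
    then have "cmod (Y t) > 0" "cmod z > 0" by auto
    then have "L t + ln (cmod z) = ln (cmod (h t))" unfolding L_def yz(1)[symmetric] by (simp add: ln_mult_pos)
    then show ?thesis using \<rho>(2)[OF t(1)] by simp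
  qed
  then show ?thesis using M(1) by blast
qed

text \<open>On the reflected arc the first term is at most U(-z), and inside the closed curve the
  second is at least U z. So positivity of \<open>S\<close> yields the inequality there, although
  which root U z refers to is not known.\<close>

definition S :: "complex \<Rightarrow> real" where "S z = Yhat (- z) - L (neg_root z)"

lemma S_harm:
  assumes "Re z > 0"
  shows "isCont S z" and "(2 - z)\<^sup>2 + of_real (12 * w) \<noteq> 0 \<Longrightarrow> touched_above S z"
proof -
  have h: "harmonic_at (\<lambda>z. - L (neg_root z)) z"
    using assms by (intro harmonic_at_minus L_neg_root_harmonic neg_root_right) simp
  have "isCont (\<lambda>z. Yhat (- z)) z" using isCont_o2[of z uminus Yhat] Yhat_isCont by (simp add: continuous_minus)
  then show "isCont S z" unfolding S_def[abs_def] using harmonic_at_imp_isCont[OF h] continuous_add by fastforce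
  assume "(2 - z)\<^sup>2 + of_real (12 * w) \<noteq> 0"
  then have "touched_above Yhat (- z)" by (intro Yhat_touched_above_isCont) (simp add: algebra_simps)
  then have "touched_above (\<lambda>z. Yhat (- z) + - L (neg_root z)) z"
    by (intro touched_above_add touched_above_compose_uminus harmonic_at_imp_touched_above[OF h])
  then show "touched_above S z" by (simp add: S_def[abs_def])
qed

text \<open>On the imaginary axis - q = cnj q, and the left root over either point lies in
  \<open>Delta\<close>; \<open>L\<close> is invariant under conjugation, so the two terms of
  \<open>S\<close> cancel.\<close>

lemma S_imaginary_axis:
  assumes "Re q = 0" "\<epsilon> > 0" shows "eventually (\<lambda>z. \<bar>S z\<bar> < \<epsilon>) (nhds q)"
proof -
  have "isCont S q" "S q = 0"
  proof -
    have h: "isCont (\<lambda>z. L (neg_root z)) q" "Re (- q) > -2"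
      using assms by (auto intro!: harmonic_at_imp_isCont L_neg_root_harmonic neg_root_right)
    have "isCont (\<lambda>z. Yhat (- z)) q" using isCont_o2[of q uminus Yhat] Yhat_isCont by (simp add: continuous_minus)
    then show "isCont S q" unfolding S_def[abs_def] using h by (intro continuous_diff)
    have "- q = cnj q" using assms by (simp add: complex_eq_iff)
    then have "L (neg_root (- q)) = L (neg_root q)" using neg_root_cnj[of q] neg_root_right(1)[of q] assms by (simp add: L_cnj)
    then show "S q = 0" using neg_root_right(2)[OF h(2)] by (simp add: S_def Yhat_def)
  qed
  then have "((\<lambda>z. \<bar>S z\<bar>) \<longlongrightarrow> 0) (at q)" unfolding isCont_def by (simp add: tendsto_rabs_zero)
  then have "eventually (\<lambda>z. \<bar>S z\<bar> < \<epsilon>) (at q)" using assms by (intro order_tendstoD(2)) auto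
  then show ?thesis using \<open>S q = 0\<close> assms by (simp add: eventually_nhds_conv_at)
qed

text \<open>Near t = 0 \<open>den\<close> dominates \<open>num\<close>, and the large root has
  modulus above 3, hence lies outside \<open>Delta\<close>. So for large \<open>z\<close> the rule
  defining \<open>Yhat\<close> selects the small root.\<close>

lemma Yhat_small_root:
  "\<exists>M>2. \<forall>z. cmod z > M \<longrightarrow> (\<exists>t. root z t \<and> cmod t \<le> cmod (conj_root t) \<and> Yhat z = L t)"
proof -
  obtain M where M: "M > 2" "\<And>z t. cmod z > M \<Longrightarrow> root z t \<Longrightarrow> cmod t \<le> cmod (conj_root t) \<Longrightarrow>
     cmod (num t) < cmod (den t) \<and> 3 < cmod (conj_root t)" using small_root_num_den by blast
  have "\<exists>t. root z t \<and> cmod t \<le> cmod (conj_root t) \<and> Yhat z = L t" if z: "cmod z > M" for z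
  proof -
    define n where "n = neg_root z"
    have r: "root z n" using neg_root by (simp add: n_def)
    note r' = root_conj_root[OF r]
    show ?thesis
    proof (cases "cmod n \<le> cmod (conj_root n)")
      case True
      then show ?thesis using M(2)[OF z r True] r by (intro exI[of _ n]) (auto simp: Yhat_def n_def)
    next
      case False
      then have c: "cmod (conj_root n) \<le> cmod (conj_root (conj_root n))" by simp
      have "n \<notin> Delta" using M(2)[OF z r' c] Delta_bound[of n] by auto
      moreover have "\<not> cmod (num n) \<le> cmod (den n)"
        using M(2)[OF z r' c] num_le_den_conj_root[of "conj_root n"] conj_root_nz[OF root_nz[OF r]] by auto
      ultimately show ?thesis using r' c by (intro exI[of _ "conj_root n"]) (auto simp: Yhat_def n_def)
    qed
  qed
  then show ?thesis using M(1) by blast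
qed

text \<open>Both terms of \<open>S\<close> are values of \<open>L\<close> at a small root and behave
  like ln 27 - ln |z|.\<close>

lemma S_infinity:
  assumes "\<epsilon> > 0" shows "\<exists>M>0. \<forall>z. Re z > 0 \<longrightarrow> cmod z > M \<longrightarrow> \<bar>S z\<bar> < \<epsilon>"
proof -
  obtain M1 where M1: "M1 > 2" "\<And>z. cmod z > M1 \<Longrightarrow> \<exists>t. root z t \<and> cmod t \<le> cmod (conj_root t) \<and> Yhat z = L t"
    using Yhat_small_root by blast
  obtain M2 where M2: "M2 > 2" "\<And>z t. cmod z > M2 \<Longrightarrow> root z t \<Longrightarrow> cmod t \<le> cmod (conj_root t) \<Longrightarrow> \<bar>L t + ln (cmod z) - ln 27\<bar> < \<epsilon> / 2"
    using L_small_root[of "\<epsilon> / 2"] assms by auto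
  have "\<bar>S z\<bar> < \<epsilon>" if z: "Re z > 0" "cmod z > max M1 M2" for z
  proof -
    obtain t where t: "root (- z) t" "cmod t \<le> cmod (conj_root t)" "Yhat (- z) = L t" using M1(2)[of "- z"] z by auto
    have "(cmod (neg_root z))\<^sup>2 < 3 * w" using neg_root_right(3)[of z] z by simp
    then have "cmod (neg_root z) \<le> cmod (conj_root (neg_root z))"
      using root_nz[OF neg_root(1)[of z]] by (simp add: cmod_conj_root field_simps power2_eq_square)
    from M2(2)[OF _ neg_root(1) this] have "\<bar>L (neg_root z) + ln (cmod z) - ln 27\<bar> < \<epsilon> / 2" using z by simp
    moreover have "\<bar>L t + ln (cmod z) - ln 27\<bar> < \<epsilon> / 2" using M2(2)[OF _ t(1,2)] z by simp
    ultimately show ?thesis unfolding S_def t(3) by linarith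
  qed
  then show ?thesis using M1(1) by (intro exI[of _ "max M1 M2"]) auto
qed

text \<open>The reflected branch points. The two values of \<open>L\<close> merge there, so
  \<open>Yhat\<close> has no local holomorphic branch to be touched by.\<close>

definition double_pts :: "complex set" where
  "double_pts = {z. (2 - z)\<^sup>2 + of_real (12 * w) = 0}"

lemma finite_double_pts: "finite double_pts"
proof -
  have "double_pts \<subseteq> {2 + \<i> * of_real (sqrt (12 * w)), 2 - \<i> * of_real (sqrt (12 * w))}"
  proof
    fix z assume "z \<in> double_pts"
    then have "(2 - z)\<^sup>2 = - of_real (12 * w)" by (simp add: double_pts_def add_eq_0_iff2)
    also have "\<dots> = (\<i> * of_real (sqrt (12 * w)))\<^sup>2" using w_pos by (simp add: power_mult_distrib flip: of_real_power)
    finally have "2 - z = \<i> * of_real (sqrt (12 * w)) \<or> 2 - z = - (\<i> * of_real (sqrt (12 * w)))" by (simp only: power2_eq_iff)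
    then show "z \<in> {2 + \<i> * of_real (sqrt (12 * w)), 2 - \<i> * of_real (sqrt (12 * w))}"
      by (auto simp: algebra_simps)
  qed
  then show ?thesis by (rule finite_subset) simp
qed

text \<open>The minimum principle for S + \<epsilon> on a large half-disc: zero on the axis and
  decay at infinity control the boundary, and continuity gives the lower bound needed at the
  reflected branch points, which are finally filled in by a limit.\<close>

lemma S_nonneg: assumes "Re z > 0" shows "S z \<ge> 0"
proof -
  have off: "S p \<ge> 0" if p: "Re p > 0" "p \<notin> double_pts" for p
  proof (rule field_le_epsilon)
    fix \<epsilon> :: real assume \<epsilon>: "\<epsilon> > 0"
    obtain M where M: "M > 0" "\<And>z. Re z > 0 \<Longrightarrow> cmod z > M \<Longrightarrow> \<bar>S z\<bar> < \<epsilon>" using S_infinity[OF \<epsilon>] by blast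
    define W where "W = {z. Re z > 0} \<inter> ball 0 (max M (cmod p) + 1)"
    have opW: "open W" unfolding W_def by (intro open_Int open_Collect_less continuous_intros open_ball)
    have "0 \<le> S p + \<epsilon>"
    proof (rule minimum_principle_except[of W double_pts "\<lambda>z. S z + \<epsilon>"])
      show "open W" by (rule opW)
      show "bounded W" by (simp add: W_def bounded_Int)
      show "finite double_pts" by (rule finite_double_pts)
      show "p \<in> W - double_pts" using p by (auto simp: W_def)
    next
      fix z assume z: "z \<in> W - double_pts"
      then have "touched_above S z" by (intro S_harm) (auto simp: W_def double_pts_def)
      then show "touched_above (\<lambda>z. S z + \<epsilon>) z" by (rule touched_above_add[OF _ harmonic_at_imp_touched_above]) simp
      show "isCont (\<lambda>z. S z + \<epsilon>) z" using S_harm(1)[of z] z by (intro continuous_intros) (auto simp: W_def)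
    next
      fix z assume z: "z \<in> double_pts"
      have "Re z > 0"
      proof (rule ccontr)
        assume a: "\<not> ?thesis"
        have "Im ((2 - z)\<^sup>2) = 0" "Re ((2 - z)\<^sup>2) < 0"
          using z w_pos by (auto simp: double_pts_def add_eq_0_iff2)
        then have "Re (2 - z) = 0" by (auto simp: power2_eq_square)
        then show False using a by simp
      qed
      then have "isCont S z" by (rule S_harm)
      then have "eventually (\<lambda>x. S x > S z - 1) (at z)" unfolding isCont_def by (rule order_tendstoD(1)) simp
      then have "eventually (\<lambda>x. S x + \<epsilon> \<ge> S z - 1) (at z)" by eventually_elim (use \<epsilon> in linarith)
      then have "eventually (\<lambda>x. S x + \<epsilon> \<ge> S z - 1) (at z within W)"
        by (rule filter_leD[OF at_le, rotated]) simp
      then show "\<exists>M. eventually (\<lambda>x. S x + \<epsilon> \<ge> M) (at z within W)" by blast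
    next
      fix q \<epsilon>' :: real and x assume x: "x \<in> frontier W - double_pts" and e': "\<epsilon>' > 0"
      have cl: "x \<in> closure W" and nW: "x \<notin> W" using x opW by (auto simp: frontier_def interior_open)
      have "closure W \<subseteq> {z. Re z \<ge> 0} \<inter> cball 0 (max M (cmod p) + 1)"
        by (rule closure_minimal) (auto simp: W_def intro!: closed_Int closed_Collect_le continuous_intros)
      then have x0: "Re x \<ge> 0" "cmod x \<le> max M (cmod p) + 1" using cl by auto
      have "eventually (\<lambda>z. S z > - \<epsilon> - \<epsilon>') (nhds x)"
      proof (cases "Re x = 0")
        case True
        show ?thesis using S_imaginary_axis[OF True \<epsilon>] e' by (auto elim!: eventually_mono)
      next
        case False
        then have xr: "Re x > 0" using x0 by simp
        then have "cmod x = max M (cmod p) + 1" using nW x0 by (auto simp: W_def)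
        then have "M < cmod x" by simp
        then have "S x > - \<epsilon>" using M(2)[OF xr] by fastforce
        then have *: "S x > - \<epsilon> - \<epsilon>'" using e' by simp
        have "eventually (\<lambda>z. S z > - \<epsilon> - \<epsilon>') (at x)"
          using S_harm(1)[OF xr] * unfolding isCont_def by (rule order_tendstoD(1))
        then show ?thesis using * by (simp add: eventually_nhds_conv_at)
      qed
      then show "eventually (\<lambda>z. S z + \<epsilon> > - \<epsilon>') (at x within W)"
        by (simp add: eventually_at_filter) (auto elim!: eventually_mono)
    qed
    then show "0 \<le> S p + \<epsilon>" .
  qed
  show ?thesis
  proof (cases "z \<in> double_pts")
    case True
    have "isCont S z" by (rule S_harm[OF assms])
    then have lim: "(S \<longlongrightarrow> S z) (at z)" by (simp add: isCont_def)
    have "open ({z. Re z > 0} - (double_pts - {z}))"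
      by (intro open_Diff open_Collect_less continuous_intros finite_imp_closed finite_Diff finite_double_pts)
    then have "eventually (\<lambda>x. x \<in> {z. Re z > 0} - (double_pts - {z}) \<and> x \<noteq> z) (at z)"
      using assms by (intro eventually_conj eventually_at_in_open') (auto simp: eventually_at_filter)
    then have "eventually (\<lambda>x. 0 \<le> S x) (at z)" by eventually_elim (use off in auto)
    then show ?thesis by (rule tendsto_lowerbound[OF lim]) simp
  qed (use off assms in auto)
qed

text \<open>One explicit value excludes that \<open>S\<close> vanishes identically. Over the
  reflected point the relevant root is -3, where |Y| = 27 / (3 + w) exactly.\<close>

lemma S_pos_at_reflected_pole: "S (of_real (5 - w)) > 0"
proof -
  \<comment> \<open>The positive root over z = 5 - w, that is of T^2 = (7 - w) T + 3w; the left root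
    is its conjugate.\<close>
  define T where "T = ((7 - w) + sqrt ((7 - w)\<^sup>2 + 12 * w)) / 2"
  have T0: "T > 0" using w_pos w_le_1 by (simp add: T_def add_pos_nonneg)
  have "2 * T - (7 - w) = sqrt ((7 - w)\<^sup>2 + 12 * w)" by (simp add: T_def field_simps)
  then have "(2 * T - (7 - w))\<^sup>2 = (7 - w)\<^sup>2 + 12 * w" using w_pos by simp
  moreover have "(2 * T - (7 - w))\<^sup>2 - ((7 - w)\<^sup>2 + 12 * w) = 4 * (T\<^sup>2 - ((7 - w) * T + 3 * w))"
    by (simp add: power2_eq_square algebra_simps)
  ultimately have "4 * (T\<^sup>2 - ((7 - w) * T + 3 * w)) = 0" by (simp only: diff_self)
  then have "T\<^sup>2 - ((7 - w) * T + 3 * w) = 0" unfolding mult_eq_0_iff by simp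
  then have T2: "T\<^sup>2 = (7 - w) * T + 3 * w" by (simp only: right_minus_eq)
  have "root (of_real (5 - w)) (of_real T)" unfolding root_def
    using arg_cong[OF T2, of complex_of_real] by simp
  then have "root (of_real (5 - w)) (conj_root (of_real T))" by (rule root_conj_root)
  moreover have "Re (conj_root (of_real T)) < 0" using T0 w_pos by (simp add: Re_conj_root)
  ultimately have n: "neg_root (of_real (5 - w)) = conj_root (of_real T)" by (rule neg_root_eq)
  have p: "T * (T + 3)\<^sup>2 > 0" "T\<^sup>2 + 2 * T + w > 0" using T0 w_pos by (auto intro!: mult_pos_pos zero_less_power add_pos_pos)
  have "Y (conj_root (of_real T)) = of_real (- 27 * (T\<^sup>2 + 2 * T + w) / (T * (T + 3)\<^sup>2))"
    using T0 by (subst Y_conj_root) auto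
  then have "cmod (Y (conj_root (of_real T))) = 27 * (T\<^sup>2 + 2 * T + w) / (T * (T + 3)\<^sup>2)"
    using p T0 by (simp only: norm_of_real) (simp add: abs_mult)
  moreover have "27 * (T\<^sup>2 + 2 * T + w) / (T * (T + 3)\<^sup>2) < 27 / (3 + w)"
  proof -
    \<comment> \<open>Reducing twice by the quadratic equation for T leaves a linear function of T
      whose coefficients are positive for 0 < w \<le> 1.\<close>
    have "T * (T + 3)\<^sup>2 - (T\<^sup>2 + 2 * T + w) * (3 + w) = T * (T\<^sup>2 + 6 * T + 9) - (T\<^sup>2 + 2 * T + w) * (3 + w)"
      by (simp add: power2_eq_square algebra_simps)
    also have "\<dots> = T * ((7 - w) * T + 3 * w + 6 * T + 9) - ((7 - w) * T + 3 * w + 2 * T + w) * (3 + w)" by (simp only: T2)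
    also have "\<dots> = (13 - w) * T\<^sup>2 + (3 * w + 9) * T - ((9 - w) * T + 4 * w) * (3 + w)"
      by (simp add: power2_eq_square algebra_simps)
    also have "\<dots> = (73 - 23 * w + 2 * w\<^sup>2) * T + w * (27 - 7 * w)"
      unfolding T2 by (simp add: power2_eq_square algebra_simps)
    also have "\<dots> > 0" using T0 w_pos w_le_1 by (intro add_pos_pos mult_pos_pos add_pos_nonneg) auto
    finally have "(T\<^sup>2 + 2 * T + w) * (3 + w) < T * (T + 3)\<^sup>2" by simp
    then have "27 * ((T\<^sup>2 + 2 * T + w) * (3 + w)) / (T * (T + 3)\<^sup>2) < 27" using p(1) by (subst pos_divide_less_eq) auto
    then show ?thesis using w_pos by (subst pos_less_divide_eq) (auto simp: mult_ac)
  qed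
  moreover have "cmod (Y (conj_root (of_real T))) > 0" using calculation(1) p by simp
  ultimately have "L (neg_root (of_real (5 - w))) < ln (27 / (3 + w))"
    using w_pos unfolding n L_def by (subst ln_less_cancel_iff) auto
  moreover have "Yhat (- of_real (5 - w)) = ln (27 / (3 + w))"
  proof -
    have "root (- of_real (5 - w)) (- 3)" by (simp add: root_def)
    then have "neg_root (- of_real (5 - w)) = -3" by (rule neg_root_eq) simp
    moreover have "Y (-3) = - of_real (27 / (3 + w))"
    proof -
      have "3 + complex_of_real w \<noteq> 0" using w_pos by (auto simp: complex_eq_iff)
      moreover have a: "(- 3 - complex_of_real w)\<^sup>2 = (3 + of_real w)\<^sup>2" by (simp add: power2_eq_square algebra_simps)
      moreover have b: "(- 3)\<^sup>2 - 6 * (- 3) + complex_of_real (9 * w) = 9 * (3 + of_real w)" by simp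
      moreover have c: "- 3 * (9 * v) / v\<^sup>2 = - (27 / v)" if "v \<noteq> 0" for v :: complex using that by (simp add: power2_eq_square)
      ultimately have "Y (- 3) = - (27 / (3 + of_real w))" unfolding Y_def a b by (intro c)
      then show ?thesis by simp
    qed
    ultimately show ?thesis using w_pos by (simp add: Yhat_def num_def L_def norm_divide del: of_real_divide)
  qed
  ultimately show ?thesis by (simp add: S_def)
qed

text \<open>Off the reflected branch points a zero would propagate over the connected punctured
  half-plane to 5 - w. At such a point the value is bounded below by the positive minimum of
  \<open>S\<close> on a small surrounding circle.\<close>

lemma S_pos: assumes z: "Re z > 0" shows "S z > 0"
proof -
  have off: "S p > 0" if p: "Re p > 0" "p \<notin> double_pts" for p
  proof (rule ccontr)
    assume "\<not> S p > 0"
    then have Sp: "S p = 0" using S_nonneg[OF p(1)] by simp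
    have op: "open {z. Re z > 0}" by (intro open_Collect_less continuous_intros)
    have "S (of_real (5 - w)) = 0"
    proof (rule touched_above_zero_set[of "{z. Re z > 0} - double_pts" S p])
      show "open ({z. Re z > 0} - double_pts)" using op by (intro open_Diff finite_imp_closed finite_double_pts)
      show "connected ({z. Re z > 0} - double_pts)"
        by (rule connected_open_delete_finite[OF op _ _ finite_double_pts])
          (auto intro!: convex_connected convex_halfspace_Re_gt)
      show "of_real (5 - w) \<in> {z. Re z > 0} - double_pts"
      proof -
        have "(2 - complex_of_real (5 - w))\<^sup>2 + of_real (12 * w) = of_real ((w - 3)\<^sup>2 + 12 * w)" by simp
        moreover have "(w - 3)\<^sup>2 + 12 * w > 0" using w_pos by (intro add_nonneg_pos) auto
        ultimately show ?thesis using w_le_1 by (simp add: double_pts_def del: of_real_add of_real_diff of_real_power)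
      qed
    qed (use S_harm S_nonneg p Sp in \<open>auto simp: double_pts_def\<close>)
    then show False using S_pos_at_reflected_pole by simp
  qed
  show ?thesis
  proof (cases "z \<in> double_pts")
    case True
    have "open ({z. Re z > 0} - (double_pts - {z}))"
      by (intro open_Diff open_Collect_less continuous_intros finite_imp_closed finite_Diff finite_double_pts)
    then obtain r where r: "r > 0" "cball z r \<subseteq> {z. Re z > 0} - (double_pts - {z})"
      using z open_contains_cball[of "{z. Re z > 0} - (double_pts - {z})"] by auto
    have "compact (sphere z r)" "sphere z r \<noteq> {}" using r by (auto simp: sphere_eq_empty)
    moreover have "continuous_on (sphere z r) S"
      using r S_harm(1) by (intro continuous_at_imp_continuous_on) (auto simp: subset_iff)
    ultimately obtain p where p: "p \<in> sphere z r" "\<And>x. x \<in> sphere z r \<Longrightarrow> S p \<le> S x"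
      using continuous_attains_inf[of "sphere z r" S] by metis
    have "Re p > 0" "p \<notin> double_pts" 
    proof -
      have "p \<in> cball z r" "p \<noteq> z" using p(1) r(1) by auto
      then show "Re p > 0" "p \<notin> double_pts" using subsetD[OF r(2), of p] by auto
    qed
    then have Sp: "S p > 0" by (rule off)
    have ge: "S x - S p \<ge> 0" if "x \<in> ball z r - {z}" for x
    proof (rule minimum_principle_except[of "ball z r" "{z}" "\<lambda>x. S x - S p"])
      fix y assume y: "y \<in> ball z r - {z}"
      then have y': "Re y > 0" "y \<notin> double_pts" using r by (auto simp: subset_iff)
      then have "touched_above S y" by (intro S_harm) (auto simp: double_pts_def)
      from touched_above_add[OF this harmonic_at_imp_touched_above[OF harmonic_at_const[of "- S p"]]]
      show "touched_above (\<lambda>x. S x - S p) y" by simp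
      show "isCont (\<lambda>x. S x - S p) y" by (intro continuous_intros S_harm y')
    next
      fix q \<epsilon> :: real and y assume y: "y \<in> frontier (ball z r) - {z}" and e: "\<epsilon> > 0"
      then have ys: "y \<in> sphere z r" using r by auto
      then have "Re y > 0" using r by (auto simp: subset_iff)
      then have "(S \<longlongrightarrow> S y) (at y)" using S_harm(1) by (simp add: isCont_def)
      then have "eventually (\<lambda>x. S x > S p - \<epsilon>) (at y)" using p(2)[OF ys] e by (intro order_tendstoD(1)) auto
      then have "eventually (\<lambda>x. S x - S p > - \<epsilon>) (at y)" by eventually_elim auto
      then show "eventually (\<lambda>x. S x - S p > - \<epsilon>) (at y within ball z r)"
        by (rule filter_leD[OF at_le, rotated]) simp
    next
      fix y assume "y \<in> {z}"
      have "eventually (\<lambda>x. x \<in> ball z r) (at y within ball z r)" by (simp add: eventually_at_filter)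
      then have "eventually (\<lambda>x. S x - S p \<ge> - S p) (at y within ball z r)"
        by eventually_elim (use r S_nonneg in \<open>auto simp: subset_iff\<close>)
      then show "\<exists>M. eventually (\<lambda>x. S x - S p \<ge> M) (at y within ball z r)" by blast
    qed (use that in auto)
    have "eventually (\<lambda>x. x \<in> ball z r - {z}) (at z)" using r by (auto simp: eventually_at dist_commute)
    then have "eventually (\<lambda>x. S p \<le> S x) (at z)" by eventually_elim (use ge in force)
    moreover have "(S \<longlongrightarrow> S z) (at z)" using S_harm(1)[OF z] by (simp add: isCont_def)
    ultimately have "S p \<le> S z" by (intro tendsto_lowerbound) auto
    then show ?thesis using Sp by simp
  qed (use off z in auto)
qed

end

section \<open>Logarithmic potential of a segment of the imaginary axis\<close>

text \<open>A primitive in \<open>k\<close> of ln |x + i k|. For x = 0 the arctan term drops out, as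
  it should.\<close>

definition log_prim :: "real \<Rightarrow> real \<Rightarrow> real" where
  "log_prim x k = k / 2 * ln (x\<^sup>2 + k\<^sup>2) - k + x * arctan (k / x)"

lemma log_prim_deriv:
  assumes "x \<noteq> 0 \<or> k \<noteq> 0"
  shows "(log_prim x has_real_derivative ln (x\<^sup>2 + k\<^sup>2) / 2) (at k)"
proof -
  have p: "x\<^sup>2 + k\<^sup>2 > 0" using assms by (auto simp: sum_power2_gt_zero_iff)
  show ?thesis
  proof (cases "x = 0")
    case True
    then have "log_prim x = (\<lambda>k. k / 2 * ln (k\<^sup>2) - k)" by (simp add: log_prim_def fun_eq_iff)
    moreover have "k * k > 0" using assms True not_real_square_gt_zero by blast
    ultimately show ?thesis using True assms
      by (auto intro!: derivative_eq_intros simp: field_simps power2_eq_square)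
  next
    case False
    have e: "1 + (k / x)\<^sup>2 = (x\<^sup>2 + k\<^sup>2) / x\<^sup>2" using False by (simp add: field_simps)
    have "(log_prim x has_real_derivative
       ln (x\<^sup>2 + k\<^sup>2) / 2 + k / 2 * (2 * k / (x\<^sup>2 + k\<^sup>2)) - 1 + x * (inverse (1 + (k / x)\<^sup>2) * (1 / x))) (at k)"
      unfolding log_prim_def[abs_def] using p False
      by (auto intro!: derivative_eq_intros)
    moreover have "k / 2 * (2 * k / P) - 1 + x * (inverse (P / x\<^sup>2) * (1 / x)) = 0" if "P = x\<^sup>2 + k\<^sup>2" "P > 0" for P
    proof -
      have "x * (inverse (P / x\<^sup>2) * (1 / x)) = x\<^sup>2 / P" using False by (simp add: power2_eq_square)
      moreover have "k / 2 * (2 * k / P) = k\<^sup>2 / P" by (simp add: power2_eq_square)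
      moreover have "k\<^sup>2 / P + x\<^sup>2 / P = 1"
      proof -
        have "k\<^sup>2 / P + x\<^sup>2 / P = (x\<^sup>2 + k\<^sup>2) / P" by (simp add: add_divide_distrib)
        then show ?thesis unfolding that(1)[symmetric] using that(2) by simp
      qed
      ultimately show ?thesis by linarith
    qed
    ultimately show ?thesis unfolding e using p by (metis (no_types, lifting) add.assoc add.right_neutral diff_conv_add_uminus)
  qed
qed

text \<open>The only critical point is the origin, where the derivative formula fails and k ln k ->
  0 takes over.\<close>

lemma log_prim_isCont: "isCont (log_prim x) k"
proof (cases "x \<noteq> 0 \<or> k \<noteq> 0")
  case True then show ?thesis using log_prim_deriv DERIV_isCont by blast
next
  case False
  then have k: "x = 0" "k = 0" by auto
  have "((\<lambda>k::real. k / 2 * ln (k\<^sup>2) - k) \<longlongrightarrow> 0) (at_right 0)" by real_asymp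
  moreover have "((\<lambda>k::real. k / 2 * ln (k\<^sup>2) - k) \<longlongrightarrow> 0) (at_left 0)" by real_asymp
  ultimately have "((\<lambda>k::real. k / 2 * ln (k\<^sup>2) - k) \<longlongrightarrow> 0) (at 0)" by (simp add: filterlim_split_at)
  moreover have "log_prim x = (\<lambda>k. k / 2 * ln (k\<^sup>2) - k)" using k by (simp add: log_prim_def fun_eq_iff)
  ultimately show ?thesis using k by (simp add: isCont_def)
qed

lemma log_prim_minus: "log_prim x (- k) = - log_prim x k"
  by (simp add: log_prim_def arctan_minus)

lemma log_prim_minus': "log_prim (- x) k = log_prim x k"
  by (simp add: log_prim_def arctan_minus)

text \<open>Writing arctan (k / x) as sgn x * pi / 2 - arctan (x / k) isolates the part |x| pi / 2,
  which is not harmonic at x = 0; the rest is the real part of a holomorphic function of k + i x for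
  k > 0.\<close>

lemma log_prim_Ln:
  assumes "k > 0"
  shows "log_prim x k = \<bar>x\<bar> * pi / 2 + Re (Complex k x * Ln (Complex k x)) - k"
proof -
  define z where "z = Complex k x"
  have z: "Re z = k" "Im z = x" "z \<noteq> 0" using assms by (auto simp: z_def complex_eq_iff)
  have "Im (Ln z) = arctan (x / k)" using arg_conv_arctan[of z] z assms by (simp add: Arg_eq_Im_Ln)
  moreover have "Re (Ln z) = ln (x\<^sup>2 + k\<^sup>2) / 2"
    using z by (simp add: cmod_def ln_sqrt add.commute sum_power2_gt_zero_iff)
  moreover have "x * arctan (k / x) = \<bar>x\<bar> * pi / 2 - x * arctan (x / k)"
  proof (cases "x = 0")
    case False
    then have "arctan (1 / (x / k)) = sgn (x / k) * pi / 2 - arctan (x / k)"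
      using assms by (intro Transcendental.arctan_inverse) auto
    moreover have "sgn (x / k) = sgn x" using assms by (simp add: sgn_divide)
    ultimately have "arctan (k / x) = sgn x * pi / 2 - arctan (x / k)" by simp
    then have "x * arctan (k / x) = x * (sgn x * pi / 2 - arctan (x / k))" by (simp only:)
    also have "\<dots> = (x * sgn x) * pi / 2 - x * arctan (x / k)" by (simp add: right_diff_distrib)
    also have "x * sgn x = \<bar>x\<bar>" by (simp add: abs_sgn)
    finally show ?thesis .
  qed simp
  ultimately show ?thesis using z unfolding z_def[symmetric] by (simp add: log_prim_def)
qed

text \<open>After the substitution k = \<theta> t - Im W the integrand is a derivative of
  \<open>log_prim\<close>. The two ends contribute |Re W| pi / 2 each, and that sum is the kink of
  the potential across the segment.\<close>

lemma log_arc_integral: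
  fixes \<theta> \<theta>' :: "real \<Rightarrow> real" and W :: complex
  assumes t12: "t1 < t2" and cont: "continuous_on {t1..t2} \<theta>"
    and der: "\<And>t. t \<in> {t1<..<t2} \<Longrightarrow> (\<theta> has_real_derivative \<theta>' t) (at t)"
    and pos: "\<And>t. t \<in> {t1<..<t2} \<Longrightarrow> \<theta>' t > 0"
    and nonneg: "\<And>t. \<theta>' t \<ge> 0"
    and meas: "(\<lambda>t. indicator {t1..t2} t * (\<theta>' t * ln (cmod (W - \<i> * of_real (\<theta> t))))) \<in> borel_measurable borel"
    and meas': "(\<lambda>t. indicator {t1..t2} t * \<theta>' t) \<in> borel_measurable borel"
    and y: "\<theta> t1 < Im W" "Im W < \<theta> t2"
  shows "integrable lborel (\<lambda>t. indicator {t1..t2} t * (\<theta>' t * ln (cmod (W - \<i> * of_real (\<theta> t)))))"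
    and "(\<integral>t. indicator {t1..t2} t * (\<theta>' t * ln (cmod (W - \<i> * of_real (\<theta> t)))) \<partial>lborel) =
      \<bar>Re W\<bar> * pi + Re ((of_real (\<theta> t2) + \<i> * W) * Ln (of_real (\<theta> t2) + \<i> * W)) +
      Re ((- of_real (\<theta> t1) - \<i> * W) * Ln (- of_real (\<theta> t1) - \<i> * W)) - (\<theta> t2 - \<theta> t1)"
proof -
  define x where "x = Re W"
  define y where "y = Im W"
  define f where "f t = \<theta>' t * ln (cmod (W - \<i> * of_real (\<theta> t)))" for t
  have mono: "\<theta> a < \<theta> b" if "a \<in> {t1..t2}" "b \<in> {t1..t2}" "a < b" for a b
    by (rule DERIV_pos_imp_increasing_open[OF that(3)])
      (use that der pos in \<open>force intro: continuous_on_subset[OF cont]\<close>)+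
  \<comment> \<open>Only where \<theta> t = Im W can the integrand be singular. Monotonicity of
    \<theta> leaves at most one such parameter, which the fundamental theorem may skip.\<close>
  define E where "E = {t\<in>{t1..t2}. \<theta> t = y}"
  have "finite E"
  proof (cases "E = {}")
    case False
    then obtain a where a: "a \<in> E" by blast
    have "E \<subseteq> {a}" using mono a unfolding E_def by (auto) (metis atLeastAtMost_iff less_irrefl linorder_neqE_linordered_idom)
    then show ?thesis by (rule finite_subset) simp
  qed simp
  have norm: "cmod (W - \<i> * of_real (\<theta> t)) = sqrt (x\<^sup>2 + (\<theta> t - y)\<^sup>2)" for t
    by (simp add: cmod_def x_def y_def power2_commute)
  have hi: "(f has_integral log_prim x (\<theta> t2 - y) - log_prim x (\<theta> t1 - y)) {t1..t2}"
  proof (rule fundamental_theorem_of_calculus_interior_strong[OF \<open>finite E\<close>])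
    show "t1 \<le> t2" using t12 by simp
    fix t assume t: "t \<in> {t1<..<t2} - E"
    then have k: "\<theta> t - y \<noteq> 0" by (auto simp: E_def)
    have "((\<lambda>t. log_prim x (\<theta> t - y)) has_real_derivative ln (x\<^sup>2 + (\<theta> t - y)\<^sup>2) / 2 * \<theta>' t) (at t)"
      by (rule DERIV_chain2[OF log_prim_deriv]) (use k der[of t] t in \<open>auto intro!: derivative_eq_intros\<close>)
    moreover have "ln (x\<^sup>2 + (\<theta> t - y)\<^sup>2) / 2 * \<theta>' t = f t"
      using k by (simp add: f_def norm ln_sqrt sum_power2_gt_zero_iff)
    ultimately show "((\<lambda>t. log_prim x (\<theta> t - y)) has_vector_derivative f t) (at t)"
      by (simp add: has_real_derivative_iff_has_vector_derivative)
  next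
    have "continuous_on UNIV (log_prim x)" by (intro continuous_at_imp_continuous_on) (auto simp: log_prim_isCont)
    then show "continuous_on {t1..t2} (\<lambda>t. log_prim x (\<theta> t - y))"
      by (rule continuous_on_compose2) (auto intro!: continuous_intros cont)
  qed
  have d\<theta>: "(\<theta>' has_integral \<theta> t2 - \<theta> t1) {t1..t2}"
    by (rule fundamental_theorem_of_calculus_interior)
      (use t12 cont der in \<open>auto simp: has_real_derivative_iff_has_vector_derivative\<close>)
  have "bounded ((\<lambda>t. W - \<i> * of_real (\<theta> t)) ` {t1..t2})"
    by (intro compact_imp_bounded compact_continuous_image continuous_intros cont) auto
  then obtain C where C: "C > 0" "\<And>t. t \<in> {t1..t2} \<Longrightarrow> cmod (W - \<i> * of_real (\<theta> t)) \<le> C"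
    unfolding bounded_pos by auto
  have ub: "f t \<le> \<bar>ln C\<bar> * \<theta>' t" if "t \<in> {t1..t2}" for t
  proof (cases "W - \<i> * of_real (\<theta> t) = 0")
    case True then show ?thesis using nonneg[of t] by (simp add: f_def)
  next
    case False
    then have "ln (cmod (W - \<i> * of_real (\<theta> t))) \<le> ln C" using C(2)[OF that] by (intro ln_mono) auto
    then have "ln (cmod (W - \<i> * of_real (\<theta> t))) \<le> \<bar>ln C\<bar>" by linarith
    then show ?thesis unfolding f_def using nonneg[of t] by (metis mult.commute mult_left_mono)
  qed
  \<comment> \<open>The logarithm is unbounded below, but a gauge integral that exists together with
    an absolutely integrable upper bound gives absolute integrability, hence a Lebesgue
    integral.\<close>
  have "(\<lambda>t. \<bar>ln C\<bar> * \<theta>' t) absolutely_integrable_on {t1..t2}"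
    using has_integral_mult_right[OF d\<theta>, of "\<bar>ln C\<bar>"] nonneg
    by (intro nonnegative_absolutely_integrable_1) (auto simp: integrable_on_def)
  then have ai: "f absolutely_integrable_on {t1..t2}"
    using hi ub by (intro absolutely_integrable_absolutely_integrable_ubound[of f _ "\<lambda>t. \<bar>ln C\<bar> * \<theta>' t"]) (auto simp: integrable_on_def)
  have "set_integrable lebesgue {t1..t2} f" "(LINT t:{t1..t2}|lebesgue. f t) = integral {t1..t2} f"
    using ai set_lebesgue_integral_eq_integral[OF ai] by auto
  then have *: "integrable lebesgue (\<lambda>t. indicator {t1..t2} t * f t)" "(\<integral>t. indicator {t1..t2} t * f t \<partial>lebesgue) = integral {t1..t2} f"
    by (simp_all add: set_integrable_def set_lebesgue_integral_def)
  have m: "(\<lambda>t. indicator {t1..t2} t * f t) \<in> borel_measurable lborel" using meas unfolding f_def by simp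
  show "integrable lborel (\<lambda>t. indicator {t1..t2} t * (\<theta>' t * ln (cmod (W - \<i> * of_real (\<theta> t)))))"
    using *(1) integrable_completion[OF m] unfolding f_def by simp
  have "(\<integral>t. indicator {t1..t2} t * f t \<partial>lborel) = log_prim x (\<theta> t2 - y) - log_prim x (\<theta> t1 - y)"
    using *(2) integral_completion[OF m] integral_unique[OF hi] by simp
  also have "\<dots> = log_prim x (\<theta> t2 - y) + log_prim (- x) (y - \<theta> t1)"
    using log_prim_minus[of x "y - \<theta> t1"] by (simp add: log_prim_minus')
  also have "\<dots> = \<bar>x\<bar> * pi + Re (Complex (\<theta> t2 - y) x * Ln (Complex (\<theta> t2 - y) x)) +
      Re (Complex (y - \<theta> t1) (- x) * Ln (Complex (y - \<theta> t1) (- x))) - (\<theta> t2 - \<theta> t1)"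
    using assms(8,9) by (subst (1 2) log_prim_Ln) (auto simp: y_def)
  also have "Complex (\<theta> t2 - y) x = of_real (\<theta> t2) + \<i> * W" by (simp add: complex_eq_iff x_def y_def)
  also have "Complex (y - \<theta> t1) (- x) = - of_real (\<theta> t1) - \<i> * W" by (simp add: complex_eq_iff x_def y_def)
  finally show "(\<integral>t. indicator {t1..t2} t * (\<theta>' t * ln (cmod (W - \<i> * of_real (\<theta> t)))) \<partial>lborel) =
      \<bar>Re W\<bar> * pi + Re ((of_real (\<theta> t2) + \<i> * W) * Ln (of_real (\<theta> t2) + \<i> * W)) +
      Re ((- of_real (\<theta> t1) - \<i> * W) * Ln (- of_real (\<theta> t1) - \<i> * W)) - (\<theta> t2 - \<theta> t1)"
    unfolding f_def x_def .
qed

section \<open>The trajectory, its measure and balanced values along it\<close>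

text \<open>The path is required to be continuous on the whole line so that it is Borel measurable;
  for a path given on [0, 1] this is achieved by extending it constantly.\<close>

locale trajectory_arc = two_sheets +
  fixes \<Gamma> :: "real \<Rightarrow> complex"
  assumes Gamma_cont: "continuous_on UNIV \<Gamma>"
    and Gamma_inj: "inj_on \<Gamma> {0..1}"
    and Gamma_C1: "\<Gamma> C1_differentiable_on {0<..<1}"
    and Gamma_traj: "t \<in> {0<..<1} \<Longrightarrow> qd (\<Gamma> t) * (vector_derivative \<Gamma> (at t))\<^sup>2 \<in> \<real> \<and>
      Re (qd (\<Gamma> t) * (vector_derivative \<Gamma> (at t))\<^sup>2) < 0"
    and Gamma_ends: "(\<Gamma> 0 + 2)\<^sup>2 + of_real (12 * w) = 0" "(\<Gamma> 1 + 2)\<^sup>2 + of_real (12 * w) = 0"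
    and mass_one: "(\<integral>\<^sup>+t. ennreal (indicator {0<..<1} t *
      (sqrt (- Re (qd (\<Gamma> t) * (vector_derivative \<Gamma> (at t))\<^sup>2)) / pi)) \<partial>lborel) = 1"
begin

abbreviation vel :: "real \<Rightarrow> complex" where
  "vel t \<equiv> vector_derivative \<Gamma> (at t)"

definition dens :: "real \<Rightarrow> real" where
  "dens t = indicator {0<..<1} t * (sqrt (- Re (qd (\<Gamma> t) * (vel t)\<^sup>2)) / pi)"

text \<open>The measure is kept on the parameter line, where integrals are one-dimensional; up to
  the change of scale its image under \<Gamma> is the given measure.\<close>

definition Mt :: "real measure" where
  "Mt = density lborel (\<lambda>t. ennreal (dens t))"

definition U :: "complex \<Rightarrow> real" where
  "U z = (\<integral>t. ln (cmod (z - \<Gamma> t)) \<partial>Mt)"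

definition Sig :: "complex set" where
  "Sig = \<Gamma> ` {0..1}"

lemma Gamma_interior:
  assumes "t \<in> {0<..<1}"
  shows "\<not> pole (\<Gamma> t)" "(\<Gamma> t + 2)\<^sup>2 + of_real (12 * w) \<noteq> 0"
proof -
  have "qd (\<Gamma> t) \<noteq> 0" using Gamma_traj[OF assms] by auto
  then show "\<not> pole (\<Gamma> t)" "(\<Gamma> t + 2)\<^sup>2 + of_real (12 * w) \<noteq> 0"
    by (auto simp: qd_def pole_def)
qed

lemma Gamma_deriv: "t \<in> {0<..<1} \<Longrightarrow> (\<Gamma> has_vector_derivative vel t) (at t)"
  using Gamma_C1 unfolding C1_differentiable_on_eq by (auto simp: vector_derivative_works)

lemma vel_cont: "continuous_on {0<..<1} vel"
  using Gamma_C1 unfolding C1_differentiable_on_eq by auto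

lemma Gamma_isCont: "isCont \<Gamma> t"
  using Gamma_cont by (simp add: continuous_on_eq_continuous_at)

text \<open>The number R * vel squares to a negative real, so it is purely imaginary, and its
  modulus is pi times the density. Only its sign depends on the choice of the root.\<close>

lemma speed:
  assumes "t \<in> {0<..<1}" "root (\<Gamma> t) s"
  shows "Re (R (\<Gamma> t) s * vel t) = 0" "\<bar>Im (R (\<Gamma> t) s * vel t)\<bar> = pi * dens t" "dens t > 0"
proof -
  define k where "k = R (\<Gamma> t) s * vel t"
  have k2: "k\<^sup>2 = qd (\<Gamma> t) * (vel t)\<^sup>2" using R_square[OF assms(2)] by (simp add: k_def power_mult_distrib)
  have r: "k\<^sup>2 \<in> \<real>" "Re (k\<^sup>2) < 0" using Gamma_traj[OF assms(1)] by (auto simp: k2)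
  have "Re k = 0 \<or> Im k = 0" using r(1) by (auto simp: complex_is_Real_iff power2_eq_square)
  moreover have "(Re k)\<^sup>2 < (Im k)\<^sup>2" using r(2) by (simp add: power2_eq_square)
  ultimately show re: "Re (R (\<Gamma> t) s * vel t) = 0" unfolding k_def[symmetric] by auto
  then have "- Re (k\<^sup>2) = (Im k)\<^sup>2" by (simp add: k_def power2_eq_square)
  then show "\<bar>Im (R (\<Gamma> t) s * vel t)\<bar> = pi * dens t"
    using assms(1) unfolding k_def[symmetric] by (simp add: dens_def flip: k2)
  show "dens t > 0" using assms(1) r by (simp add: dens_def flip: k2)
qed

lemma dens_nonneg: "dens t \<ge> 0"
proof (cases "t \<in> {0<..<1}")
  case True
  then show ?thesis using speed(3)[OF True neg_root(1)] by simp
qed (auto simp: dens_def)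

lemma dens_measurable [measurable]: "dens \<in> borel_measurable borel"
proof -
  have "continuous_on {0<..<1} (\<lambda>t. sqrt (- Re (qd (\<Gamma> t) * (vel t)\<^sup>2)) / pi)"
    unfolding qd_def using Gamma_interior(1)
    by (intro continuous_intros vel_cont continuous_on_subset[OF Gamma_cont]) (auto simp: pole_def add_eq_0_iff2)
  from borel_measurable_continuous_on_indicator[OF _ this] show ?thesis
    unfolding dens_def[abs_def] by simp
qed

lemma Gamma_measurable [measurable]: "\<Gamma> \<in> borel_measurable borel"
  by (rule borel_measurable_continuous_onI[OF Gamma_cont])

lemma sets_Mt [simp, measurable_cong]: "sets Mt = sets borel" and space_Mt [simp]: "space Mt = UNIV"
  by (simp_all add: Mt_def)

lemma prob_Mt: "prob_space Mt"
proof
  have "(\<integral>\<^sup>+t. ennreal (dens t) \<partial>lborel) = 1" using mass_one unfolding dens_def .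
  then show "emeasure Mt (space Mt) = 1" by (simp add: Mt_def emeasure_density)
qed

sublocale prob_space Mt by (rule prob_Mt)

lemma integral_Mt:
  fixes f :: "real \<Rightarrow> real"
  assumes "f \<in> borel_measurable borel"
  shows "integrable Mt f \<longleftrightarrow> integrable lborel (\<lambda>t. dens t * f t)" "(\<integral>t. f t \<partial>Mt) = (\<integral>t. dens t * f t \<partial>lborel)"
  using assms dens_nonneg unfolding Mt_def
  by (auto simp: integrable_density integral_density)

lemma AE_Mt: "AE t in Mt. t \<in> {0<..<1} \<and> t \<noteq> a"
proof -
  have "AE t in lborel. t \<noteq> a" by (rule AE_lborel_singleton)
  then have "AE t in lborel. 0 < ennreal (dens t) \<longrightarrow> t \<in> {0<..<1} \<and> t \<noteq> a"
    by (rule AE_mp, intro AE_I2) (auto simp: dens_def split: split_indicator_asm)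
  moreover have "(\<lambda>t. ennreal (dens t)) \<in> borel_measurable lborel" by simp
  ultimately show ?thesis unfolding Mt_def by (simp only: AE_density)
qed

text \<open>Along the trajectory the derivative of \<psi> is purely imaginary, so the difference of
  \<open>L\<close> at the two roots is locally constant up to sign; it tends to 0 at the end point,
  where the roots merge.\<close>

lemma balanced:
  assumes t: "t \<in> {0<..<1}" and s: "root (\<Gamma> t) s"
  shows "L s = L (conj_root s)" "cmod (num s) = cmod (den s)"
proof -
  \<comment> \<open>The absolute value makes this independent of the root that
    \<open>neg_root\<close> picks, which need not vary continuously.\<close>
  define K where "K t = \<bar>L (neg_root (\<Gamma> t)) - L (conj_root (neg_root (\<Gamma> t)))\<bar>" for t
  have Kroot: "K t = \<bar>L s - L (conj_root s)\<bar>" if "root (\<Gamma> t) s" for t s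
    using root_cases[OF neg_root(1) that] by (auto simp: K_def)
  have loc: "\<exists>e>0. \<forall>t'\<in>ball t e. K t' = K t" if t: "t \<in> {0<..<1}" for t
  proof -
    have ne: "conj_root (neg_root (\<Gamma> t)) \<noteq> neg_root (\<Gamma> t)"
      using conj_root_eq_iff[OF neg_root(1)] Gamma_interior(2)[OF t] by blast
    obtain r T \<psi> where b: "r > 0" "T holomorphic_on ball (\<Gamma> t) r" "\<psi> holomorphic_on ball (\<Gamma> t) r"
      "\<And>z. z \<in> ball (\<Gamma> t) r \<Longrightarrow> root z (T z) \<and> conj_root (T z) \<noteq> T z \<and> \<not> pole z"
      "\<And>z. z \<in> ball (\<Gamma> t) r \<Longrightarrow> exp (2 * \<psi> z) = num (T z) / den (T z)"
      "\<And>z. z \<in> ball (\<Gamma> t) r \<Longrightarrow> (\<psi> has_field_derivative R z (T z)) (at z)"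
      using branch_log[OF neg_root(1) ne Gamma_interior(1)[OF t]] by metis
    obtain e1 where e1: "e1 > 0" "\<And>t'. dist t' t < e1 \<Longrightarrow> \<Gamma> t' \<in> ball (\<Gamma> t) r"
      using Gamma_isCont[of t] b(1) unfolding continuous_at_eps_delta by (auto simp: dist_commute)
    define e where "e = min e1 (min t (1 - t))"
    have e: "e > 0" using e1 t by (simp add: e_def)
    have in01: "t' \<in> {0<..<1}" "\<Gamma> t' \<in> ball (\<Gamma> t) r" if "t' \<in> ball t e" for t'
      using that e1(2)[of t'] by (auto simp: e_def dist_real_def)
    have KRe: "K t' = \<bar>2 * Re (\<psi> (\<Gamma> t'))\<bar>" if "t' \<in> ball t e" for t'
    proof -
      note g = in01[OF that]
      have "cmod (num (T (\<Gamma> t'))) / cmod (den (T (\<Gamma> t'))) = exp (2 * Re (\<psi> (\<Gamma> t')))"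
        using b(5)[OF g(2)] by (metis norm_divide norm_exp_eq_Re Re_complex_of_real mult_2 plus_complex.sel(1))
      then have "L (T (\<Gamma> t')) - L (conj_root (T (\<Gamma> t'))) = 2 * Re (\<psi> (\<Gamma> t'))"
        using L_diff[of "\<Gamma> t'" "T (\<Gamma> t')"] b(4)[OF g(2)] by simp
      then show ?thesis using Kroot[of t' "T (\<Gamma> t')"] b(4)[OF g(2)] by simp
    qed
    have "Re (\<psi> (\<Gamma> t')) = Re (\<psi> (\<Gamma> t))" if "t' \<in> ball t e" for t'
    proof -
      have "((\<lambda>t. Re (\<psi> (\<Gamma> t))) has_real_derivative 0) (at x)" if x: "x \<in> ball t e" for x
      proof -
        note g = in01[OF x]
        have "((\<psi> \<circ> \<Gamma>) has_vector_derivative (vel x * R (\<Gamma> x) (T (\<Gamma> x)))) (at x)"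
          by (rule field_vector_diff_chain_at[OF Gamma_deriv[OF g(1)] b(6)[OF g(2)]])
        then have "((\<lambda>t. Re (\<psi> (\<Gamma> t))) has_vector_derivative Re (vel x * R (\<Gamma> x) (T (\<Gamma> x)))) (at x)"
          unfolding o_def by (rule bounded_linear.has_vector_derivative[OF bounded_linear_Re])
        moreover have "Re (vel x * R (\<Gamma> x) (T (\<Gamma> x))) = 0"
          using speed(1)[OF g(1)] b(4)[OF g(2)] by (metis mult.commute)
        ultimately show ?thesis by (simp add: has_real_derivative_iff_has_vector_derivative)
      qed
      then have "\<exists>c. \<forall>x\<in>ball t e. Re (\<psi> (\<Gamma> x)) = c"
        by (intro has_field_derivative_zero_constant[of "ball t e"]) (auto intro: has_field_derivative_at_within)
      then show ?thesis using that e by (metis centre_in_ball)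
    qed
    then have "K t' = K t" if "t' \<in> ball t e" for t'
      using KRe[OF that] KRe[of t] e that by (metis centre_in_ball)
    then show ?thesis using e by blast
  qed
  have const: "K constant_on {0<..<1}"
  proof (rule locally_constant_imp_constant)
    show "connected {0<..<1::real}" by simp
    show "\<exists>T. openin (top_of_set {0<..<1}) T \<and> a \<in> T \<and> (\<forall>x\<in>T. K x = K a)" if a: "a \<in> {0<..<1}" for a
    proof -
      obtain e where e: "e > 0" "\<forall>t'\<in>ball a e. K t' = K a" using loc[OF a] by blast
      show ?thesis
      proof (intro exI conjI)
        show "openin (top_of_set {0<..<1}) ({0<..<1} \<inter> ball a e)" by (intro openin_open_Int open_ball)
        show "a \<in> {0<..<1} \<inter> ball a e" using a e(1) by simp
        show "\<forall>x\<in>{0<..<1} \<inter> ball a e. K x = K a" using e(2) by blast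
      qed
    qed
  qed
  have "K t = 0"
  proof (rule ccontr)
    assume K0: "K t \<noteq> 0"
    then have Kt: "K t > 0" by (simp add: K_def)
    define t0 where "t0 = neg_root (\<Gamma> 0)"
    have r0: "root (\<Gamma> 0) t0" "conj_root t0 = t0"
      using neg_root(1) conj_root_eq_iff[OF neg_root(1)] Gamma_ends(1) by (auto simp: t0_def)
    obtain \<delta> where d: "\<delta> > 0" "\<And>z s. cmod (z - \<Gamma> 0) < \<delta> \<Longrightarrow> root z s \<Longrightarrow> \<bar>L s - L t0\<bar> < K t / 2"
      using L_near_double_root[OF r0, of "K t / 2"] Kt by auto
    obtain e where e: "e > 0" "\<And>x. dist x 0 < e \<Longrightarrow> cmod (\<Gamma> x - \<Gamma> 0) < \<delta>"
      using Gamma_isCont[of 0] d(1) unfolding continuous_at_eps_delta by (auto simp: dist_norm)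
    define x where "x = min (e / 2) (1 / 2)"
    have x: "x \<in> {0<..<1}" "dist x 0 < e" using e(1) by (auto simp: x_def)
    note n = neg_root(1)[of "\<Gamma> x"]
    have "K x < K t" using d(2)[OF e(2)[OF x(2)] n] d(2)[OF e(2)[OF x(2)] root_conj_root[OF n]]
      unfolding K_def[of x] by linarith
    then show False using const x t unfolding constant_on_def by (metis less_irrefl)
  qed
  then show l: "L s = L (conj_root s)" using Kroot[OF s] by simp
  note nd = not_pole_num_den[OF s Gamma_interior(1)[OF t]]
  have "ln (cmod (num s) / cmod (den s)) = 0" using L_diff[OF s Gamma_interior(1)[OF t]] l by simp
  then show "cmod (num s) = cmod (den s)" using nd by (simp add: ln_div)
qed

text \<open>For a remote piece of the arc, ln |z - \<Gamma> t| is the real part of Ln (1 + (z - p) /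
  (p - \<Gamma> t)) plus a constant. The quotient stays below 1/2 in modulus, so the principal
  branch is holomorphic and bounded in \<open>z\<close>.\<close>

lemma rest_potential:
  assumes A: "A \<in> sets borel" "A \<subseteq> {0<..<1}" and r: "r > 0" "\<And>t. t \<in> A \<Longrightarrow> r \<le> cmod (\<Gamma> t - p)"
  obtains F where "F holomorphic_on ball p (r / 2)"
    "\<And>z. z \<in> ball p (r / 2) \<Longrightarrow> integrable Mt (\<lambda>t. indicator A t * ln (cmod (z - \<Gamma> t))) \<and>
       (\<integral>t. indicator A t * ln (cmod (z - \<Gamma> t)) \<partial>Mt) = Re (F z)"
proof -
  have "bounded ((\<lambda>t. \<Gamma> t - p) ` {0..1})"
    by (intro compact_imp_bounded compact_continuous_image continuous_intros continuous_on_subset[OF Gamma_cont]) auto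
  then obtain C where C: "C > 0" "\<And>t. t \<in> {0..1} \<Longrightarrow> cmod (\<Gamma> t - p) \<le> C" unfolding bounded_pos by auto
  define h where "h z t = (if t \<in> A then Ln (1 + (z - p) / (p - \<Gamma> t)) + of_real (ln (cmod (p - \<Gamma> t))) else 0)" for z t
  define F where "F z = (\<integral>t. h z t \<partial>Mt)" for z
  have small: "cmod ((z - p) / (p - \<Gamma> t)) < 1 / 2" if "z \<in> ball p (r / 2)" "t \<in> A" for z t
  proof -
    have "cmod (z - p) < r / 2" using that(1) by (simp add: dist_norm norm_minus_commute)
    moreover have "r \<le> cmod (p - \<Gamma> t)" using r(2)[OF that(2)] by (simp add: norm_minus_commute)
    ultimately have "0 < cmod (p - \<Gamma> t)" "2 * cmod (z - p) < cmod (p - \<Gamma> t)" using r(1) by linarith+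
    then show ?thesis by (simp add: norm_divide pos_divide_less_eq)
  qed
  have pos: "1 + u \<notin> \<real>\<^sub>\<le>\<^sub>0" if "cmod u < 1 / 2" for u
  proof -
    have "\<bar>Re u\<bar> < 1 / 2" using that abs_Re_le_cmod[of u] by linarith
    then have "Re (1 + u) > 0" by auto
    then show ?thesis by (auto simp: complex_nonpos_Reals_iff)
  qed
  have ne: "p - \<Gamma> t \<noteq> 0" if "t \<in> A" for t using r(1) r(2)[OF that] by auto
  have hol: "(\<lambda>z. h z t) holomorphic_on ball p (r / 2)" for t
    by (cases "t \<in> A") (use small pos ne in \<open>auto simp: h_def intro!: holomorphic_intros\<close>)
  have meas: "h z \<in> borel_measurable Mt" for z
    unfolding h_def using A(1) by (measurable; auto simp: measurable_cong_sets[OF sets_Mt refl] borel_measurable_Ln)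
  have bnd: "norm (h z t) \<le> 1 + (\<bar>ln r\<bar> + \<bar>ln C\<bar>)" if "z \<in> ball p (r / 2)" for z t
  proof (cases "t \<in> A")
    case True
    have "cmod (Ln (1 + (z - p) / (p - \<Gamma> t))) \<le> 2 * cmod ((z - p) / (p - \<Gamma> t))"
      by (rule norm_Ln_le[OF small[OF that True]])
    also have "\<dots> \<le> 1" using small[OF that True] by simp
    finally have 1: "cmod (Ln (1 + (z - p) / (p - \<Gamma> t))) \<le> 1" .
    have "r \<le> cmod (p - \<Gamma> t)" "cmod (p - \<Gamma> t) \<le> C" using r(2)[OF True] C(2)[of t] A(2) True
      by (auto simp: norm_minus_commute)
    then have "ln r \<le> ln (cmod (p - \<Gamma> t))" "ln (cmod (p - \<Gamma> t)) \<le> ln C" using r(1) by (auto intro!: ln_mono)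
    then have "\<bar>ln (cmod (p - \<Gamma> t))\<bar> \<le> \<bar>ln r\<bar> + \<bar>ln C\<bar>" by linarith
    then show ?thesis using 1 True norm_triangle_ineq[of "Ln (1 + (z - p) / (p - \<Gamma> t))" "of_real (ln (cmod (p - \<Gamma> t)))"]
      by (simp add: h_def)
  qed (simp add: h_def)
  show thesis
  proof
    show "F holomorphic_on ball p (r / 2)" unfolding F_def
      by (rule holomorphic_on_lebesgue_integral[where g = "\<lambda>_. 1 + (\<bar>ln r\<bar> + \<bar>ln C\<bar>)"]) (use hol meas bnd in auto)
    fix z assume z: "z \<in> ball p (r / 2)"
    have int: "integrable Mt (h z)"
      by (rule integrable_const_bound[where B = "1 + (\<bar>ln r\<bar> + \<bar>ln C\<bar>)"]) (use meas bnd[OF z] in auto)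
    have eq: "indicator A t * ln (cmod (z - \<Gamma> t)) = Re (h z t)" for t
    proof (cases "t \<in> A")
      case True
      have "z - \<Gamma> t = (p - \<Gamma> t) * (1 + (z - p) / (p - \<Gamma> t))" using ne[OF True] by (simp add: field_simps)
      then have "cmod (z - \<Gamma> t) = cmod (p - \<Gamma> t) * cmod (1 + (z - p) / (p - \<Gamma> t))" by (metis norm_mult)
      moreover have "1 + (z - p) / (p - \<Gamma> t) \<noteq> 0" using pos[OF small[OF z True]] by auto
      ultimately show ?thesis using True ne[OF True] by (simp add: h_def ln_mult)
    qed (simp add: h_def)
    show "integrable Mt (\<lambda>t. indicator A t * ln (cmod (z - \<Gamma> t))) \<and>
       (\<integral>t. indicator A t * ln (cmod (z - \<Gamma> t)) \<partial>Mt) = Re (F z)"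
      unfolding eq F_def using int by (simp add: integral_Re)
  qed
qed

end

section \<open>The potential near an interior point of the arc\<close>

context trajectory_arc
begin

lemma R_conj_root: "t \<noteq> 0 \<Longrightarrow> R z (conj_root t) = - R z t"
  unfolding R_def conj_root_conj_root by (metis minus_diff_eq minus_divide_left mult_minus_left)

text \<open>The primitive \<psi> is a conformal coordinate that straightens the arc into the
  imaginary axis, with density d\<theta> / pi there. Write ln |z - \<Gamma> t| as ln |\<psi> z - i
  \<theta> t| minus the logarithm of a difference quotient: the first part integrates explicitly to
  |Re \<psi>| plus harmonic terms, the second is harmonic in \<open>z\<close>.\<close>

lemma local_structure:
  assumes t0: "t0 \<in> {0<..<1}"
  obtains B \<psi> T F where "open B" "\<Gamma> t0 \<in> B" "\<psi> holomorphic_on B" "T holomorphic_on B" "F holomorphic_on B"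
    "\<And>z. z \<in> B \<Longrightarrow> root z (T z) \<and> conj_root (T z) \<noteq> T z \<and> \<not> pole z"
    "\<And>z. z \<in> B \<Longrightarrow> L (T z) - L (conj_root (T z)) = 2 * Re (\<psi> z)"
    "\<And>z. z \<in> B \<Longrightarrow> z \<in> Sig \<longleftrightarrow> Re (\<psi> z) = 0"
    "connected {z\<in>B. Re (\<psi> z) > 0}" "connected {z\<in>B. Re (\<psi> z) < 0}"
    "\<And>z. z \<in> B \<Longrightarrow> Re (\<psi> z) = 0 \<Longrightarrow> z \<in> closure {z\<in>B. Re (\<psi> z) > 0} \<and> z \<in> closure {z\<in>B. Re (\<psi> z) < 0}"
    "\<And>z. z \<in> B \<Longrightarrow> integrable Mt (\<lambda>t. ln (cmod (z - \<Gamma> t))) \<and> U z = \<bar>Re (\<psi> z)\<bar> + Re (F z)"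
proof -
  define p where "p = \<Gamma> t0"
  have np: "\<not> pole p" "(p + 2)\<^sup>2 + of_real (12 * w) \<noteq> 0" using Gamma_interior[OF t0] by (auto simp: p_def)
  \<comment> \<open>The root is chosen with the sign for which \<theta> will increase along the arc;
    the other root reverses the sign of \<open>R\<close>.\<close>
  obtain s0 where s0: "root p s0" "Im (R p s0 * vel t0) > 0"
  proof -
    define n where "n = neg_root p"
    have n: "root p n" by (simp add: n_def neg_root)
    have "\<bar>Im (R p n * vel t0)\<bar> > 0" using speed(2,3)[OF t0, of n] n by (simp add: p_def)
    moreover have "Im (R p (conj_root n) * vel t0) = - Im (R p n * vel t0)"
      using R_conj_root[OF root_nz[OF n]] by simp
    ultimately show thesis using that[OF n] that[OF root_conj_root[OF n]] by linarith
  qed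
  have ne: "conj_root s0 \<noteq> s0" using conj_root_eq_iff[OF s0(1)] np by blast
  obtain r1 T \<psi> where b: "r1 > 0" "T holomorphic_on ball p r1" "T p = s0" "\<psi> holomorphic_on ball p r1"
      "\<And>z. z \<in> ball p r1 \<Longrightarrow> root z (T z) \<and> conj_root (T z) \<noteq> T z \<and> \<not> pole z"
      "\<And>z. z \<in> ball p r1 \<Longrightarrow> exp (2 * \<psi> z) = num (T z) / den (T z)"
      "\<And>z. z \<in> ball p r1 \<Longrightarrow> (\<psi> has_field_derivative R z (T z)) (at z)"
    using branch_log[OF s0(1) ne np(1)] by metis
  have LT: "L (T z) - L (conj_root (T z)) = 2 * Re (\<psi> z)" if "z \<in> ball p r1" for z
  proof -
    have "cmod (num (T z)) / cmod (den (T z)) = exp (2 * Re (\<psi> z))"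
      using b(6)[OF that] by (metis norm_divide norm_exp_eq_Re Re_complex_of_real mult_2 plus_complex.sel(1))
    then show ?thesis using L_diff[of z "T z"] b(5)[OF that] by simp
  qed
  define c where "c = R p s0"
  have c0: "c \<noteq> 0" using s0(2) by (auto simp: c_def)
  have derR: "deriv \<psi> z = R z (T z)" if "z \<in> ball p r1" for z
    using b(7)[OF that] by (rule DERIV_imp_deriv)
  have "continuous_on (ball p r1) (deriv \<psi>)"
    by (intro holomorphic_on_imp_continuous_on holomorphic_deriv b(4)) auto
  then have "isCont (deriv \<psi>) p" using b(1) by (simp add: continuous_on_eq_continuous_at)
  \<comment> \<open>With deviation at most |c| / 5 the map \<psi> is injective with lower Lipschitz
    constant 4 |c| / 5, and the normalised difference quotients stay within 1/5 of 1, well inside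
    the domain of the principal logarithm.\<close>
  then obtain r2 where r2: "r2 > 0" "\<And>z. dist z p < r2 \<Longrightarrow> dist (deriv \<psi> z) (deriv \<psi> p) < cmod c / 5"
    using c0 unfolding continuous_at_eps_delta by (metis divide_pos_pos zero_less_norm_iff zero_less_numeral)
  define \<rho> where "\<rho> = min r1 r2"
  have \<rho>: "\<rho> > 0" "ball p \<rho> \<subseteq> ball p r1" using b(1) r2(1) by (auto simp: \<rho>_def)
  have dc: "cmod (deriv \<psi> z - c) \<le> cmod c / 5" if "z \<in> ball p \<rho>" for z
    using r2(2)[of z] that derR[of p] b(1,3) by (auto simp: \<rho>_def c_def dist_norm norm_minus_commute)
  have \<psi>h: "\<psi> holomorphic_on ball p \<rho>" by (rule holomorphic_on_subset[OF b(4) \<rho>(2)])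
  have lin: "cmod (\<psi> z - \<psi> s - c * (z - s)) \<le> cmod c / 5 * cmod (z - s)" if "z \<in> ball p \<rho>" "s \<in> ball p \<rho>" for z s
  proof -
    have "cmod ((\<psi> z - c * z) - (\<psi> s - c * s)) \<le> cmod c / 5 * cmod (z - s)"
    proof (rule field_differentiable_bound[of "ball p \<rho>" "\<lambda>z. \<psi> z - c * z" "\<lambda>z. deriv \<psi> z - c"])
      fix x assume x: "x \<in> ball p \<rho>"
      have "(\<psi> has_field_derivative deriv \<psi> x) (at x)" using holomorphic_derivI[OF \<psi>h open_ball x] .
      then show "((\<lambda>z. \<psi> z - c * z) has_field_derivative deriv \<psi> x - c) (at x within ball p \<rho>)"
        by (rule has_field_derivative_at_within[OF DERIV_diff[OF _ DERIV_cmult_Id]])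
    qed (use that dc in auto)
    then show ?thesis by (simp add: algebra_simps)
  qed
  have low: "4 / 5 * cmod c * cmod (z - s) \<le> cmod (\<psi> z - \<psi> s)" if "z \<in> ball p \<rho>" "s \<in> ball p \<rho>" for z s
  proof -
    have "cmod (c * (z - s)) \<le> cmod (\<psi> z - \<psi> s) + cmod (\<psi> z - \<psi> s - c * (z - s))"
      using norm_triangle_ineq4[of "\<psi> z - \<psi> s" "\<psi> z - \<psi> s - c * (z - s)"] by simp
    then show ?thesis using lin[OF that] by (simp add: norm_mult)
  qed
  have inj: "inj_on \<psi> (ball p \<rho>)"
  proof (rule inj_onI)
    fix x y assume xy: "x \<in> ball p \<rho>" "y \<in> ball p \<rho>" "\<psi> x = \<psi> y"
    then have "cmod c * cmod (x - y) \<le> 0" using low[of x y] by simp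
    then show "x = y" using c0 by (simp add: mult_le_0_iff)
  qed
  obtain e1 where e1: "e1 > 0" "\<And>t. dist t t0 < e1 \<Longrightarrow> \<Gamma> t \<in> ball p \<rho>"
    using Gamma_isCont[of t0] \<rho>(1) unfolding continuous_at_eps_delta by (auto simp: dist_commute p_def)
  define e where "e = min e1 (min t0 (1 - t0)) / 2"
  have e: "e > 0" using e1 t0 by (auto simp: e_def)
  define t1 t2 where "t1 = t0 - e" and "t2 = t0 + e"
  have t12: "t1 < t0" "t0 < t2" "0 < t1" "t2 < 1" 
  proof -
    have "e \<le> t0 / 2" "e \<le> (1 - t0) / 2" by (simp_all add: e_def)
    then show "t1 < t0" "t0 < t2" "0 < t1" "t2 < 1" using e t0 by (auto simp: t1_def t2_def)
  qed
  have inB: "\<Gamma> t \<in> ball p \<rho>" if "t \<in> {t1..t2}" for t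
  proof (rule e1(2))
    have "e \<le> e1 / 2" by (simp add: e_def)
    moreover have "\<bar>t - t0\<bar> \<le> e" using that by (auto simp: t1_def t2_def)
    ultimately show "dist t t0 < e1" using e1(1) by (simp add: dist_real_def)
  qed
  have in01: "t \<in> {0<..<1}" if "t \<in> {t1..t2}" for t using that t12 by auto
  have Re0: "Re (\<psi> (\<Gamma> t)) = 0" if "t \<in> {t1..t2}" for t
  proof -
    have "\<Gamma> t \<in> ball p r1" using inB[OF that] \<rho>(2) by blast
    then show ?thesis using LT[of "\<Gamma> t"] balanced(1)[OF in01[OF that], of "T (\<Gamma> t)"] b(5) by simp
  qed
  define k where "k t = Im (deriv \<psi> (\<Gamma> t) * vel t)" for t
  have kabs: "\<bar>k t\<bar> = pi * dens t" "dens t > 0" if "t \<in> {t1..t2}" for t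
  proof -
    have B: "\<Gamma> t \<in> ball p r1" using inB[OF that] \<rho>(2) by blast
    then show "\<bar>k t\<bar> = pi * dens t" "dens t > 0" unfolding k_def derR[OF B]
      using speed(2,3)[OF in01[OF that], of "T (\<Gamma> t)"] b(5) by auto
  qed
  have kcont: "continuous_on {t1..t2} k"
  proof -
    have "continuous_on {t1..t2} (\<lambda>t. deriv \<psi> (\<Gamma> t))"
      by (rule continuous_on_compose2[of "ball p \<rho>"])
        (use inB in \<open>auto intro!: holomorphic_on_imp_continuous_on holomorphic_deriv \<psi>h continuous_on_subset[OF Gamma_cont]\<close>)
    moreover have "continuous_on {t1..t2} vel" by (rule continuous_on_subset[OF vel_cont]) (use in01 in auto)
    ultimately show ?thesis unfolding k_def by (intro continuous_intros)
  qed
  have kpos: "k t = pi * dens t" if t: "t \<in> {t1..t2}" for t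
  proof -
    have k0: "k t0 > 0" using s0(2) derR[of p] b(1,3) by (simp add: k_def p_def)
    have "k t > 0"
    proof (rule ccontr)
      assume "\<not> k t > 0"
      moreover have nz: "k x \<noteq> 0" if "x \<in> {t1..t2}" for x using kabs[OF that] by auto
      ultimately have neg: "k t < 0" using t by force
      have "connected (k ` {t1..t2})" by (rule connected_continuous_image[OF kcont]) simp
      then have "0 \<in> k ` {t1..t2}"
        using connectedD_interval[of "k ` {t1..t2}" "k t" "k t0" 0] neg k0 t t12 by auto
      then show False using nz by auto
    qed
    then show ?thesis using kabs[OF t] by simp
  qed
  \<comment> \<open>Clamping the parameter to [t1, t2] makes \<theta> continuous on the whole line,
    hence measurable, without changing it on the piece under study.\<close>
  define \<theta> where "\<theta> t = Im (\<psi> (\<Gamma> (max t1 (min t2 t))))" for t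
  have \<theta>eq: "\<psi> (\<Gamma> t) = \<i> * of_real (\<theta> t)" if "t \<in> {t1..t2}" for t
  proof -
    have "max t1 (min t2 t) = t" using that by auto
    then show ?thesis using Re0[OF that] by (simp add: \<theta>_def complex_eq_iff)
  qed
  have \<theta>cont: "continuous_on UNIV \<theta>"
  proof -
    have "continuous_on UNIV (\<lambda>t. \<Gamma> (max t1 (min t2 t)))"
      by (rule continuous_on_compose2[OF Gamma_cont]) (auto intro!: continuous_intros)
    then have "continuous_on UNIV (\<lambda>t. \<psi> (\<Gamma> (max t1 (min t2 t))))"
      by (rule continuous_on_compose2[OF holomorphic_on_imp_continuous_on[OF \<psi>h]]) (use t12 in \<open>auto intro!: inB simp del: mem_ball\<close>)
    then show ?thesis unfolding \<theta>_def by (intro continuous_intros)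
  qed
  have \<theta>der: "(\<theta> has_real_derivative pi * dens t) (at t)" if t: "t \<in> {t1<..<t2}" for t
  proof -
    have t': "t \<in> {t1..t2}" using t by auto
    have "(\<psi> has_field_derivative deriv \<psi> (\<Gamma> t)) (at (\<Gamma> t))"
      using holomorphic_derivI[OF \<psi>h open_ball inB[OF t']] .
    from field_vector_diff_chain_at[OF Gamma_deriv[OF in01[OF t']] this]
    have "((\<lambda>t. Im (\<psi> (\<Gamma> t))) has_vector_derivative Im (vel t * deriv \<psi> (\<Gamma> t))) (at t)"
      unfolding o_def by (rule bounded_linear.has_vector_derivative[OF bounded_linear_Im])
    then have "((\<lambda>t. Im (\<psi> (\<Gamma> t))) has_real_derivative pi * dens t) (at t)"
      using kpos[OF t'] by (simp add: has_real_derivative_iff_has_vector_derivative k_def mult.commute)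
    then show ?thesis
      by (rule has_field_derivative_transform_within_open[of _ _ _ "{t1<..<t2}"]) (use t in \<open>auto simp: \<theta>_def\<close>)
  qed
  have \<theta>mono: "\<theta> x < \<theta> y" if "x \<in> {t1..t2}" "y \<in> {t1..t2}" "x < y" for x y
  proof (rule DERIV_pos_imp_increasing_open[OF that(3)])
    show "continuous_on {x..y} \<theta>" by (rule continuous_on_subset[OF \<theta>cont]) auto
    fix u assume "x < u" "u < y"
    then have u: "u \<in> {t1<..<t2}" "u \<in> {t1..t2}" using that by auto
    show "\<exists>y. (\<theta> has_real_derivative y) (at u) \<and> 0 < y"
      using \<theta>der[OF u(1)] kabs(2)[OF u(2)] by (intro exI[of _ "pi * dens u"]) auto
  qed
  have "compact (\<Gamma> ` ({0..t1} \<union> {t2..1}))"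
    by (intro compact_continuous_image continuous_on_subset[OF Gamma_cont] compact_Un) auto
  moreover have "p \<notin> \<Gamma> ` ({0..t1} \<union> {t2..1})"
  proof
    assume "p \<in> \<Gamma> ` ({0..t1} \<union> {t2..1})"
    then obtain t where "t \<in> {0..t1} \<union> {t2..1}" "\<Gamma> t0 = \<Gamma> t" unfolding p_def by blast
    then show False using inj_onD[OF Gamma_inj, of t0 t] t12 t0 by auto
  qed
  ultimately obtain d where d: "d > 0" "\<And>t. t \<in> {0..t1} \<union> {t2..1} \<Longrightarrow> d \<le> dist p (\<Gamma> t)"
    using separate_point_closed[of "\<Gamma> ` ({0..t1} \<union> {t2..1})" p] compact_imp_closed by blast
  have "open (\<psi> ` ball p \<rho>)" by (rule open_mapping_thm3[OF \<psi>h open_ball inj])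
  then obtain \<delta>0 where \<delta>0: "\<delta>0 > 0" "ball (\<psi> p) \<delta>0 \<subseteq> \<psi> ` ball p \<rho>"
    using \<rho>(1) by (meson centre_in_ball imageI openE)
  \<comment> \<open>The first bound keeps the disc inside the image of \<psi>, the next two keep Im
    \<psi> strictly between the end values of \<theta>, and the last keeps \<open>B\<close> within
    d/2 of \<open>p\<close>, clear of the rest of the arc.\<close>
  define \<delta> where "\<delta> = Min {\<delta>0, \<theta> t2 - \<theta> t0, \<theta> t0 - \<theta> t1, cmod c * d / 4}"
  have "\<delta> > 0" using \<delta>0(1) \<theta>mono[of t0 t2] \<theta>mono[of t1 t0] t12 c0 d(1) by (auto simp: \<delta>_def)
  moreover have "\<delta> \<le> \<delta>0" "\<delta> \<le> \<theta> t2 - \<theta> t0" "\<delta> \<le> \<theta> t0 - \<theta> t1" "\<delta> \<le> cmod c * d / 4"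
    unfolding \<delta>_def by (rule Min_le; simp)+
  ultimately have \<delta>: "\<delta> > 0" "\<delta> \<le> \<delta>0" "\<delta> \<le> \<theta> t2 - \<theta> t0" "\<delta> \<le> \<theta> t0 - \<theta> t1" "\<delta> \<le> cmod c * d / 4"
    by blast+
  \<comment> \<open>Taking the preimage of a disc makes the two sides of the arc preimages of
    half-discs, hence connected.\<close>
  define B where "B = {z \<in> ball p \<rho>. \<psi> z \<in> ball (\<psi> p) \<delta>}"
  have B\<rho>: "z \<in> ball p \<rho>" "z \<in> ball p r1" if "z \<in> B" for z using that \<rho>(2) unfolding B_def by blast+
  have opB: "open B"
  proof -
    have eq: "B = ball p \<rho> \<inter> \<psi> -` ball (\<psi> p) \<delta>" by (auto simp: B_def)
    show ?thesis unfolding eq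
      by (rule continuous_open_preimage[OF holomorphic_on_imp_continuous_on[OF \<psi>h]]) auto
  qed
  have pB: "p \<in> B" using \<rho>(1) \<delta>(1) by (simp add: B_def)
  have Bd: "cmod (z - p) < d / 2" if "z \<in> B" for z
  proof -
    have "4 / 5 * cmod c * cmod (z - p) \<le> cmod (\<psi> z - \<psi> p)" using low[OF B\<rho>(1)[OF that]] \<rho>(1) by simp
    also have "\<dots> < cmod c * d / 4" using that \<delta>(5) by (simp add: B_def dist_norm norm_minus_commute)
    finally have "cmod c * (4 / 5 * cmod (z - p)) < cmod c * (d / 4)" by simp
    then have "4 / 5 * cmod (z - p) < d / 4" using c0 by (subst (asm) mult_less_cancel_left_pos) auto
    then show ?thesis using d(1) by simp
  qed
  have t0in: "t0 \<in> {t1..t2}" using t12 by simp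
  have \<psi>p: "Re (\<psi> p) = 0" "Im (\<psi> p) = \<theta> t0" using \<theta>eq[OF t0in] by (simp_all add: p_def)
  have Im\<psi>: "\<theta> t1 < Im (\<psi> z)" "Im (\<psi> z) < \<theta> t2" if "z \<in> B" for z
  proof -
    have "\<bar>Im (\<psi> z - \<psi> p)\<bar> < \<delta>"
      using that abs_Im_le_cmod[of "\<psi> z - \<psi> p"] by (simp add: B_def dist_norm norm_minus_commute)
    then show "\<theta> t1 < Im (\<psi> z)" "Im (\<psi> z) < \<theta> t2" using \<delta>(3,4) \<psi>p by auto
  qed
  have SigB: "z \<in> Sig \<longleftrightarrow> Re (\<psi> z) = 0" if z: "z \<in> B" for z
  proof
    assume "z \<in> Sig"
    then obtain t where t: "t \<in> {0..1}" "z = \<Gamma> t" by (auto simp: Sig_def)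
    have "t \<in> {t1..t2}"
    proof (rule ccontr)
      assume "t \<notin> {t1..t2}"
      then have "d \<le> dist p z" using d(2)[of t] t by auto
      then show False using Bd[OF z] d(1) by (simp add: dist_norm norm_minus_commute)
    qed
    then show "Re (\<psi> z) = 0" using Re0 t by simp
  next
    assume a: "Re (\<psi> z) = 0"
    have "connected (\<theta> ` {t1..t2})"
      by (intro connected_continuous_image continuous_on_subset[OF \<theta>cont]) auto
    then have "Im (\<psi> z) \<in> \<theta> ` {t1..t2}"
      using connectedD_interval[of "\<theta> ` {t1..t2}" "\<theta> t1" "\<theta> t2" "Im (\<psi> z)"] Im\<psi>[OF z] t12 by auto
    then obtain t where t: "t \<in> {t1..t2}" "Im (\<psi> z) = \<theta> t" by auto
    then have "\<psi> z = \<psi> (\<Gamma> t)" using \<theta>eq[OF t(1)] a by (simp add: complex_eq_iff)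
    then have "z = \<Gamma> t" using inj_onD[OF inj] B\<rho>(1)[OF z] inB[OF t(1)] by blast
    then show "z \<in> Sig" using in01[OF t(1)] by (auto simp: Sig_def)
  qed
  define \<phi> where "\<phi> = the_inv_into (ball p \<rho>) \<psi>"
  have \<phi>: "\<phi> v \<in> B" "\<psi> (\<phi> v) = v" if "v \<in> ball (\<psi> p) \<delta>" for v
  proof -
    have v: "v \<in> \<psi> ` ball p \<rho>" using that \<delta>0(2) \<delta>(2) by (auto simp: subset_iff)
    have "\<phi> v \<in> ball p \<rho>" unfolding \<phi>_def by (rule the_inv_into_into[OF inj v]) simp
    moreover show "\<psi> (\<phi> v) = v" unfolding \<phi>_def by (rule f_the_inv_into_f[OF inj v])
    ultimately show "\<phi> v \<in> B" using that unfolding B_def by (simp del: mem_ball)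
  qed
  have \<phi>\<psi>: "\<phi> (\<psi> z) = z" if "z \<in> B" for z
    unfolding \<phi>_def by (rule the_inv_into_f_f[OF inj B\<rho>(1)[OF that]])
  have \<phi>cont: "continuous_on (ball (\<psi> p) \<delta>) \<phi>"
    unfolding continuous_on_iff
  proof (intro ballI allI impI)
    fix v \<epsilon> :: "_" assume v: "v \<in> ball (\<psi> p) \<delta>" and \<epsilon>: "(\<epsilon>::real) > 0"
    have "dist (\<phi> u) (\<phi> v) < \<epsilon>" if u: "u \<in> ball (\<psi> p) \<delta>" "dist u v < 4 / 5 * cmod c * \<epsilon>" for u
    proof -
      have "4 / 5 * cmod c * cmod (\<phi> u - \<phi> v) \<le> cmod (u - v)"
        using low[OF B\<rho>(1)[OF \<phi>(1)[OF u(1)]] B\<rho>(1)[OF \<phi>(1)[OF v]]] \<phi>(2)[OF u(1)] \<phi>(2)[OF v] by simp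
      also have "\<dots> < 4 / 5 * cmod c * \<epsilon>" using u(2) by (simp add: dist_norm)
      finally show ?thesis using c0 by (subst (asm) mult_less_cancel_left_pos) (auto simp: dist_norm)
    qed
    moreover have "4 / 5 * cmod c * \<epsilon> > 0" using c0 \<epsilon> by simp
    ultimately show "\<exists>da>0. \<forall>x'\<in>ball (\<psi> p) \<delta>. dist x' v < da \<longrightarrow> dist (\<phi> x') (\<phi> v) < \<epsilon>" by blast
  qed
  have conn: "connected {z \<in> B. Re (\<psi> z) \<in> J}" if "convex J" for J
  proof -
    have "convex (ball (\<psi> p) \<delta> \<inter> Re -` J)"
      by (intro convex_Int convex_ball convex_linear_vimage that bounded_linear.linear bounded_linear_Re)
    then have "connected (\<phi> ` (ball (\<psi> p) \<delta> \<inter> Re -` J))"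
      by (intro connected_continuous_image continuous_on_subset[OF \<phi>cont] convex_connected) auto
    moreover have "\<phi> ` (ball (\<psi> p) \<delta> \<inter> Re -` J) = {z \<in> B. Re (\<psi> z) \<in> J}"
    proof
      show "\<phi> ` (ball (\<psi> p) \<delta> \<inter> Re -` J) \<subseteq> {z \<in> B. Re (\<psi> z) \<in> J}" using \<phi> by (auto simp del: mem_ball)
      show "{z \<in> B. Re (\<psi> z) \<in> J} \<subseteq> \<phi> ` (ball (\<psi> p) \<delta> \<inter> Re -` J)"
      proof
        fix z assume z: "z \<in> {z \<in> B. Re (\<psi> z) \<in> J}"
        then have "\<psi> z \<in> ball (\<psi> p) \<delta> \<inter> Re -` J" by (auto simp: B_def)
        moreover have "z = \<phi> (\<psi> z)" using \<phi>\<psi> z by simp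
        ultimately show "z \<in> \<phi> ` (ball (\<psi> p) \<delta> \<inter> Re -` J)" by (rule rev_image_eqI)
      qed
    qed
    ultimately show ?thesis by simp
  qed
  have clos: "z \<in> closure {z\<in>B. Re (\<psi> z) * \<sigma> > 0}" if z: "z \<in> B" "Re (\<psi> z) = 0" and \<sigma>: "\<sigma> = 1 \<or> \<sigma> = -1" for z and \<sigma> :: real
    unfolding closure_approachable
  proof (intro allI impI)
    fix \<epsilon> :: real assume \<epsilon>: "\<epsilon> > 0"
    have v: "\<psi> z \<in> ball (\<psi> p) \<delta>" using z by (simp add: B_def)
    obtain \<eta>1 where \<eta>1: "\<eta>1 > 0" "\<And>u. u \<in> ball (\<psi> p) \<delta> \<Longrightarrow> dist u (\<psi> z) < \<eta>1 \<Longrightarrow> dist (\<phi> u) (\<phi> (\<psi> z)) < \<epsilon>"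
      using \<phi>cont v \<epsilon> unfolding continuous_on_iff by blast
    obtain \<eta>2 where \<eta>2: "\<eta>2 > 0" "ball (\<psi> z) \<eta>2 \<subseteq> ball (\<psi> p) \<delta>" using v open_ball openE by blast
    define \<eta> where "\<eta> = min \<eta>1 \<eta>2 / 2"
    have \<eta>: "\<eta> > 0" "\<eta> < \<eta>1" "\<eta> < \<eta>2" using \<eta>1(1) \<eta>2(1) by (auto simp: \<eta>_def)
    define u where "u = \<psi> z + of_real (\<sigma> * \<eta>)"
    have du: "dist u (\<psi> z) = \<eta>" using \<sigma> \<eta>(1) by (auto simp: u_def dist_norm)
    have u: "u \<in> ball (\<psi> p) \<delta>" using \<eta>2(2) du \<eta>(3) by (auto simp: subset_iff dist_commute)
    have "\<phi> u \<in> {z\<in>B. Re (\<psi> z) * \<sigma> > 0}" using \<phi>[OF u] \<sigma> \<eta>(1) z(2) by (auto simp: u_def)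
    moreover have "dist (\<phi> u) z < \<epsilon>" using \<eta>1(2)[OF u] du \<eta>(2) \<phi>\<psi>[OF z(1)] by simp
    ultimately show "\<exists>y\<in>{z\<in>B. Re (\<psi> z) * \<sigma> > 0}. dist y z < \<epsilon>" by blast
  qed
  \<comment> \<open>The value on the diagonal removes the singularity, so for fixed \<open>t\<close>
    the normalised quotient is holomorphic in \<open>z\<close>, also at points of the arc.\<close>
  define Dq where "Dq z t = (if z = \<Gamma> t then deriv \<psi> (\<Gamma> t) else (\<psi> z - \<psi> (\<Gamma> t)) / (z - \<Gamma> t)) / c" for z t
  have Dq1: "cmod (Dq z t - 1) \<le> 1 / 5" if z: "z \<in> ball p \<rho>" and t: "t \<in> {t1..t2}" for z t
  proof (cases "z = \<Gamma> t")
    case True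
    then have "Dq z t - 1 = (deriv \<psi> z - c) / c" using c0 by (simp add: Dq_def field_simps)
    then have "cmod (Dq z t - 1) = cmod (deriv \<psi> z - c) / cmod c" by (simp only: norm_divide)
    also have "\<dots> \<le> (cmod c / 5) / cmod c" by (intro divide_right_mono dc z) auto
    also have "\<dots> = 1 / 5" using c0 by simp
    finally show ?thesis .
  next
    case False
    then have "Dq z t - 1 = (\<psi> z - \<psi> (\<Gamma> t) - c * (z - \<Gamma> t)) / (c * (z - \<Gamma> t))"
      using c0 by (simp add: Dq_def field_simps)
    then have "cmod (Dq z t - 1) = cmod (\<psi> z - \<psi> (\<Gamma> t) - c * (z - \<Gamma> t)) / (cmod c * cmod (z - \<Gamma> t))"
      by (simp add: norm_divide norm_mult)
    also have "\<dots> \<le> (cmod c / 5 * cmod (z - \<Gamma> t)) / (cmod c * cmod (z - \<Gamma> t))"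
      by (intro divide_right_mono lin z inB t) auto
    also have "\<dots> = 1 / 5" using c0 False by simp
    finally show ?thesis .
  qed
  have Dqnp: "Dq z t \<notin> \<real>\<^sub>\<le>\<^sub>0" if "z \<in> ball p \<rho>" "t \<in> {t1..t2}" for z t
  proof -
    have "\<bar>Re (Dq z t - 1)\<bar> \<le> 1 / 5" using Dq1[OF that] abs_Re_le_cmod[of "Dq z t - 1"] by linarith
    then have "\<bar>Re (Dq z t) - 1\<bar> \<le> 1 / 5" by simp
    then have "Re (Dq z t) > 0" by linarith
    then show ?thesis by (auto simp: complex_nonpos_Reals_iff)
  qed
  define G where "G z t = (if t \<in> {t1..t2} then Ln (Dq z t) + of_real (ln (cmod c)) else 0)" for z t
  have Gh: "(\<lambda>z. G z t) holomorphic_on ball p \<rho>" for t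
  proof (cases "t \<in> {t1..t2}")
    case True
    have "(\<lambda>z. Dq z t) holomorphic_on ball p \<rho>" unfolding Dq_def
      by (intro holomorphic_intros pole_lemma_open[OF \<psi>h open_ball]) (use c0 in auto)
    then show ?thesis using Dqnp[OF _ True] True unfolding G_def by (auto intro!: holomorphic_intros)
  qed (auto simp: G_def)
  have G\<psi>: "\<psi> (\<Gamma> t) = \<i> * of_real (\<theta> t)" "deriv \<psi> (\<Gamma> t) = deriv \<psi> (\<Gamma> (max t1 (min t2 t)))" if "t \<in> {t1..t2}" for t
    using \<theta>eq[OF that] that by (auto simp: max_def min_def)
  have Gm: "G z \<in> borel_measurable Mt" if z: "z \<in> ball p \<rho>" for z
  proof -
    have [measurable]: "\<theta> \<in> borel_measurable borel" by (rule borel_measurable_continuous_onI[OF \<theta>cont])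
    have [measurable]: "(\<lambda>t. deriv \<psi> (\<Gamma> (max t1 (min t2 t)))) \<in> borel_measurable borel"
    proof (rule borel_measurable_continuous_onI)
      have "continuous_on UNIV (\<lambda>t. \<Gamma> (max t1 (min t2 t)))"
        by (rule continuous_on_compose2[OF Gamma_cont]) (auto intro!: continuous_intros)
      then show "continuous_on UNIV (\<lambda>t. deriv \<psi> (\<Gamma> (max t1 (min t2 t))))"
        by (rule continuous_on_compose2[OF holomorphic_on_imp_continuous_on[OF holomorphic_deriv[OF \<psi>h open_ball]]])
          (use t12 in \<open>auto intro!: inB simp del: mem_ball\<close>)
    qed
    \<comment> \<open>Every ingredient is replaced by its clamped version, which is continuous on
      the line, so that measurability can be read off.\<close>
    have eq: "G z = (\<lambda>t. if t \<in> {t1..t2} then Ln ((if z = \<Gamma> t then deriv \<psi> (\<Gamma> (max t1 (min t2 t)))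
        else (\<psi> z - \<i> * of_real (\<theta> t)) / (z - \<Gamma> t)) / c) + of_real (ln (cmod c)) else 0)"
      using G\<psi> by (auto simp: G_def Dq_def fun_eq_iff)
    show ?thesis unfolding eq measurable_cong_sets[OF sets_Mt refl]
      by (intro measurable_If measurable_const borel_measurable_add measurable_compose[OF _ borel_measurable_Ln]
          borel_measurable_divide) measurable
  qed
  have Gb: "norm (G z t) \<le> 1 + \<bar>ln (cmod c)\<bar>" if z: "z \<in> ball p \<rho>" for z t
  proof (cases "t \<in> {t1..t2}")
    case True
    have "cmod (Ln (1 + (Dq z t - 1))) \<le> 2 * cmod (Dq z t - 1)"
      by (rule norm_Ln_le) (use Dq1[OF z True] in linarith)
    then have "cmod (Ln (Dq z t)) \<le> 1" using Dq1[OF z True] by simp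
    then show ?thesis using True norm_triangle_ineq[of "Ln (Dq z t)" "of_real (ln (cmod c))"] by (simp add: G_def)
  next
    case False
    then have "G z t = 0" unfolding G_def by (rule if_not_P)
    then show ?thesis by simp
  qed
  define G1 where "G1 z = (\<integral>t. G z t \<partial>Mt)" for z
  have G1h: "G1 holomorphic_on ball p \<rho>" unfolding G1_def
    by (rule holomorphic_on_lebesgue_integral[where g = "\<lambda>_. 1 + \<bar>ln (cmod c)\<bar>"]) (use Gh Gm Gb in auto)
  have Gi: "integrable Mt (G z)" if z: "z \<in> ball p \<rho>" for z
    by (rule integrable_const_bound[where B = "1 + \<bar>ln (cmod c)\<bar>"]) (use Gm Gb z in auto)
  define A where "A = {0<..<1} - {t1..t2}"
  have Ad: "d \<le> cmod (\<Gamma> t - p)" if "t \<in> A" for t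
    using d(2)[of t] that by (auto simp: A_def dist_norm norm_minus_commute)
  obtain F2 where F2: "F2 holomorphic_on ball p (d / 2)"
    "\<And>z. z \<in> ball p (d / 2) \<Longrightarrow> integrable Mt (\<lambda>t. indicator A t * ln (cmod (z - \<Gamma> t))) \<and>
       (\<integral>t. indicator A t * ln (cmod (z - \<Gamma> t)) \<partial>Mt) = Re (F2 z)"
  proof -
    have "A \<in> sets borel" "A \<subseteq> {0<..<1}" by (auto simp: A_def)
    from rest_potential[OF this d(1) Ad] that show thesis by blast
  qed
  \<comment> \<open>The harmonic remainder of \<open>log_arc_integral\<close> for W = \<psi> z. Its
    logarithms stay off their cut because Im \<psi> lies strictly between the end values of
    \<theta>.\<close>
  define F1 where "F1 z = ((of_real (\<theta> t2) + \<i> * \<psi> z) * Ln (of_real (\<theta> t2) + \<i> * \<psi> z) +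
      (- of_real (\<theta> t1) - \<i> * \<psi> z) * Ln (- of_real (\<theta> t1) - \<i> * \<psi> z) - of_real (\<theta> t2 - \<theta> t1)) / of_real pi" for z
  have \<psi>B: "\<psi> holomorphic_on B" by (rule holomorphic_on_subset[OF \<psi>h]) (use B\<rho> in auto)
  have F1h: "F1 holomorphic_on B" unfolding F1_def
  proof (intro holomorphic_intros \<psi>B)
    fix z assume "z \<in> B"
    note i = Im\<psi>[OF this]
    show "of_real (\<theta> t2) + \<i> * \<psi> z \<notin> \<real>\<^sub>\<le>\<^sub>0" "- of_real (\<theta> t1) - \<i> * \<psi> z \<notin> \<real>\<^sub>\<le>\<^sub>0"
      using i by (auto simp: complex_nonpos_Reals_iff)
  qed auto
  define F where "F z = F1 z - G1 z + F2 z" for z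
  have Fh: "F holomorphic_on B"
  proof -
    have "G1 holomorphic_on B" by (rule holomorphic_on_subset[OF G1h]) (use B\<rho> in auto)
    moreover have "F2 holomorphic_on B"
      by (rule holomorphic_on_subset[OF F2(1)]) (use Bd in \<open>auto simp: dist_norm norm_minus_commute\<close>)
    ultimately show ?thesis unfolding F_def by (intro holomorphic_intros F1h)
  qed
  have pot: "integrable Mt (\<lambda>t. ln (cmod (z - \<Gamma> t))) \<and> U z = \<bar>Re (\<psi> z)\<bar> + Re (F z)" if z: "z \<in> B" for z
  proof -
    have [measurable]: "\<theta> \<in> borel_measurable borel" by (rule borel_measurable_continuous_onI[OF \<theta>cont])
    define l where "l t = indicator {t1..t2} t * ln (cmod (\<psi> z - \<i> * of_real (\<theta> t)))" for t
    have lm: "l \<in> borel_measurable borel" unfolding l_def by measurable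
    have *: "integrable lborel (\<lambda>t. indicator {t1..t2} t * (pi * dens t * ln (cmod (\<psi> z - \<i> * of_real (\<theta> t)))))"
      "(\<integral>t. indicator {t1..t2} t * (pi * dens t * ln (cmod (\<psi> z - \<i> * of_real (\<theta> t)))) \<partial>lborel) =
        \<bar>Re (\<psi> z)\<bar> * pi + Re ((of_real (\<theta> t2) + \<i> * \<psi> z) * Ln (of_real (\<theta> t2) + \<i> * \<psi> z)) +
        Re ((- of_real (\<theta> t1) - \<i> * \<psi> z) * Ln (- of_real (\<theta> t1) - \<i> * \<psi> z)) - (\<theta> t2 - \<theta> t1)"
      by (rule log_arc_integral[of t1 t2 \<theta> "\<lambda>t. pi * dens t" "\<psi> z"];
          use t12 \<theta>cont \<theta>der kabs(2) dens_nonneg Im\<psi>[OF z] in \<open>auto intro: continuous_on_subset\<close>)+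
    have e: "dens t * l t = (1 / pi) * (indicator {t1..t2} t * (pi * dens t * ln (cmod (\<psi> z - \<i> * of_real (\<theta> t)))))" for t
      by (simp add: l_def)
    have li: "integrable Mt l" unfolding integral_Mt(1)[OF lm] e using *(1) by (rule integrable_mult_right)
    have lv: "(\<integral>t. l t \<partial>Mt) = \<bar>Re (\<psi> z)\<bar> + Re (F1 z)"
      unfolding integral_Mt(2)[OF lm] e integral_mult_right_zero *(2) F1_def
      by (simp add: Re_divide_of_real) (simp add: field_simps)
    note g = Gi[OF B\<rho>(1)[OF z]]
    have zd: "z \<in> ball p (d / 2)" using Bd[OF z] by (simp add: dist_norm norm_minus_commute)
    note f2 = F2(2)[OF zd]
    have ex: "\<exists>a. \<forall>t\<in>{0..1}. z = \<Gamma> t \<longrightarrow> t = a" using Gamma_inj by (metis inj_onD)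
    then obtain a where a: "\<And>t. t \<in> {0..1} \<Longrightarrow> z = \<Gamma> t \<Longrightarrow> t = a" by blast
    \<comment> \<open>The splitting of the logarithm fails only at the parameter with \<Gamma> t =
      z, at most one by injectivity and hence of measure zero.\<close>
    have ae: "AE t in Mt. ln (cmod (z - \<Gamma> t)) = l t - Re (G z t) + indicator A t * ln (cmod (z - \<Gamma> t))"
      using AE_Mt[of a]
    proof eventually_elim
      case (elim t)
      show ?case
      proof (cases "t \<in> {t1..t2}")
        case True
        have zt: "z \<noteq> \<Gamma> t" using a[of t] elim by auto
        have "\<psi> z - \<i> * of_real (\<theta> t) = c * Dq z t * (z - \<Gamma> t)"
          using G\<psi>(1)[OF True] zt c0 by (simp add: Dq_def)
        then have "cmod (\<psi> z - \<i> * of_real (\<theta> t)) = cmod c * cmod (Dq z t) * cmod (z - \<Gamma> t)" by (simp add: norm_mult)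
        moreover have "Dq z t \<noteq> 0" using Dqnp[OF B\<rho>(1)[OF z] True] by auto
        ultimately have "l t = ln (cmod c) + ln (cmod (Dq z t)) + ln (cmod (z - \<Gamma> t))"
          using True zt c0 by (simp add: l_def ln_mult)
        then show ?thesis using True \<open>Dq z t \<noteq> 0\<close> by (simp add: G_def A_def)
      next
        case False
        then have "G z t = 0" unfolding G_def by (rule if_not_P)
        moreover have "l t = 0" using False by (simp add: l_def)
        moreover have "t \<in> A" using False elim by (simp add: A_def)
        ultimately show ?thesis by simp
      qed
    qed
    have rhs: "integrable Mt (\<lambda>t. l t - Re (G z t) + indicator A t * ln (cmod (z - \<Gamma> t)))"
      using li g f2 by auto
    have m1: "(\<lambda>t. ln (cmod (z - \<Gamma> t))) \<in> borel_measurable Mt"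
      unfolding measurable_cong_sets[OF sets_Mt refl] by measurable
    have int: "integrable Mt (\<lambda>t. ln (cmod (z - \<Gamma> t)))"
      using integrable_cong_AE[OF m1 borel_measurable_integrable[OF rhs] ae] rhs by blast
    have "U z = (\<integral>t. l t - Re (G z t) + indicator A t * ln (cmod (z - \<Gamma> t)) \<partial>Mt)"
      unfolding U_def by (rule integral_cong_AE[OF m1 borel_measurable_integrable[OF rhs] ae])
    also have "\<dots> = (\<integral>t. l t \<partial>Mt) - (\<integral>t. Re (G z t) \<partial>Mt) + (\<integral>t. indicator A t * ln (cmod (z - \<Gamma> t)) \<partial>Mt)"
      using li g f2 by simp
    also have "\<dots> = \<bar>Re (\<psi> z)\<bar> + Re (F z)"
      using lv f2 g by (simp add: F_def G1_def integral_Re)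
    finally show ?thesis using int by simp
  qed
  show thesis
  proof (rule that[of B \<psi> T F])
    show "open B" by (rule opB)
    show "\<Gamma> t0 \<in> B" using pB by (simp add: p_def)
    show "\<psi> holomorphic_on B" by (rule \<psi>B)
    show "T holomorphic_on B" by (rule holomorphic_on_subset[OF b(2)]) (use B\<rho> in auto)
    show "F holomorphic_on B" by (rule Fh)
    show "connected {z\<in>B. Re (\<psi> z) > 0}" using conn[of "{0<..}"] by simp
    show "connected {z\<in>B. Re (\<psi> z) < 0}" using conn[of "{..<0}"] by simp
    show "z \<in> closure {z\<in>B. Re (\<psi> z) > 0} \<and> z \<in> closure {z\<in>B. Re (\<psi> z) < 0}" if "z \<in> B" "Re (\<psi> z) = 0" for z
      using clos[OF that, of 1] clos[OF that, of "-1"] by simp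
  qed (use b(5) LT SigB pot B\<rho> in auto)
qed

end

section \<open>Difference of the two values of \<open>L\<close>, and uniqueness of branches\<close>

context two_sheets
begin

definition dL :: "complex \<Rightarrow> real" where
  "dL z = L (neg_root z) - L (conj_root (neg_root z))"

lemma dL_deriv:
  assumes c: "(c has_vector_derivative v) (at s)" and neg: "Re (neg_root (c s)) < 0" and np: "\<not> pole (c s)"
  shows "((\<lambda>s. dL (c s)) has_real_derivative 2 * Re (R (c s) (neg_root (c s)) * v)) (at s)"
proof -
  have ne: "conj_root (neg_root (c s)) \<noteq> neg_root (c s)" using conj_root_Re_pos[OF neg] neg by auto
  obtain r T \<psi> where b: "r > 0" "T holomorphic_on ball (c s) r" "T (c s) = neg_root (c s)"
      "\<And>z. z \<in> ball (c s) r \<Longrightarrow> root z (T z) \<and> conj_root (T z) \<noteq> T z \<and> \<not> pole z"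
      "\<And>z. z \<in> ball (c s) r \<Longrightarrow> exp (2 * \<psi> z) = num (T z) / den (T z)"
      "\<And>z. z \<in> ball (c s) r \<Longrightarrow> (\<psi> has_field_derivative R z (T z)) (at z)"
    using branch_log[OF neg_root(1) ne np] by metis
  have "isCont T (c s)" using holomorphic_on_imp_continuous_on[OF b(2)] b(1) by (simp add: continuous_on_eq_continuous_at)
  then have "((\<lambda>z. Re (T z)) \<longlongrightarrow> Re (T (c s))) (at (c s))" by (intro tendsto_Re) (simp add: isCont_def)
  then have "eventually (\<lambda>z. Re (T z) < 0) (at (c s))" using neg b(3) by (intro order_tendstoD(2)) auto
  then have "eventually (\<lambda>z. Re (T z) < 0) (nhds (c s))" using neg b(3) by (simp add: eventually_nhds_conv_at)
  moreover have "eventually (\<lambda>z. z \<in> ball (c s) r) (nhds (c s))" using b(1) by (intro eventually_nhds_in_open) auto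
  ultimately have "eventually (\<lambda>z. Re (T z) < 0 \<and> z \<in> ball (c s) r) (nhds (c s))" by (rule eventually_conj)
  then have ev1: "eventually (\<lambda>z. dL z = 2 * Re (\<psi> z)) (nhds (c s))"
  proof eventually_elim
    case (elim z)
    then have n: "neg_root z = T z" using b(4) by (intro neg_root_eq) auto
    have "cmod (num (T z)) / cmod (den (T z)) = exp (2 * Re (\<psi> z))"
      using b(5)[of z] elim by (metis norm_divide norm_exp_eq_Re Re_complex_of_real mult_2 plus_complex.sel(1))
    then show ?case using L_diff[of z "T z"] b(4)[of z] elim n by (simp add: dL_def)
  qed
  have cc: "filterlim c (nhds (c s)) (nhds s)"
    using c has_vector_derivative_continuous[OF c] by (simp add: continuous_within tendsto_nhds_iff)
  have ev: "eventually (\<lambda>x. dL (c x) = 2 * Re (\<psi> (c x))) (nhds s)"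
    using filterlim_iff[THEN iffD1, OF cc, rule_format, OF ev1] .
  have "((\<psi> \<circ> c) has_vector_derivative v * R (c s) (T (c s))) (at s)"
    by (rule field_vector_diff_chain_at[OF c b(6)]) (use b(1) in simp)
  from bounded_linear.has_vector_derivative[OF bounded_linear_Re this]
  have "((\<lambda>x. Re (\<psi> (c x))) has_real_derivative Re (v * R (c s) (T (c s)))) (at s)"
    unfolding o_def by (simp add: has_real_derivative_iff_has_vector_derivative)
  from DERIV_cmult[OF this, of 2]
  have "((\<lambda>x. 2 * Re (\<psi> (c x))) has_real_derivative 2 * Re (R (c s) (neg_root (c s)) * v)) (at s)"
    using b(3) by (simp add: mult.commute)
  then show ?thesis using DERIV_cong_ev[OF refl ev refl] by blast
qed

lemma real_neg_root:
  assumes "Im z = 0" shows "Re (neg_root z) < 0" "Im (neg_root z) = 0"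
proof -
  define n where "n = neg_root z"
  have r: "root z n" and le: "Re n \<le> 0" using neg_root by (auto simp: n_def)
  have n0: "n \<noteq> 0" using root_nz[OF r] .
  have im: "Im n + Im (conj_root n) = 0" using root_sum[OF r] assms by (metis complex_Im_numeral plus_complex.sel(2) add.right_neutral)
  have "Im (conj_root n) = 3 * w * Im n / (cmod n)\<^sup>2"
    unfolding conj_root_def by (simp add: complex_div_cnj[of _ n] Im_divide_of_real flip: of_real_power)
  then have "Im n * (1 + 3 * w / (cmod n)\<^sup>2) = 0" using im by (simp add: algebra_simps)
  moreover have "1 + 3 * w / (cmod n)\<^sup>2 > 0" using w_pos by (intro add_pos_nonneg) auto
  ultimately show i: "Im (neg_root z) = 0" by (auto simp: n_def)
  have "Re n \<noteq> 0" using n0 i by (auto simp: n_def complex_eq_iff)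
  then show "Re (neg_root z) < 0" using le by (simp add: n_def)
qed

text \<open>For real x > 0 beyond the poles the left root n is real and n - conj_root n < 0, while
  the other factors of \<open>R\<close> are positive; thus the derivative 2 R is negative.\<close>

lemma dL_real_decreasing:
  assumes "a < b" "0 < a" "a\<^sup>2 > 16 * (1 - w)"
  shows "dL (of_real b) < dL (of_real a)"
proof (rule DERIV_neg_imp_decreasing[OF assms(1)])
  fix x assume x: "a \<le> x" "x \<le> b"
  have x0: "x > 0" using x assms by simp
  have "a\<^sup>2 \<le> x\<^sup>2" using x assms by (intro power_mono) auto
  then have x2: "x\<^sup>2 - 16 * (1 - w) > 0" using assms(3) by linarith
  have np: "\<not> pole (of_real x)"
  proof
    assume "pole (of_real x)"
    then have "x\<^sup>2 = 16 * (1 - w) \<or> x = w - 5"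
      unfolding pole_def by (metis of_real_eq_iff of_real_power)
    then show False using x2 x0 w_le_1 by auto
  qed
  define n where "n = neg_root (of_real x)"
  have n: "Re n < 0" "Im n = 0" using real_neg_root[of "of_real x"] by (auto simp: n_def)
  have "((\<lambda>s. dL (of_real s)) has_real_derivative 2 * Re (R (of_real x) n * 1)) (at x)"
    unfolding n_def by (rule dL_deriv) (use real_neg_root[of "of_real x"] np in \<open>auto intro!: derivative_eq_intros\<close>)
  moreover have "Re (R (of_real x) n * 1) < 0"
  proof -
    have nr: "n = of_real (Re n)" using n by (simp add: complex_eq_iff)
    have "conj_root (of_real k) = of_real (- (3 * w / k))" for k by (simp add: conj_root_def)
    from this[of "Re n"] have "conj_root n = of_real (- (3 * w / Re n))" using nr by simp
    then have d: "n - conj_root n = of_real (Re n + 3 * w / Re n)" using nr by simp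
    have e: "(complex_of_real x)\<^sup>2 - of_real (16 * (1 - w)) = of_real (x\<^sup>2 - 16 * (1 - w))"
      "complex_of_real x + of_real (2 - 2 * w) = of_real (x + (2 - 2 * w))"
      "complex_of_real x + of_real (5 - w) = of_real (x + (5 - w))" by simp_all
    have "R (of_real x) n = of_real ((Re n + 3 * w / Re n) * (x + (2 - 2 * w)) / ((x\<^sup>2 - 16 * (1 - w)) * (x + (5 - w))))"
      unfolding R_def d e by (simp only: of_real_mult of_real_divide)
    moreover have "Re n + 3 * w / Re n < 0" using n w_pos by (intro add_neg_neg divide_pos_neg) auto
    moreover have "x + (2 - 2 * w) > 0" "x + (5 - w) > 0" using x0 w_le_1 by auto
    ultimately show ?thesis using x2 by (simp add: divide_neg_pos mult_neg_pos)
  qed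
  ultimately show "\<exists>y. ((\<lambda>s. dL (of_real s)) has_real_derivative y) (at x) \<and> y < 0"
    by (intro exI[of _ "2 * Re (R (of_real x) n * 1)"] conjI) auto
qed

text \<open>The quotient \<open>h\<close> takes only the values 0 and 1, according to the root that
  f picks, and it is continuous on a connected set.\<close>

lemma branch_unique:
  assumes K: "connected K" "continuous_on K f" "continuous_on K g" "\<And>x. x \<in> K \<Longrightarrow> root x (f x)" "\<And>x. x \<in> K \<Longrightarrow> root x (g x)"
    and ne: "\<And>x. x \<in> K \<Longrightarrow> conj_root (g x) \<noteq> g x" and a: "a \<in> K" "f a = g a" and x: "x \<in> K"
  shows "f x = g x"
proof -
  define h where "h x = (f x - g x) / (conj_root (g x) - g x)" for x
  have "continuous_on K (\<lambda>x. conj_root (g x))" unfolding conj_root_def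
    by (intro continuous_intros K) (use K(5) root_nz in auto)
  then have "continuous_on K h" unfolding h_def by (intro continuous_intros K) (use ne in auto)
  then have "connected (h ` K)" using K(1) by (rule connected_continuous_image)
  moreover have sub: "h ` K \<subseteq> {0, 1}"
  proof
    fix y assume "y \<in> h ` K"
    then obtain x where x: "x \<in> K" "y = h x" by blast
    have "f x = g x \<or> f x = conj_root (g x)" by (rule root_cases[OF K(5)[OF x(1)] K(4)[OF x(1)]])
    then show "y \<in> {0, 1}" using ne[OF x(1)] x(2) by (auto simp: h_def)
  qed
  moreover have "finite (h ` K)" using sub by (rule finite_subset) simp
  ultimately obtain c where "h ` K \<subseteq> {c}" using connected_finite_iff_sing by (metis empty_subsetI subset_refl)
  then have "h x = h a" using a x by (metis image_subset_iff singletonD)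
  then have "h x = 0" using a by (simp add: h_def)
  then show ?thesis using ne[OF x] by (simp add: h_def)
qed

lemma branch_dichotomy:
  assumes K: "connected K" "continuous_on K f" "continuous_on K g" "\<And>x. x \<in> K \<Longrightarrow> root x (f x)" "\<And>x. x \<in> K \<Longrightarrow> root x (g x)"
    and ne: "\<And>x. x \<in> K \<Longrightarrow> conj_root (g x) \<noteq> g x"
  shows "(\<forall>x\<in>K. f x = g x) \<or> (\<forall>x\<in>K. f x = conj_root (g x))"
proof (cases "\<exists>a\<in>K. f a = g a")
  case True
  then show ?thesis using branch_unique[OF K ne] by blast
next
  case False
  then show ?thesis using root_cases K(4,5) by blast
qed

end

section \<open>The branch of the root continued from infinity\<close>

text \<open>The last assumption says that the arc crosses the positive axis to the right of every
  pole. It places all poles on the part of the real axis where the continued branch is the left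
  root, a point at which \<open>L\<close> is regular.\<close>

locale trajectory_core = trajectory_arc +
  fixes xs :: real
  assumes symmetric: "cnj ` \<Gamma> ` {0..1} = \<Gamma> ` {0..1}"
    and crossing: "\<Gamma> ` {0..1} \<inter> complex_of_real ` {0<..} = {of_real xs}"
    and crossing_gt: "0 < xs" "16 * (1 - w) < xs\<^sup>2"
begin

lemma path_Gamma: "path \<Gamma>" "path_image \<Gamma> = Sig" "pathstart \<Gamma> = \<Gamma> 0" "pathfinish \<Gamma> = \<Gamma> 1"
  using continuous_on_subset[OF Gamma_cont] by (simp_all add: path_def path_image_def Sig_def pathstart_def pathfinish_def)

lemma compact_Sig: "compact Sig"
  unfolding Sig_def by (intro compact_continuous_image continuous_on_subset[OF Gamma_cont]) auto

lemma open_Compl_Sig: "open (- Sig)"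
  using compact_Sig compact_imp_closed by blast

lemma double_points:
  assumes "(z + 2)\<^sup>2 + of_real (12 * w) = 0" shows "z = \<Gamma> 0 \<or> z = \<Gamma> 1"
proof -
  have "\<Gamma> 0 \<noteq> \<Gamma> 1" using inj_onD[OF Gamma_inj, of 0 1] by auto
  moreover have eq: "(\<Gamma> 0 + 2)\<^sup>2 = (z + 2)\<^sup>2" "(\<Gamma> 1 + 2)\<^sup>2 = (z + 2)\<^sup>2"
    using assms Gamma_ends by (simp_all add: add_eq_0_iff2)
  moreover have "\<Gamma> 0 + 2 = z + 2 \<or> \<Gamma> 0 + 2 = - (z + 2)" "\<Gamma> 1 + 2 = z + 2 \<or> \<Gamma> 1 + 2 = - (z + 2)"
    using eq by (simp_all only: power2_eq_iff)
  ultimately show ?thesis by (metis add_right_cancel)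
qed

lemma ends_sum_prod: "\<Gamma> 0 + \<Gamma> 1 = -4" "\<Gamma> 0 * \<Gamma> 1 = of_real (4 + 12 * w)"
proof -
  have "\<Gamma> 0 \<noteq> \<Gamma> 1" using inj_onD[OF Gamma_inj, of 0 1] by auto
  moreover have "(\<Gamma> 0 + 2)\<^sup>2 = (\<Gamma> 1 + 2)\<^sup>2" using Gamma_ends by (simp add: add_eq_0_iff2)
  ultimately have e: "\<Gamma> 0 + 2 = - (\<Gamma> 1 + 2)" unfolding power2_eq_iff by auto
  then have "\<Gamma> 0 = - (\<Gamma> 1 + 2) - 2" by (simp only: eq_diff_eq)
  then show s: "\<Gamma> 0 + \<Gamma> 1 = -4" by simp
  then have g: "\<Gamma> 1 = - 4 - \<Gamma> 0" by (metis add_diff_cancel_left')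
  have "\<Gamma> 0 * (- 4 - \<Gamma> 0) = 4 - (\<Gamma> 0 + 2)\<^sup>2" by (simp add: power2_eq_square algebra_simps)
  also have "(\<Gamma> 0 + 2)\<^sup>2 = - of_real (12 * w)" using Gamma_ends(1) by (simp add: add_eq_0_iff2)
  finally show "\<Gamma> 0 * \<Gamma> 1 = of_real (4 + 12 * w)" unfolding g by simp
qed

lemma cnj_ends: "cnj (\<Gamma> 0) = \<Gamma> 1"
proof -
  have "(cnj (\<Gamma> 0) + 2)\<^sup>2 + of_real (12 * w) = cnj ((\<Gamma> 0 + 2)\<^sup>2 + of_real (12 * w))" by simp
  then have "cnj (\<Gamma> 0) = \<Gamma> 0 \<or> cnj (\<Gamma> 0) = \<Gamma> 1" unfolding Gamma_ends(1) by (intro double_points) simp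
  moreover have "cnj (\<Gamma> 0) \<noteq> \<Gamma> 0"
  proof
    assume "cnj (\<Gamma> 0) = \<Gamma> 0"
    then have "\<Gamma> 0 = of_real (Re (\<Gamma> 0))" by (simp add: complex_eq_iff)
    then obtain k where k: "\<Gamma> 0 = of_real k" by blast
    have "of_real ((k + 2)\<^sup>2 + 12 * w) = (\<Gamma> 0 + 2)\<^sup>2 + of_real (12 * w)" by (simp add: k)
    then have "complex_of_real ((k + 2)\<^sup>2 + 12 * w) = 0" unfolding Gamma_ends(1) .
    then have "(k + 2)\<^sup>2 + 12 * w = 0" unfolding of_real_eq_0_iff .
    moreover have "(k + 2)\<^sup>2 + 12 * w > 0" using w_pos by (intro add_nonneg_pos) auto
    ultimately show False by simp
  qed
  ultimately show ?thesis by blast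
qed

text \<open>Conjugation acts on the parameter interval as a continuous injection \<sigma> with
  \<sigma> 0 = 1. Such a map is decreasing, so it has at most one fixed point, and fixed points are
  the real points of the arc.\<close>

lemma Sig_real: assumes "z \<in> Sig" "Im z = 0" shows "z = of_real xs"
proof -
  define \<sigma> where "\<sigma> t = inv_into {0..1} \<Gamma> (cnj (\<Gamma> t))" for t
  have cin: "cnj (\<Gamma> t) \<in> \<Gamma> ` {0..1}" if "t \<in> {0..1}" for t using symmetric that by blast
  have \<sigma>: "\<sigma> t \<in> {0..1}" "\<Gamma> (\<sigma> t) = cnj (\<Gamma> t)" if "t \<in> {0..1}" for t
    using inv_into_into[OF cin[OF that]] f_inv_into_f[OF cin[OF that]] by (auto simp: \<sigma>_def)
  have uniq: "s = t" if "\<Gamma> s = \<Gamma> t" "s \<in> {0..1}" "t \<in> {0..1}" for s t using inj_onD[OF Gamma_inj] that by blast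
  have cont: "continuous_on {0..1} \<sigma>" unfolding \<sigma>_def
  proof (rule continuous_on_compose2[of "\<Gamma> ` {0..1}"])
    show "continuous_on (\<Gamma> ` {0..1}) (inv_into {0..1} \<Gamma>)"
      by (rule continuous_on_inv[OF continuous_on_subset[OF Gamma_cont]]) (auto simp: Gamma_inj)
    show "continuous_on {0..1} (\<lambda>t. cnj (\<Gamma> t))" by (intro continuous_intros continuous_on_subset[OF Gamma_cont]) auto
  qed (use cin in auto)
  have inj: "inj_on \<sigma> {0..1}"
  proof (rule inj_onI)
    fix s t assume st: "s \<in> {0..1}" "t \<in> {0..1}" "\<sigma> s = \<sigma> t"
    then have "cnj (\<Gamma> s) = cnj (\<Gamma> t)" using \<sigma>(2) by metis
    then show "s = t" using uniq st by simp
  qed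
  have \<sigma>0: "\<sigma> 0 = 1" using uniq[of "\<sigma> 0" 1] \<sigma>[of 0] cnj_ends by auto
  have no: False if "0 < a" "a < b" "b \<le> 1" "\<sigma> a = a" "\<sigma> b = b" for a b
    using continuous_inj_imp_mono[of 0 a b \<sigma>] that \<sigma>0
      continuous_on_subset[OF cont, of "{0..b}"] inj_on_subset[OF inj, of "{0..b}"] by auto
  have fix_real: "\<sigma> t = t" if "t \<in> {0..1}" "Im (\<Gamma> t) = 0" for t
    using uniq[of "\<sigma> t" t] \<sigma>[OF that(1)] that by (simp add: complex_eq_iff)
  obtain t where t: "t \<in> {0..1}" "z = \<Gamma> t" using assms by (auto simp: Sig_def)
  have "of_real xs \<in> \<Gamma> ` {0..1}" using crossing by blast
  then obtain t' where t': "t' \<in> {0..1}" "of_real xs = \<Gamma> t'" by blast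
  have f: "\<sigma> t = t" "\<sigma> t' = t'" using fix_real t t' assms by (auto, metis Im_complex_of_real)
  have "t \<noteq> 0" "t' \<noteq> 0" using f \<sigma>0 by auto
  then have "t = t'" using no[of t t'] no[of t' t] f t(1) t'(1) by (cases t t' rule: linorder_cases) auto
  then show ?thesis using t t' by simp
qed

lemma ends_in_Sig: "\<Gamma> 0 \<in> Sig" "\<Gamma> 1 \<in> Sig"
  by (simp_all add: Sig_def)

lemma Compl_Sig_disc: "z \<notin> Sig \<Longrightarrow> root z t \<Longrightarrow> conj_root t \<noteq> t"
  using conj_root_eq_iff[of z t] double_points[of z] ends_in_Sig by metis

lemma big_root_exists:
  "\<exists>M>2. \<forall>z t. cmod z > M \<longrightarrow> root z t \<longrightarrow> cmod t \<noteq> cmod (conj_root t)"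
proof -
  obtain M where M: "M > 2" "\<And>z t. cmod z > M \<Longrightarrow> root z t \<Longrightarrow> cmod t \<le> cmod (conj_root t) \<Longrightarrow> cmod t < 1 \<and> 3 < cmod (conj_root t)"
    using small_root_small[of 1] by auto
  have "cmod t \<noteq> cmod (conj_root t)" if "cmod z > M" "root z t" for z t
    using M(2)[OF that] by fastforce
  then show ?thesis using M(1) by blast
qed

text \<open>The last clause singles out the large root near infinity, where the two moduli differ;
  it is the root whose \<open>L\<close> grows like ln |z|.\<close>

definition phys_spec :: "(complex \<Rightarrow> complex) \<Rightarrow> bool" where
  "phys_spec f \<longleftrightarrow> (\<forall>z\<in>- Sig. root z (f z)) \<and> continuous_on (- Sig) f \<and>
     (\<exists>M>2. Sig \<subseteq> cball 0 M \<and> (\<forall>z. cmod z > M \<longrightarrow> cmod (conj_root (f z)) < cmod (f z)))"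

text \<open>Half the winding number of the arc supplies a single-valued square root of the
  discriminant off the arc.\<close>

lemma phys_exists: "\<exists>f. phys_spec f"
proof -
  \<comment> \<open>exp (2 pi i n) for the winding number n is the ratio of \<Gamma> 1 - z to
    \<Gamma> 0 - z, so \<rho> squares to the product of the two differences, which is the
    discriminant.\<close>
  define \<rho> where "\<rho> z = exp (pi * \<i> * winding_number \<Gamma> z) * (\<Gamma> 0 - z)" for z
  have \<rho>2: "(\<rho> z)\<^sup>2 = (z + 2)\<^sup>2 + of_real (12 * w)" if "z \<notin> Sig" for z
  proof -
    define k where "k = exp (pi * \<i> * winding_number \<Gamma> z)"
    have "z \<notin> path_image \<Gamma>" by (subst path_Gamma(2)) (rule that)
    from winding_number_exp_2pi[OF path_Gamma(1) this]
    have "\<Gamma> 1 - z = exp (2 * pi * \<i> * winding_number \<Gamma> z) * (\<Gamma> 0 - z)"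
      unfolding path_Gamma(3,4) .
    moreover have "exp (2 * pi * \<i> * winding_number \<Gamma> z) = k\<^sup>2"
    proof -
      have "2 * pi * \<i> * winding_number \<Gamma> z = 2 * (pi * \<i> * winding_number \<Gamma> z)" by (simp only: of_real_mult of_real_numeral mult.assoc)
      then show ?thesis by (simp only: exp_double k_def)
    qed
    ultimately have ex: "\<Gamma> 1 - z = k\<^sup>2 * (\<Gamma> 0 - z)" by (simp only:)
    have "(\<rho> z)\<^sup>2 = k\<^sup>2 * (\<Gamma> 0 - z) * (\<Gamma> 0 - z)"
      unfolding \<rho>_def k_def[symmetric] by (simp only: power_mult_distrib power2_eq_square mult_ac)
    also have "\<dots> = (\<Gamma> 1 - z) * (\<Gamma> 0 - z)" unfolding ex ..
    also have "\<dots> = \<Gamma> 0 * \<Gamma> 1 - (\<Gamma> 0 + \<Gamma> 1) * z + z\<^sup>2" by (simp add: power2_eq_square algebra_simps)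
    also have "\<dots> = (z + 2)\<^sup>2 + of_real (12 * w)" unfolding ends_sum_prod by (simp add: power2_eq_square algebra_simps)
    finally show ?thesis .
  qed
  define f where "f z = (z + 2 + \<rho> z) / 2" for z
  have rt: "root z (f z)" if "z \<in> - Sig" for z
  proof -
    have "4 * (((z + 2 + r) / 2)\<^sup>2 - ((z + 2) * ((z + 2 + r) / 2) + of_real (3 * w))) = r\<^sup>2 - ((z + 2)\<^sup>2 + of_real (12 * w))" for r
      by (simp add: power2_eq_square field_simps)
    then have "4 * ((f z)\<^sup>2 - ((z + 2) * f z + of_real (3 * w))) = (\<rho> z)\<^sup>2 - ((z + 2)\<^sup>2 + of_real (12 * w))"
      unfolding f_def .
    also have "\<dots> = 0" using \<rho>2 that by simp
    finally show ?thesis unfolding root_def mult_eq_0_iff by simp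
  qed
  have cont: "continuous_on (- Sig) f" unfolding f_def \<rho>_def
    using continuous_on_winding_number[OF path_Gamma(1)] unfolding path_Gamma(2) by (intro continuous_intros) auto
  have contc: "continuous_on (- Sig) (\<lambda>z. conj_root (f z))" unfolding conj_root_def
    by (intro continuous_on_divide continuous_on_const cont ballI root_nz[OF rt] continuous_on_minus)
  obtain M1 where M1: "M1 > 2" "\<And>z t. cmod z > M1 \<Longrightarrow> root z t \<Longrightarrow> cmod t \<noteq> cmod (conj_root t)"
    by (rule exE[OF big_root_exists], elim conjE, rule that) (assumption | (drule spec, drule spec, drule mp, assumption, erule mp, assumption))+
  obtain M2 where "0 < M2 \<and> Sig \<subseteq> ball 0 M2" using bounded_subset_ballD[OF compact_imp_bounded[OF compact_Sig]] ..
  then have M2: "Sig \<subseteq> cball 0 M2" using ball_subset_cball by (rule order_trans[OF conjunct2])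
  define M where "M = max M1 M2"
  have M: "M > 2" "Sig \<subseteq> cball 0 M" "\<And>z t. cmod z > M \<Longrightarrow> root z t \<Longrightarrow> cmod t \<noteq> cmod (conj_root t)"
  proof -
    show "M > 2" using M1(1) by (simp add: M_def)
    have "cball 0 M2 \<subseteq> cball 0 M" unfolding M_def by (intro subset_cball) simp
    then show "Sig \<subseteq> cball 0 M" using M2 by (rule order_trans[rotated])
    show "cmod t \<noteq> cmod (conj_root t)" if "cmod z > M" "root z t" for z t
    proof (rule M1(2)[OF _ that(2)])
      show "M1 < cmod z" using that(1) by (simp add: M_def)
    qed
  qed
  define E where "E = - cball (0::complex) M"
  have ES: "E \<subseteq> - Sig" using M(2) by (auto simp: E_def)
  have "connected E" unfolding E_def by (rule connected_complement_bounded_convex) auto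
  \<comment> \<open>Near infinity the moduli of the two roots never agree, so the sign of
    \<open>h\<close> is constant on the connected exterior; if it is negative, the conjugate branch
    is the required one.\<close>
  define h where "h z = cmod (f z) - cmod (conj_root (f z))" for z
  have "continuous_on E h" unfolding h_def
    by (intro continuous_on_diff continuous_on_norm continuous_on_subset[OF cont ES] continuous_on_subset[OF contc ES])
  then have ch: "connected (h ` E)" using \<open>connected E\<close> by (rule connected_continuous_image)
  have h0: "h z \<noteq> 0" if "z \<in> E" for z proof -
    have "cmod z > M" using that by (simp add: E_def)
    from M(3)[OF this rt[OF subsetD[OF ES that]]] show ?thesis by (simp add: h_def)
  qed
  have dich: "(\<forall>z\<in>E. h z > 0) \<or> (\<forall>z\<in>E. h z < 0)"
  proof (cases "\<exists>a\<in>E. h a \<le> 0")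
    case True
    then obtain a where a: "a \<in> E" "h a \<le> 0" by blast
    have "h b < 0" if b: "b \<in> E" for b
    proof (rule ccontr)
      assume "\<not> h b < 0"
      then have "0 \<le> h b" by simp
      then have "0 \<in> h ` E"
        by (rule connectedD_interval[OF ch imageI[OF a(1)] imageI[OF b] a(2)])
      then show False using h0 by (metis imageE)
    qed
    then show ?thesis by (intro disjI2 ballI)
  next
    case False
    then show ?thesis by (intro disjI1 ballI) (simp add: not_le)
  qed
  then show ?thesis
  proof
    assume a: "\<forall>z\<in>E. h z > 0"
    have "\<forall>z. cmod z > M \<longrightarrow> cmod (conj_root (f z)) < cmod (f z)" using a by (simp add: E_def h_def)
    then have "phys_spec f" unfolding phys_spec_def by (intro conjI exI[of _ M] ballI rt cont M(1,2))
    then show ?thesis by (rule exI[where x = f])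
  next
    assume a: "\<forall>z\<in>E. h z < 0"
    have "\<forall>z. cmod z > M \<longrightarrow> cmod (conj_root (conj_root (f z))) < cmod (conj_root (f z))" using a by (simp add: E_def h_def)
    moreover have "\<forall>z\<in>- Sig. root z (conj_root (f z))" using rt root_conj_root by blast
    ultimately have "phys_spec (\<lambda>z. conj_root (f z))" unfolding phys_spec_def by (intro conjI exI[of _ M] contc M(1,2))
    then show ?thesis by (rule exI[where x = "\<lambda>z. conj_root (f z)"])
  qed
qed

definition phys :: "complex \<Rightarrow> complex" where "phys = (SOME f. phys_spec f)"

lemma phys_spec: "phys_spec phys" unfolding phys_def using someI_ex[OF phys_exists] .

lemma phys_root: "z \<notin> Sig \<Longrightarrow> root z (phys z)" using phys_spec unfolding phys_spec_def by (elim conjE bspec) simp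
lemma phys_cont: "continuous_on (- Sig) phys" using phys_spec unfolding phys_spec_def by (elim conjE)

lemma phys_big: obtains M where "M > 2" "Sig \<subseteq> cball 0 M" "\<And>z. cmod z > M \<Longrightarrow> cmod (conj_root (phys z)) < cmod (phys z)"
proof -
  have *: "\<exists>M. M > 2 \<and> Sig \<subseteq> cball 0 M \<and> (\<forall>z. cmod z > M \<longrightarrow> cmod (conj_root (phys z)) < cmod (phys z))"
    using phys_spec unfolding phys_spec_def by (elim conjE)
  show thesis
    by (rule exE[OF *], elim conjE, rule that) (assumption | (drule spec, erule mp, assumption))+
qed

lemma phys_local:
  assumes "z0 \<notin> Sig"
  obtains r where "r > 0" "ball z0 r \<subseteq> - Sig" "phys holomorphic_on ball z0 r"
proof -
  obtain r1 T where T: "r1 > 0" "T holomorphic_on ball z0 r1" "T z0 = phys z0" "\<And>z. z \<in> ball z0 r1 \<Longrightarrow> root z (T z)"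
     "\<And>z. z \<in> ball z0 r1 \<Longrightarrow> conj_root (T z) \<noteq> T z"
    by (rule local_branch[OF phys_root[OF assms] Compl_Sig_disc[OF assms phys_root[OF assms]]]) (rule that)
  have "z0 \<in> - Sig" using assms by simp
  from openE[OF open_Compl_Sig this] obtain r2 where r2: "r2 > 0" "ball z0 r2 \<subseteq> - Sig" .
  define r where "r = min r1 r2"
  have r: "r > 0" "ball z0 r \<subseteq> ball z0 r1" "ball z0 r \<subseteq> - Sig" using T(1) r2 by (auto simp: r_def)
  have eq: "phys z = T z" if "z \<in> ball z0 r" for z
  proof (rule branch_unique[of "ball z0 r" phys T z0 z])
    show "continuous_on (ball z0 r) T" using continuous_on_subset[OF holomorphic_on_imp_continuous_on[OF T(2)] r(2)] .
    show "continuous_on (ball z0 r) phys" using continuous_on_subset[OF phys_cont r(3)] .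
    show "root x (phys x)" if "x \<in> ball z0 r" for x by (rule phys_root[OF subsetD[OF r(3) that, unfolded Compl_iff]])
    show "root x (T x)" "conj_root (T x) \<noteq> T x" if "x \<in> ball z0 r" for x using T(4,5)[OF subsetD[OF r(2) that]] .
    show "z0 \<in> ball z0 r" "phys z0 = T z0" using r(1) T(3) by simp_all
    show "z \<in> ball z0 r" by (rule that)
  qed simp
  have "T holomorphic_on ball z0 r" by (rule holomorphic_on_subset[OF T(2) r(2)])
  then have "phys holomorphic_on ball z0 r" by (rule holomorphic_transform) (simp only: eq)
  from that[OF r(1,3) this] show thesis .
qed

text \<open>The arc cuts the real axis only at \<open>xs\<close>, so on each of the two half-lines
  the branch is determined by one far point, where it must be the larger root.\<close>

lemma phys_real:
  assumes "x \<noteq> xs"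
  shows "of_real x \<notin> Sig" "x < xs \<Longrightarrow> phys (of_real x) = neg_root (of_real x)"
    "x > xs \<Longrightarrow> phys (of_real x) = conj_root (neg_root (of_real x))"
proof -
  have off: "of_real y \<notin> Sig" if "y \<noteq> xs" for y :: real using Sig_real[of "of_real y"] that by auto
  show "of_real x \<notin> Sig" using off assms .
  obtain M where M: "M > 2" "Sig \<subseteq> cball 0 M" "\<And>z. cmod z > M \<Longrightarrow> cmod (conj_root (phys z)) < cmod (phys z)"
    by (rule phys_big) (rule that)
  have nr: "Re (neg_root (of_real y)) < 0" "Im (neg_root (of_real y)) = 0" for y :: real using real_neg_root[of "of_real y"] by auto
  have ncont: "continuous_on (of_real ` J) neg_root" for J :: "real set"
    using nr by (auto intro!: continuous_at_imp_continuous_on neg_root_isCont)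
  have ne: "conj_root (neg_root (of_real y)) \<noteq> neg_root (of_real y)" for y :: real
    using conj_root_Re_pos[OF nr(1)[of y]] nr(1)[of y] by auto
  \<comment> \<open>Over a real point y the roots are real of opposite signs with sum y + 2, so this
    difference of moduli tells which root is the larger.\<close>
  have size: "cmod (conj_root (neg_root (of_real y))) - cmod (neg_root (of_real y)) = y + 2" for y :: real
  proof -
    define n where "n = neg_root (of_real y)"
    have r: "root (of_real y) n" unfolding n_def by (rule neg_root(1))
    obtain k where k: "n = of_real k" "k < 0"
    proof
      show "n = of_real (Re n)" "Re n < 0" using nr[of y] unfolding n_def by (simp_all add: complex_eq_iff)
    qed
    have "conj_root n = of_real y + 2 - of_real k" unfolding root_sum[OF r, symmetric] k(1) by simp
    then have c: "conj_root n = of_real (y + 2 - k)" by simp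
    have "Re (conj_root n) > 0" by (rule conj_root_Re_pos) (simp add: k)
    then have "cmod (conj_root n) = y + 2 - k" unfolding c norm_of_real Re_complex_of_real by (rule abs_of_pos)
    moreover have "cmod n = - k" unfolding k(1) norm_of_real using k(2) by simp
    ultimately show ?thesis by (simp add: n_def)
  qed
  have pc: "phys (of_real y) = neg_root (of_real y) \<or> phys (of_real y) = conj_root (neg_root (of_real y))" if "y \<noteq> xs" for y
    using root_cases[OF neg_root(1) phys_root[OF off[OF that]]] by blast
  have cr: "conj_root (conj_root t) = t" for t by simp
  show "phys (of_real x) = neg_root (of_real x)" if "x < xs"
  proof -
    define a where "a = min (xs - 1) (- M - 1)"
    have a: "a < xs" "a < - M" "a + 2 < 0" using M(1) by (auto simp: a_def)
    have "cmod (complex_of_real a) > M" using a M(1) by simp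
    from M(3)[OF this] have lt: "cmod (conj_root (phys (of_real a))) < cmod (phys (of_real a))" .
    have "phys (of_real a) = neg_root (of_real a)"
      using pc[of a]
    proof
      assume "phys (of_real a) = neg_root (of_real a)"
      then show ?thesis using lt size[of a] a M(1) by simp
    next
      assume "phys (of_real a) = conj_root (neg_root (of_real a))"
      then show ?thesis using lt size[of a] a M(1) by (simp add: cr)
    qed (use a in simp)
    moreover have "connected (complex_of_real ` {..<xs})"
      by (intro connected_continuous_image continuous_intros) auto
    ultimately show ?thesis
    proof (rule_tac branch_unique[of "complex_of_real ` {..<xs}" phys neg_root "of_real a" "of_real x"])
      show "continuous_on (complex_of_real ` {..<xs}) phys" by (rule continuous_on_subset[OF phys_cont]) (use off in auto)
      show "root y (phys y)" if "y \<in> complex_of_real ` {..<xs}" for y using that off phys_root by force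
      show "conj_root (neg_root y) \<noteq> neg_root y" if "y \<in> complex_of_real ` {..<xs}" for y using that ne by force
    qed (use a that ncont neg_root(1) in auto)
  qed
  show "phys (of_real x) = conj_root (neg_root (of_real x))" if "x > xs"
  proof -
    define a where "a = max (xs + 1) (M + 1)"
    have a: "a > xs" "a > M" using M(1) by (auto simp: a_def)
    have "cmod (complex_of_real a) > M" using a M(1) by simp
    from M(3)[OF this] have lt: "cmod (conj_root (phys (of_real a))) < cmod (phys (of_real a))" .
    have "phys (of_real a) = conj_root (neg_root (of_real a))"
      using pc[of a]
    proof
      assume "phys (of_real a) = neg_root (of_real a)"
      then show ?thesis using lt size[of a] a M(1) by simp
    next
      assume "phys (of_real a) = conj_root (neg_root (of_real a))"
      then show ?thesis using lt size[of a] a M(1) by (simp add: cr)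
    qed (use a in simp)
    moreover have "connected (complex_of_real ` {xs<..})"
      by (intro connected_continuous_image continuous_intros) auto
    moreover have "continuous_on (complex_of_real ` {xs<..}) (\<lambda>z. conj_root (neg_root z))"
      unfolding conj_root_def by (intro continuous_intros ncont) (use neg_root(1) root_nz in auto)
    ultimately show ?thesis
    proof (rule_tac branch_unique[of "complex_of_real ` {xs<..}" phys "\<lambda>z. conj_root (neg_root z)" "of_real a" "of_real x"])
      show "continuous_on (complex_of_real ` {xs<..}) phys" by (rule continuous_on_subset[OF phys_cont]) (use off in auto)
      show "root y (phys y)" if "y \<in> complex_of_real ` {xs<..}" for y using that off phys_root by force
      show "root y (conj_root (neg_root y))" if "y \<in> complex_of_real ` {xs<..}" for y using neg_root(1) root_conj_root by blast
      show "conj_root (conj_root (neg_root y)) \<noteq> conj_root (neg_root y)" if "y \<in> complex_of_real ` {xs<..}" for y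
      proof -
        from that obtain k where "y = of_real k" by blast
        then show ?thesis using ne[of k] unfolding cr by simp
      qed
    qed (use a that in auto)
  qed
qed

text \<open>All poles are real and lie to the left of the crossing. There the continued branch is
  the left root, so L(phys) has no finite singularity off the arc.\<close>

lemma pole_phys: assumes "pole z" shows "z \<notin> Sig" "phys z = neg_root z"
proof -
  have "\<exists>x. z = of_real x \<and> x < xs"
  proof (cases "z = of_real (w - 5)")
    case True then show ?thesis using crossing_gt w_le_1 by (intro exI[of _ "w - 5"]) auto
  next
    case False
    then have "z\<^sup>2 = of_real (16 * (1 - w))" using assms by (auto simp: pole_def)
    also have "\<dots> = (of_real (4 * sqrt (1 - w)))\<^sup>2"
      using w_le_1 by (simp add: power_mult_distrib flip: of_real_power)
    finally have "z = of_real (4 * sqrt (1 - w)) \<or> z = - of_real (4 * sqrt (1 - w))" by (simp only: power2_eq_iff)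
    moreover have "4 * sqrt (1 - w) < xs"
    proof (rule power2_less_imp_less)
      show "(4 * sqrt (1 - w))\<^sup>2 < xs\<^sup>2" using crossing_gt w_le_1 by (simp add: power_mult_distrib)
    qed (use crossing_gt in simp)
    moreover have "- (4 * sqrt (1 - w)) < xs" using crossing_gt w_le_1 by (smt (verit) real_sqrt_ge_zero)
    ultimately show ?thesis by (metis of_real_minus)
  qed
  then obtain x where "z = of_real x" "x < xs" by blast
  then show "z \<notin> Sig" "phys z = neg_root z" using phys_real[of x] by auto
qed

lemma phys_regular: assumes "z \<notin> Sig" shows "regular (phys z)"
proof (cases "pole z")
  case True then show ?thesis using pole_phys(2) pole_neg_root(1) regular_neg by metis
next
  case False then show ?thesis using not_pole_num_den(3)[OF phys_root[OF assms]] by blast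
qed

text \<open>The sign condition under which L(phys) is the larger of the two values on both sides of
  the arc, and so has the same upward kink |Re \<psi>| as the potential.\<close>

definition good :: "real \<Rightarrow> bool" where
  "good t \<longleftrightarrow> (\<exists>V. open V \<and> \<Gamma> t \<in> V \<and> (\<forall>z\<in>V - Sig. L (conj_root (phys z)) < L (phys z)))"

text \<open>On one side of the arc the continued branch is T or its conjugate throughout, and Re
  \<psi> has constant sign, so one sample point decides for the whole side.\<close>

lemma side_const:
  assumes K: "connected K" "K \<subseteq> B" "K \<inter> Sig = {}" and T: "continuous_on B T" "\<And>z. z \<in> B \<Longrightarrow> root z (T z)"
    and \<psi>: "\<And>z. z \<in> B \<Longrightarrow> L (T z) - L (conj_root (T z)) = 2 * Re (\<psi> z)"
    and sgn: "(\<forall>z\<in>K. Re (\<psi> z) > 0) \<or> (\<forall>z\<in>K. Re (\<psi> z) < 0)"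
    and a: "a \<in> K" "L (conj_root (phys a)) < L (phys a)" and z: "z \<in> K"
  shows "L (conj_root (phys z)) < L (phys z)"
proof -
  have "(\<forall>x\<in>K. phys x = T x) \<or> (\<forall>x\<in>K. phys x = conj_root (T x))"
  proof (rule branch_dichotomy[OF K(1)])
    show "continuous_on K phys" by (rule continuous_on_subset[OF phys_cont]) (use K in auto)
    show "continuous_on K T" by (rule continuous_on_subset[OF T(1) K(2)])
    show "root x (phys x)" if "x \<in> K" for x using phys_root K(3) that by blast
    show "root x (T x)" if "x \<in> K" for x using T(2) K(2) that by blast
    then show "conj_root (T x) \<noteq> T x" if "x \<in> K" for x using Compl_Sig_disc K(3) that by blast
  qed
  then have *: "(\<forall>x\<in>K. L (phys x) - L (conj_root (phys x)) = 2 * Re (\<psi> x)) \<or>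
      (\<forall>x\<in>K. L (phys x) - L (conj_root (phys x)) = - 2 * Re (\<psi> x))"
  proof
    assume "\<forall>x\<in>K. phys x = T x" then show ?thesis using \<psi> K(2) by auto
  next
    assume c: "\<forall>x\<in>K. phys x = conj_root (T x)"
    have "L (phys x) - L (conj_root (phys x)) = - 2 * Re (\<psi> x)" if "x \<in> K" for x
      using c that \<psi>[of x] K(2) by (simp add: subset_iff)
    then show ?thesis by blast
  qed
  show ?thesis
    using sgn
  proof
    assume p: "\<forall>z\<in>K. Re (\<psi> z) > 0"
    then have "\<forall>x\<in>K. L (phys x) - L (conj_root (phys x)) = 2 * Re (\<psi> x)" using * a by force
    then show ?thesis using p z by force
  next
    assume p: "\<forall>z\<in>K. Re (\<psi> z) < 0"
    then have "\<forall>x\<in>K. L (phys x) - L (conj_root (phys x)) = - 2 * Re (\<psi> x)" using * a by force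
    then show ?thesis using p z by force
  qed
qed

text \<open>Near an interior point both sides of the arc reach every nearby point of it, so the
  property is locally constant along the arc. At the real crossing it can be checked: the difference
  of \<open>L\<close> at the left root and its conjugate changes from positive to negative there,
  while the branch changes from the left root to its conjugate.\<close>

lemma good_all: assumes t: "t \<in> {0<..<1}" shows "good t"
proof -
  have loc: "\<exists>e>0. \<forall>t'\<in>{0<..<1}. dist t' t0 < e \<longrightarrow> good t' = good t0" and star: "\<Gamma> t0 = of_real xs \<Longrightarrow> good t0"
    if t0: "t0 \<in> {0<..<1}" for t0
  proof -
    obtain B \<psi> T F where B': "open B" "\<Gamma> t0 \<in> B" "\<psi> holomorphic_on B" "T holomorphic_on B" "F holomorphic_on B"
      "\<And>z. z \<in> B \<Longrightarrow> root z (T z) \<and> conj_root (T z) \<noteq> T z \<and> \<not> pole z"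
      "\<And>z. z \<in> B \<Longrightarrow> L (T z) - L (conj_root (T z)) = 2 * Re (\<psi> z)"
      "\<And>z. z \<in> B \<Longrightarrow> z \<in> Sig \<longleftrightarrow> Re (\<psi> z) = 0"
      "connected {z\<in>B. Re (\<psi> z) > 0}" "connected {z\<in>B. Re (\<psi> z) < 0}"
      "\<And>z. z \<in> B \<Longrightarrow> Re (\<psi> z) = 0 \<Longrightarrow> z \<in> closure {z\<in>B. Re (\<psi> z) > 0} \<and> z \<in> closure {z\<in>B. Re (\<psi> z) < 0}"
      "\<And>z. z \<in> B \<Longrightarrow> integrable Mt (\<lambda>t. ln (cmod (z - \<Gamma> t))) \<and> U z = \<bar>Re (\<psi> z)\<bar> + Re (F z)"
      by (rule local_structure[OF t0]) (rule that)
    note B = B'(1,2,4,6,7,8,9,10,11)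
    have Tc: "continuous_on B T" using B(3) by (rule holomorphic_on_imp_continuous_on)
    have sides: "L (conj_root (phys z)) < L (phys z)"
      if ab: "a \<in> B" "Re (\<psi> a) > 0" "L (conj_root (phys a)) < L (phys a)"
        "b \<in> B" "Re (\<psi> b) < 0" "L (conj_root (phys b)) < L (phys b)" and z: "z \<in> B - Sig" for a b z
    proof -
      have "Re (\<psi> z) > 0 \<or> Re (\<psi> z) < 0" using z B(6)[of z] by auto
      then show ?thesis
      proof
        assume "Re (\<psi> z) > 0"
        then show ?thesis
          by (intro side_const[OF B(7) _ _ Tc, of \<psi> a z]) (use ab z B in auto)
      next
        assume "Re (\<psi> z) < 0"
        then show ?thesis
          by (intro side_const[OF B(8) _ _ Tc, of \<psi> b z]) (use ab z B in auto)
      qed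
    qed
    have all: "\<forall>z\<in>B - Sig. L (conj_root (phys z)) < L (phys z)" if g: "good s" "\<Gamma> s \<in> B" "s \<in> {0..1}" for s
    proof -
      obtain V where V: "open V" "\<Gamma> s \<in> V" "\<forall>z\<in>V - Sig. L (conj_root (phys z)) < L (phys z)"
        using g(1) by (auto simp: good_def)
      have "Re (\<psi> (\<Gamma> s)) = 0" using B(6)[OF g(2)] g(3) by (auto simp: Sig_def)
      then have cl: "\<Gamma> s \<in> closure {z\<in>B. Re (\<psi> z) > 0}" "\<Gamma> s \<in> closure {z\<in>B. Re (\<psi> z) < 0}" using B(9)[OF g(2)] by auto
      obtain a where a: "a \<in> V" "a \<in> B" "Re (\<psi> a) > 0"
        using open_Int_closure_eq_empty[OF V(1), of "{z\<in>B. Re (\<psi> z) > 0}"] V(2) cl(1) by auto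
      obtain b where b: "b \<in> V" "b \<in> B" "Re (\<psi> b) < 0"
        using open_Int_closure_eq_empty[OF V(1), of "{z\<in>B. Re (\<psi> z) < 0}"] V(2) cl(2) by auto
      have "a \<notin> Sig" "b \<notin> Sig" using B(6) a b by auto
      then show ?thesis using sides[of a b] a b V(3) by blast
    qed
    show "\<exists>e>0. \<forall>t'\<in>{0<..<1}. dist t' t0 < e \<longrightarrow> good t' = good t0"
    proof -
      obtain r where r: "r > 0" "ball (\<Gamma> t0) r \<subseteq> B" using B openE by blast
      obtain e where e: "e > 0" "\<And>t'. dist t' t0 < e \<Longrightarrow> \<Gamma> t' \<in> ball (\<Gamma> t0) r"
        using Gamma_isCont[of t0] r(1) unfolding continuous_at_eps_delta by (auto simp: dist_commute)
      have "good t' = good t0" if t': "t' \<in> {0<..<1}" "dist t' t0 < e" for t'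
      proof -
        have tB: "\<Gamma> t' \<in> B" using e(2)[OF t'(2)] r(2) by blast
        show ?thesis
        proof
          assume "good t'"
          from all[OF this tB] t'(1) show "good t0" unfolding good_def using B(1,2) by auto
        next
          assume "good t0"
          from all[OF this B(2)] t0 show "good t'" unfolding good_def using B(1) tB by auto
        qed
      qed
      then show ?thesis using e(1) by blast
    qed
    show "good t0" if x: "\<Gamma> t0 = of_real xs"
    proof -
      obtain r where r: "r > 0" "ball (of_real xs) r \<subseteq> B" using B(1,2) x openE by metis
      have "continuous_on UNIV (\<lambda>y::real. y\<^sup>2)" by (intro continuous_intros)
      define m where "m = 4 * sqrt (1 - w)"
      have m: "0 \<le> m" "m < xs"
      proof -
        show "0 \<le> m" using w_le_1 by (simp add: m_def)
        show "m < xs" by (rule power2_less_imp_less) (use crossing_gt w_le_1 in \<open>auto simp: m_def power_mult_distrib\<close>)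
      qed
      \<comment> \<open>Small enough for the real segment around \<open>xs\<close> to stay inside
        \<open>B\<close> and to the right of the poles, where \<open>dL\<close> is strictly
        decreasing.\<close>
      define \<eta> where "\<eta> = min r (xs - m) / 2"
      have \<eta>: "\<eta> > 0" "\<eta> < r" "xs - \<eta> > m" using r(1) m by (auto simp: \<eta>_def min_def field_simps)
      define J where "J = complex_of_real ` {xs - \<eta>..xs + \<eta>}"
      have JB: "J \<subseteq> B"
      proof -
        have "J \<subseteq> ball (of_real xs) r" using \<eta> by (auto simp: J_def dist_real_def simp flip: of_real_diff)
        then show ?thesis using r(2) by blast
      qed
      have sq: "(xs - \<eta>)\<^sup>2 > 16 * (1 - w)" "0 < xs - \<eta>" "xs\<^sup>2 > 16 * (1 - w)"
      proof -
        have "m\<^sup>2 < (xs - \<eta>)\<^sup>2" using \<eta> m by (intro power_strict_mono) auto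
        then show "(xs - \<eta>)\<^sup>2 > 16 * (1 - w)" using w_le_1 by (simp add: m_def power_mult_distrib)
      qed (use \<eta> m crossing_gt in auto)
      have d0: "dL (of_real xs) = 0"
        using balanced(1)[OF t0, of "neg_root (of_real xs)"] neg_root(1) x by (simp add: dL_def)
      have dm: "dL (of_real (xs - \<eta>)) > 0" using dL_real_decreasing[of "xs - \<eta>" xs] \<eta> sq d0 by simp
      have dp: "dL (of_real (xs + \<eta>)) < 0" using dL_real_decreasing[of xs "xs + \<eta>"] \<eta> sq d0 crossing_gt by simp
      have gm: "L (conj_root (phys (of_real (xs - \<eta>)))) < L (phys (of_real (xs - \<eta>)))"
        using phys_real(2)[of "xs - \<eta>"] \<eta> dm by (simp add: dL_def)
      have gp: "L (conj_root (phys (of_real (xs + \<eta>)))) < L (phys (of_real (xs + \<eta>)))"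
        using phys_real(3)[of "xs + \<eta>"] \<eta> dp by (simp add: dL_def)
      have "(\<forall>x\<in>J. T x = neg_root x) \<or> (\<forall>x\<in>J. T x = conj_root (neg_root x))"
      proof (rule branch_dichotomy)
        show "connected J" unfolding J_def by (intro connected_continuous_image continuous_intros) auto
        show "continuous_on J T" by (rule continuous_on_subset[OF Tc JB])
        have nr: "Re (neg_root x) < 0" if "x \<in> J" for x using real_neg_root(1)[of x] that by (auto simp: J_def)
        show "continuous_on J neg_root" using nr by (intro continuous_at_imp_continuous_on ballI neg_root_isCont)
        show "conj_root (neg_root x) \<noteq> neg_root x" if "x \<in> J" for x
          using nr[OF that] conj_root_Re_pos[OF nr[OF that]] by auto
      qed (use B(4) JB neg_root in auto)
      note dich = this
      have J: "of_real (xs - \<eta>) \<in> J" "of_real (xs + \<eta>) \<in> J" unfolding J_def by (intro imageI; use \<eta>(1) in simp)+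
      from dich have "(2 * Re (\<psi> (of_real (xs - \<eta>))) = dL (of_real (xs - \<eta>)) \<and> 2 * Re (\<psi> (of_real (xs + \<eta>))) = dL (of_real (xs + \<eta>)))
        \<or> (2 * Re (\<psi> (of_real (xs - \<eta>))) = - dL (of_real (xs - \<eta>)) \<and> 2 * Re (\<psi> (of_real (xs + \<eta>))) = - dL (of_real (xs + \<eta>)))"
      proof
        assume a: "\<forall>x\<in>J. T x = neg_root x"
        show ?thesis using B(5)[OF subsetD[OF JB J(1)]] B(5)[OF subsetD[OF JB J(2)]] a[rule_format, OF J(1)] a[rule_format, OF J(2)]
          by (simp add: dL_def)
      next
        assume a: "\<forall>x\<in>J. T x = conj_root (neg_root x)"
        show ?thesis using B(5)[OF subsetD[OF JB J(1)]] B(5)[OF subsetD[OF JB J(2)]] a[rule_format, OF J(1)] a[rule_format, OF J(2)]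
          by (simp add: dL_def)
      qed
      then have "\<forall>z\<in>B - Sig. L (conj_root (phys z)) < L (phys z)"
      proof
        assume "2 * Re (\<psi> (of_real (xs - \<eta>))) = dL (of_real (xs - \<eta>)) \<and> 2 * Re (\<psi> (of_real (xs + \<eta>))) = dL (of_real (xs + \<eta>))"
        then have "Re (\<psi> (of_real (xs - \<eta>))) > 0" "Re (\<psi> (of_real (xs + \<eta>))) < 0" using dm dp by linarith+
        then show ?thesis using sides[of "of_real (xs - \<eta>)" "of_real (xs + \<eta>)"] gm gp subsetD[OF JB J(1)] subsetD[OF JB J(2)] by blast
      next
        assume "2 * Re (\<psi> (of_real (xs - \<eta>))) = - dL (of_real (xs - \<eta>)) \<and> 2 * Re (\<psi> (of_real (xs + \<eta>))) = - dL (of_real (xs + \<eta>))"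
        then have "Re (\<psi> (of_real (xs - \<eta>))) < 0" "Re (\<psi> (of_real (xs + \<eta>))) > 0" using dm dp by linarith+
        then show ?thesis using sides[of "of_real (xs + \<eta>)" "of_real (xs - \<eta>)"] gm gp subsetD[OF JB J(1)] subsetD[OF JB J(2)] by blast
      qed
      then show ?thesis unfolding good_def using B(1,2) by blast
    qed
  qed
  have const: "good constant_on {0<..<1}"
  proof (rule locally_constant_imp_constant)
    show "connected {0<..<1::real}" by simp
    show "\<exists>T. openin (top_of_set {0<..<1}) T \<and> a \<in> T \<and> (\<forall>x\<in>T. good x = good a)" if a: "a \<in> {0<..<1}" for a
    proof -
      obtain e where e: "e > 0" "\<forall>t'\<in>{0<..<1}. dist t' a < e \<longrightarrow> good t' = good a" using loc[OF a] by blast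
      show ?thesis
      proof (intro exI conjI)
        show "openin (top_of_set {0<..<1}) ({0<..<1} \<inter> ball a e)" by (intro openin_open_Int open_ball)
        show "a \<in> {0<..<1} \<inter> ball a e" using a e(1) by simp
        show "\<forall>x\<in>{0<..<1} \<inter> ball a e. good x = good a" using e(2) by (metis IntD1 IntD2 dist_commute mem_ball)
      qed
    qed
  qed
  have "of_real xs \<in> \<Gamma> ` {0..1}" using crossing by blast
  then obtain t' where t': "t' \<in> {0..1}" "\<Gamma> t' = of_real xs" by force
  \<comment> \<open>The end points are conjugate and distinct, hence not real, so the crossing has
    an interior parameter.\<close>
  have nreal: "Im (\<Gamma> 0) \<noteq> 0" "Im (\<Gamma> 1) \<noteq> 0"
      proof -
    have ne: "\<Gamma> 0 \<noteq> \<Gamma> 1" using inj_onD[OF Gamma_inj, of 0 1] by auto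
    show "Im (\<Gamma> 0) \<noteq> 0"
    proof
      assume "Im (\<Gamma> 0) = 0"
      then have "cnj (\<Gamma> 0) = \<Gamma> 0" by (simp add: complex_eq_iff)
      then show False using ne cnj_ends by simp
    qed
    then show "Im (\<Gamma> 1) \<noteq> 0" using arg_cong[OF cnj_ends, of Im] by simp
  qed
  then have "t' \<noteq> 0" "t' \<noteq> 1" using t'(2) by auto
  then have "t' \<in> {0<..<1}" using t'(1) by auto
  then show ?thesis using const star[OF _ t'(2)] t unfolding constant_on_def by metis
qed

end

section \<open>Identification of the potential with \<open>L\<close> at the continued root\<close>

text \<open>A crude uniform bound: the real part is at most ln 2 \<le> 1 in modulus and the
  imaginary part at most pi < 4.\<close>

lemma norm_Ln_one_minus: assumes "cmod u \<le> 1 / 2" shows "cmod (Ln (1 - u)) \<le> 5"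
proof -
  have lo: "1 / 2 \<le> cmod (1 - u)" using norm_triangle_ineq2[of 1 u] assms by simp
  have hi: "cmod (1 - u) \<le> 2" using norm_triangle_ineq4[of 1 u] assms by simp
  have nz: "1 - u \<noteq> 0" using lo by auto
  have ln2: "ln (2::real) \<le> 1" using ln_le_minus_one[of 2] by simp
  have "ln (cmod (1 - u)) \<le> ln 2" using hi nz by (subst ln_le_cancel_iff) auto
  moreover have "ln (1 / 2 :: real) \<le> ln (cmod (1 - u))" using lo nz by (subst ln_le_cancel_iff) auto
  moreover have "ln (1 / 2 :: real) = - ln 2" by (simp add: ln_div)
  ultimately have "\<bar>ln (cmod (1 - u))\<bar> \<le> 1" using ln2 by linarith
  then have "\<bar>Re (Ln (1 - u))\<bar> \<le> 1" unfolding Re_Ln[OF nz] .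
  moreover have "\<bar>Im (Ln (1 - u))\<bar> \<le> pi" using mpi_less_Im_Ln[OF nz] Im_Ln_le_pi[OF nz] by simp
  ultimately show ?thesis using cmod_le[of "Ln (1 - u)"] pi_less_4 by simp
qed

text \<open>The algebra behind the small root in the chart \<zeta> = 1 / z: \<zeta> k solves the
  root equation multiplied by \<zeta>. The factor Q is cleared by multiplying with its
  square.\<close>

lemma small_root_equation:
  fixes \<zeta> Q k c :: complex
  assumes "Q\<^sup>2 = 2 * (1 + 2 * \<zeta>) * Q + 12 * c * \<zeta>\<^sup>2" "k * Q = - (6 * c)" "Q \<noteq> 0"
  shows "\<zeta> * (\<zeta> * k)\<^sup>2 = (1 + 2 * \<zeta>) * (\<zeta> * k) + 3 * c * \<zeta>"
proof -
  have "(\<zeta> * (\<zeta> * k)\<^sup>2) * Q\<^sup>2 = ((1 + 2 * \<zeta>) * (\<zeta> * k) + 3 * c * \<zeta>) * Q\<^sup>2"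
    using assms(1,2) by algebra
  then show ?thesis using assms(3) by simp
qed

context trajectory_core
begin

text \<open>On the arc, where no continued branch exists, the mean of the two values of
  \<open>L\<close> does not depend on the choice of the root and is the value that makes the
  difference harmonic across the arc.\<close>

definition X :: "complex \<Rightarrow> real" where
  "X z = U z - (if z \<in> Sig then (L (neg_root z) + L (conj_root (neg_root z))) / 2 else L (phys z))"

lemma Gamma_Sig: "t \<in> {0..1} \<Longrightarrow> \<Gamma> t \<in> Sig" by (simp add: Sig_def)

lemma U_harmonic:
  assumes "p \<notin> Sig"
  shows "harmonic_at U p" and "integrable Mt (\<lambda>t. ln (cmod (p - \<Gamma> t)))"
proof -
  have "p \<in> - Sig" using assms by simp
  from openE[OF open_Compl_Sig this] obtain r where r: "r > 0" "ball p r \<subseteq> - Sig" .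
  have far: "r \<le> cmod (\<Gamma> t - p)" if "t \<in> {0<..<1}" for t
  proof (rule ccontr)
    assume "\<not> r \<le> cmod (\<Gamma> t - p)"
    then have "\<Gamma> t \<in> ball p r" by (simp add: dist_norm norm_minus_commute)
    then show False using r(2) Gamma_Sig[of t] that by auto
  qed
  obtain F where F: "F holomorphic_on ball p (r / 2)"
    "\<And>z. z \<in> ball p (r / 2) \<Longrightarrow> integrable Mt (\<lambda>t. indicator {0<..<1} t * ln (cmod (z - \<Gamma> t))) \<and>
       (\<integral>t. indicator {0<..<1} t * ln (cmod (z - \<Gamma> t)) \<partial>Mt) = Re (F z)"
    by (rule rest_potential[OF _ subset_refl r(1) far]) (simp, assumption, rule that)
  have ae: "AE t in Mt. indicator {0<..<1} t * ln (cmod (z - \<Gamma> t)) = ln (cmod (z - \<Gamma> t))"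
      "AE t in Mt. ln (cmod (z - \<Gamma> t)) = indicator {0<..<1} t * ln (cmod (z - \<Gamma> t))" for z
    using AE_Mt[of 0] by (eventually_elim, simp)+
  have int: "integrable Mt (\<lambda>t. ln (cmod (z - \<Gamma> t)))" "U z = Re (F z)" if "z \<in> ball p (r / 2)" for z
  proof -
    show "integrable Mt (\<lambda>t. ln (cmod (z - \<Gamma> t)))"
    proof (rule integrable_cong_AE_imp[OF conjunct1[OF F(2)[OF that]]])
      show "(\<lambda>t. ln (cmod (z - \<Gamma> t))) \<in> borel_measurable Mt" by measurable
    qed (rule ae)
    have "U z = (\<integral>t. indicator {0<..<1} t * ln (cmod (z - \<Gamma> t)) \<partial>Mt)" unfolding U_def
    proof (rule integral_cong_AE)
      show "(\<lambda>t. ln (cmod (z - \<Gamma> t))) \<in> borel_measurable Mt" by measurable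
      show "(\<lambda>t. indicator {0<..<1} t * ln (cmod (z - \<Gamma> t))) \<in> borel_measurable Mt" by measurable
    qed (rule ae)
    then show "U z = Re (F z)" using F(2)[OF that] by simp
  qed
  show "harmonic_at U p" by (rule harmonic_atI[OF F(1)]) (use int r(1) in auto)
  show "integrable Mt (\<lambda>t. ln (cmod (p - \<Gamma> t)))" using int(1)[of p] r(1) by simp
qed

lemma X_harmonic_off: assumes "p \<notin> Sig" shows "harmonic_at X p"
proof -
  obtain r where r: "r > 0" "ball p r \<subseteq> - Sig" "phys holomorphic_on ball p r" by (rule phys_local[OF assms]) (rule that)
  have "harmonic_at (\<lambda>z. L (phys z)) p"
    by (rule harmonic_at_compose[OF L_harmonic[OF phys_regular[OF assms]] r(3)]) (use r(1) in auto)
  then have h: "harmonic_at (\<lambda>z. U z - L (phys z)) p" by (rule harmonic_at_diff[OF U_harmonic(1)[OF assms]])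
  show ?thesis by (rule harmonic_at_cong[OF h, of "ball p r"]) (use r in \<open>auto simp: X_def\<close>)
qed

text \<open>Since the branch carries the larger value on both sides, L(phys) is |Re \<psi>| plus the
  mean over the two roots. The same |Re \<psi>| occurs in the potential, so the kinks
  cancel.\<close>

lemma X_harmonic_on: assumes t0: "t0 \<in> {0<..<1}"
  shows "harmonic_at X (\<Gamma> t0)" "integrable Mt (\<lambda>t. ln (cmod (\<Gamma> t0 - \<Gamma> t)))"
proof -
  obtain B \<psi> T F where B: "open B" "\<Gamma> t0 \<in> B" "\<psi> holomorphic_on B" "T holomorphic_on B" "F holomorphic_on B"
      "\<And>z. z \<in> B \<Longrightarrow> root z (T z) \<and> conj_root (T z) \<noteq> T z \<and> \<not> pole z"
      "\<And>z. z \<in> B \<Longrightarrow> L (T z) - L (conj_root (T z)) = 2 * Re (\<psi> z)"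
      "\<And>z. z \<in> B \<Longrightarrow> z \<in> Sig \<longleftrightarrow> Re (\<psi> z) = 0"
      "connected {z\<in>B. Re (\<psi> z) > 0}" "connected {z\<in>B. Re (\<psi> z) < 0}"
      "\<And>z. z \<in> B \<Longrightarrow> Re (\<psi> z) = 0 \<Longrightarrow> z \<in> closure {z\<in>B. Re (\<psi> z) > 0} \<and> z \<in> closure {z\<in>B. Re (\<psi> z) < 0}"
      "\<And>z. z \<in> B \<Longrightarrow> integrable Mt (\<lambda>t. ln (cmod (z - \<Gamma> t))) \<and> U z = \<bar>Re (\<psi> z)\<bar> + Re (F z)"
    by (rule local_structure[OF t0]) (rule that)
  obtain V where V: "open V" "\<Gamma> t0 \<in> V" "\<forall>z\<in>V - Sig. L (conj_root (phys z)) < L (phys z)"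
    using good_all[OF t0] unfolding good_def by (elim exE conjE) (rule that)
  show "integrable Mt (\<lambda>t. ln (cmod (\<Gamma> t0 - \<Gamma> t)))" using B(12)[OF B(2)] ..
  have reg: "regular (T (\<Gamma> t0))" "regular (conj_root (T (\<Gamma> t0)))"
  proof -
    have r: "root (\<Gamma> t0) (T (\<Gamma> t0))" "\<not> pole (\<Gamma> t0)" using B(6)[OF B(2)] by simp_all
    show "regular (T (\<Gamma> t0))" by (rule not_pole_num_den(3)[OF r])
    show "regular (conj_root (T (\<Gamma> t0)))" by (rule not_pole_num_den(3)[OF root_conj_root[OF r(1)] r(2)])
  qed
  have Tnz: "T z \<noteq> 0" if "z \<in> B" for z by (rule root_nz[OF conjunct1[OF B(6)[OF that]]])
  have "(\<lambda>z. conj_root (T z)) holomorphic_on B" unfolding conj_root_def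
    by (intro holomorphic_intros B(4)) (use Tnz in auto)
  note ch = this
  note hb = harmonic_at_compose[of L T, OF L_harmonic[OF reg(1)] B(4,1,2)]
  note hc = harmonic_at_compose[of L "\<lambda>z. conj_root (T z)", OF L_harmonic[OF reg(2)] ch B(1,2)]
  have h: "harmonic_at (\<lambda>z. Re (F z) - (1/2) * (L (T z) + L (conj_root (T z)))) (\<Gamma> t0)"
    by (intro harmonic_at_diff harmonic_at_cmult harmonic_at_add hb hc harmonic_atI[OF B(5,1,2) refl])
  show "harmonic_at X (\<Gamma> t0)"
  proof (rule harmonic_at_cong[OF h, of "B \<inter> V"])
    fix z assume z: "z \<in> B \<inter> V"
    have zB: "z \<in> B" using z by simp
    have rt: "root z (T z)" using B(6)[OF zB] by simp
    note Uz = conjunct2[OF B(12)[OF zB]] and d = B(7)[OF zB]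
    have cc: "conj_root (conj_root (T z)) = T z" by simp
    have half: "x = \<bar>r\<bar> + (x + y) / 2" if "y < x" "x - y = 2 * r" for x y r :: real using that by (simp add: abs_if field_simps)
    have half2: "x = \<bar>r\<bar> + (x + y) / 2" if "y < x" "y - x = 2 * r" for x y r :: real using that by (simp add: abs_if field_simps)
    show "Re (F z) - (1/2) * (L (T z) + L (conj_root (T z))) = X z"
    proof (cases "z \<in> Sig")
      case True
      have "neg_root z = T z \<or> neg_root z = conj_root (T z)" by (rule root_cases[OF rt neg_root(1)])
      then have "L (neg_root z) + L (conj_root (neg_root z)) = L (T z) + L (conj_root (T z))"
      proof
        assume e: "neg_root z = T z" show ?thesis unfolding e ..
      next
        assume e: "neg_root z = conj_root (T z)" show ?thesis unfolding e cc by (rule add.commute)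
      qed
      moreover have "Re (\<psi> z) = 0" using B(8)[OF zB] True by simp
      ultimately show ?thesis unfolding X_def Uz if_P[OF True] by simp
    next
      case False
      have lt: "L (conj_root (phys z)) < L (phys z)" using bspec[OF V(3), of z] z False by simp
      have "phys z = T z \<or> phys z = conj_root (T z)" by (rule root_cases[OF rt phys_root[OF False]])
      then have "L (phys z) = \<bar>Re (\<psi> z)\<bar> + (L (T z) + L (conj_root (T z))) / 2"
      proof
        assume e: "phys z = T z"
        show ?thesis unfolding e by (rule half[OF lt[unfolded e]]) (use d in simp)
      next
        assume e: "phys z = conj_root (T z)"
        show ?thesis unfolding e add.commute[of "L (T z)"] by (rule half2[OF lt[unfolded e cc]]) (use d in simp)
      qed
      then show ?thesis unfolding X_def Uz if_not_P[OF False] by simp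
    qed
  qed (use B(1,2) V(1,2) in \<open>simp_all add: open_Int\<close>)
qed

lemma X_harmonic: assumes "p \<noteq> \<Gamma> 0" "p \<noteq> \<Gamma> 1"
  shows "harmonic_at X p" "integrable Mt (\<lambda>t. ln (cmod (p - \<Gamma> t)))"
proof -
  have "p \<notin> Sig \<or> (\<exists>t\<in>{0<..<1}. p = \<Gamma> t)"
  proof (cases "p \<in> Sig")
    case True
    then obtain t where t: "t \<in> {0..1}" "p = \<Gamma> t" by (auto simp: Sig_def)
    then have "t \<noteq> 0" "t \<noteq> 1" using assms by auto
    then show ?thesis using t by (intro disjI2 bexI[of _ t]) auto
  qed simp
  then show "harmonic_at X p" "integrable Mt (\<lambda>t. ln (cmod (p - \<Gamma> t)))"
    using X_harmonic_off U_harmonic(2) X_harmonic_on by auto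
qed

lemma Sig_bound: obtains M where "M > 0" "\<And>t. t \<in> {0..1} \<Longrightarrow> cmod (\<Gamma> t) < M"
proof -
  obtain M where M: "0 < M \<and> Sig \<subseteq> ball 0 M" using bounded_subset_ballD[OF compact_imp_bounded[OF compact_Sig]] ..
  have "cmod (\<Gamma> t) < M" if "t \<in> {0..1}" for t using M Gamma_Sig[OF that] by auto
  then show thesis using that M by blast
qed

text \<open>In the chart \<zeta> = 1 / z both U + ln |\<zeta>| and L(phys) + ln |\<zeta>| extend
  harmonically to \<zeta> = 0 with value 0: the measure has mass one, and Y(t) ~ t ~ z at the large
  root.\<close>

lemma X_infinity:
  obtains V \<rho> where "\<rho> > 0" "harmonic_at V 0" "V 0 = 0" "\<And>\<zeta>. \<zeta> \<in> ball 0 \<rho> \<Longrightarrow> \<zeta> \<noteq> 0 \<Longrightarrow> V \<zeta> = X (inverse \<zeta>)"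
proof -
  obtain M where M: "M > 0" "\<And>t. t \<in> {0..1} \<Longrightarrow> cmod (\<Gamma> t) < M" by (rule Sig_bound) (rule that)
  obtain M2 where M2: "M2 > 2" "Sig \<subseteq> cball 0 M2" "\<And>z. cmod z > M2 \<Longrightarrow> cmod (conj_root (phys z)) < cmod (phys z)"
    by (rule phys_big) (rule that)
  define F where "F \<zeta> t = of_real (indicator {0<..<1} t) * Ln (1 - \<zeta> * \<Gamma> t)" for \<zeta> t
  define \<rho>1 where "\<rho>1 = 1 / (2 * M)"
  have \<rho>1: "\<rho>1 > 0" using M by (simp add: \<rho>1_def)
  have small: "cmod (\<zeta> * \<Gamma> t) \<le> 1 / 2" if "\<zeta> \<in> ball 0 \<rho>1" "t \<in> {0<..<1}" for \<zeta> t
  proof -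
    have "cmod \<zeta> * cmod (\<Gamma> t) \<le> \<rho>1 * M" using that M(2)[of t] M(1) \<rho>1 by (intro mult_mono) auto
    then show ?thesis using M(1) by (simp add: norm_mult \<rho>1_def)
  qed
  have right: "1 - \<zeta> * \<Gamma> t \<notin> \<real>\<^sub>\<le>\<^sub>0" if "\<zeta> \<in> ball 0 \<rho>1" "t \<in> {0<..<1}" for \<zeta> t
  proof -
    have "Re (\<zeta> * \<Gamma> t) \<le> 1 / 2" using small[OF that] complex_Re_le_cmod[of "\<zeta> * \<Gamma> t"] by (rule order_trans[rotated])
    then have "Re (1 - \<zeta> * \<Gamma> t) > 0" by (simp only: minus_complex.sel one_complex.sel)
    then show ?thesis using complex_nonpos_Reals_iff by (metis not_le)
  qed
  have hol: "(\<lambda>\<zeta>. \<integral>t. F \<zeta> t \<partial>Mt) holomorphic_on ball 0 \<rho>1"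
  proof (rule holomorphic_on_lebesgue_integral[where g = "\<lambda>_. 5"])
    show "(\<lambda>\<zeta>. F \<zeta> t) holomorphic_on ball 0 \<rho>1" for t
    proof (cases "t \<in> {0<..<1}")
      case True
      have "(\<lambda>\<zeta>. Ln (1 - \<zeta> * \<Gamma> t)) holomorphic_on ball 0 \<rho>1"
        by (intro holomorphic_intros) (rule right[OF _ True])
      then show ?thesis using True by (simp add: F_def)
    qed (simp add: F_def)
    show "F \<zeta> \<in> borel_measurable Mt" for \<zeta>
    proof -
      have m: "(\<lambda>t. 1 - \<zeta> * \<Gamma> t) \<in> borel_measurable Mt" by measurable
      have "(\<lambda>t. Ln (1 - \<zeta> * \<Gamma> t)) \<in> borel_measurable Mt" using measurable_compose[OF m borel_measurable_Ln] .
      then show ?thesis unfolding F_def by measurable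
    qed
    show "norm (F \<zeta> t) \<le> 5" if "\<zeta> \<in> ball 0 \<rho>1" for \<zeta> t
      using norm_Ln_one_minus[OF small[OF that, of t]] by (cases "t \<in> {0<..<1}") (simp_all add: F_def)
    show "integrable Mt (\<lambda>_. 5 :: real)" by simp
  qed simp
  define P where "P \<zeta> = (\<integral>t. F \<zeta> t \<partial>Mt)" for \<zeta>
  have P: "P holomorphic_on ball 0 \<rho>1" by (rule holomorphic_transform[OF hol]) (simp add: P_def)
  have P0: "P 0 = 0" by (simp add: P_def F_def)
  have Fint: "integrable Mt (F \<zeta>)" if "\<zeta> \<in> ball 0 \<rho>1" for \<zeta>
  proof (rule integrable_const_bound[where B = 5])
    show "AE t in Mt. norm (F \<zeta> t) \<le> 5"
      using norm_Ln_one_minus[OF small[OF that]] by (intro AE_I2) (simp add: F_def indicator_def)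
    have m: "(\<lambda>t. 1 - \<zeta> * \<Gamma> t) \<in> borel_measurable Mt" by measurable
    have "(\<lambda>t. Ln (1 - \<zeta> * \<Gamma> t)) \<in> borel_measurable Mt" using measurable_compose[OF m borel_measurable_Ln] .
    then show "F \<zeta> \<in> borel_measurable Mt" unfolding F_def by measurable
  qed
  have PU: "Re (P \<zeta>) = U (inverse \<zeta>) + ln (cmod \<zeta>)" if z: "\<zeta> \<in> ball 0 \<rho>1" "\<zeta> \<noteq> 0" for \<zeta>
  proof -
    have key: "Re (F \<zeta> t) = ln (cmod (inverse \<zeta> - \<Gamma> t)) + ln (cmod \<zeta>)" if t: "t \<in> {0<..<1}" for t
    proof -
      have "1 - \<zeta> * \<Gamma> t \<noteq> 0" using right[OF z(1) t] by auto
      then have a: "Re (F \<zeta> t) = ln (cmod (1 - \<zeta> * \<Gamma> t))" using t by (simp add: F_def)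
      have "1 - \<zeta> * \<Gamma> t = (inverse \<zeta> - \<Gamma> t) * \<zeta>" using z(2) by (simp add: algebra_simps)
      then have b: "cmod (1 - \<zeta> * \<Gamma> t) = cmod (inverse \<zeta> - \<Gamma> t) * cmod \<zeta>" by (simp only: norm_mult)
      have "cmod (inverse \<zeta> - \<Gamma> t) \<noteq> 0" using b \<open>1 - \<zeta> * \<Gamma> t \<noteq> 0\<close> by (metis mult_zero_left norm_eq_zero)
      then show ?thesis unfolding a b using z(2) by (subst ln_mult) auto
    qed
    have ae: "AE t in Mt. Re (F \<zeta> t) - ln (cmod \<zeta>) = ln (cmod (inverse \<zeta> - \<Gamma> t))"
      using AE_Mt[of 0] by eventually_elim (simp add: key)
    have re: "integrable Mt (\<lambda>t. Re (F \<zeta> t))" using Fint[OF z(1)] by (rule integrable_Re)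
    have "U (inverse \<zeta>) = (\<integral>t. Re (F \<zeta> t) - ln (cmod \<zeta>) \<partial>Mt)" unfolding U_def
    proof (rule integral_cong_AE)
      show "(\<lambda>t. Re (F \<zeta> t) - ln (cmod \<zeta>)) \<in> borel_measurable Mt" using borel_measurable_integrable[OF re] by measurable
      show "AE t in Mt. ln (cmod (inverse \<zeta> - \<Gamma> t)) = Re (F \<zeta> t) - ln (cmod \<zeta>)" using ae by eventually_elim simp
    qed measurable
    also have "\<dots> = (\<integral>t. Re (F \<zeta> t) \<partial>Mt) - ln (cmod \<zeta>)"
      using re prob_space.prob_space[OF prob_Mt] by (simp add: Bochner_Integration.integral_diff)
    also have "(\<integral>t. Re (F \<zeta> t) \<partial>Mt) = Re (P \<zeta>)" unfolding P_def using Fint[OF z(1)] by simp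
    finally show ?thesis by simp
  qed
  \<comment> \<open>The small root is written as -6w \<zeta> / (1 + 2 \<zeta> + sqrt D), the form
    without cancellation, which is holomorphic at \<zeta> = 0; \<open>f\<close> is - \<zeta> times Y
    at its conjugate, the large root.\<close>
  define D where "D \<zeta> = (1 + 2 * \<zeta>)\<^sup>2 + of_real (12 * w) * \<zeta>\<^sup>2" for \<zeta> :: complex
  define q where "q \<zeta> = 1 + 2 * \<zeta> + csqrt (D \<zeta>)" for \<zeta>
  define k where "k \<zeta> = - of_real (6 * w) / q \<zeta>" for \<zeta>
  define s where "s \<zeta> = \<zeta> * k \<zeta>" for \<zeta>
  define f where "f \<zeta> = 27 * ((s \<zeta>)\<^sup>2 + 2 * s \<zeta> + of_real w) / (k \<zeta> * (s \<zeta> + 3)\<^sup>2)" for \<zeta>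
  have Dc: "isCont D 0" unfolding D_def by (intro continuous_intros)
  have D0: "D 0 = 1" by (simp add: D_def)
  have q0: "q 0 = 2" by (simp add: q_def D0)
  have qc: "isCont q 0" unfolding q_def by (intro continuous_intros continuous_at_compose[OF Dc, unfolded o_def]) (simp add: D0)
  have kc: "isCont k 0" unfolding k_def using qc q0 by (intro continuous_intros) auto
  have sc: "isCont s 0" unfolding s_def using kc by (intro continuous_intros) auto
  have k0: "k 0 = - of_real (3 * w)" by (simp add: k_def q0)
  have s0: "s 0 = 0" by (simp add: s_def)
  have fc: "isCont f 0" unfolding f_def using sc kc s0 k0 w_pos by (intro continuous_intros) auto
  have f0: "f 0 = - 1" using w_pos by (simp add: f_def s0 k0 field_simps)
  have "\<exists>r>0. \<forall>\<zeta>\<in>ball 0 r. Re (D \<zeta>) > 0 \<and> q \<zeta> \<noteq> 0 \<and> (cmod (s \<zeta>))\<^sup>2 < 3 * w \<and> s \<zeta> + 3 \<noteq> 0"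
  proof -
    have t: "(D \<longlongrightarrow> D 0) (nhds 0)" "(q \<longlongrightarrow> q 0) (nhds 0)" "(s \<longlongrightarrow> s 0) (nhds 0)"
      using Dc qc sc by (simp_all only: isCont_def tendsto_at_iff_tendsto_nhds)
    have "eventually (\<lambda>\<zeta>. Re (D \<zeta>) > 0) (nhds 0)" using tendsto_Re[OF t(1)] D0 by (intro order_tendstoD) auto
    moreover have "eventually (\<lambda>\<zeta>. q \<zeta> \<noteq> 0) (nhds 0)" using t(2) q0 by (intro tendsto_imp_eventually_ne) auto
    moreover have "((\<lambda>\<zeta>. (cmod (s \<zeta>))\<^sup>2) \<longlongrightarrow> (cmod (s 0))\<^sup>2) (nhds 0)" by (intro tendsto_intros t(3))
    then have "eventually (\<lambda>\<zeta>. (cmod (s \<zeta>))\<^sup>2 < 3 * w) (nhds 0)" by (rule order_tendstoD(2)) (use s0 w_pos in simp)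
    moreover have "eventually (\<lambda>\<zeta>. s \<zeta> + 3 \<noteq> 0) (nhds 0)"
      using tendsto_add[OF t(3) tendsto_const[of 3]] s0 by (intro tendsto_imp_eventually_ne) auto
    ultimately have "eventually (\<lambda>\<zeta>. Re (D \<zeta>) > 0 \<and> q \<zeta> \<noteq> 0 \<and> (cmod (s \<zeta>))\<^sup>2 < 3 * w \<and> s \<zeta> + 3 \<noteq> 0) (nhds 0)"
      by (intro eventually_conj)
    then show ?thesis unfolding eventually_nhds_metric by (simp add: dist_commute Ball_def)
  qed
  then obtain \<rho>2 where \<rho>2: "\<rho>2 > 0" "\<And>\<zeta>. \<zeta> \<in> ball 0 \<rho>2 \<Longrightarrow> Re (D \<zeta>) > 0 \<and> q \<zeta> \<noteq> 0 \<and> (cmod (s \<zeta>))\<^sup>2 < 3 * w \<and> s \<zeta> + 3 \<noteq> 0"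
    by (elim exE conjE) (rule that, assumption, erule (1) bspec)
  define \<rho> where "\<rho> = min (min \<rho>1 \<rho>2) (1 / M2)"
  have \<rho>: "\<rho> > 0" "ball 0 \<rho> \<subseteq> ball 0 \<rho>1" "ball 0 \<rho> \<subseteq> ball (0::complex) \<rho>2" "\<rho> \<le> 1 / M2"
    using \<rho>1 \<rho>2(1) M2(1) by (auto simp: \<rho>_def)
  have Dn: "D \<zeta> \<notin> \<real>\<^sub>\<le>\<^sub>0" if "\<zeta> \<in> ball 0 \<rho>2" for \<zeta> using \<rho>2(2)[OF that] by (auto simp: complex_nonpos_Reals_iff)
  have qh: "q holomorphic_on ball 0 \<rho>2" unfolding q_def using Dn unfolding D_def by (intro holomorphic_intros) auto
  have kh: "k holomorphic_on ball 0 \<rho>2" unfolding k_def using qh \<rho>2(2) by (intro holomorphic_intros) auto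
  have sh: "s holomorphic_on ball 0 \<rho>2" unfolding s_def using kh by (intro holomorphic_intros) auto
  have kz: "k \<zeta> \<noteq> 0" if "\<zeta> \<in> ball 0 \<rho>2" for \<zeta> using \<rho>2(2)[OF that] w_pos by (simp add: k_def)
  have fh: "f holomorphic_on ball 0 \<rho>2" unfolding f_def using kh sh kz \<rho>2(2) by (intro holomorphic_intros) auto
  have rt: "root (inverse \<zeta>) (s \<zeta>)" if z: "\<zeta> \<in> ball 0 \<rho>2" "\<zeta> \<noteq> 0" for \<zeta>
  proof -
    define d where "d = csqrt (D \<zeta>)"
    have d2: "d\<^sup>2 = (1 + 2 * \<zeta>)\<^sup>2 + of_real (12 * w) * \<zeta>\<^sup>2" by (simp add: d_def D_def)
    have qz: "q \<zeta> \<noteq> 0" using \<rho>2(2)[OF z(1)] by simp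
    have qd: "d = q \<zeta> - (1 + 2 * \<zeta>)" by (simp add: q_def d_def)
    have "(q \<zeta>)\<^sup>2 = 2 * (1 + 2 * \<zeta>) * q \<zeta> + 12 * of_real w * \<zeta>\<^sup>2"
      using d2 unfolding qd by (simp add: power2_eq_square algebra_simps)
    moreover have "k \<zeta> * q \<zeta> = - (6 * of_real w)" using qz by (simp add: k_def)
    ultimately have e: "\<zeta> * (s \<zeta>)\<^sup>2 = (1 + 2 * \<zeta>) * s \<zeta> + 3 * of_real w * \<zeta>" unfolding s_def by (rule small_root_equation[OF _ _ qz])
    have "(s \<zeta>)\<^sup>2 = inverse \<zeta> * (\<zeta> * (s \<zeta>)\<^sup>2)" using z(2) by simp
    also have "\<dots> = inverse \<zeta> * s \<zeta> + inverse \<zeta> * \<zeta> * (2 * s \<zeta> + 3 * of_real w)" unfolding e by (simp only: algebra_simps mult_1)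
    also have "\<dots> = (inverse \<zeta> + 2) * s \<zeta> + of_real (3 * w)" unfolding left_inverse[OF z(2)] by (simp add: distrib_right)
    finally show ?thesis by (simp add: root_def)
  qed
  have LV: "L (phys (inverse \<zeta>)) + ln (cmod \<zeta>) = ln (cmod (f \<zeta>))" "inverse \<zeta> \<notin> Sig" if z: "\<zeta> \<in> ball 0 \<rho>" "\<zeta> \<noteq> 0" for \<zeta>
  proof -
    have z2: "\<zeta> \<in> ball 0 \<rho>2" using \<rho>(3) z(1) by blast
    have "cmod \<zeta> < 1 / M2" using z(1) \<rho>(4) by simp
    then have big: "cmod (inverse \<zeta>) > M2" using M2(1) z(2)
      unfolding norm_inverse by (simp add: inverse_eq_divide pos_less_divide_eq mult.commute)
    show off: "inverse \<zeta> \<notin> Sig" using big M2(2) by (meson less_le_not_le mem_cball_0 subsetD)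
    have rs: "root (inverse \<zeta>) (s \<zeta>)" by (rule rt[OF z2 z(2)])
    have snz: "s \<zeta> \<noteq> 0" by (rule root_nz[OF rs])
    have "cmod (s \<zeta>) * cmod (s \<zeta>) < 3 * w" using \<rho>2(2)[OF z2] by (simp add: power2_eq_square)
    then have lt: "cmod (s \<zeta>) < cmod (conj_root (s \<zeta>))" using snz by (simp add: cmod_conj_root pos_less_divide_eq)
    \<comment> \<open>The small root has the smaller modulus, whereas the continued branch is the
      larger root this far out.\<close>
    have ph: "phys (inverse \<zeta>) = conj_root (s \<zeta>)"
      using root_cases[OF rs phys_root[OF off]]
    proof
      assume "phys (inverse \<zeta>) = s \<zeta>"
      then show ?thesis using M2(3)[OF big] lt by simp
    qed
    have s3: "s \<zeta> + 3 \<noteq> 0" using \<rho>2(2)[OF z2] by simp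
    have gen: "- 27 * N / ((\<zeta> * a) * m) * \<zeta> = - (27 * N / (a * m))" if "a \<noteq> 0" "m \<noteq> 0" for N a m
      using that z(2) by (simp add: field_simps)
    have "Y (conj_root (s \<zeta>)) * \<zeta> = - f \<zeta>"
    proof -
      have "s \<zeta> * (s \<zeta> + 3)\<^sup>2 = (\<zeta> * k \<zeta>) * (s \<zeta> + 3)\<^sup>2" by (simp only: s_def)
      then show ?thesis unfolding Y_conj_root[OF snz] f_def by (elim ssubst) (rule gen, use kz[OF z2] s3 in simp_all)
    qed
    then have c: "cmod (Y (phys (inverse \<zeta>))) * cmod \<zeta> = cmod (f \<zeta>)" unfolding ph by (metis norm_minus_cancel norm_mult)
    have "Y (phys (inverse \<zeta>)) \<noteq> 0" by (rule regular_Y[OF phys_regular[OF off]])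
    then have "ln (cmod (Y (phys (inverse \<zeta>)))) + ln (cmod \<zeta>) = ln (cmod (Y (phys (inverse \<zeta>))) * cmod \<zeta>)"
      using z(2) by (subst ln_mult) auto
    then show "L (phys (inverse \<zeta>)) + ln (cmod \<zeta>) = ln (cmod (f \<zeta>))" unfolding L_def c .
  qed
  define V where "V \<zeta> = Re (P \<zeta>) - ln (cmod (f \<zeta>))" for \<zeta>
  show thesis
  proof
    show "\<rho> > 0" by (rule \<rho>(1))
    show "harmonic_at V 0" unfolding V_def
      by (intro harmonic_at_diff harmonic_atI[OF P _ _ refl] harmonic_at_ln_norm[OF fh]) (use \<rho>1 \<rho>2(1) f0 in auto)
    show "V 0 = 0" by (simp add: V_def P0 f0)
    show "V \<zeta> = X (inverse \<zeta>)" if z: "\<zeta> \<in> ball 0 \<rho>" "\<zeta> \<noteq> 0" for \<zeta>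
      using PU[OF subsetD[OF \<rho>(2) z(1)] z(2)] LV[OF z] by (simp add: V_def X_def)
  qed
qed

end

context trajectory_core
begin

lemma end_root: assumes "z0 = \<Gamma> 0 \<or> z0 = \<Gamma> 1" obtains t0 where "root z0 t0" "conj_root t0 = t0"
proof -
  have e: "(z0 + 2)\<^sup>2 + of_real (12 * w) = 0" using assms Gamma_ends by (elim disjE) (simp_all only:)
  show thesis by (rule that[OF neg_root(1)]) (simp only: conj_root_eq_iff[OF neg_root(1)] e)
qed

lemma X_small_far: assumes "\<epsilon> > 0" obtains R where "R > 0" "\<And>z. cmod z > R \<Longrightarrow> \<bar>X z\<bar> < \<epsilon>"
proof -
  obtain V \<rho> where V: "\<rho> > 0" "harmonic_at V 0" "V 0 = 0" "\<And>\<zeta>. \<zeta> \<in> ball 0 \<rho> \<Longrightarrow> \<zeta> \<noteq> 0 \<Longrightarrow> V \<zeta> = X (inverse \<zeta>)"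
    by (rule X_infinity) (rule that)
  obtain d where d: "d > 0" "\<And>\<zeta>. dist \<zeta> 0 < d \<Longrightarrow> dist (V \<zeta>) (V 0) < \<epsilon>"
    using harmonic_at_imp_isCont[OF V(2)] assms unfolding continuous_at_eps_delta
    by (metis dist_norm diff_zero norm_conv_dist)
  define R where "R = max (1 / \<rho>) (1 / d)"
  have R: "R > 0" "R \<ge> 1 / \<rho>" "R \<ge> 1 / d" using V(1) by (auto simp: R_def less_max_iff_disj)
  have "\<bar>X z\<bar> < \<epsilon>" if "cmod z > R" for z
  proof -
    have z0: "z \<noteq> 0" using that R(1) by auto
    have lt: "1 / cmod z < x" if "R \<ge> 1 / x" "x > 0" for x
    proof -
      have "1 / x < cmod z" using that(1) \<open>cmod z > R\<close> by simp
      then show ?thesis using that(2) z0 by (simp add: divide_less_eq mult.commute)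
    qed
    have n: "cmod (inverse z) = 1 / cmod z" unfolding norm_inverse by (simp add: inverse_eq_divide)
    have "inverse z \<in> ball 0 \<rho>" "dist (inverse z) 0 < d" using lt[OF R(2) V(1)] lt[OF R(3) d(1)] n by simp_all
    then have "V (inverse z) = X z" "dist (V (inverse z)) 0 < \<epsilon>" using V(4)[of "inverse z"] d(2)[of "inverse z"] V(3) z0 by simp_all
    then show ?thesis by simp
  qed
  then show thesis using that R(1) by blast
qed

text \<open>Near the end points the potential is so far bounded only from above, because ln |z -
  \<Gamma> t| is, while \<open>L\<close> is continuous at the double root. This one-sided bound for
  X is what the minimum principle for \<epsilon> - X accepts at exceptional points.\<close>

lemma X_nonpos: assumes "z \<noteq> \<Gamma> 0" "z \<noteq> \<Gamma> 1" shows "X z \<le> 0"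
proof (rule field_le_epsilon)
  fix \<epsilon> :: real assume e: "\<epsilon> > 0"
  obtain R where R: "R > 0" "\<And>z. cmod z > R \<Longrightarrow> \<bar>X z\<bar> < \<epsilon>" by (rule X_small_far[OF e]) (rule that)
  show "X z \<le> 0 + \<epsilon>"
  proof (cases "cmod z > R")
    case True
    then show ?thesis using R(2)[OF True] by simp
  next
    case False
    obtain M where M: "M > 0" "\<And>t. t \<in> {0..1} \<Longrightarrow> cmod (\<Gamma> t) < M" by (rule Sig_bound) (rule that)
    define W where "W = ball (0::complex) (R + 1)"
    have "0 \<le> \<epsilon> - X z"
    proof (rule minimum_principle_except[of W "{\<Gamma> 0, \<Gamma> 1}" "\<lambda>z. \<epsilon> - X z"])
      show "open W" "bounded W" by (simp_all add: W_def)
      show "finite {\<Gamma> 0, \<Gamma> 1}" by simp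
      show "z \<in> W - {\<Gamma> 0, \<Gamma> 1}" using False assms by (simp add: W_def)
      fix p assume p: "p \<in> W - {\<Gamma> 0, \<Gamma> 1}"
      have h: "harmonic_at (\<lambda>z. \<epsilon> - X z) p"
        by (rule harmonic_at_diff[OF harmonic_at_const X_harmonic(1)]) (use p in auto)
      show "touched_above (\<lambda>z. \<epsilon> - X z) p" by (rule harmonic_at_imp_touched_above[OF h])
      show "isCont (\<lambda>z. \<epsilon> - X z) p" by (rule harmonic_at_imp_isCont[OF h])
    next
      fix p and \<delta> :: real assume p: "p \<in> frontier W - {\<Gamma> 0, \<Gamma> 1}" "\<delta> > 0"
      have "frontier W = sphere 0 (R + 1)" unfolding W_def using R(1) by (intro frontier_ball) simp
      then have "cmod p = R + 1" using p(1) by simp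
      then have "p \<in> - cball 0 R" by simp
      then have "eventually (\<lambda>z. z \<in> - cball 0 R) (at p within W)"
        by (intro eventually_at_topological[THEN iffD2] exI[of _ "- cball 0 R"]) auto
      then show "eventually (\<lambda>z. \<epsilon> - X z > - \<delta>) (at p within W)"
      proof eventually_elim
        case (elim z)
        then have "cmod z > R" by simp
        from R(2)[OF this] show ?case using p(2) by simp
      qed
    next
      fix p assume p: "p \<in> {\<Gamma> 0, \<Gamma> 1}"
      then have "p = \<Gamma> 0 \<or> p = \<Gamma> 1" by simp
      then obtain t0 where t0: "root p t0" "conj_root t0 = t0" by (rule end_root) (rule that)
      obtain \<delta> where "\<delta> > 0 \<and> (\<forall>z t. cmod (z - p) < \<delta> \<longrightarrow> root z t \<longrightarrow> \<bar>L t - L t0\<bar> < 1)"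
        by (rule exE[OF L_near_double_root[OF t0 zero_less_one]]) (rule that)
      note \<delta> = conjunct1[OF this] conjunct2[OF this]
      have d: "\<delta> > 0" "\<And>z t. cmod (z - p) < \<delta> \<Longrightarrow> root z t \<Longrightarrow> L t - L t0 > - 1"
      proof -
        show "\<delta> > 0" by (rule \<delta>(1))
        show "L t - L t0 > - 1" if "cmod (z - p) < \<delta>" "root z t" for z t
          using \<delta>(2)[rule_format, OF that] by linarith
      qed
      show "\<exists>m. eventually (\<lambda>z. m \<le> \<epsilon> - X z) (at p within W)"
      proof (intro exI)
        have "eventually (\<lambda>z. z \<in> ball p \<delta>) (at p within W)"
          by (rule eventually_at_topological[THEN iffD2], intro exI[of _ "ball p \<delta>"]) (use d(1) in auto)
        moreover have "eventually (\<lambda>z. z \<in> W) (at p within W)" by (simp add: eventually_at_filter)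
        ultimately show "eventually (\<lambda>z. \<epsilon> + L t0 - 1 - max 0 (ln (R + 1 + M)) \<le> \<epsilon> - X z) (at p within W)"
        proof eventually_elim
          case (elim z)
          have zp: "cmod (z - p) < \<delta>" using elim(1) by (simp add: dist_norm norm_minus_commute)
          \<comment> \<open>The maximum with 0 covers the two conventions: ln 0 = 0 when z =
            \<Gamma> t, and integral 0 when the logarithm is not integrable.\<close>
          have Ub: "U z \<le> max 0 (ln (R + 1 + M))"
          proof (cases "integrable Mt (\<lambda>t. ln (cmod (z - \<Gamma> t)))")
            case True
            have "AE t in Mt. ln (cmod (z - \<Gamma> t)) \<le> max 0 (ln (R + 1 + M))"
              using AE_Mt[of 0]
            proof eventually_elim
              case (elim t)
              have "cmod (z - \<Gamma> t) \<le> cmod z + cmod (\<Gamma> t)" by (rule norm_triangle_ineq4)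
              also have "\<dots> \<le> R + 1 + M" using \<open>z \<in> W\<close> M(2)[of t] elim by (simp add: W_def)
              finally have le: "cmod (z - \<Gamma> t) \<le> R + 1 + M" .
              show ?case
              proof (cases "z = \<Gamma> t")
                case False
                then have "ln (cmod (z - \<Gamma> t)) \<le> ln (R + 1 + M)" using le by (subst ln_le_cancel_iff) (use R(1) M(1) in auto)
                then show ?thesis by simp
              qed simp
            qed
            then have "U z \<le> (\<integral>t. max 0 (ln (R + 1 + M)) \<partial>Mt)" unfolding U_def
              by (intro integral_mono_AE True) auto
            then show ?thesis using prob_space.prob_space[OF prob_Mt] by simp
          next
            case False
            show ?thesis unfolding U_def not_integrable_integral_eq[OF False] by simp
          qed
          have "X z \<le> U z - (L t0 - 1)"
          proof (cases "z \<in> Sig")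
            case True
            have "L (neg_root z) > L t0 - 1" "L (conj_root (neg_root z)) > L t0 - 1"
              using d(2)[OF zp neg_root(1)] d(2)[OF zp root_conj_root[OF neg_root(1)]] by linarith+
            moreover have "u - (x + y) / 2 \<le> u - m" if "m < x" "m < y" for m x y u :: real using that by simp
            ultimately show ?thesis unfolding X_def if_P[OF True] by blast
          next
            case False
            show ?thesis using d(2)[OF zp phys_root[OF False]] unfolding X_def if_not_P[OF False] by simp
          qed
          then show ?case using Ub by simp
        qed
      qed
    qed
    then show ?thesis by simp
  qed
qed

text \<open>The maximum 0 is attained at the interior point \<zeta> = 0 of the chart at infinity, so
  X vanishes at points near infinity and then throughout the plane without the two end
  points.\<close>

lemma X_zero: assumes "z \<noteq> \<Gamma> 0" "z \<noteq> \<Gamma> 1" shows "X z = 0"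
proof -
  obtain V \<rho> where V: "\<rho> > 0" "harmonic_at V 0" "V 0 = 0" "\<And>\<zeta>. \<zeta> \<in> ball 0 \<rho> \<Longrightarrow> \<zeta> \<noteq> 0 \<Longrightarrow> V \<zeta> = X (inverse \<zeta>)"
    by (rule X_infinity) (rule that)
  obtain M where M: "M > 0" "\<And>t. t \<in> {0..1} \<Longrightarrow> cmod (\<Gamma> t) < M" by (rule Sig_bound) (rule that)
  define r where "r = min \<rho> (1 / M)"
  have r: "r > 0" "r \<le> \<rho>" "r \<le> 1 / M" using V(1) M(1) by (auto simp: r_def)
  have far: "inverse \<zeta> \<noteq> \<Gamma> 0" "inverse \<zeta> \<noteq> \<Gamma> 1" if "\<zeta> \<in> ball 0 r" "\<zeta> \<noteq> 0" for \<zeta>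
  proof -
    have "cmod \<zeta> < 1 / M" using that(1) r(3) by simp
    then have "M * cmod \<zeta> < 1" using M(1) by (simp add: pos_less_divide_eq mult.commute)
    then have "cmod (inverse \<zeta>) > M" unfolding norm_inverse using that(2) by (simp add: inverse_eq_divide pos_less_divide_eq)
    then show "inverse \<zeta> \<noteq> \<Gamma> 0" "inverse \<zeta> \<noteq> \<Gamma> 1" using M(2)[of 0] M(2)[of 1] by auto
  qed
  have le: "V \<zeta> \<le> 0" if "\<zeta> \<in> ball 0 r" for \<zeta>
  proof (cases "\<zeta> = 0")
    case False
    have "\<zeta> \<in> ball 0 \<rho>" using that r(2) by simp
    then show ?thesis using V(4)[OF _ False] X_nonpos[OF far[OF that False]] by simp
  qed (simp add: V(3))
  have "\<exists>s>0. \<forall>z\<in>ball 0 s. - V z = - V 0"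
    by (rule touched_above_local_min[OF harmonic_at_imp_touched_above[OF harmonic_at_minus[OF V(2)]] r(1)]) (simp add: le V(3))
  then obtain s where s: "s > 0" "\<forall>z\<in>ball 0 s. - V z = - V 0" by blast
  define \<zeta> where "\<zeta> = complex_of_real (min r s / 2)"
  have \<zeta>: "\<zeta> \<in> ball 0 r" "\<zeta> \<in> ball 0 s" "\<zeta> \<noteq> 0" using r(1) s(1) by (auto simp: \<zeta>_def min_def)
  have "V \<zeta> = 0" using bspec[OF s(2) \<zeta>(2)] V(3) by simp
  moreover have "\<zeta> \<in> ball 0 \<rho>" using \<zeta>(1) r(2) by simp
  ultimately have X0: "X (inverse \<zeta>) = 0" using V(4)[OF _ \<zeta>(3)] by simp
  have W: "open (UNIV - {\<Gamma> 0, \<Gamma> 1})" "connected (UNIV - {\<Gamma> 0, \<Gamma> 1})"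
  proof -
    show "open (UNIV - {\<Gamma> 0, \<Gamma> 1})" by (intro open_Diff open_UNIV finite_imp_closed) simp
    show "connected (UNIV - {\<Gamma> 0, \<Gamma> 1})" by (rule connected_open_delete_finite) (simp_all add: convex_connected)
  qed
  have h: "harmonic_at (\<lambda>z. - X z) p" if "p \<in> UNIV - {\<Gamma> 0, \<Gamma> 1}" for p
    by (rule harmonic_at_minus[OF X_harmonic(1)]) (use that in auto)
  have "- X z = 0"
  proof (rule touched_above_zero_set[OF W])
    show "touched_above (\<lambda>z. - X z) p" "isCont (\<lambda>z. - X z) p" if "p \<in> UNIV - {\<Gamma> 0, \<Gamma> 1}" for p
      using harmonic_at_imp_touched_above[OF h[OF that]] harmonic_at_imp_isCont[OF h[OF that]] .
    show "0 \<le> - X p" if "p \<in> UNIV - {\<Gamma> 0, \<Gamma> 1}" for p using X_nonpos[of p] that by simp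
    show "inverse \<zeta> \<in> UNIV - {\<Gamma> 0, \<Gamma> 1}" using far[OF \<zeta>(1,3)] by simp
    show "- X (inverse \<zeta>) = 0" using X0 by simp
    show "z \<in> UNIV - {\<Gamma> 0, \<Gamma> 1}" using assms by simp
  qed
  then show ?thesis by simp
qed

lemma U_phys: assumes "z \<notin> Sig" shows "U z = L (phys z)"
proof -
  have "z \<noteq> \<Gamma> 0" "z \<noteq> \<Gamma> 1" using assms ends_in_Sig by blast+
  from X_zero[OF this] show ?thesis using assms by (simp add: X_def)
qed

lemma U_Sig: assumes "t \<in> {0<..<1}" "root (\<Gamma> t) s" shows "U (\<Gamma> t) = L s"
proof -
  have ne: "\<Gamma> t \<noteq> \<Gamma> 0" "\<Gamma> t \<noteq> \<Gamma> 1" using inj_onD[OF Gamma_inj, of t 0] inj_onD[OF Gamma_inj, of t 1] assms(1) by auto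
  have "\<Gamma> t \<in> Sig" using assms(1) by (intro Gamma_Sig) simp
  then have "U (\<Gamma> t) = (L (neg_root (\<Gamma> t)) + L (conj_root (neg_root (\<Gamma> t)))) / 2"
    using X_zero[OF ne] by (simp add: X_def)
  moreover have "L (neg_root (\<Gamma> t)) = L (conj_root (neg_root (\<Gamma> t)))" by (rule balanced(1)[OF assms(1) neg_root(1)])
  moreover have "s = neg_root (\<Gamma> t) \<or> s = conj_root (neg_root (\<Gamma> t))" by (rule root_cases[OF neg_root(1) assms(2)])
  moreover have "(x + x) / 2 = x" for x :: real by simp
  ultimately show ?thesis by (elim disjE) (simp_all only:)
qed

lemma Sig_cases:
  assumes "z \<in> Sig" obtains (interior) t where "t \<in> {0<..<1}" "z = \<Gamma> t" | (endpoint) "z = \<Gamma> 0 \<or> z = \<Gamma> 1"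
proof -
  obtain t where t: "t \<in> {0..1}" "z = \<Gamma> t" using assms unfolding Sig_def by (elim imageE) (rule that)
  show thesis
  proof (cases "t = 0 \<or> t = 1")
    case True then show thesis using t(2) by (intro that(2)) auto
  next
    case False then show thesis using t by (intro that(1)[of t]) auto
  qed
qed

lemma U_root: assumes "z \<noteq> \<Gamma> 0" "z \<noteq> \<Gamma> 1" obtains t where "root z t" "U z = L t"
proof (cases "z \<in> Sig")
  case True
  then show thesis
  proof (cases rule: Sig_cases)
    case (interior t)
    show thesis by (rule that[OF neg_root(1)]) (simp only: interior(2) U_Sig[OF interior(1) neg_root(1)])
  next
    case endpoint
    then show thesis using assms by (elim disjE) (erule (1) notE)+
  qed
next
  case False
  show thesis by (rule that[OF phys_root[OF False] U_phys[OF False]])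
qed

text \<open>Fatou's lemma for the nonnegative functions C - ln |a n - \<Gamma> t|: their integrals C
  - U(a n) converge because U(a n) is \<open>L\<close> at a root that tends to the double root.
  Fatou gives integrability and a one-sided comparison.\<close>

lemma U_end:
  assumes z0: "z0 = \<Gamma> 0 \<or> z0 = \<Gamma> 1" and t0: "root z0 t0"
  shows "integrable Mt (\<lambda>t. ln (cmod (z0 - \<Gamma> t)))" "L t0 \<le> U z0"
proof -
  have c0: "conj_root t0 = t0"
    using conj_root_eq_iff[OF t0] z0 Gamma_ends by (elim disjE) (simp_all only:)
  obtain M where M: "M > 0" "\<And>t. t \<in> {0..1} \<Longrightarrow> cmod (\<Gamma> t) < M" by (rule Sig_bound) (rule that)
  define C where "C = ln (2 * M + 1)"
  \<comment> \<open>A horizontal approach never meets the other end point, whose imaginary part has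
    the opposite sign; n + 1 keeps the step finite and positive.\<close>
  define a where "a n = z0 + of_real (1 / real (n + 1))" for n :: nat
  have z0M: "cmod z0 < M" using z0 M(2)[of 0] M(2)[of 1] by auto
  have Im0: "Im (\<Gamma> 1) = - Im (\<Gamma> 0)" using arg_cong[OF cnj_ends, of Im] by simp
  have "\<Gamma> 0 \<noteq> \<Gamma> 1" using inj_onD[OF Gamma_inj, of 0 1] by auto
  have Imne: "Im (\<Gamma> 0) \<noteq> 0"
  proof
    assume "Im (\<Gamma> 0) = 0"
    then have "cnj (\<Gamma> 0) = \<Gamma> 0" by (simp add: complex_eq_iff)
    then show False using \<open>\<Gamma> 0 \<noteq> \<Gamma> 1\<close> unfolding cnj_ends by simp
  qed
  have a_ne: "a n \<noteq> \<Gamma> 0" "a n \<noteq> \<Gamma> 1" for n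
  proof -
    have I: "Im (a n) = Im z0" "Re (a n) > Re z0" by (simp_all add: a_def)
    have "a n \<noteq> e" if "z0 = e \<or> Im z0 = - Im e \<and> Im e \<noteq> 0" for e
    proof
      assume "a n = e"
      then have "Im e = Im z0" "Re e > Re z0" using I by simp_all
      then show False using that by auto
    qed
    note * = this
    show "a n \<noteq> \<Gamma> 0" by (rule *) (use z0 Im0 Imne in auto)
    show "a n \<noteq> \<Gamma> 1" by (rule *) (use z0 Im0 Imne in auto)
  qed
  have alim: "a \<longlonglongrightarrow> z0"
  proof -
    have "(\<lambda>n. 1 / real (n + 1)) \<longlonglongrightarrow> 0" using LIMSEQ_inverse_real_of_nat by (simp add: inverse_eq_divide)
    then have "(\<lambda>n. z0 + of_real (1 / real (n + 1))) \<longlonglongrightarrow> z0 + of_real 0" by (intro tendsto_intros)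
    then show ?thesis by (simp add: a_def[abs_def])
  qed
  have aM: "cmod (a n - \<Gamma> t) \<le> 2 * M + 1" if "t \<in> {0..1}" for n t
  proof -
    have "cmod (a n - \<Gamma> t) \<le> cmod (a n) + cmod (\<Gamma> t)" by (rule norm_triangle_ineq4)
    also have "cmod (a n) \<le> cmod z0 + cmod (of_real (1 / real (n + 1)))" unfolding a_def by (rule norm_triangle_ineq)
    also have "cmod (complex_of_real (1 / real (n + 1))) = 1 / real (n + 1)" unfolding norm_of_real by simp
    also have "1 / real (n + 1) \<le> 1" by simp
    finally show ?thesis using z0M M(2)[OF that] by simp
  qed
  have lnC: "ln (cmod v) \<le> C" if "cmod v \<le> 2 * M + 1" for v
  proof (cases "v = 0")
    case True then show ?thesis using M(1) by (simp add: C_def)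
  next
    case False then show ?thesis using that M(1) unfolding C_def by (subst ln_le_cancel_iff) auto
  qed
  have z0b: "cmod (z0 - \<Gamma> t) \<le> 2 * M + 1" if "t \<in> {0..1}" for t
    using norm_triangle_ineq4[of z0 "\<Gamma> t"] z0M M(2)[OF that] M(1) by linarith
  have int: "integrable Mt (\<lambda>t. ln (cmod (a n - \<Gamma> t)))" for n by (rule X_harmonic(2)[OF a_ne])
  have Ulim: "(\<lambda>n. U (a n)) \<longlonglongrightarrow> L t0"
  proof (rule LIMSEQ_I)
    fix \<epsilon> :: real assume eps: "\<epsilon> > 0"
    obtain \<delta> where d: "\<delta> > 0 \<and> (\<forall>z t. cmod (z - z0) < \<delta> \<longrightarrow> root z t \<longrightarrow> \<bar>L t - L t0\<bar> < \<epsilon>)"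
      by (rule exE[OF L_near_double_root[OF t0 c0 eps]]) (rule that)
    obtain no where no: "\<forall>n\<ge>no. cmod (a n - z0) < \<delta>" by (rule exE[OF LIMSEQ_D[OF alim conjunct1[OF d]]]) (rule that)
    have "norm (U (a n) - L t0) < \<epsilon>" if "n \<ge> no" for n
    proof -
      obtain t where t: "root (a n) t" "U (a n) = L t" by (rule U_root[OF a_ne]) (rule that)
      have "cmod (a n - z0) < \<delta>" using no that by simp
      then show ?thesis unfolding t(2) real_norm_def by (rule conjunct2[OF d, rule_format, OF _ t(1)])
    qed
    then show "\<exists>no. \<forall>n\<ge>no. norm (U (a n) - L t0) < \<epsilon>" by blast
  qed
  define f where "f n t = ennreal (C - ln (cmod (a n - \<Gamma> t)))" for n t
  have fint: "(\<integral>\<^sup>+t. f n t \<partial>Mt) = ennreal (C - U (a n))" for n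
  proof -
    have "AE t in Mt. 0 \<le> C - ln (cmod (a n - \<Gamma> t))" using AE_Mt[of 0]
      by eventually_elim (use lnC aM in \<open>simp add: less_imp_le\<close>)
    moreover have "integrable Mt (\<lambda>t. C - ln (cmod (a n - \<Gamma> t)))" using int by simp
    ultimately have "(\<integral>\<^sup>+t. f n t \<partial>Mt) = ennreal (\<integral>t. C - ln (cmod (a n - \<Gamma> t)) \<partial>Mt)" unfolding f_def
      by (rule nn_integral_eq_integral[rotated])
    also have "(\<integral>t. C - ln (cmod (a n - \<Gamma> t)) \<partial>Mt) = C - U (a n)" unfolding U_def
      using int prob_space.prob_space[OF prob_Mt] by (subst Bochner_Integration.integral_diff) auto
    finally show ?thesis .
  qed
  have flim: "AE t in Mt. ennreal (C - ln (cmod (z0 - \<Gamma> t))) = liminf (\<lambda>n. f n t)"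
    using AE_Mt[of 0]
  proof eventually_elim
    case (elim t)
    have ne: "z0 - \<Gamma> t \<noteq> 0" using z0 elim inj_onD[OF Gamma_inj, of t 0] inj_onD[OF Gamma_inj, of t 1] by auto
    have "(\<lambda>n. f n t) \<longlonglongrightarrow> ennreal (C - ln (cmod (z0 - \<Gamma> t)))" unfolding f_def
      by (intro tendsto_intros alim) (use ne in simp)
    then show ?case using lim_imp_Liminf[of sequentially "\<lambda>n. f n t"] by simp
  qed
  have "(\<integral>\<^sup>+t. ennreal (C - ln (cmod (z0 - \<Gamma> t))) \<partial>Mt) = (\<integral>\<^sup>+t. liminf (\<lambda>n. f n t) \<partial>Mt)"
    by (rule nn_integral_cong_AE[OF flim])
  also have "\<dots> \<le> liminf (\<lambda>n. \<integral>\<^sup>+t. f n t \<partial>Mt)" by (rule nn_integral_liminf) (simp add: f_def)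
  also have "\<dots> = ennreal (C - L t0)"
  proof (rule lim_imp_Liminf)
    show "(\<lambda>n. \<integral>\<^sup>+t. f n t \<partial>Mt) \<longlonglongrightarrow> ennreal (C - L t0)" unfolding fint by (intro tendsto_intros Ulim)
  qed simp
  finally have fin: "(\<integral>\<^sup>+t. ennreal (C - ln (cmod (z0 - \<Gamma> t))) \<partial>Mt) \<le> ennreal (C - L t0)" .
  have nn: "AE t in Mt. 0 \<le> C - ln (cmod (z0 - \<Gamma> t))" using AE_Mt[of 0]
    by eventually_elim (use lnC z0b in \<open>simp add: less_imp_le\<close>)
  have i: "integrable Mt (\<lambda>t. C - ln (cmod (z0 - \<Gamma> t)))"
  proof (rule integrableI_nonneg[OF _ nn])
    show "(\<integral>\<^sup>+t. ennreal (C - ln (cmod (z0 - \<Gamma> t))) \<partial>Mt) < \<infinity>" using fin by (rule le_less_trans) simp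
  qed measurable
  have "integrable Mt (\<lambda>t. C - (C - ln (cmod (z0 - \<Gamma> t))))" by (intro Bochner_Integration.integrable_diff i) simp
  then show j: "integrable Mt (\<lambda>t. ln (cmod (z0 - \<Gamma> t)))" by simp
  have "ennreal (\<integral>t. C - ln (cmod (z0 - \<Gamma> t)) \<partial>Mt) \<le> ennreal (C - L t0)"
    using fin unfolding nn_integral_eq_integral[OF i nn] .
  moreover have "(\<integral>t. C - ln (cmod (z0 - \<Gamma> t)) \<partial>Mt) = C - U z0" unfolding U_def
    using j prob_space.prob_space[OF prob_Mt] by (subst Bochner_Integration.integral_diff) auto
  moreover have "0 \<le> C - L t0"
  proof (rule LIMSEQ_le_const[of "\<lambda>n. C - U (a n)"])
    show "(\<lambda>n. C - U (a n)) \<longlonglongrightarrow> C - L t0" by (intro tendsto_intros Ulim)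
    have "0 \<le> (\<integral>t. C - ln (cmod (a n - \<Gamma> t)) \<partial>Mt)" for n
      by (rule integral_nonneg_AE) (use AE_Mt[of 0] in \<open>eventually_elim, use lnC aM in \<open>simp add: less_imp_le\<close>\<close>)
    moreover have "(\<integral>t. C - ln (cmod (a n - \<Gamma> t)) \<partial>Mt) = C - U (a n)" for n unfolding U_def
      using int prob_space.prob_space[OF prob_Mt] by (subst Bochner_Integration.integral_diff) auto
    ultimately show "\<exists>N. \<forall>n\<ge>N. 0 \<le> C - U (a n)" by simp
  qed
  ultimately show "L t0 \<le> U z0" by (simp add: ennreal_le_iff)
qed

end

section \<open>The difference of the two values inside the closed curve\<close>

text \<open>Multiplication by a nonzero constant carries components of complements to one another.
  It serves for the reflection, with c = -1, and for the change of scale.\<close>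

lemma inside_scale:
  fixes c u :: complex
  assumes c: "c \<noteq> 0" and u: "c * u \<in> inside C" and D: "\<And>x. x \<in> D \<longleftrightarrow> c * x \<in> C"
  shows "u \<in> inside D"
proof -
  have nC: "c * u \<notin> C" and bd: "bounded (connected_component_set (- C) (c * u))"
    using u by (simp_all add: inside_def)
  define K where "K = connected_component_set (- D) u"
  have uD: "u \<notin> D" using nC D by simp
  have uK: "u \<in> K" using uD by (simp add: K_def connected_component_refl_eq)
  have sub: "(\<lambda>x. c * x) ` K \<subseteq> connected_component_set (- C) (c * u)"
  proof (rule connected_component_maximal)
    show "c * u \<in> (\<lambda>x. c * x) ` K" using uK by (rule imageI)
    show "connected ((\<lambda>x. c * x) ` K)" unfolding K_def
      by (intro connected_continuous_image continuous_intros connected_connected_component)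
    have "K \<subseteq> - D" unfolding K_def by (rule connected_component_subset)
    then show "(\<lambda>x. c * x) ` K \<subseteq> - C" using D by auto
  qed
  have "bounded ((\<lambda>x. c * x) ` K)" by (rule bounded_subset[OF bd sub])
  then have "bounded ((\<lambda>x. inverse c * x) ` (\<lambda>x. c * x) ` K)"
    by (rule bounded_linear_image) (rule bounded_linear_mult_right)
  moreover have "(\<lambda>x. inverse c * x) ` (\<lambda>x. c * x) ` K = K" using c by (simp add: image_image mult.assoc[symmetric])
  ultimately have "bounded K" by simp
  then show ?thesis using uD by (simp add: inside_def K_def)
qed

lemma eventually_within: "eventually P (nhds q) \<Longrightarrow> eventually P (at q within A)"
  unfolding eventually_at_filter by (erule eventually_mono) simp

lemma isCont_tendsto_nhds:
  fixes f :: "complex \<Rightarrow> real"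
  shows "isCont f p \<Longrightarrow> (f \<longlongrightarrow> f p) (nhds p)"
  by (simp only: isCont_def tendsto_at_iff_tendsto_nhds)

lemma isCont_reflect:
  fixes f :: "complex \<Rightarrow> real"
  assumes "isCont f (- q)" shows "isCont (\<lambda>z. f (- z)) q"
proof -
  have "isCont (\<lambda>z :: complex. - z) q" by (intro continuous_intros)
  from isCont_o2[OF this assms] show ?thesis .
qed

lemma mem_uminus_image: "x \<in> uminus ` A \<longleftrightarrow> - x \<in> A" for x :: complex
proof
  assume "- x \<in> A"
  from imageI[OF this, of uminus] show "x \<in> uminus ` A" by simp
qed auto

context two_sheets
begin

text \<open>Over a pole in the closed right half-plane the left root satisfies t^2 + 2t + w = 0,
  which is a factor of \<open>den\<close> but not a zero of \<open>num\<close>. So regions where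
  \<open>num\<close> is dominated by \<open>den\<close> contain no poles.\<close>

lemma right_pole: assumes "Re q \<ge> 0" "pole q" shows "cmod (den (neg_root q)) < cmod (num (neg_root q))"
proof -
  define t where "t = neg_root q"
  have r: "root q t" and neg: "Re t < 0" unfolding t_def using neg_root(1) neg_root_right(1)[of q] assms(1) by auto
  have "q \<noteq> of_real (w - 5)" using assms(1) w_le_1 by auto
  then have "q\<^sup>2 = of_real (16 * (1 - w))" using assms(2) unfolding pole_def by blast
  then have z: "(t\<^sup>2 - 6 * t + of_real (9 * w)) * (t\<^sup>2 + 2 * t + of_real w) = 0" using root_pole_factors(1)[OF r] by simp
  have nz: "t \<noteq> 0" "t\<^sup>2 - 6 * t + of_real (9 * w) \<noteq> 0" using regular_neg[OF neg] unfolding regular_def by blast+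
  then have z2: "t\<^sup>2 + 2 * t + of_real w = 0" using z by simp
  then have d: "den t = 0" unfolding den_def by simp
  have "t + 3 \<noteq> 0"
  proof
    assume "t + 3 = 0"
    then have "t = - 3" by (simp add: eq_neg_iff_add_eq_0)
    then have "complex_of_real (3 + w) = 0" using z2 by simp
    then have "3 + w = 0" unfolding of_real_eq_0_iff .
    then show False using w_pos by simp
  qed
  then have "num t \<noteq> 0" unfolding num_def using nz by simp
  then show ?thesis unfolding t_def[symmetric] d by simp
qed

lemma dL_harmonic: assumes "Re (neg_root z) < 0" "\<not> pole z" shows "harmonic_at dL z"
proof -
  obtain r where r: "r > 0" "neg_root holomorphic_on ball z r" "\<And>x. x \<in> ball z r \<Longrightarrow> Re (neg_root x) < 0"
    by (rule neg_root_nbhd[OF assms(1)]) (rule that)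
  have nz: "neg_root x \<noteq> 0" for x by (rule root_nz[OF neg_root(1)])
  have "(\<lambda>x. conj_root (neg_root x)) holomorphic_on ball z r" unfolding conj_root_def
    by (intro holomorphic_intros r(2)) (rule nz)
  moreover have "regular (conj_root (neg_root z))" by (rule not_pole_num_den(3)[OF root_conj_root[OF neg_root(1)] assms(2)])
  ultimately have "harmonic_at (\<lambda>x. L (conj_root (neg_root x))) z"
    by (intro harmonic_at_compose[of L "\<lambda>x. conj_root (neg_root x)" z "ball z r"] L_harmonic) (use r(1) in simp_all)
  from harmonic_at_diff[OF L_neg_root_harmonic[OF assms(1)] this] show ?thesis unfolding dL_def[abs_def] .
qed

lemma dL_num_den: assumes "\<not> pole z"
  shows "dL z < 0 \<longleftrightarrow> cmod (num (neg_root z)) < cmod (den (neg_root z))"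
    "cmod (num (neg_root z)) = cmod (den (neg_root z)) \<Longrightarrow> dL z = 0"
proof -
  define a b where "a = cmod (num (neg_root z))" and "b = cmod (den (neg_root z))"
  have ab: "a > 0" "b > 0" using not_pole_num_den(1,2)[OF neg_root(1) assms] by (simp_all add: a_def b_def)
  have e: "dL z = ln (a / b)" unfolding dL_def a_def b_def by (rule L_diff[OF neg_root(1) assms])
  show "dL z < 0 \<longleftrightarrow> cmod (num (neg_root z)) < cmod (den (neg_root z))"
    unfolding e a_def[symmetric] b_def[symmetric] using ab by (simp add: ln_less_zero_iff)
  show "cmod (num (neg_root z)) = cmod (den (neg_root z)) \<Longrightarrow> dL z = 0"
    unfolding e a_def[symmetric] b_def[symmetric] using ab by simp
qed

text \<open>With \<delta> = t - conj_root t, the imaginary part of \<delta>^2 gives Re \<delta> * Im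
  \<delta> = 2y; as Re \<delta> < 0, also Im \<delta> \<le> 0. Rationalising \<open>R\<close> then
  splits the derivative into two nonpositive terms.\<close>

lemma dL_imaginary_deriv:
  assumes y: "y \<ge> 0" and np: "\<not> pole (\<i> * of_real y)"
  shows "\<exists>d. ((\<lambda>s. dL (\<i> * of_real s)) has_real_derivative d) (at y) \<and> d \<le> 0"
proof -
  define z where "z = \<i> * of_real y"
  define t where "t = neg_root z"
  have neg: "Re t < 0" unfolding t_def by (rule neg_root_right(1)) (simp add: z_def)
  have r: "root z t" unfolding t_def by (rule neg_root(1))
  define \<delta> where "\<delta> = t - conj_root t"
  have Red: "Re \<delta> < 0" using neg conj_root_Re_pos[OF neg] by (simp add: \<delta>_def)
  have "\<delta>\<^sup>2 = (z + 2)\<^sup>2 + of_real (12 * w)" unfolding \<delta>_def root_diff[OF r] by (rule root_disc[OF r])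
  then have "Im (\<delta>\<^sup>2) = 4 * y" by (simp add: z_def power2_eq_square)
  then have prd: "Re \<delta> * Im \<delta> = 2 * y" by (simp add: power2_eq_square mult.commute)
  have Imd: "Im \<delta> \<le> 0"
  proof (rule ccontr)
    assume "\<not> Im \<delta> \<le> 0"
    then have "Re \<delta> * Im \<delta> < 0" using Red by (intro mult_neg_pos) simp_all
    then show False using prd y by simp
  qed
  define a b k where "a = 2 - 2 * w" and "b = 5 - w" and "k = y\<^sup>2 + 16 * (1 - w)"
  have ab: "a \<ge> 0" "b > 0" "b - a > 0" using w_le_1 w_pos by (simp_all add: a_def b_def)
  have k: "k \<noteq> 0"
  proof
    assume "k = 0"
    then have "z\<^sup>2 = of_real (16 * (1 - w))" by (simp add: z_def k_def power_mult_distrib add_eq_0_iff2 flip: of_real_power)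
    then show False using np unfolding pole_def z_def by blast
  qed
  have kp: "k > 0" using k w_le_1 by (simp add: k_def less_le)
  have z2: "z\<^sup>2 - of_real (16 * (1 - w)) = - of_real k" by (simp add: z_def k_def power_mult_distrib)
  have bz: "z + of_real b \<noteq> 0" using ab by (auto simp: z_def complex_eq_iff)
  define m where "m = b\<^sup>2 + y\<^sup>2"
  have m: "m > 0" unfolding m_def using ab by (intro add_pos_nonneg) auto
  have meq: "of_real m = (z + of_real b) * (of_real b - z)" by (simp add: z_def m_def complex_eq_iff power2_eq_square)
  have "of_real b - z \<noteq> 0" using ab by (auto simp: z_def complex_eq_iff)
  \<comment> \<open>Multiplying by \<open>of_real b - z\<close>, the conjugate of
    \<open>z + of_real b\<close> on the imaginary axis, makes this denominator real.\<close>
  then have inv: "(z + of_real a) / (z + of_real b) = (z + of_real a) * (of_real b - z) / of_real m"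
    unfolding meq by (rule mult_divide_mult_cancel_right[symmetric])
  have "R z t = \<delta> * (z + of_real a) / ((- of_real k) * (z + of_real b))"
    unfolding R_def \<delta>_def a_def b_def z2 ..
  also have "\<dots> = \<delta> * ((z + of_real a) / (z + of_real b)) / (- of_real k)" by (simp add: mult.commute)
  also have "\<dots> = \<delta> * ((z + of_real a) * (of_real b - z)) * of_real (- 1 / (m * k))" unfolding inv by (simp add: divide_inverse)
  finally have Re: "R z t = \<delta> * ((z + of_real a) * (of_real b - z)) * of_real (- 1 / (m * k))" .
  have "Re (R z t * \<i>) = (Im \<delta> * (a * b + y\<^sup>2) + Re \<delta> * (y * (b - a))) * (1 / (m * k))"
    unfolding Re by (simp add: z_def power2_eq_square algebra_simps)
  moreover have "Im \<delta> * (a * b + y\<^sup>2) \<le> 0" using Imd ab by (intro mult_nonpos_nonneg) auto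
  moreover have "Re \<delta> * (y * (b - a)) \<le> 0" using Red ab y by (intro mult_nonpos_nonneg) auto
  moreover have "0 \<le> 1 / (m * k)" using m kp by simp
  ultimately have "Re (R z t * \<i>) \<le> 0" by (elim ssubst) (erule (2) mult_nonpos_nonneg[OF add_nonpos_nonpos])
  moreover have "((\<lambda>s. dL (\<i> * of_real s)) has_real_derivative 2 * Re (R z t * \<i>)) (at y)"
    unfolding z_def t_def
  proof (rule dL_deriv)
    show "((\<lambda>s. \<i> * complex_of_real s) has_vector_derivative \<i>) (at y)" by (auto intro!: derivative_eq_intros)
    show "Re (neg_root (\<i> * complex_of_real y)) < 0" using neg by (simp add: t_def z_def)
  qed (rule np)
  ultimately show ?thesis by (intro exI[of _ "2 * Re (R z t * \<i>)"] conjI) simp_all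
qed

lemma not_pole_right: assumes "Re z \<ge> 0" "cmod (num (neg_root z)) \<le> cmod (den (neg_root z))" shows "\<not> pole z"
  using right_pole[OF assms(1)] assms(2) by linarith

lemma num_less_den_ray:
  assumes "0 \<le> y" "y \<le> y'" and lt: "cmod (num (neg_root (\<i> * of_real y))) < cmod (den (neg_root (\<i> * of_real y)))"
  shows "cmod (num (neg_root (\<i> * of_real y'))) < cmod (den (neg_root (\<i> * of_real y')))"
proof -
  have np: "\<not> pole (\<i> * of_real y)" by (rule not_pole_right) (use lt in simp_all)
  have np': "\<not> pole (\<i> * of_real x)" if "x \<ge> y" for x
  proof (cases "x = y")
    case False
    show ?thesis
    proof
      assume p: "pole (\<i> * of_real x)"
      have "\<i> * of_real x \<noteq> of_real (w - 5)" using w_le_1 by (auto simp: complex_eq_iff)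
      then have "(\<i> * of_real x)\<^sup>2 = of_real (16 * (1 - w))" using p unfolding pole_def by blast
      then have "complex_of_real (- (x\<^sup>2)) = of_real (16 * (1 - w))" by (simp add: power_mult_distrib)
      then have "- (x\<^sup>2) = 16 * (1 - w)" unfolding of_real_eq_iff .
      moreover have "x\<^sup>2 > 0" using False that assms(1) by simp
      ultimately show False using w_le_1 by simp
    qed
  qed (simp add: np)
  have "dL (\<i> * of_real y') \<le> dL (\<i> * of_real y)"
  proof (rule DERIV_nonpos_imp_nonincreasing[OF assms(2)])
    fix x assume "y \<le> x" "x \<le> y'"
    then show "\<exists>d. ((\<lambda>s. dL (\<i> * of_real s)) has_real_derivative d) (at x) \<and> d \<le> 0"
      by (intro dL_imaginary_deriv np') (use assms(1) in simp_all)
  qed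
  moreover have "dL (\<i> * of_real y) < 0" using dL_num_den(1)[OF np] lt by blast
  ultimately show ?thesis using dL_num_den(1)[OF np'[OF assms(2)]] by simp
qed

end

context trajectory_core
begin

lemma Re_ends: "Re (\<Gamma> 0) = -2" "Re (\<Gamma> 1) = -2"
proof -
  have "Re (\<Gamma> 0) + Re (\<Gamma> 1) = -4" using arg_cong[OF ends_sum_prod(1), of Re] by simp
  moreover have "Re (\<Gamma> 1) = Re (\<Gamma> 0)" using arg_cong[OF cnj_ends, of Re] by simp
  ultimately show "Re (\<Gamma> 0) = -2" "Re (\<Gamma> 1) = -2" by simp_all
qed

lemma not_end: "Re z > -2 \<Longrightarrow> z \<noteq> \<Gamma> 0 \<and> z \<noteq> \<Gamma> 1"
  using Re_ends by auto

lemma cnj_Sig: "cnj z \<in> Sig \<longleftrightarrow> z \<in> Sig"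
proof -
  have s: "cnj ` Sig = Sig" using symmetric unfolding Sig_def .
  have "cnj x \<in> Sig" if "x \<in> Sig" for x using imageI[OF that, of cnj] unfolding s .
  from this[of z] this[of "cnj z"] show ?thesis by auto
qed

lemma Sig_num_den: assumes "z \<in> Sig" "Re z > -2" shows "cmod (num (neg_root z)) = cmod (den (neg_root z))"
  using assms(1)
proof (cases rule: Sig_cases)
  case (interior t)
  show ?thesis using balanced(2)[OF interior(1), of "neg_root z"] neg_root(1)[of z] unfolding interior(2) by simp
next
  case endpoint
  then show ?thesis using not_end[OF assms(2)] by simp
qed

lemma closed_curve_imaginary: assumes "q \<in> closed_curve Sig" "Re q = 0" shows "q \<in> Sig"
proof -
  have "q \<in> Sig \<or> - q \<in> Sig" using assms(1) unfolding closed_curve_def by auto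
  moreover have "- q = cnj q" using assms(2) by (simp add: complex_eq_iff)
  ultimately show ?thesis using cnj_Sig by auto
qed

lemma closed_curve_right: assumes "Re q > 0" shows "q \<in> closed_curve Sig \<longleftrightarrow> q \<in> Sig"
  using assms unfolding closed_curve_def by auto

lemma compact_closed_curve: "compact (closed_curve Sig)"
proof -
  have n: "compact (uminus ` Sig)" by (intro compact_continuous_image continuous_intros compact_Sig)
  show ?thesis unfolding closed_curve_def
    by (intro compact_Un compact_Int_closed compact_Sig n closed_halfspace_Re_ge closed_halfspace_Re_le)
qed

text \<open>Moving away from the real axis \<open>dL\<close> does not increase, so it stays
  negative, while on the arc it vanishes. The vertical ray from \<open>q\<close> therefore misses
  the curve and connects \<open>q\<close> to infinity.\<close>

lemma ray_not_inside:
  assumes q: "Re q = 0" and lt: "cmod (num (neg_root q)) < cmod (den (neg_root q))"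
  shows "q \<notin> Omega0 Sig"
proof
  assume "q \<in> Omega0 Sig"
  then have b: "bounded (connected_component_set (- closed_curve Sig) q)" by (simp add: Omega0_def inside_def)
  define y where "y = \<bar>Im q\<bar>"
  define v :: complex where "v = (if Im q \<ge> 0 then \<i> else - \<i>)"
  have qv: "q = v * of_real y" using q by (auto simp: v_def y_def complex_eq_iff)
  have sym: "cmod (num (neg_root (v * of_real s))) = cmod (num (neg_root (\<i> * of_real s))) \<and>
      cmod (den (neg_root (v * of_real s))) = cmod (den (neg_root (\<i> * of_real s)))" for s
  proof (cases "Im q \<ge> 0")
    case False
    have "neg_root (cnj (\<i> * of_real s)) = cnj (neg_root (\<i> * of_real s))"
      by (intro neg_root_cnj neg_root_right(1)) simp
    moreover have "v * of_real s = cnj (\<i> * of_real s)" using False by (simp add: v_def)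
    ultimately show ?thesis by (simp only: num_cnj den_cnj simp_thms)
  qed (simp add: v_def)
  define K where "K = (\<lambda>s. v * complex_of_real s) ` {y..}"
  have cK: "connected K" unfolding K_def by (intro connected_continuous_image continuous_intros) auto
  have off: "K \<subseteq> - closed_curve Sig"
  proof
    fix p assume "p \<in> K"
    then obtain s where s: "s \<ge> y" "p = v * of_real s" unfolding K_def by auto
    have R0: "Re p = 0" unfolding s(2) by (simp add: v_def)
    have "cmod (num (neg_root (\<i> * of_real y))) < cmod (den (neg_root (\<i> * of_real y)))"
      using lt sym[of y] unfolding qv by simp
    then have "cmod (num (neg_root (\<i> * of_real s))) < cmod (den (neg_root (\<i> * of_real s)))"
      by (intro num_less_den_ray[OF _ s(1)]) (simp_all add: y_def)
    then have "cmod (num (neg_root p)) < cmod (den (neg_root p))" using sym[of s] unfolding s(2) by simp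
    then have "p \<notin> Sig" using Sig_num_den[of p] R0 by auto
    then show "p \<in> - closed_curve Sig" using closed_curve_imaginary[OF _ R0] by auto
  qed
  have qK: "q \<in> K" unfolding K_def qv by (intro imageI) simp
  have "K \<subseteq> connected_component_set (- closed_curve Sig) q" by (rule connected_component_maximal[OF qK cK off])
  then have "bounded K" by (rule bounded_subset[OF b])
  then obtain B where B: "\<forall>x\<in>K. cmod x \<le> B" unfolding bounded_iff ..
  have "v * of_real (max y (B + 1)) \<in> K" unfolding K_def by (intro imageI) simp
  from bspec[OF B this] have "cmod (v * of_real (max y (B + 1))) \<le> B" .
  moreover have "cmod v = 1" by (simp add: v_def)
  ultimately have "\<bar>max y (B + 1)\<bar> \<le> B" by (simp add: norm_mult)
  then show False by linarith
qed

text \<open>If \<open>dL\<close> were negative somewhere, consider the set G of such points inside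
  the curve. It cannot end on the curve, where the moduli agree, nor at an inside point of the
  imaginary axis, by the ray argument, while \<open>dL\<close> is still negative; so
  \<open>dL\<close> = 0 on its frontier, against the minimum principle.\<close>

lemma dL_inside:
  assumes z: "z \<in> Omega0 Sig" "Re z > 0"
  shows "cmod (den (neg_root z)) \<le> cmod (num (neg_root z))"
proof (rule ccontr)
  assume "\<not> ?thesis"
  then have lt: "cmod (num (neg_root z)) < cmod (den (neg_root z))" by simp
  define g where "g x = cmod (den (neg_root x)) - cmod (num (neg_root x))" for x
  have gc: "isCont g x" if "Re x > - 2" for x
  proof -
    have n: "isCont neg_root x" by (rule neg_root_isCont[OF neg_root_right(1)[OF that]])
    have "isCont den (neg_root x)" "isCont num (neg_root x)"
      unfolding den_def[abs_def] num_def[abs_def] by (intro continuous_intros)+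
    from isCont_o2[OF n this(1)] isCont_o2[OF n this(2)]
    show ?thesis unfolding g_def by (intro continuous_intros)
  qed
  define G where "G = {x. Re x > 0 \<and> 0 < g x} \<inter> Omega0 Sig"
  have oO: "open (Omega0 Sig)" unfolding Omega0_def by (rule open_inside[OF compact_imp_closed[OF compact_closed_curve]])
  have oH: "open {x. Re x > 0}" by (rule open_halfspace_Re_gt)
  have "continuous_on {x. Re x > 0} g" by (intro continuous_at_imp_continuous_on ballI gc) simp
  from continuous_open_preimage[OF this oH open_greaterThan[of 0]]
  have "open ({x. Re x > 0} \<inter> g -` {0<..})" .
  moreover have "{x. Re x > 0} \<inter> g -` {0<..} = {x. Re x > 0 \<and> 0 < g x}" by auto
  ultimately have oG: "open G" unfolding G_def using oO by auto
  have bG: "bounded G" unfolding G_def Omega0_def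
    by (intro bounded_Int disjI2 bounded_inside compact_imp_bounded[OF compact_closed_curve])
  have npG: "\<not> pole x" "Re (neg_root x) < 0" if "x \<in> G" for x
  proof -
    have "Re x > 0" "cmod (num (neg_root x)) < cmod (den (neg_root x))" using that by (simp_all add: G_def g_def)
    then show "\<not> pole x" "Re (neg_root x) < 0" by (simp_all add: not_pole_right neg_root_right(1))
  qed
  have zG: "z \<in> G" using z lt by (simp add: G_def g_def)
  have "0 \<le> dL z"
  proof (rule minimum_principle[OF oG bG])
    show "touched_above dL p" "isCont dL p" if "p \<in> G" for p
      using harmonic_at_imp_touched_above[OF dL_harmonic[OF npG(2)[OF that] npG(1)[OF that]]]
        harmonic_at_imp_isCont[OF dL_harmonic[OF npG(2)[OF that] npG(1)[OF that]]] .
    show "z \<in> G" by (rule zG)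
    fix q and \<epsilon> :: real assume q: "q \<in> frontier G" and e: "\<epsilon> > 0"
    have qcl: "q \<in> closure G" and qn: "q \<notin> G" using q oG by (simp_all add: frontier_def interior_open)
    have "closure G \<subseteq> {x. 0 \<le> Re x}" by (rule closure_minimal) (auto simp: G_def closed_halfspace_Re_ge)
    then have R0: "Re q \<ge> 0" using qcl by blast
    have g0: "g q = 0"
    proof (rule ccontr)
      assume "g q \<noteq> 0"
      then consider "g q < 0" | "g q > 0" by linarith
      then show False
      proof cases
        case 1
        have "(g \<longlongrightarrow> g q) (nhds q)" using gc[of q] R0 by (simp add: isCont_def tendsto_at_iff_tendsto_nhds)
        then have "eventually (\<lambda>x. g x < 0) (nhds q)" using 1 by (rule order_tendstoD(2))
        then obtain A where A: "open A" "q \<in> A" "\<forall>x\<in>A. g x < 0" unfolding eventually_nhds by blast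
        have "A \<inter> G = {}" using A(3) by (force simp: G_def)
        then have "A \<inter> closure G = {}" using open_Int_closure_eq_empty[OF A(1)] by blast
        then show False using qcl A(2) by blast
      next
        case 2
        then have lq: "cmod (num (neg_root q)) < cmod (den (neg_root q))" by (simp add: g_def)
        have nS: "q \<notin> Sig" using Sig_num_den[of q] R0 lq by auto
        have nC: "q \<notin> closed_curve Sig"
        proof
          assume c: "q \<in> closed_curve Sig"
          then show False using nS closed_curve_imaginary[OF c] closed_curve_right[of q] R0 by (cases "Re q = 0") auto
        qed
        have "q \<in> closure (Omega0 Sig)" using qcl closure_mono[of G "Omega0 Sig"] by (auto simp: G_def)
        moreover have "frontier (Omega0 Sig) \<subseteq> closed_curve Sig" unfolding Omega0_def
          by (rule frontier_inside_subset[OF compact_imp_closed[OF compact_closed_curve]])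
        ultimately have qO: "q \<in> Omega0 Sig" using nC oO by (auto simp: frontier_def interior_open)
        then have "Re q \<noteq> 0" using ray_not_inside[OF _ lq] by blast
        then have "q \<in> G" using qO 2 R0 by (simp add: G_def)
        then show False using qn by blast
      qed
    qed
    then have eq: "cmod (num (neg_root q)) = cmod (den (neg_root q))" by (simp add: g_def)
    have np: "\<not> pole q" by (rule not_pole_right[OF R0]) (simp add: eq)
    have neg: "Re (neg_root q) < 0" by (rule neg_root_right(1)) (use R0 in simp)
    have d0: "dL q = 0" by (rule dL_num_den(2)[OF np eq])
    have "(dL \<longlongrightarrow> dL q) (nhds q)" using harmonic_at_imp_isCont[OF dL_harmonic[OF neg np]]
      by (simp add: isCont_def tendsto_at_iff_tendsto_nhds)
    then have "eventually (\<lambda>x. dL x > - \<epsilon>) (nhds q)" by (rule order_tendstoD(1)) (simp add: d0 e)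
    then show "eventually (\<lambda>x. dL x > - \<epsilon>) (at q within G)" by (rule eventually_within)
  qed
  moreover have "dL z < 0" using dL_num_den(1)[OF npG(1)[OF zG]] lt by blast
  ultimately show False by simp
qed

text \<open>It is not decided here which root the continued branch picks. Since the left root has
  the larger value of \<open>L\<close>, the inequality holds in either case; over a pole the branch
  is the left root itself.\<close>

lemma U_inside:
  assumes z: "z \<in> Omega0 Sig" "Re z > 0"
  shows "z \<notin> Sig" "U z \<le> L (neg_root z)"
proof -
  have "z \<notin> closed_curve Sig" using z(1) inside_no_overlap[of "closed_curve Sig"] unfolding Omega0_def by blast
  then show nS: "z \<notin> Sig" using closed_curve_right[OF z(2)] by blast
  show "U z \<le> L (neg_root z)"
  proof (cases "pole z")
    case True
    show ?thesis unfolding U_phys[OF nS] pole_phys(2)[OF True] by simp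
  next
    case False
    have "\<not> dL z < 0" unfolding dL_num_den(1)[OF False] using dL_inside[OF z] by simp
    then have le: "L (conj_root (neg_root z)) \<le> L (neg_root z)" by (simp add: dL_def)
    have "phys z = neg_root z \<or> phys z = conj_root (neg_root z)" by (rule root_cases[OF neg_root(1) phys_root[OF nS]])
    then show ?thesis unfolding U_phys[OF nS] using le by (elim disjE) (simp_all only: order_refl)
  qed
qed

text \<open>On the arc the kink of the potential points up, so - U lies below the harmonic function
  - Re F and agrees with it where Re \<psi> = 0.\<close>

lemma U_local:
  assumes "p \<noteq> \<Gamma> 0" "p \<noteq> \<Gamma> 1"
  shows "isCont U p" "touched_above (\<lambda>z. - U z) p"
proof -
  have "isCont U p \<and> touched_above (\<lambda>z. - U z) p"
  proof (cases "p \<in> Sig")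
    case False
    note h = U_harmonic(1)[OF False]
    show ?thesis using harmonic_at_imp_isCont[OF h] harmonic_at_imp_touched_above[OF harmonic_at_minus[OF h]] by blast
  next
    case True
    then show ?thesis
    proof (cases rule: Sig_cases)
      case (interior t0)
      obtain B \<psi> T F where B: "open B" "\<Gamma> t0 \<in> B" "\<psi> holomorphic_on B" "T holomorphic_on B" "F holomorphic_on B"
        "\<And>z. z \<in> B \<Longrightarrow> root z (T z) \<and> conj_root (T z) \<noteq> T z \<and> \<not> pole z"
        "\<And>z. z \<in> B \<Longrightarrow> L (T z) - L (conj_root (T z)) = 2 * Re (\<psi> z)"
        "\<And>z. z \<in> B \<Longrightarrow> z \<in> Sig \<longleftrightarrow> Re (\<psi> z) = 0"
        "connected {z\<in>B. Re (\<psi> z) > 0}" "connected {z\<in>B. Re (\<psi> z) < 0}"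
        "\<And>z. z \<in> B \<Longrightarrow> Re (\<psi> z) = 0 \<Longrightarrow> z \<in> closure {z\<in>B. Re (\<psi> z) > 0} \<and> z \<in> closure {z\<in>B. Re (\<psi> z) < 0}"
        "\<And>z. z \<in> B \<Longrightarrow> integrable Mt (\<lambda>t. ln (cmod (z - \<Gamma> t))) \<and> U z = \<bar>Re (\<psi> z)\<bar> + Re (F z)"
        by (rule local_structure[OF interior(1)]) (rule that)
      have pB: "p \<in> B" using B(2) interior(2) by simp
      have Ue: "U z = \<bar>Re (\<psi> z)\<bar> + Re (F z)" if "z \<in> B" for z using B(12)[OF that] ..
      have "continuous_on B (\<lambda>z. \<bar>Re (\<psi> z)\<bar> + Re (F z))"
        by (intro continuous_intros holomorphic_on_imp_continuous_on[OF B(3)] holomorphic_on_imp_continuous_on[OF B(5)])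
      then have "continuous_on B U" by (rule continuous_on_eq) (simp only: Ue)
      then have c: "isCont U p" using B(1) pB by (simp add: continuous_on_eq_continuous_at)
      obtain r where r: "r > 0" "ball p r \<subseteq> B" using openE[OF B(1) pB] .
      have "Re (\<psi> p) = 0" using B(8)[OF pB] True by blast
      then have Up: "U p = Re (F p)" unfolding Ue[OF pB] by simp
      have "touched_above (\<lambda>z. - U z) p" unfolding touched_above_def
      proof (intro exI conjI ballI)
        show "0 < r" by (rule r(1))
        show "(\<lambda>z. - F z) holomorphic_on ball p r" by (intro holomorphic_on_minus holomorphic_on_subset[OF B(5) r(2)])
        show "Re (- F p) = - U p" unfolding Up by simp
        fix z assume "z \<in> ball p r"
        from Ue[OF subsetD[OF r(2) this]] show "- U z \<le> Re (- F z)" by simp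
      qed
      then show ?thesis using c by blast
    next
      case endpoint
      then show ?thesis using assms by blast
    qed
  qed
  then show "isCont U p" "touched_above (\<lambda>z. - U z) p" by blast+
qed

text \<open>Off the arc, z -> cnj (phys (cnj z)) is again a continuous branch on the connected
  complement and agrees with \<open>phys\<close> at a real point left of the crossing, where the
  left root is real.\<close>

lemma U_cnj: assumes "z \<noteq> \<Gamma> 0" "z \<noteq> \<Gamma> 1" shows "U (cnj z) = U z"
proof (cases "z \<in> Sig")
  case True
  then show ?thesis
  proof (cases rule: Sig_cases)
    case (interior t)
    have "cnj z \<in> Sig" using True cnj_Sig by blast
    then show ?thesis
    proof (cases rule: Sig_cases)
      case i2: (interior s)
      have "root (\<Gamma> s) (cnj (neg_root z))" unfolding i2(2)[symmetric] by (rule root_cnj[OF neg_root(1)])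
      from U_Sig[OF i2(1) this] have "U (cnj z) = L (neg_root z)" unfolding i2(2)[symmetric] L_cnj .
      moreover have "U z = L (neg_root z)" unfolding interior(2) by (rule U_Sig[OF interior(1) neg_root(1)])
      ultimately show ?thesis by simp
    next
      case endpoint
      then show ?thesis
      proof
        assume a: "cnj z = \<Gamma> 0"
        have "z = cnj (cnj z)" by simp
        also have "\<dots> = \<Gamma> 1" unfolding a by (rule cnj_ends)
        finally show ?thesis using assms(2) by blast
      next
        assume a: "cnj z = \<Gamma> 1"
        have "z = cnj (cnj z)" by simp
        also have "\<dots> = \<Gamma> 0" unfolding a cnj_ends[symmetric] by simp
        finally show ?thesis using assms(1) by blast
      qed
    qed
  next
    case endpoint
    then show ?thesis using assms by blast
  qed
next
  case False
  have cn: "connected (- Sig)"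
  proof -
    have "arc \<Gamma>" unfolding arc_def using path_Gamma(1) Gamma_inj by blast
    then have "connected (- path_image \<Gamma>)" by (rule connected_arc_complement) simp
    then show ?thesis unfolding path_Gamma(2) .
  qed
  have co: "cnj x \<in> - Sig" if "x \<in> - Sig" for x using that cnj_Sig by simp
  define a where "a = complex_of_real (xs - 1)"
  have a: "a \<notin> Sig" "phys a = neg_root a" unfolding a_def using phys_real(1,2)[of "xs - 1"] by simp_all
  have "phys z = cnj (phys (cnj z))"
  proof (rule branch_unique[OF cn phys_cont, of "\<lambda>x. cnj (phys (cnj x))" a z])
    have "continuous_on (- Sig) (\<lambda>x. phys (cnj x))"
    proof (rule continuous_on_compose2[OF phys_cont])
      show "continuous_on (- Sig) cnj" by (rule continuous_on_cnj[OF continuous_on_id])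
      show "cnj ` (- Sig) \<subseteq> - Sig"
      proof
        fix y assume "y \<in> cnj ` (- Sig)"
        then obtain x where "y = cnj x" "x \<in> - Sig" by (rule imageE) (rule that)
        then show "y \<in> - Sig" using co[of x] by (simp only:)
      qed
    qed
    then show "continuous_on (- Sig) (\<lambda>x. cnj (phys (cnj x)))" by (rule continuous_on_cnj)
    show "root x (phys x)" if "x \<in> - Sig" for x by (rule phys_root[OF that[unfolded Compl_iff]])
    have rc: "root x (cnj (phys (cnj x)))" if "x \<in> - Sig" for x
    proof -
      have "cnj x \<notin> Sig" using co[OF that] unfolding Compl_iff .
      from root_cnj[OF phys_root[OF this]] show ?thesis unfolding complex_cnj_cnj .
    qed
    show "root x (cnj (phys (cnj x)))" if "x \<in> - Sig" for x by (rule rc[OF that])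
    show "conj_root (cnj (phys (cnj x))) \<noteq> cnj (phys (cnj x))" if "x \<in> - Sig" for x
      by (rule Compl_Sig_disc[OF that[unfolded Compl_iff] rc[OF that]])
    show "a \<in> - Sig" using a(1) by simp
    have "cnj a = a" by (simp add: a_def)
    moreover have "cnj (neg_root a) = neg_root a" using real_neg_root(2)[of a] by (simp add: a_def complex_eq_iff)
    ultimately show "phys a = cnj (phys (cnj a))" by (simp only: a(2))
    show "z \<in> - Sig" using False by simp
  qed
  then have "L (phys z) = L (phys (cnj z))" by (simp only: L_cnj)
  moreover have "cnj z \<notin> Sig" using False cnj_Sig by blast
  ultimately show ?thesis unfolding U_phys[OF False] by (simp only: U_phys[OF \<open>cnj z \<notin> Sig\<close>])
qed

lemma U_difference_far:
  assumes "\<epsilon> > 0" obtains N where "N > 0" "\<And>z. cmod z > N \<Longrightarrow> \<bar>U (- z) - U z\<bar> < \<epsilon>"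
proof -
  obtain M where M: "M > 0" "\<And>t. t \<in> {0..1} \<Longrightarrow> cmod (\<Gamma> t) < M" by (rule Sig_bound) (rule that)
  have bnd: "ln (cmod z - M) \<le> U z \<and> U z \<le> ln (cmod z + M)" if z: "cmod z > M" for z
  proof -
    have nS: "z \<notin> Sig"
    proof
      assume "z \<in> Sig"
      then obtain t where t: "t \<in> {0..1}" "z = \<Gamma> t" unfolding Sig_def by (elim imageE) (rule that)
      show False using M(2)[OF t(1)] z unfolding t(2) by simp
    qed
    note i = U_harmonic(2)[OF nS]
    have both: "ln (cmod z - M) \<le> ln (cmod (z - \<Gamma> t)) \<and> ln (cmod (z - \<Gamma> t)) \<le> ln (cmod z + M)" if t: "t \<in> {0<..<1}" for t
    proof -
      have t1: "cmod (\<Gamma> t) < M" by (rule M(2)) (use t in simp)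
      have lo: "cmod z - M \<le> cmod (z - \<Gamma> t)" using norm_triangle_ineq2[of z "\<Gamma> t"] t1 by linarith
      have hi: "cmod (z - \<Gamma> t) \<le> cmod z + M" using norm_triangle_ineq4[of z "\<Gamma> t"] t1 by linarith
      show ?thesis using lo hi z by (intro conjI ln_mono) linarith+
    qed
    have c: "(\<integral>t. k \<partial>Mt) = k" for k :: real using prob_space.prob_space[OF prob_Mt] by simp
    have ae1: "AE t in Mt. ln (cmod z - M) \<le> ln (cmod (z - \<Gamma> t))"
      using AE_Mt[of 0] by eventually_elim (elim conjE, erule conjunct1[OF both])
    have ae2: "AE t in Mt. ln (cmod (z - \<Gamma> t)) \<le> ln (cmod z + M)"
      using AE_Mt[of 0] by eventually_elim (elim conjE, erule conjunct2[OF both])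
    have k: "integrable Mt (\<lambda>t. k)" for k :: real by simp
    have "(\<integral>t. ln (cmod z - M) \<partial>Mt) \<le> U z" unfolding U_def by (rule integral_mono_AE[OF k i ae1])
    moreover have "U z \<le> (\<integral>t. ln (cmod z + M) \<partial>Mt)" unfolding U_def by (rule integral_mono_AE[OF i k ae2])
    ultimately show ?thesis unfolding c by blast
  qed
  \<comment> \<open>Beyond this radius |z| + M < (|z| - M) exp (\<epsilon> / 2), so the logarithmic
    bounds for z and - z differ by less than \<epsilon> / 2.\<close>
  define N where "N = M + 2 * M / (exp (\<epsilon> / 2) - 1)"
  have E: "exp (\<epsilon> / 2) > 1" using assms by simp
  have "2 * M / (exp (\<epsilon> / 2) - 1) > 0" using E M(1) by simp
  then have N: "N > M" "N > 0" using M(1) by (simp_all add: N_def)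
  have "\<bar>U (- z) - U z\<bar> < \<epsilon>" if z: "cmod z > N" for z
  proof -
    have zM: "cmod z > M" "cmod (- z) > M" using z N by simp_all
    have "2 * M / (exp (\<epsilon> / 2) - 1) < cmod z - M" using z by (simp add: N_def)
    then have "2 * M < (cmod z - M) * (exp (\<epsilon> / 2) - 1)" using E by (simp add: pos_divide_less_eq)
    then have "cmod z + M < (cmod z - M) * exp (\<epsilon> / 2)" by (simp add: algebra_simps)
    then have "ln (cmod z + M) < ln ((cmod z - M) * exp (\<epsilon> / 2))" using zM(1) M(1) by (subst ln_less_cancel_iff) auto
    also have "\<dots> = ln (cmod z - M) + \<epsilon> / 2" using zM(1) by (subst ln_mult) auto
    finally have l: "ln (cmod z + M) < ln (cmod z - M) + \<epsilon> / 2" .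
    have "ln (cmod z - M) \<le> U (- z)" "U (- z) \<le> ln (cmod z + M)" using bnd[OF zM(2)] by simp_all
    with bnd[OF zM(1)] l show ?thesis using assms by linarith
  qed
  then show thesis using that N(2) by blast
qed

section \<open>The strict inequality, given that the left part of the arc lies inside the
  curve\<close>

context
  assumes contained: "Sig \<inter> {z. Re z < 0} \<subseteq> Omega0 Sig"
begin

text \<open>By symmetry of the closed curve \<open>q\<close> is inside as well, so U q \<le> L
  (neg_root q), which is less than Yhat (- q) by positivity of \<open>S\<close>. The latter is the
  value of \<open>L\<close> at the arc point - q; both sides are then compared with an intermediate
  number on a whole neighbourhood.\<close>

lemma U_reflected_near_Sig:
  assumes q: "Re q > 0" "- q \<in> Sig"
  shows "eventually (\<lambda>z. U z < U (- z)) (nhds q)"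
proof -
  have "- q \<in> Omega0 Sig" using contained q by auto
  then have "q \<in> Omega0 Sig" unfolding Omega0_def
  proof (intro inside_scale[of "- 1" q "closed_curve Sig"])
    show "x \<in> closed_curve Sig \<longleftrightarrow> - 1 * x \<in> closed_curve Sig" for x
      unfolding closed_curve_def by (auto simp: mem_uminus_image)
  qed simp_all
  note Uq = U_inside[OF this q(1)]
  obtain t where t: "root (- q) t" "Yhat (- q) = L t" using Yhat_cases[of "- q"] by (elim exE conjE) (rule that)
  have lt: "U q < L t" using S_pos[OF q(1)] Uq(2) t(2) by (simp add: S_def)
  define m where "m = (U q + L t) / 2"
  have m: "U q < m" "m < L t" using lt by (simp_all add: m_def field_simps)
  have qe: "q \<noteq> \<Gamma> 0" "q \<noteq> \<Gamma> 1" using not_end[of q] q(1) by simp_all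
  have "(U \<longlongrightarrow> U q) (nhds q)" using U_local(1)[OF qe] by (simp add: isCont_def tendsto_at_iff_tendsto_nhds)
  then have e1: "eventually (\<lambda>z. U z < m) (nhds q)" using m(1) by (rule order_tendstoD(2))
  have e2: "eventually (\<lambda>z. m < U (- z)) (nhds q)"
    using q(2)
  proof (cases rule: Sig_cases)
    case (interior s)
    have ne: "- q \<noteq> \<Gamma> 0" "- q \<noteq> \<Gamma> 1"
      using interior inj_onD[OF Gamma_inj, of s 0] inj_onD[OF Gamma_inj, of s 1] by auto
    have "U (- q) = L t" unfolding interior(2) by (rule U_Sig[OF interior(1)]) (use t(1) interior(2) in simp)
    moreover have "((\<lambda>z. U (- z)) \<longlongrightarrow> U (- q)) (nhds q)"
      by (rule isCont_tendsto_nhds[OF isCont_reflect[OF U_local(1)[OF ne]]])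
    ultimately have "((\<lambda>z. U (- z)) \<longlongrightarrow> L t) (nhds q)" by simp
    then show ?thesis using m(2) by (rule order_tendstoD(1))
  next
    case endpoint
    have c0: "conj_root t = t" using conj_root_eq_iff[OF t(1)] endpoint Gamma_ends by (elim disjE) (simp_all only:)
    have "L t - m > 0" using m by simp
    from L_near_double_root[OF t(1) c0 this]
    obtain d where d: "d > 0 \<and> (\<forall>z u. cmod (z - - q) < d \<longrightarrow> root z u \<longrightarrow> \<bar>L u - L t\<bar> < L t - m)" by (rule exE) (rule that)
    \<comment> \<open>Near an end point U is the value of \<open>L\<close> at some root close to the
      double root, except at the end point itself, where Fatou's inequality supplies the lower
      bound.\<close>
    have "m < U (- z)" if "z \<in> ball q d" for z
    proof (cases "- z = \<Gamma> 0 \<or> - z = \<Gamma> 1")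
      case True
      have c: "cmod (- z - - q) < d" using that by (simp add: dist_norm)
      have "\<bar>L (neg_root (- z)) - L t\<bar> < L t - m" by (rule conjunct2[OF d, rule_format, OF c neg_root(1)])
      then show ?thesis using U_end(2)[OF True neg_root(1)] by linarith
    next
      case False
      then have ne: "- z \<noteq> \<Gamma> 0" "- z \<noteq> \<Gamma> 1" by simp_all
      obtain u where u: "root (- z) u" "U (- z) = L u" by (rule U_root[OF ne]) (rule that)
      have c: "cmod (- z - - q) < d" using that by (simp add: dist_norm)
      have "\<bar>L u - L t\<bar> < L t - m" by (rule conjunct2[OF d, rule_format, OF c u(1)])
      then show ?thesis unfolding u(2) by linarith
    qed
    then show ?thesis unfolding eventually_nhds by (intro exI[of _ "ball q d"]) (use conjunct1[OF d] in simp)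
  qed
  from e1 e2 show ?thesis by eventually_elim linarith
qed

lemma reflected_local:
  assumes "Re p > 0" "- p \<notin> Sig"
  shows "isCont (\<lambda>z. U (- z) - U z) p" "touched_above (\<lambda>z. U (- z) - U z) p"
proof -
  have pe: "p \<noteq> \<Gamma> 0" "p \<noteq> \<Gamma> 1" using not_end[of p] assms(1) by simp_all
  have h: "harmonic_at U (- p)" by (rule U_harmonic(1)[OF assms(2)])
  have "isCont (\<lambda>z. U (- z)) p"
    by (rule isCont_reflect[OF harmonic_at_imp_isCont[OF h]])
  then show "isCont (\<lambda>z. U (- z) - U z) p" using U_local(1)[OF pe] by (intro continuous_intros)
  have "touched_above (\<lambda>z. U (- z) + - U z) p"
    by (rule touched_above_add[OF touched_above_compose_uminus[OF harmonic_at_imp_touched_above[OF h]] U_local(2)[OF pe]])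
  then show "touched_above (\<lambda>z. U (- z) - U z) p" by (simp only: add_uminus_conv_diff)
qed

text \<open>The minimum principle on the right half-disc without the reflected arc. On the axis the
  difference is 0 by conjugation symmetry, far out it is small, and near the reflected arc it is
  positive.\<close>

lemma U_reflected_ge: assumes z: "Re z > 0" shows "U z \<le> U (- z)"
proof (cases "- z \<in> Sig")
  case True
  from eventually_nhds_x_imp_x[OF U_reflected_near_Sig[OF z True]] show ?thesis by simp
next
  case False
  show ?thesis
  proof (rule field_le_epsilon)
    fix \<epsilon> :: real assume e: "\<epsilon> > 0"
    obtain N where N: "N > 0" "\<And>z. cmod z > N \<Longrightarrow> \<bar>U (- z) - U z\<bar> < \<epsilon>" by (rule U_difference_far[OF e]) (rule that)
    define \<rho> where "\<rho> = N + cmod z + 1"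
    have oN: "open (uminus ` (- Sig))" by (rule open_negations[OF open_Compl_Sig])
    define W where "W = ball 0 \<rho> \<inter> {x. Re x > 0} \<inter> uminus ` (- Sig)"
    have mem: "x \<in> uminus ` (- Sig) \<longleftrightarrow> - x \<notin> Sig" for x :: complex
      by (simp add: mem_uminus_image)
    have W: "open W" "bounded W" unfolding W_def
      by (intro open_Int open_ball open_halfspace_Re_gt oN) (intro bounded_Int disjI1 bounded_ball)
    have "0 \<le> \<epsilon> + (U (- z) - U z)"
    proof (rule minimum_principle[OF W])
      show "z \<in> W" using z False N(1) by (simp add: W_def mem \<rho>_def)
      show "touched_above (\<lambda>z. \<epsilon> + (U (- z) - U z)) p" if "p \<in> W" for p
        by (intro touched_above_add harmonic_at_imp_touched_above[OF harmonic_at_const] reflected_local(2))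
          (use that in \<open>simp_all add: W_def mem\<close>)
      show "isCont (\<lambda>z. \<epsilon> + (U (- z) - U z)) p" if "p \<in> W" for p
        by (intro continuous_add[OF continuous_const] reflected_local(1)) (use that in \<open>simp_all add: W_def mem\<close>)
      fix q and \<delta> :: real assume q: "q \<in> frontier W" and d: "\<delta> > 0"
      have qcl: "q \<in> closure W" and qn: "q \<notin> W" using q W(1) by (simp_all add: frontier_def interior_open)
      have "closure W \<subseteq> {x. 0 \<le> Re x}" by (rule closure_minimal) (auto simp: W_def closed_halfspace_Re_ge)
      then have R0: "Re q \<ge> 0" using qcl by blast
      have "closure W \<subseteq> cball 0 \<rho>" by (rule closure_minimal) (auto simp: W_def)
      then have Rq: "cmod q \<le> \<rho>" using qcl by auto
      have "eventually (\<lambda>z. \<epsilon> + (U (- z) - U z) > - \<delta>) (nhds q)"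
      proof (cases "cmod q > N")
        case True
        have "eventually (\<lambda>x. x \<in> - cball 0 N) (nhds q)" by (rule eventually_nhds_in_open) (use True in auto)
        then show ?thesis
        proof eventually_elim
          case (elim x)
          then have "cmod x > N" by simp
          from N(2)[OF this] show ?case using d by linarith
        qed
      next
        case small: False
        show ?thesis
        proof (cases "Re q = 0")
          case True
          have qe: "q \<noteq> \<Gamma> 0" "q \<noteq> \<Gamma> 1" "- q \<noteq> \<Gamma> 0" "- q \<noteq> \<Gamma> 1" using not_end[of q] not_end[of "- q"] True by simp_all
          have "- q = cnj q" using True by (simp add: complex_eq_iff)
          then have "U (- q) = U q" using U_cnj[OF qe(1,2)] by simp
          moreover have "isCont (\<lambda>z. U (- z)) q"
            by (rule isCont_reflect[OF U_local(1)[OF qe(3,4)]])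
          then have "isCont (\<lambda>z. \<epsilon> + (U (- z) - U z)) q" using U_local(1)[OF qe(1,2)] by (intro continuous_intros)
          then have "((\<lambda>z. \<epsilon> + (U (- z) - U z)) \<longlongrightarrow> \<epsilon> + (U (- q) - U q)) (nhds q)"
            by (rule isCont_tendsto_nhds)
          ultimately show ?thesis by (intro order_tendstoD(1)) (use e d in auto)
        next
          case False
          then have "Re q > 0" using R0 by simp
          moreover have "- q \<in> Sig"
          proof (rule ccontr)
            assume "- q \<notin> Sig"
            moreover have "cmod q < \<rho>" using small norm_ge_zero[of z] unfolding \<rho>_def by linarith
            ultimately have "q \<in> W" using \<open>Re q > 0\<close> by (simp add: W_def mem)
            then show False using qn by blast
          qed
          ultimately have "eventually (\<lambda>z. U z < U (- z)) (nhds q)" by (rule U_reflected_near_Sig)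
          then show ?thesis by eventually_elim (use e d in linarith)
        qed
      qed
      then show "eventually (\<lambda>z. \<epsilon> + (U (- z) - U z) > - \<delta>) (at q within W)" by (rule eventually_within)
    qed
    then show "U z \<le> U (- z) + \<epsilon>" by linarith
  qed
qed

text \<open>Equality is an open condition by rigidity, since it cannot occur on the reflected arc;
  strict inequality is open by continuity. The half-plane is connected, and strictness holds at one
  real point.\<close>

lemma U_reflected_less: assumes z: "Re z > 0" shows "U z < U (- z)"
proof (rule ccontr)
  assume c: "\<not> U z < U (- z)"
  define H where "H = {z. Re z > 0}"
  define A where "A = {z\<in>H. U (- z) = U z}"
  define B where "B = {z\<in>H. U z < U (- z)}"
  have oH: "open H" unfolding H_def by (rule open_halfspace_Re_gt)
  have AB: "H = A \<union> B" "A \<inter> B = {}"   proof -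
    show "H = A \<union> B"
    proof (intro equalityI subsetI)
      fix x assume x: "x \<in> H"
      then have "Re x > 0" by (simp add: H_def)
      from U_reflected_ge[OF this] have "U (- x) = U x \<or> U x < U (- x)" by linarith
      then show "x \<in> A \<union> B" using x by (simp add: A_def B_def)
    qed (auto simp: A_def B_def)
    show "A \<inter> B = {}" by (auto simp: A_def B_def)
  qed
  have offA: "- p \<notin> Sig" if "p \<in> A" for p
  proof
    assume s: "- p \<in> Sig"
    have "Re p > 0" using that by (simp add: A_def H_def)
    from eventually_nhds_x_imp_x[OF U_reflected_near_Sig[OF this s]] show False using that by (simp add: A_def)
  qed
  have "open A" unfolding open_contains_ball
  proof
    fix p assume p: "p \<in> A"
    have pH: "p \<in> H" and Rp: "Re p > 0" and eq: "U (- p) = U p" using p by (simp_all add: A_def H_def)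
    obtain r where r: "r > 0" "ball p r \<subseteq> H" using openE[OF oH pH] .
    have "\<exists>s>0. \<forall>z\<in>ball p s. U (- z) - U z = U (- p) - U p"
    proof (rule touched_above_local_min[OF reflected_local(2)[OF Rp offA[OF p]] r(1)])
      fix x assume "x \<in> ball p r"
      then have "Re x > 0" using r(2) by (auto simp: H_def)
      from U_reflected_ge[OF this] show "U (- p) - U p \<le> U (- x) - U x" using eq by simp
    qed
    then obtain s where s: "s > 0" "\<forall>z\<in>ball p s. U (- z) - U z = U (- p) - U p" by (elim exE conjE) (rule that)
    show "\<exists>s>0. ball p s \<subseteq> A"
    proof (intro exI conjI subsetI)
      show "min r s > 0" using r s by simp
      fix x assume x: "x \<in> ball p (min r s)"
      then have "x \<in> H" using r(2) by auto
      moreover have "U (- x) - U x = U (- p) - U p" using bspec[OF s(2), of x] x by simp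
      ultimately show "x \<in> A" using eq by (simp add: A_def)
    qed
  qed
  moreover have "open B" unfolding open_subopen[of B]
  proof
    fix p assume p: "p \<in> B"
    have pH: "p \<in> H" and Rp: "Re p > 0" and lt: "U p < U (- p)" using p by (simp_all add: B_def H_def)
    have ev: "eventually (\<lambda>z. U z < U (- z)) (nhds p)"
    proof (cases "- p \<in> Sig")
      case False
      have "((\<lambda>z. U (- z) - U z) \<longlongrightarrow> U (- p) - U p) (nhds p)"
        by (rule isCont_tendsto_nhds[OF reflected_local(1)[OF Rp False]])
      then have "eventually (\<lambda>z. 0 < U (- z) - U z) (nhds p)" by (rule order_tendstoD(1)) (use lt in simp)
      then show ?thesis by eventually_elim simp
    qed (rule U_reflected_near_Sig[OF Rp])
    moreover have "eventually (\<lambda>z. z \<in> H) (nhds p)" by (rule eventually_nhds_in_open[OF oH pH])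
    ultimately have "eventually (\<lambda>z. z \<in> B) (nhds p)" by eventually_elim (simp add: B_def)
    then show "\<exists>T. open T \<and> p \<in> T \<and> T \<subseteq> B" unfolding eventually_nhds by (auto simp: subset_eq)
  qed
  moreover have "connected H" unfolding H_def by (intro convex_connected convex_halfspace_Re_gt)
  moreover have "z \<in> A"
  proof -
    have "U (- z) = U z" using c U_reflected_ge[OF z] by linarith
    then show ?thesis using z by (simp add: A_def H_def)
  qed
  moreover have "\<exists>x. x \<in> B"
  proof -
    \<comment> \<open>Both x and - x lie left of the crossing, so the branch is the left root at
      both; x < 2 puts the left root over - x into \<open>Delta\<close>, where the two values are
      compared by \<open>S\<close> directly.\<close>
    define x where "x = min (xs / 2) 1"
    have x: "0 < x" "x < xs" "x < 2" "- x < xs" using crossing_gt(1) by (auto simp: x_def min_def)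
    have px: "complex_of_real x \<notin> Sig" "phys (of_real x) = neg_root (of_real x)" using phys_real(1,2)[of x] x by simp_all
    have mx: "complex_of_real (- x) \<notin> Sig" "phys (of_real (- x)) = neg_root (of_real (- x))" using phys_real(1,2)[of "- x"] x by simp_all
    have "neg_root (of_real (- x)) \<in> Delta" by (rule neg_root_right(2)) (use x in simp)
    then have "Yhat (of_real (- x)) = L (neg_root (of_real (- x)))" by (simp add: Yhat_def)
    also have "\<dots> = U (of_real (- x))" unfolding U_phys[OF mx(1)] mx(2) ..
    finally have y: "Yhat (- of_real x) = U (- of_real x)" by simp
    have "U (of_real x) = L (neg_root (of_real x))" unfolding U_phys[OF px(1)] px(2) ..
    then have "U (of_real x) < U (- of_real x)" using S_pos[of "of_real x"] x(1) y by (simp add: S_def)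
    then show ?thesis using x(1) by (intro exI[of _ "of_real x"]) (simp add: B_def H_def)
  qed
  ultimately show False using connectedD[of H A B] AB by blast
qed

end

end

section \<open>Change of scale and transfer to the given trajectory\<close>

text \<open>The positive branch turns w v into pi i times a positive number, so its square
  determines that number; the density becomes a formula in which no branch appears.\<close>

lemma pos_branch_value:
  assumes "neg_real (q s * v\<^sup>2)"
  shows "Re (pos_branch q s v * v / (of_real pi * \<i>)) = sqrt (- Re (q s * v\<^sup>2)) / pi"
proof -
  define W where "W = pos_branch q s v"
  define k where "k = Re (W * v / (of_real pi * \<i>))"
  have W: "W\<^sup>2 = q s \<and> W * v / (of_real pi * \<i>) \<in> \<real> \<and> 0 < Re (W * v / (of_real pi * \<i>))"
    unfolding W_def pos_branch_def by (rule theI'[OF pos_branch_ex1[of q s v, OF assms]])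
  have k: "k > 0" using W by (simp only: k_def)
  have "W * v / (of_real pi * \<i>) = of_real k" using W unfolding k_def by (simp only: of_real_Re)
  then have wv: "W * v = of_real (k * pi) * \<i>" by (simp add: field_simps)
  have "q s * v\<^sup>2 = (W * v)\<^sup>2" unfolding power_mult_distrib conjunct1[OF W] ..
  also have "\<dots> = of_real (- ((k * pi)\<^sup>2))" unfolding wv by (simp add: power_mult_distrib)
  finally have "- Re (q s * v\<^sup>2) = (k * pi)\<^sup>2" by (simp only: Re_complex_of_real minus_minus)
  then have "sqrt (- Re (q s * v\<^sup>2)) = k * pi" using k by simp
  then show ?thesis unfolding W_def[symmetric] k_def[symmetric] by simp
qed

text \<open>With \<open>\<sigma> = (1 + \<surd>\<alpha>)\<^sup>2 / 16\<close>, the substitution \<open>z = \<sigma> Z\<close> removes \<open>\<alpha>\<close> in favour of \<open>w\<close>.\<close>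

definition scale :: "real \<Rightarrow> real" where "scale \<alpha> = (1 + sqrt \<alpha>)\<^sup>2 / 16"
definition width :: "real \<Rightarrow> real" where "width \<alpha> = 1 - 4 * (1 - sqrt \<alpha>)\<^sup>2 / (1 + sqrt \<alpha>)\<^sup>2"

text \<open>The scale makes the real part of both simple zeros -2 in the new variable, and the width
  makes their squared imaginary part 12w. With a = sqrt \<alpha> and A = (1 + a)^2 one has w A = (3a
  - 1)(3 - a), so \<alpha> > 1/9 is the positivity of w.\<close>

lemma scale_width:
  assumes "1 / 9 < \<alpha>" "\<alpha> \<le> 1"
  shows "scale \<alpha> > 0" "0 < width \<alpha>" "width \<alpha> \<le> 1"
    and "(1 - sqrt \<alpha>)\<^sup>2 / 2 = (2 - 2 * width \<alpha>) * scale \<alpha>"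
    and "(beta \<alpha>)\<^sup>2 = 16 * (1 - width \<alpha>) * (scale \<alpha>)\<^sup>2"
    and "\<alpha> + beta \<alpha> = (5 - width \<alpha>) * scale \<alpha>"
    and "9 / 64 * (1 + sqrt \<alpha>)\<^sup>2 * ((1 - sqrt \<alpha> / 3) * (3 * sqrt \<alpha> - 1)) = 12 * width \<alpha> * (scale \<alpha>)\<^sup>2"
    and "(1 - sqrt \<alpha> / 3) * (3 * sqrt \<alpha> - 1) \<ge> 0"
proof -
  define a where "a = sqrt \<alpha>"
  have "sqrt (1 / 9) < a" unfolding a_def using assms(1) by (rule real_sqrt_less_mono)
  moreover have "sqrt (1 / 9) = 1 / 3" by (rule real_sqrt_unique) (simp_all add: power2_eq_square)
  ultimately have a: "1 / 3 < a" "a \<le> 1" "a\<^sup>2 = \<alpha>" using assms by (simp_all add: a_def)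
  define A where "A = (1 + a)\<^sup>2"
  have A: "A > 0" unfolding A_def using a by (intro zero_less_power) simp
  have s: "scale \<alpha> = A / 16" by (simp add: scale_def A_def a_def)
  have w: "width \<alpha> = 1 - 4 * (1 - a)\<^sup>2 / A" by (simp add: width_def A_def a_def)
  have e1: "(1 - width \<alpha>) * A = 4 * (1 - a)\<^sup>2" unfolding w using A by simp
  have e2: "width \<alpha> * A = (3 * a - 1) * (3 - a)"
  proof -
    have "width \<alpha> * A = A - (1 - width \<alpha>) * A" by (simp add: algebra_simps)
    then show ?thesis unfolding e1 by (simp add: A_def power2_eq_square algebra_simps)
  qed
  show "scale \<alpha> > 0" using A s by simp
  have "width \<alpha> * A > 0" unfolding e2 using a by (intro mult_pos_pos) simp_all
  then show "0 < width \<alpha>" using A by (simp add: zero_less_mult_iff)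
  show "width \<alpha> \<le> 1" unfolding w using A by simp
  have "(2 - 2 * width \<alpha>) * scale \<alpha> = ((1 - width \<alpha>) * A) / 8" unfolding s by simp
  then show "(1 - sqrt \<alpha>)\<^sup>2 / 2 = (2 - 2 * width \<alpha>) * scale \<alpha>" unfolding e1 a_def by simp
  have "16 * (1 - width \<alpha>) * (scale \<alpha>)\<^sup>2 = ((1 - width \<alpha>) * A) * A / 16" unfolding s by (simp add: power2_eq_square)
  also have "\<dots> = ((1 - a\<^sup>2) / 2)\<^sup>2" unfolding e1 unfolding A_def by (simp add: power2_eq_square field_simps)
  finally show "(beta \<alpha>)\<^sup>2 = 16 * (1 - width \<alpha>) * (scale \<alpha>)\<^sup>2" unfolding beta_def a(3) by simp
  have "(5 - width \<alpha>) * scale \<alpha> = (4 * A + (1 - width \<alpha>) * A) / 16" unfolding s by (simp add: algebra_simps)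
  also have "\<dots> = (1 + a\<^sup>2) / 2" unfolding e1 unfolding A_def by (simp add: power2_eq_square algebra_simps)
  finally show "\<alpha> + beta \<alpha> = (5 - width \<alpha>) * scale \<alpha>" unfolding beta_def a(3) by (simp add: field_simps)
  have "12 * width \<alpha> * (scale \<alpha>)\<^sup>2 = 12 * (width \<alpha> * A) * A / 256" unfolding s by (simp add: power2_eq_square)
  also have "\<dots> = 9 / 64 * A * ((1 - a / 3) * (3 * a - 1))" unfolding e2 by (simp add: field_simps)
  finally show "9 / 64 * (1 + sqrt \<alpha>)\<^sup>2 * ((1 - sqrt \<alpha> / 3) * (3 * sqrt \<alpha> - 1)) = 12 * width \<alpha> * (scale \<alpha>)\<^sup>2"
    unfolding A_def a_def by simp
  show "(1 - sqrt \<alpha> / 3) * (3 * sqrt \<alpha> - 1) \<ge> 0" unfolding a_def[symmetric] using a by (intro mult_nonneg_nonneg) simp_all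
qed

lemma double_zero_scale:
  assumes \<alpha>: "1 / 9 < \<alpha>" "\<alpha> \<le> 1"
  shows "(of_real (scale \<alpha>) * Z - z_plus \<alpha>) * (of_real (scale \<alpha>) * Z - z_minus \<alpha>) =
    of_real ((scale \<alpha>)\<^sup>2) * ((Z + 2)\<^sup>2 + of_real (12 * width \<alpha>))"
proof -
  define A b \<sigma> where "A = 1 + sqrt \<alpha>" and "b = sqrt ((1 - sqrt \<alpha> / 3) * (3 * sqrt \<alpha> - 1))" and "\<sigma> = scale \<alpha>"
  define K where "K = 3 / 8 * A * b"
  have s: "2 * \<sigma> = A * A / 8" by (simp add: \<sigma>_def scale_def A_def power2_eq_square)
  have sc: "2 * complex_of_real \<sigma> = of_real A * of_real A / 8" using arg_cong[OF s, of complex_of_real] by simp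
  have zp: "z_plus \<alpha> = - (2 * of_real \<sigma>) + \<i> * of_real K" unfolding sc z_plus_def A_def[symmetric] b_def[symmetric] K_def
    by (simp add: algebra_simps)
  have zm: "z_minus \<alpha> = - (2 * of_real \<sigma>) - \<i> * of_real K" unfolding sc z_minus_def A_def[symmetric] b_def[symmetric] K_def
    by (simp add: algebra_simps)
  have b2: "b\<^sup>2 = (1 - sqrt \<alpha> / 3) * (3 * sqrt \<alpha> - 1)" unfolding b_def using scale_width(8)[OF \<alpha>] by simp
  have "K\<^sup>2 = 9 / 64 * A\<^sup>2 * b\<^sup>2" unfolding K_def power_mult_distrib by (simp add: power2_eq_square)
  also have "\<dots> = 12 * width \<alpha> * \<sigma>\<^sup>2" unfolding b2 A_def \<sigma>_def by (rule scale_width(7)[OF \<alpha>])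
  finally have K2: "(complex_of_real K)\<^sup>2 = of_real (12 * width \<alpha>) * (of_real \<sigma>)\<^sup>2" by (metis of_real_mult of_real_power)
  have gen: "(S * Z - (- (2 * S) + \<i> * k)) * (S * Z - (- (2 * S) - \<i> * k)) = S\<^sup>2 * (Z + 2)\<^sup>2 + k\<^sup>2" for S k :: complex
  proof -
    have "(S * Z - (- (2 * S) + \<i> * k)) * (S * Z - (- (2 * S) - \<i> * k)) = (S * (Z + 2))\<^sup>2 - (\<i> * k)\<^sup>2"
      by (simp add: power2_eq_square algebra_simps)
    then show ?thesis by (simp add: power_mult_distrib)
  qed
  show ?thesis unfolding \<sigma>_def[symmetric] zp zm gen K2 by (simp add: distrib_left mult.commute)
qed

text \<open>The outer factor is the square of dz = scale * dZ. Both numerator and denominator are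
  then homogeneous of degree 6 in the scale, which cancels.\<close>

lemma Q_scale:
  assumes \<alpha>: "1 / 9 < \<alpha>" "\<alpha> \<le> 1"
  shows "two_sheets.qd (width \<alpha>) Z = of_real ((scale \<alpha>)\<^sup>2) * Q \<alpha> (of_real (scale \<alpha>) * Z)"
proof -
  interpret two_sheets "width \<alpha>" by unfold_locales (use scale_width[OF \<alpha>] in simp_all)
  define S where "S = complex_of_real (scale \<alpha>)"
  define P N D E where "P = (Z + 2)\<^sup>2 + of_real (12 * width \<alpha>)" and "N = Z + of_real (2 - 2 * width \<alpha>)"
    and "D = Z\<^sup>2 - of_real (16 * (1 - width \<alpha>))" and "E = Z + of_real (5 - width \<alpha>)"
  have S0: "S \<noteq> 0" using scale_width(1)[OF \<alpha>] by (simp add: S_def)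
  have n: "S * Z + of_real ((1 - sqrt \<alpha>)\<^sup>2 / 2) = S * N"
    unfolding scale_width(4)[OF \<alpha>] N_def S_def by (simp add: algebra_simps)
  have e: "S * Z + of_real (\<alpha> + beta \<alpha>) = S * E"
    unfolding scale_width(6)[OF \<alpha>] E_def S_def by (simp add: algebra_simps)
  have d: "(S * Z - of_real (beta \<alpha>))\<^sup>2 * (S * Z + of_real (beta \<alpha>))\<^sup>2 = (S\<^sup>2 * D)\<^sup>2"
  proof -
    have "(S * Z - of_real (beta \<alpha>)) * (S * Z + of_real (beta \<alpha>)) = S\<^sup>2 * Z\<^sup>2 - of_real ((beta \<alpha>)\<^sup>2)"
      by (simp add: power2_eq_square algebra_simps)
    also have "\<dots> = S\<^sup>2 * D" unfolding scale_width(5)[OF \<alpha>] D_def S_def by (simp add: algebra_simps)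
    finally show ?thesis by (simp only: power_mult_distrib[symmetric])
  qed
  have p: "(S * Z - z_plus \<alpha>) * (S * Z - z_minus \<alpha>) = S\<^sup>2 * P"
    unfolding S_def P_def double_zero_scale[OF \<alpha>] by simp
  have n6: "S\<^sup>2 * ((S\<^sup>2 * P) * (S * N)\<^sup>2) = S ^ 6 * (P * N\<^sup>2)" by (simp add: eval_nat_numeral mult_ac)
  have d6: "(S\<^sup>2 * D)\<^sup>2 * (S * E)\<^sup>2 = S ^ 6 * (D\<^sup>2 * E\<^sup>2)" by (simp add: eval_nat_numeral mult_ac)
  have "S\<^sup>2 * Q \<alpha> (S * Z) = S\<^sup>2 * ((S\<^sup>2 * P) * (S * N)\<^sup>2 / ((S\<^sup>2 * D)\<^sup>2 * (S * E)\<^sup>2))"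
    unfolding Q_def p n e d ..
  also have "\<dots> = (S ^ 6 * (P * N\<^sup>2)) / (S ^ 6 * (D\<^sup>2 * E\<^sup>2))"
    unfolding times_divide_eq_right n6 d6 ..
  also have "\<dots> = P * N\<^sup>2 / (D\<^sup>2 * E\<^sup>2)" using S0 by (intro mult_divide_mult_cancel_left) simp
  finally show ?thesis unfolding qd_def P_def N_def D_def E_def S_def by simp
qed

lemma closed_curve_scale:
  assumes s: "s > 0" and AB: "\<And>x. x \<in> A \<longleftrightarrow> of_real s * x \<in> B"
  shows "x \<in> closed_curve A \<longleftrightarrow> of_real s * x \<in> closed_curve B"
proof -
  have a: "0 \<le> s * k \<longleftrightarrow> 0 \<le> k" and b: "s * k \<le> 0 \<longleftrightarrow> k \<le> 0" for k
    using mult_le_cancel_left_pos[OF s, of 0 k] mult_le_cancel_left_pos[OF s, of k 0] unfolding mult_zero_right .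
  have r: "Re (of_real s * x) = s * Re x" by simp
  have n: "x \<in> uminus ` A \<longleftrightarrow> of_real s * x \<in> uminus ` B"
    unfolding mem_uminus_image AB[of "- x"] mult_minus_right ..
  show ?thesis
    unfolding closed_curve_def Un_iff Int_iff mem_Collect_eq r a b n AB[of x] ..
qed

theorem theorem2p6:
  fixes \<alpha> xstar :: real and \<gamma> c :: "real \<Rightarrow> complex"
    and \<Sigma>\<^sub>0 :: "complex set" and \<mu>\<^sub>0 :: "complex measure" and g :: "complex \<Rightarrow> complex"
  assumes alpha: "1 / 9 < \<alpha>" "\<alpha> \<le> 1"
    and crit: "critical_trajectory (Q \<alpha>) \<gamma> (z_minus \<alpha>) (z_plus \<alpha>)"
    and Sigma0: "\<Sigma>\<^sub>0 = path_image \<gamma>"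
    and symmetric: "cnj ` \<Sigma>\<^sub>0 = \<Sigma>\<^sub>0"
    and crossing: "\<Sigma>\<^sub>0 \<inter> complex_of_real ` {0<..} = {complex_of_real xstar}" "beta \<alpha> < xstar"
    and mu0: "\<mu>\<^sub>0 = trajectory_measure (Q \<alpha>) \<gamma>" "prob_space \<mu>\<^sub>0"
    and g: "g = g_fun \<mu>\<^sub>0"
    and closed: "simple_path c" "pathfinish c = pathstart c" "path_image c = closed_curve \<Sigma>\<^sub>0"
    and contained: "\<Sigma>\<^sub>0 \<inter> {z. Re z < 0} \<subseteq> Omega0 \<Sigma>\<^sub>0"
  shows "\<forall>z. 0 < Re z \<longrightarrow> Re (g (- z)) > Re (g z)"
proof -
  define \<sigma> v where "\<sigma> = scale \<alpha>" and "v = width \<alpha>"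
  have \<sigma>: "\<sigma> > 0" and v: "0 < v" "v \<le> 1" using scale_width(1-3)[OF alpha] by (simp_all add: \<sigma>_def v_def)
  interpret T: two_sheets v by unfold_locales (use v in simp_all)
  have Qs: "T.qd Z = of_real (\<sigma>\<^sup>2) * Q \<alpha> (of_real \<sigma> * Z)" for Z unfolding \<sigma>_def v_def by (rule Q_scale[OF alpha])
  have arc: "arc \<gamma>" and ends: "\<gamma> 0 = z_minus \<alpha>" "\<gamma> 1 = z_plus \<alpha>" and traj: "trajectory (Q \<alpha>) \<gamma>"
    using crit by (simp_all add: critical_trajectory_def pathstart_def pathfinish_def)
  have \<gamma>c: "continuous_on {0..1} \<gamma>" and \<gamma>i: "inj_on \<gamma> {0..1}" using arc by (simp_all add: arc_def path_def)
  obtain V where V: "\<And>t. t \<in> {0<..<1} \<Longrightarrow> (\<gamma> has_vector_derivative V t) (at t)" "continuous_on {0<..<1} V"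
    using traj unfolding trajectory_def C1_differentiable_on_def by blast
  have vd: "vector_derivative \<gamma> (at t) = V t" if "t \<in> {0<..<1}" for t by (rule vector_derivative_at[OF V(1)[OF that]])
  have neg: "neg_real (Q \<alpha> (\<gamma> t) * (V t)\<^sup>2)" if "t \<in> {0<..<1}" for t
  proof -
    have "neg_real (Q \<alpha> (\<gamma> t) * (vector_derivative \<gamma> (at t))\<^sup>2)" using traj that unfolding trajectory_def by blast
    then show ?thesis unfolding vd[OF that] .
  qed
  \<comment> \<open>Clamping the parameter extends the rescaled path continuously to the whole line,
    because nothing is known of \<gamma> outside the unit interval.\<close>
  define \<Gamma> where "\<Gamma> t = \<gamma> (max 0 (min 1 t)) / of_real \<sigma>" for t
  have \<Gamma>\<gamma>: "of_real \<sigma> * \<Gamma> t = \<gamma> t" if "t \<in> {0..1}" for t using that \<sigma> by (simp add: \<Gamma>_def)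
  have \<Gamma>e: "\<Gamma> t = \<gamma> t / of_real \<sigma>" if "t \<in> {0..1}" for t using that by (simp add: \<Gamma>_def)
  have \<Gamma>d: "(\<Gamma> has_vector_derivative V t / of_real \<sigma>) (at t)" if t: "t \<in> {0<..<1}" for t
  proof (rule has_vector_derivative_transform_within_open)
    show "((\<lambda>t. \<gamma> t / of_real \<sigma>) has_vector_derivative V t / of_real \<sigma>) (at t)"
      using V(1)[OF t] by (rule has_vector_derivative_divide)
    show "open {0<..<1::real}" "t \<in> {0<..<1}" using t by simp_all
    show "\<gamma> x / of_real \<sigma> = \<Gamma> x" if "x \<in> {0<..<1}" for x using \<Gamma>e[of x] that by simp
  qed
  have vd\<Gamma>: "vector_derivative \<Gamma> (at t) = V t / of_real \<sigma>" if "t \<in> {0<..<1}" for t by (rule vector_derivative_at[OF \<Gamma>d[OF that]])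
  have qd: "T.qd (\<Gamma> t) * (vector_derivative \<Gamma> (at t))\<^sup>2 = Q \<alpha> (\<gamma> t) * (V t)\<^sup>2" if t: "t \<in> {0<..<1}" for t
  proof -
    have "of_real \<sigma> * \<Gamma> t = \<gamma> t" by (rule \<Gamma>\<gamma>) (use t in simp)
    then show ?thesis unfolding Qs vd\<Gamma>[OF t] using \<sigma> by (simp add: power_divide)
  qed
  define E where "E t = sqrt (- Re (Q \<alpha> (\<gamma> t) * (V t)\<^sup>2)) / pi" for t
  \<comment> \<open>Measurability of \<gamma> and of its derivative is available only on the open
    unit interval, so the given measure is treated on the restricted space before it is compared
    with the one on the line.\<close>
  define Rs where "Rs = restrict_space lborel {0<..<1::real}"
  have spRs: "space Rs = {0<..<1}" by (simp add: Rs_def space_restrict_space)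
  have contm: "f \<in> borel_measurable Rs" if "continuous_on {0<..<1} f" for f :: "real \<Rightarrow> complex"
  proof -
    have f: "f \<in> borel_measurable (restrict_space borel {0<..<1})" by (rule borel_measurable_continuous_on_restrict[OF that])
    have "sets Rs = sets (restrict_space borel {0<..<1})" unfolding Rs_def by (intro sets_restrict_space_cong) simp
    then have eq: "measurable Rs (borel :: complex measure) = measurable (restrict_space borel {0<..<1}) borel"
      by (rule measurable_cong_sets[OF _ refl])
    show ?thesis unfolding eq by (rule f)
  qed
  have m\<gamma>: "\<gamma> \<in> borel_measurable Rs" by (rule contm, rule continuous_on_subset[OF \<gamma>c]) auto
  have mV: "V \<in> borel_measurable Rs" by (rule contm[OF V(2)])
  have mQ: "Q \<alpha> \<in> borel_measurable borel" unfolding Q_def[abs_def] by measurable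
  have "(\<lambda>t. Q \<alpha> (\<gamma> t)) \<in> borel_measurable Rs" by (rule measurable_compose[OF m\<gamma> mQ])
  then have mE: "E \<in> borel_measurable Rs" unfolding E_def[abs_def] using mV by measurable
  have E0: "E t \<ge> 0" if "t \<in> {0<..<1}" for t using neg[OF that] by (simp add: E_def neg_real_def)
  define N where "N = density Rs (\<lambda>t. ennreal (E t))"
  have pb: "(let v = vector_derivative \<gamma> (at t) in ennreal (Re (pos_branch (Q \<alpha>) (\<gamma> t) v * v / (of_real pi * \<i>)))) = ennreal (E t)"
    if t: "t \<in> {0<..<1}" for t
    unfolding Let_def vd[OF t] E_def by (subst pos_branch_value[of "Q \<alpha>" "\<gamma> t" "V t", OF neg[OF t]]) simp
  have "density Rs (\<lambda>t. let v = vector_derivative \<gamma> (at t) in ennreal (Re (pos_branch (Q \<alpha>) (\<gamma> t) v * v / (of_real pi * \<i>)))) = N"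
    unfolding N_def
  proof (rule density_cong)
    show mE': "(\<lambda>t. ennreal (E t)) \<in> borel_measurable Rs" using mE by measurable
    show "(\<lambda>t. let v = vector_derivative \<gamma> (at t) in ennreal (Re (pos_branch (Q \<alpha>) (\<gamma> t) v * v / (of_real pi * \<i>)))) \<in> borel_measurable Rs"
      by (rule measurable_cong[THEN iffD2, OF _ mE']) (rule pb, simp add: spRs)
    show "AE t in Rs. (let v = vector_derivative \<gamma> (at t) in ennreal (Re (pos_branch (Q \<alpha>) (\<gamma> t) v * v / (of_real pi * \<i>)))) = ennreal (E t)"
      by (rule AE_I2) (rule pb, simp add: spRs)
  qed
  then have \<mu>: "\<mu>\<^sub>0 = distr N borel \<gamma>" unfolding mu0(1) trajectory_measure_def Rs_def by simp
  have mN: "\<gamma> \<in> borel_measurable N" using m\<gamma> by (simp add: N_def)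
  have setsN: "sets N = sets Rs" "space N = {0<..<1}" by (simp_all add: N_def spRs)
  have mEe: "(\<lambda>t. ennreal (E t)) \<in> borel_measurable Rs" using mE by measurable
  have S01: "{0<..<1::real} \<inter> space lborel \<in> sets lborel" by simp
  have nnN: "emeasure N A = (\<integral>\<^sup>+t. ennreal (E t) * indicator A t * indicator {0<..<1} t \<partial>lborel)" if "A \<in> sets Rs" for A
  proof -
    have "emeasure N A = (\<integral>\<^sup>+t. ennreal (E t) * indicator A t \<partial>Rs)" unfolding N_def by (rule emeasure_density[OF mEe that])
    then show ?thesis unfolding Rs_def by (simp only: nn_integral_restrict_space[OF S01])
  qed
  \<comment> \<open>The probability hypothesis, pulled back to the parameter, is the total mass
    condition on the rescaled arc.\<close>
  have "emeasure \<mu>\<^sub>0 (space \<mu>\<^sub>0) = 1" by (rule prob_space.emeasure_space_1[OF mu0(2)])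
  then have "emeasure N (space N) = 1" unfolding \<mu> using emeasure_distr[OF mN, of UNIV] by simp
  then have "emeasure N {0<..<1} = 1" unfolding setsN(2) .
  moreover have S01s: "{0<..<1} \<in> sets Rs" using sets.top[of Rs] unfolding spRs .
  ultimately have one: "(\<integral>\<^sup>+t. ennreal (E t) * indicator {0<..<1} t * indicator {0<..<1} t \<partial>lborel) = 1" using nnN[OF S01s] by simp
  have dE: "indicator {0<..<1} t * (sqrt (- Re (T.qd (\<Gamma> t) * (vector_derivative \<Gamma> (at t))\<^sup>2)) / pi) = indicator {0<..<1} t * E t" for t
    by (cases "t \<in> {0<..<1}") (simp_all add: qd E_def)
  have img: "\<Gamma> ` {0..1} = (\<lambda>s. s / of_real \<sigma>) ` \<Sigma>\<^sub>0"
    unfolding Sigma0 path_image_def image_image by (rule image_cong[OF refl \<Gamma>e])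
  have mem: "x \<in> \<Gamma> ` {0..1} \<longleftrightarrow> of_real \<sigma> * x \<in> \<Sigma>\<^sub>0" for x
  proof
    assume "x \<in> \<Gamma> ` {0..1}"
    then show "of_real \<sigma> * x \<in> \<Sigma>\<^sub>0" unfolding img using \<sigma> by auto
  next
    assume "of_real \<sigma> * x \<in> \<Sigma>\<^sub>0"
    from imageI[OF this, of "\<lambda>s. s / of_real \<sigma>"] show "x \<in> \<Gamma> ` {0..1}" unfolding img using \<sigma> by simp
  qed
  have x0: "xstar > 0" and xS: "of_real xstar \<in> \<Sigma>\<^sub>0"
  proof -
    have "complex_of_real xstar \<in> \<Sigma>\<^sub>0 \<inter> complex_of_real ` {0<..}" unfolding crossing(1) by simp
    then show "xstar > 0" "of_real xstar \<in> \<Sigma>\<^sub>0" by auto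
  qed
  interpret C: trajectory_core v \<Gamma> "xstar / \<sigma>"
  proof unfold_locales
    have "continuous_on UNIV (\<lambda>t. \<gamma> (max 0 (min 1 t)))"
    proof (rule continuous_on_compose2[OF \<gamma>c])
      show "continuous_on UNIV (\<lambda>t::real. max 0 (min 1 t))" by (intro continuous_intros)
    qed auto
    then show "continuous_on UNIV \<Gamma>" unfolding \<Gamma>_def[abs_def] using \<sigma> by (intro continuous_intros) simp_all
    show "inj_on \<Gamma> {0..1}"
    proof (rule inj_onI)
      fix s t :: real assume st: "s \<in> {0..1}" "t \<in> {0..1}" "\<Gamma> s = \<Gamma> t"
      then have "of_real \<sigma> * \<Gamma> s = of_real \<sigma> * \<Gamma> t" by simp
      then have "\<gamma> s = \<gamma> t" unfolding \<Gamma>\<gamma>[OF st(1)] \<Gamma>\<gamma>[OF st(2)] .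
      then show "s = t" using inj_onD[OF \<gamma>i] st by blast
    qed
    have "continuous_on {0<..<1} (\<lambda>t. V t / of_real \<sigma>)" using V(2) \<sigma> by (intro continuous_intros) simp_all
    then show "\<Gamma> C1_differentiable_on {0<..<1}" unfolding C1_differentiable_on_def
      by (intro exI[of _ "\<lambda>t. V t / of_real \<sigma>"] conjI ballI \<Gamma>d)
    show "T.qd (\<Gamma> t) * (vector_derivative \<Gamma> (at t))\<^sup>2 \<in> \<real> \<and> Re (T.qd (\<Gamma> t) * (vector_derivative \<Gamma> (at t))\<^sup>2) < 0"
      if "t \<in> {0<..<1}" for t unfolding qd[OF that] using neg[OF that] by (simp add: neg_real_def)
    have de: "(\<Gamma> t + 2)\<^sup>2 + of_real (12 * v) = 0" if "t \<in> {0..1}" "\<gamma> t = z_minus \<alpha> \<or> \<gamma> t = z_plus \<alpha>" for t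
    proof -
      have "(of_real \<sigma> * \<Gamma> t - z_plus \<alpha>) * (of_real \<sigma> * \<Gamma> t - z_minus \<alpha>) =
          of_real (\<sigma>\<^sup>2) * ((\<Gamma> t + 2)\<^sup>2 + of_real (12 * v))"
        unfolding \<sigma>_def v_def by (rule double_zero_scale[OF alpha])
      moreover have "(\<gamma> t - z_plus \<alpha>) * (\<gamma> t - z_minus \<alpha>) = 0"
        using that(2) unfolding mult_eq_0_iff right_minus_eq by (rule disj_commute[THEN iffD1])
      ultimately have "of_real (\<sigma>\<^sup>2) * ((\<Gamma> t + 2)\<^sup>2 + of_real (12 * v)) = 0"
        unfolding \<Gamma>\<gamma>[OF that(1)] by (rule trans[OF sym])
      then show ?thesis using \<sigma> unfolding mult_eq_0_iff by simp
    qed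
    show "(\<Gamma> 0 + 2)\<^sup>2 + of_real (12 * v) = 0" "(\<Gamma> 1 + 2)\<^sup>2 + of_real (12 * v) = 0"
      by (rule de, simp, simp only: ends simp_thms)+
    show "(\<integral>\<^sup>+t. ennreal (indicator {0<..<1} t * (sqrt (- Re (T.qd (\<Gamma> t) * (vector_derivative \<Gamma> (at t))\<^sup>2)) / pi)) \<partial>lborel) = 1"
      unfolding dE by (rule trans[OF nn_integral_cong one]) (simp add: indicator_def)
    show "cnj ` \<Gamma> ` {0..1} = \<Gamma> ` {0..1}"
    proof -
      have "cnj ` \<Gamma> ` {0..1} = (\<lambda>s. s / of_real \<sigma>) ` cnj ` \<Sigma>\<^sub>0" 
      proof -
        have "cnj (s / of_real \<sigma>) = cnj s / of_real \<sigma>" for s by simp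
        then show ?thesis unfolding img by (simp only: image_image)
      qed
      also have "\<dots> = \<Gamma> ` {0..1}" by (simp only: symmetric img)
      finally show ?thesis .
    qed
    show "\<Gamma> ` {0..1} \<inter> complex_of_real ` {0<..} = {of_real (xstar / \<sigma>)}"
    proof (intro equalityI subsetI)
      fix x assume x: "x \<in> \<Gamma> ` {0..1} \<inter> complex_of_real ` {0<..}"
      from IntD2[OF x] obtain r where r': "x = of_real r" "r \<in> {0<..}" by (rule imageE) (rule that)
      then have r: "r > 0" "x = of_real r" by simp_all
      have "of_real (\<sigma> * r) \<in> \<Sigma>\<^sub>0" using x mem[of x] r(2) by simp
      moreover have "of_real (\<sigma> * r) \<in> complex_of_real ` {0<..}" by (rule imageI) (use r(1) \<sigma> in simp)
      ultimately have "complex_of_real (\<sigma> * r) \<in> {complex_of_real xstar}" unfolding crossing(1)[symmetric] by blast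
      then have "\<sigma> * r = xstar" by (simp only: singleton_iff of_real_eq_iff)
      then have "r = xstar / \<sigma>" using \<sigma> by (simp add: field_simps)
      then show "x \<in> {of_real (xstar / \<sigma>)}" using r(2) by simp
    next
      fix x assume "x \<in> {complex_of_real (xstar / \<sigma>)}"
      then have x: "x = of_real (xstar / \<sigma>)" by simp
      have "of_real \<sigma> * x = of_real xstar" unfolding x using \<sigma> by simp
      then have "x \<in> \<Gamma> ` {0..1}" using mem[of x] xS by simp
      moreover have "x \<in> complex_of_real ` {0<..}" unfolding x by (rule imageI) (use x0 \<sigma> in simp)
      ultimately show "x \<in> \<Gamma> ` {0..1} \<inter> complex_of_real ` {0<..}" by blast
    qed
    show "0 < xstar / \<sigma>" using x0 \<sigma> by simp
    have "0 \<le> beta \<alpha>" using alpha(2) by (simp add: beta_def)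
    then have "(beta \<alpha>)\<^sup>2 < xstar\<^sup>2" by (intro power_strict_mono[OF crossing(2)]) simp_all
    then have "16 * (1 - v) * \<sigma>\<^sup>2 < xstar\<^sup>2" unfolding scale_width(5)[OF alpha] \<sigma>_def v_def .
    moreover have "0 < \<sigma>\<^sup>2" using \<sigma> by simp
    ultimately show "16 * (1 - v) < (xstar / \<sigma>)\<^sup>2" unfolding power_divide by (simp only: pos_less_divide_eq)
  qed
  have Sig: "x \<in> C.Sig \<longleftrightarrow> of_real \<sigma> * x \<in> \<Sigma>\<^sub>0" for x unfolding C.Sig_def by (rule mem)
  have cont: "C.Sig \<inter> {z. Re z < 0} \<subseteq> Omega0 C.Sig"
  proof
    fix u assume u: "u \<in> C.Sig \<inter> {z. Re z < 0}"
    have "Re u < 0" using IntD2[OF u] unfolding mem_Collect_eq .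
    from mult_pos_neg[OF \<sigma> this] have "Re (of_real \<sigma> * u) < 0" by simp
    moreover have "of_real \<sigma> * u \<in> \<Sigma>\<^sub>0" using IntD1[OF u] unfolding Sig[of u] .
    ultimately have "of_real \<sigma> * u \<in> \<Sigma>\<^sub>0 \<inter> {z. Re z < 0}" unfolding Int_iff mem_Collect_eq by (rule conjI[rotated])
    then have "of_real \<sigma> * u \<in> Omega0 \<Sigma>\<^sub>0" by (rule subsetD[OF contained])
    then show "u \<in> Omega0 C.Sig" unfolding Omega0_def
    proof (intro inside_scale[of "of_real \<sigma>" u "closed_curve \<Sigma>\<^sub>0"])
      show "complex_of_real \<sigma> \<noteq> 0" using \<sigma> by simp
      show "x \<in> closed_curve C.Sig \<longleftrightarrow> of_real \<sigma> * x \<in> closed_curve \<Sigma>\<^sub>0" for x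
        by (rule closed_curve_scale[OF \<sigma> Sig])
    qed
  qed
  have dens: "C.dens t = indicator {0<..<1} t * E t" for t unfolding C.dens_def by (rule dE)
  have single: "\<exists>a. \<forall>t\<in>{0<..<1}. t \<noteq> a \<longrightarrow> \<gamma> t \<noteq> z" for z
  proof (cases "\<exists>a\<in>{0..1}. \<gamma> a = z")
    case True
    then obtain a where a: "a \<in> {0..1}" "\<gamma> a = z" by blast
    show ?thesis
    proof (intro exI[of _ a] ballI impI)
      fix t :: real assume t: "t \<in> {0<..<1}" "t \<noteq> a"
      show "\<gamma> t \<noteq> z" using inj_onD[OF \<gamma>i, of t a] a t by auto
    qed
  next
    case False
    then show ?thesis by (intro exI[of _ 0] ballI impI) auto
  qed
  \<comment> \<open>The real part of \<open>g\<close> is the logarithmic potential at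
    \<open>z\<close> only if \<open>z\<close> carries no mass; injectivity of the path leaves at
    most one parameter over \<open>z\<close>.\<close>
  have null: "emeasure \<mu>\<^sub>0 {z} = 0" for z
  proof -
    obtain a where a: "\<forall>t\<in>{0<..<1}. t \<noteq> a \<longrightarrow> \<gamma> t \<noteq> z" using single[of z] by (rule exE)
    define A where "A = \<gamma> -` {z} \<inter> space N"
    have As: "A \<in> sets Rs" unfolding A_def setsN(1)[symmetric] by (rule measurable_sets[OF mN]) simp
    have "emeasure \<mu>\<^sub>0 {z} = emeasure N A" unfolding \<mu> A_def by (rule emeasure_distr[OF mN]) simp
    also have "\<dots> = (\<integral>\<^sup>+t. ennreal (E t) * indicator A t * indicator {0<..<1} t \<partial>lborel)" by (rule nnN[OF As])
    also have "\<dots> = (\<integral>\<^sup>+t. 0 \<partial>(lborel :: real measure))"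
    proof (rule nn_integral_cong_AE)
      show "AE t in lborel. ennreal (E t) * indicator A t * indicator {0<..<1} t = 0"
        using AE_lborel_singleton[of a]
      proof eventually_elim
        case (elim t)
        show ?case
        proof (cases "t \<in> {0<..<1}")
          case True
          have "\<gamma> t \<noteq> z" using a True elim by blast
          then have "t \<notin> A" by (simp add: A_def)
          then show ?thesis by simp
        qed simp
      qed
    qed
    finally show ?thesis by simp
  qed
  \<comment> \<open>Since the mass is one, the change of scale adds the constant ln \<sigma>, which
    is the same at z and - z and cancels in the comparison.\<close>
  have val: "Re (g z) = ln \<sigma> + C.U (z / of_real \<sigma>)" for z
  proof -
    define Z where "Z = z / of_real \<sigma>"
    have zZ: "z = of_real \<sigma> * Z" using \<sigma> by (simp add: Z_def)
    have mf: "(\<lambda>s. ln (cmod (z - s))) \<in> borel_measurable borel" by measurable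
    have mf2: "(\<lambda>t. ln (cmod (z - \<gamma> t))) \<in> borel_measurable Rs" by (rule measurable_compose[OF m\<gamma> mf])
    have "Re (g z) = (\<integral>s. ln (cmod (z - s)) \<partial>\<mu>\<^sub>0)" unfolding g
      by (rule Re_g_fun[OF prob_space.finite_measure[OF mu0(2)] _ null]) (simp add: \<mu>)
    also have "\<dots> = (\<integral>t. ln (cmod (z - \<gamma> t)) \<partial>N)" unfolding \<mu> by (rule integral_distr[OF mN mf])
    also have "\<dots> = (\<integral>t. E t *\<^sub>R ln (cmod (z - \<gamma> t)) \<partial>Rs)" unfolding N_def
      by (rule integral_density[OF mf2 mE AE_I2]) (rule E0, simp add: spRs)
    also have "\<dots> = (\<integral>t. indicator {0<..<1} t *\<^sub>R (E t *\<^sub>R ln (cmod (z - \<gamma> t))) \<partial>lborel)"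
      unfolding Rs_def by (rule integral_restrict_space[OF S01])
    also have "\<dots> = (\<integral>t. C.dens t * ln (cmod (z - of_real \<sigma> * \<Gamma> t)) \<partial>lborel)"
    proof (rule Bochner_Integration.integral_cong[OF refl])
      fix t :: real
      show "indicator {0<..<1} t *\<^sub>R (E t *\<^sub>R ln (cmod (z - \<gamma> t))) = C.dens t * ln (cmod (z - of_real \<sigma> * \<Gamma> t))"
      proof (cases "t \<in> {0<..<1}")
        case True
        then have "of_real \<sigma> * \<Gamma> t = \<gamma> t" by (intro \<Gamma>\<gamma>) simp
        then show ?thesis using True by (simp add: dens)
      qed (simp add: dens)
    qed
    also have "\<dots> = (\<integral>t. ln (cmod (z - of_real \<sigma> * \<Gamma> t)) \<partial>C.Mt)"
      by (rule C.integral_Mt(2)[symmetric]) measurable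
    also have "\<dots> = (\<integral>t. ln \<sigma> + ln (cmod (Z - \<Gamma> t)) \<partial>C.Mt)"
    proof (rule integral_cong_AE)
      obtain a where a: "\<forall>t\<in>{0<..<1}. t \<noteq> a \<longrightarrow> \<gamma> t \<noteq> z" using single[of z] by (rule exE)
      show "AE t in C.Mt. ln (cmod (z - of_real \<sigma> * \<Gamma> t)) = ln \<sigma> + ln (cmod (Z - \<Gamma> t))"
        using C.AE_Mt[of a]
      proof eventually_elim
        case (elim t)
        have "\<gamma> t \<noteq> z" using a elim by blast
        have g: "of_real \<sigma> * \<Gamma> t = \<gamma> t" by (rule \<Gamma>\<gamma>) (use elim in simp)
        have ne: "cmod (Z - \<Gamma> t) > 0"
        proof -
          have "\<Gamma> t \<noteq> Z"
          proof
            assume "\<Gamma> t = Z"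
            then have "\<gamma> t = z" unfolding zZ g[symmetric] by (rule arg_cong)
            then show False using \<open>\<gamma> t \<noteq> z\<close> by (rule notE[rotated])
          qed
          then show ?thesis by simp
        qed
        have "z - of_real \<sigma> * \<Gamma> t = of_real \<sigma> * (Z - \<Gamma> t)" unfolding zZ by (rule right_diff_distrib[symmetric])
        then have "cmod (z - of_real \<sigma> * \<Gamma> t) = cmod (of_real \<sigma>) * cmod (Z - \<Gamma> t)" by (simp only: norm_mult)
        also have "cmod (of_real \<sigma>) = \<sigma>" using \<sigma> by simp
        finally have c: "cmod (z - of_real \<sigma> * \<Gamma> t) = \<sigma> * cmod (Z - \<Gamma> t)" .
        show ?case unfolding c by (subst ln_mult) (use \<sigma> ne in auto)
      qed
    qed measurable
    also have "\<dots> = ln \<sigma> + C.U Z"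
    proof -
      have i: "integrable C.Mt (\<lambda>t. ln (cmod (Z - \<Gamma> t)))"
      proof (cases "Z = \<Gamma> 0 \<or> Z = \<Gamma> 1")
        case True
        show ?thesis by (rule C.U_end(1)[OF True T.neg_root(1)])
      next
        case False
        then have "Z \<noteq> \<Gamma> 0" "Z \<noteq> \<Gamma> 1" by blast+
        then show ?thesis by (rule C.X_harmonic(2))
      qed
      have c: "(\<integral>t. ln \<sigma> \<partial>C.Mt) = ln \<sigma>" using prob_space.prob_space[OF C.prob_Mt] by simp
      have k: "integrable C.Mt (\<lambda>t. ln \<sigma>)" by simp
      show ?thesis unfolding C.U_def Bochner_Integration.integral_add[OF k i] c ..
    qed
    finally show ?thesis unfolding Z_def .
  qed
  show ?thesis
  proof (intro allI impI)
    fix z :: complex assume z: "0 < Re z"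
    have "Re (z / of_real \<sigma>) = Re z / \<sigma>" by (rule Re_divide_of_real)
    then have Rz: "Re (z / of_real \<sigma>) > 0" using divide_pos_pos[OF z \<sigma>] by (rule ssubst)
    have m: "- z / of_real \<sigma> = - (z / of_real \<sigma>)" by (rule minus_divide_left[symmetric])
    have "ln \<sigma> + C.U (z / of_real \<sigma>) < ln \<sigma> + C.U (- z / of_real \<sigma>)"
      unfolding m by (rule add_strict_left_mono[OF C.U_reflected_less[OF cont Rz]])
    then show "Re (g z) < Re (g (- z))" unfolding val[of z] val[of "- z"] .
  qed
qed

end
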